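(* (1) Let $l\ge1$ and $1\le p$ with $2p\le l+1$. Up to conjugation by automorphisms, the real Lie algebra $\mathfrak{su}_{p,l+1-p}$ has exactly $p$ non-zero abelian inner ideals, namely $$\mathcal B_{\{1,l\}}\subset\mathcal B_{\{2,l-1\}}\subset\dots\subset\mathcal B_{\{p,l+1-p\}}\quad\text{if } 2p\le l,$$ $$\mathcal B_{\{1,l\}}\subset\mathcal B_{\{2,l-1\}}\subset\dots\subset\mathcal B_{\{p-1,p+1\}}\subset\mathcal B_{\{p\}}\quad\text{if } 2p= l+1.$$ (2) If $l>1$ is odd and $m=\frac{l+1}2$, then, up to conjugation by automorphisms, the non-zero abelian inner ideals of $\mathfrak{sl}_m(\mathbb H)$ are $$\{\mathcal B_{\{2s,2t\}}:1\le s\le t\le m-1\}$$ (i.e. each of these is a non-zero abelian inner ideal, and every non-zero abelian inner ideal is conjugate to one of them; different members of the list may be conjugate).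
   Context: $\mathfrak{su}_{p,q}=\{x\in\mathfrak{sl}_{p+q}(\mathbb C):I_{p,q}x+\bar x^tI_{p,q}=0\}$ with $I_{p,q}=\mathrm{diag}(I_p,-I_q)$; $\mathfrak{sl}_m(\mathbb H)=\{x\in\mathfrak{gl}_m(\mathbb H):\mathrm{Re}(\mathrm{tr}\,x)=0\}$. Both are real forms of $\mathfrak{sl}_{l+1}(\mathbb C)$ (with $p+q=l+1$, resp. $2m=l+1$). A subspace $B$ of a Lie algebra $L$ is an inner ideal if $[B,[B,L]]\subseteq B$; abelian if $[B,B]=0$. Subspaces $B,B'$ of $\mathfrak g$ are conjugate if $\varphi(B)=B'$ for some $\varphi\in\mathrm{Aut}(\mathfrak g)$. Setting, for a real form $\mathfrak g$ of a simple complex Lie algebra. Fix a maximal abelian subspace $\mathfrak a\subseteq\mathfrak g$ on which the Killing form is positive definite and such that some Cartan involution $\theta$ satisfies $\theta|_{\mathfrak a}=-\mathrm{id}$; put $\mathfrak g_\lambda=\{x\in\mathfrak g:[h,x]=\lambda(h)x\ \forall h\in\mathfrak a\}$ for $\lambda\in\mathfrak a^*$. Let $\mathfrak h\supseteq\mathfrak a$ be a maximal abelian subalgebra of $\mathfrak g$, $\Phi$ the root system of $\mathfrak g^{\mathbb C}$ relative to $\mathfrak h^{\mathbb C}$, $\bar\alpha=\alpha|_{\mathfrak a}$, $\Phi_0=\{\alpha\in\Phi:\bar\alpha=0\}$, $\Sigma=\{\bar\alpha:\alpha\in\Phi\setminus\Phi_0\}$. Let $\Delta=\{\alpha_1,\dots,\alpha_l\}$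 be a basis of $\Phi$ as for Satake diagrams: $\Delta\cap\Phi_0$ is a basis of $\Phi_0$ and the positive roots in $\Phi\setminus\Phi_0$ restrict to a positive system of $\Sigma$. In the Satake diagram, nodes in $\Phi_0$ are black, others are white, and distinct white nodes with equal restriction to $\mathfrak a$ are joined by an arrow. If $\tilde\alpha=\sum m_i\alpha_i$ is the maximal root and $I\subseteq\{1,\dots,l\}$ is non-empty, consists of white nodes and is closed under arrows, put $\Phi_I=\{\sum p_i\alpha_i\in\Phi:p_j=m_j\ \forall j\in I\}$ and $\mathcal B_I=\bigoplus\{\mathfrak g_{\bar\alpha}:\alpha\in\Phi_I\}$ (sum over distinct restrictions), with $\mathcal B_{\{s,s\}}=\mathcal B_{\{s\}}$. Labelling: $A_l$ is the chain $1-2-\dots-l$. The Satake diagram of $\mathfrak{su}_{p,l+1-p}$ has white nodes $\{1,\dots,p\}\cup\{l+1-p,\dots,l\}$ with arrows joining $i$ and $l+1-i$ for $i\le p$ (when distinct); that of $\mathfrak{sl}_m(\mathbb H)$ has white nodes $\{2,4,\dots,l-1\}$ and no arrows. *)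

theory Defs
  imports "HOL-Analysis.Analysis"
begin

section \<open>Quaternions\<close>

datatype quat = Quat (qRe: real) (qI: real) (qJ: real) (qK: real)

instantiation quat :: real_algebra_1
begin

definition "0 = Quat 0 0 0 0"
definition "1 = Quat 1 0 0 0"
definition "x + y = Quat (qRe x + qRe y) (qI x + qI y) (qJ x + qJ y) (qK x + qK y)"
definition "x - y = Quat (qRe x - qRe y) (qI x - qI y) (qJ x - qJ y) (qK x - qK y)"
definition "- x = Quat (- qRe x) (- qI x) (- qJ x) (- qK x)"
definition "c *\<^sub>R x = Quat (c * qRe x) (c * qI x) (c * qJ x) (c * qK x)"
definition "x * y = Quat
   (qRe x * qRe y - qI x * qI y - qJ x * qJ y - qK x * qK y)
   (qRe x * qI y + qI x * qRe y + qJ x * qK y - qK x * qJ y)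
   (qRe x * qJ y - qI x * qK y + qJ x * qRe y + qK x * qI y)
   (qRe x * qK y + qI x * qJ y - qJ x * qI y + qK x * qRe y)"

instance
  by standard
    (simp_all add: zero_quat_def one_quat_def plus_quat_def minus_quat_def uminus_quat_def
      scaleR_quat_def times_quat_def algebra_simps)

end

section \<open>The real Lie algebras\<close>

definition comm_bracket ::
    "('a::ring_1)^'n^'n \<Rightarrow> 'a^'n^'n \<Rightarrow> ('a::ring_1)^'n^'n" where
  "comm_bracket x y = x ** y - y ** x"

definition Ipq :: "complex^('p::finite + 'q::finite)^('p + 'q)" where
  "Ipq = (\<chi> i j. if i = j then (case i of Inl _ \<Rightarrow> 1 | Inr _ \<Rightarrow> - 1) else 0)"

definition conj_transpose :: "complex^'n^'n \<Rightarrow> complex^'n^'n" where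
  "conj_transpose x = (\<chi> i j. cnj (x $ j $ i))"

text \<open>The signature \<open>(p, q)\<close> is \<open>(CARD('p), CARD('q))\<close>.\<close>

definition su_algebra :: "(complex^('p::finite + 'q::finite)^('p + 'q)) set" where
  "su_algebra = {x. trace x = 0 \<and> Ipq ** x + conj_transpose x ** Ipq = 0}"

definition slH_algebra :: "(quat^'m^'m::finite) set" where
  "slH_algebra = {x. qRe (trace x) = 0}"

section \<open>Inner ideals and conjugacy\<close>

text \<open>A real Lie algebra is given by a carrier subspace \<open>L\<close> of a real vector space together with
  a bracket \<open>br\<close>, which is only meaningful on \<open>L\<close>.\<close>

type_synonym 'a bracket = "'a \<Rightarrow> 'a \<Rightarrow> 'a"

definition bracket_space :: "'a::real_vector bracket \<Rightarrow> 'a set \<Rightarrow> 'a set \<Rightarrow> 'a set" where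
  "bracket_space br S T = span {br x y | x y. x \<in> S \<and> y \<in> T}"

definition abelian :: "'a::real_vector bracket \<Rightarrow> 'a set \<Rightarrow> bool" where
  "abelian br B \<longleftrightarrow> bracket_space br B B = {0}"

definition inner_ideal :: "'a::real_vector set \<Rightarrow> 'a bracket \<Rightarrow> 'a set \<Rightarrow> bool" where
  "inner_ideal L br B \<longleftrightarrow> subspace B \<and> B \<subseteq> L \<and>
     bracket_space br B (bracket_space br B L) \<subseteq> B"

definition nonzero_abelian_inner_ideal ::
    "'a::real_vector set \<Rightarrow> 'a bracket \<Rightarrow> 'a set \<Rightarrow> bool" where
  "nonzero_abelian_inner_ideal L br B \<longleftrightarrow> inner_ideal L br B \<and> abelian br B \<and> B \<noteq> {0}"

definition lie_automorphism :: "'a::real_vector set \<Rightarrow> 'a bracket \<Rightarrow> ('a \<Rightarrow> 'a) \<Rightarrow> bool" where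
  "lie_automorphism L br \<phi> \<longleftrightarrow> bij_betw \<phi> L L \<and>
     (\<forall>x\<in>L. \<forall>y\<in>L. \<phi> (x + y) = \<phi> x + \<phi> y) \<and>
     (\<forall>c. \<forall>x\<in>L. \<phi> (c *\<^sub>R x) = c *\<^sub>R \<phi> x) \<and>
     (\<forall>x\<in>L. \<forall>y\<in>L. \<phi> (br x y) = br (\<phi> x) (\<phi> y))"

definition conjugate :: "'a::real_vector set \<Rightarrow> 'a bracket \<Rightarrow> 'a set \<Rightarrow> 'a set \<Rightarrow> bool" where
  "conjugate L br B B' \<longleftrightarrow> (\<exists>\<phi>. lie_automorphism L br \<phi> \<and> \<phi> ` B = B')"

definition abelian_inner_ideal_classes ::
    "'a::real_vector set \<Rightarrow> 'a bracket \<Rightarrow> 'a set set set" where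
  "abelian_inner_ideal_classes L br =
     {B. nonzero_abelian_inner_ideal L br B} //
       {(B, B'). nonzero_abelian_inner_ideal L br B \<and> nonzero_abelian_inner_ideal L br B' \<and>
          conjugate L br B B'}"

section \<open>Killing form, Cartan involutions, and the subspaces \<open>\<aa>\<close> and \<open>\<hh>\<close>\<close>

text \<open>The trace of an endomorphism of a finite-dimensional subspace, read off in some basis.\<close>

definition trace_on :: "'a::real_vector set \<Rightarrow> ('a \<Rightarrow> 'a) \<Rightarrow> real" where
  "trace_on V f =
     (let B = (SOME B. independent B \<and> span B = V) in \<Sum>b\<in>B. representation B (f b) b)"

definition killing :: "'a::real_vector set \<Rightarrow> 'a bracket \<Rightarrow> 'a \<Rightarrow> 'a \<Rightarrow> real" where
  "killing L br x y = trace_on L (\<lambda>z. br x (br y z))"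

definition cartan_involution :: "'a::real_vector set \<Rightarrow> 'a bracket \<Rightarrow> ('a \<Rightarrow> 'a) \<Rightarrow> bool" where
  "cartan_involution L br \<theta> \<longleftrightarrow> lie_automorphism L br \<theta> \<and> (\<forall>x\<in>L. \<theta> (\<theta> x) = x) \<and>
     (\<forall>x\<in>L. x \<noteq> 0 \<longrightarrow> killing L br x (\<theta> x) < 0)"

definition split_abelian :: "'a::real_vector set \<Rightarrow> 'a bracket \<Rightarrow> 'a set \<Rightarrow> bool" where
  "split_abelian L br a \<longleftrightarrow> subspace a \<and> a \<subseteq> L \<and> abelian br a \<and>
     (\<forall>x\<in>a. x \<noteq> 0 \<longrightarrow> 0 < killing L br x x) \<and>
     (\<exists>\<theta>. cartan_involution L br \<theta> \<and> (\<forall>x\<in>a. \<theta> x = - x))"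

definition maximal_split_abelian :: "'a::real_vector set \<Rightarrow> 'a bracket \<Rightarrow> 'a set \<Rightarrow> bool" where
  "maximal_split_abelian L br a \<longleftrightarrow> split_abelian L br a \<and>
     (\<forall>a'. split_abelian L br a' \<and> a \<subseteq> a' \<longrightarrow> a' = a)"

definition maximal_abelian_subalgebra ::
    "'a::real_vector set \<Rightarrow> 'a bracket \<Rightarrow> 'a set \<Rightarrow> bool" where
  "maximal_abelian_subalgebra L br h \<longleftrightarrow> subspace h \<and> h \<subseteq> L \<and> abelian br h \<and>
     (\<forall>h'. subspace h' \<and> h' \<subseteq> L \<and> abelian br h' \<and> h \<subseteq> h' \<longrightarrow> h' = h)"

section \<open>Roots of the complexification\<close>

text \<open>The complexification of a real subspace \<open>V\<close> is \<open>V \<times> V\<close>, the pair \<open>(x, y)\<close> standing for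
  \<open>x + \<i> y\<close>.\<close>

definition cscale :: "complex \<Rightarrow> 'a::real_vector \<times> 'a \<Rightarrow> 'a \<times> 'a" where
  "cscale c z = (Re c *\<^sub>R fst z - Im c *\<^sub>R snd z, Re c *\<^sub>R snd z + Im c *\<^sub>R fst z)"

definition cbracket :: "'a::real_vector bracket \<Rightarrow> ('a \<times> 'a) bracket" where
  "cbracket br z w = (br (fst z) (fst w) - br (snd z) (snd w),
                      br (fst z) (snd w) + br (snd z) (fst w))"

text \<open>Complex linear forms on the complexification \<open>h \<times> h\<close> of \<open>h\<close> are represented by functions that
  vanish off \<open>h \<times> h\<close>, so that equality of forms is equality of functions.\<close>

type_synonym 'a cform = "'a \<times> 'a \<Rightarrow> complex"

definition complex_dual :: "'a::real_vector set \<Rightarrow> 'a cform set" where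
  "complex_dual h = {f.
     (\<forall>z\<in>h \<times> h. \<forall>w\<in>h \<times> h. f (z + w) = f z + f w) \<and>
     (\<forall>c. \<forall>z\<in>h \<times> h. f (cscale c z) = c * f z) \<and>
     (\<forall>z. z \<notin> h \<times> h \<longrightarrow> f z = 0)}"

definition roots :: "'a::real_vector set \<Rightarrow> 'a bracket \<Rightarrow> 'a set \<Rightarrow> 'a cform set" where
  "roots L br h = {\<beta> \<in> complex_dual h. \<beta> \<noteq> (\<lambda>z. 0) \<and>
     (\<exists>x\<in>L \<times> L. x \<noteq> 0 \<and> (\<forall>k\<in>h \<times> h. cbracket br k x = cscale (\<beta> k) x))}"

definition restr :: "'a::real_vector set \<Rightarrow> 'a cform \<Rightarrow> 'a \<Rightarrow> complex" where
  "restr a \<beta> = (\<lambda>x. if x \<in> a then \<beta> (x, 0) else 0)"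

definition zero_restr_roots ::
    "'a::real_vector set \<Rightarrow> 'a bracket \<Rightarrow> 'a set \<Rightarrow> 'a set \<Rightarrow> 'a cform set" where
  "zero_restr_roots L br a h = {\<beta> \<in> roots L br h. restr a \<beta> = (\<lambda>x. 0)}"

definition restricted_roots ::
    "'a::real_vector set \<Rightarrow> 'a bracket \<Rightarrow> 'a set \<Rightarrow> 'a set \<Rightarrow> ('a \<Rightarrow> complex) set" where
  "restricted_roots L br a h = restr a ` (roots L br h - zero_restr_roots L br a h)"

text \<open>Restrictions of roots to \<open>a\<close> are real-valued, since \<open>ad x\<close> is symmetric for a scalar product
  whenever \<open>x \<in> a\<close>; hence \<open>Re\<close> loses nothing here and in the definition of positive systems.\<close>

definition restricted_space ::
    "'a::real_vector set \<Rightarrow> 'a bracket \<Rightarrow> 'a set \<Rightarrow> ('a \<Rightarrow> complex) \<Rightarrow> 'a set" where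
  "restricted_space L br a \<mu> = {x \<in> L. \<forall>k\<in>a. br k x = Re (\<mu> k) *\<^sub>R x}"

section \<open>Bases of roots and the labelled Satake diagram\<close>

definition root_basis :: "'a cform set \<Rightarrow> 'a cform set \<Rightarrow> bool" where
  "root_basis R D \<longleftrightarrow> finite D \<and> D \<subseteq> R \<and>
     (\<forall>c::'a cform \<Rightarrow> real. (\<forall>z. (\<Sum>\<delta>\<in>D. of_real (c \<delta>) * \<delta> z) = 0) \<longrightarrow> (\<forall>\<delta>\<in>D. c \<delta> = 0)) \<and>
     (\<forall>\<beta>\<in>R. \<exists>c::'a cform \<Rightarrow> int. \<beta> = (\<lambda>z. \<Sum>\<delta>\<in>D. of_int (c \<delta>) * \<delta> z) \<and>
        ((\<forall>\<delta>\<in>D. 0 \<le> c \<delta>) \<or> (\<forall>\<delta>\<in>D. c \<delta> \<le> 0)))"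

definition comb :: "nat \<Rightarrow> (nat \<Rightarrow> 'a cform) \<Rightarrow> (nat \<Rightarrow> int) \<Rightarrow> 'a cform" where
  "comb l \<alpha> c = (\<lambda>z. \<Sum>i\<in>{1..l}. of_int (c i) * \<alpha> i z)"

definition positive_roots ::
    "'a::real_vector set \<Rightarrow> 'a bracket \<Rightarrow> 'a set \<Rightarrow> nat \<Rightarrow> (nat \<Rightarrow> 'a cform) \<Rightarrow> 'a cform set" where
  "positive_roots L br h l \<alpha> =
     {\<beta> \<in> roots L br h. \<exists>c. \<beta> = comb l \<alpha> c \<and> (\<forall>i\<in>{1..l}. 0 \<le> c i)}"

text \<open>A positive system is the set of restricted roots that are positive at some regular element of
  \<open>a\<close>.\<close>

definition positive_system ::
    "'a set \<Rightarrow> ('a \<Rightarrow> complex) set \<Rightarrow> ('a \<Rightarrow> complex) set \<Rightarrow> bool" where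
  "positive_system a S P \<longleftrightarrow>
     (\<exists>k\<in>a. (\<forall>\<mu>\<in>S. Re (\<mu> k) \<noteq> 0) \<and> P = {\<mu> \<in> S. 0 < Re (\<mu> k)})"

text \<open>The Cartan integer of \<open>\<beta>\<close> and \<open>\<alpha>\<close>, for \<open>\<beta> \<noteq> \<plusminus> \<alpha>\<close>, is \<open>r - q\<close> where
  \<open>\<beta> - r \<alpha>, \<dots>, \<beta> + q \<alpha>\<close> is the \<open>\<alpha>\<close>-string of roots through \<open>\<beta>\<close>.\<close>

definition cartan_integer :: "'a cform set \<Rightarrow> 'a cform \<Rightarrow> 'a cform \<Rightarrow> int" where
  "cartan_integer R \<beta> \<alpha> =
     int (card {k::nat. 1 \<le> k \<and> (\<lambda>z. \<beta> z - of_nat k * \<alpha> z) \<in> R}) -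
     int (card {k::nat. 1 \<le> k \<and> (\<lambda>z. \<beta> z + of_nat k * \<alpha> z) \<in> R})"

text \<open>The Dynkin diagram is the chain \<open>1 - 2 - \<dots> - l\<close> in this order.\<close>

definition chain_labelled :: "'a cform set \<Rightarrow> nat \<Rightarrow> (nat \<Rightarrow> 'a cform) \<Rightarrow> bool" where
  "chain_labelled R l \<alpha> \<longleftrightarrow> (\<forall>i\<in>{1..l}. \<forall>j\<in>{1..l}. i \<noteq> j \<longrightarrow>
     cartan_integer R (\<alpha> i) (\<alpha> j) = (if i = Suc j \<or> j = Suc i then - 1 else 0))"

text \<open>The data fixed for a real form of type \<open>A\<^sub>l\<close>: the subspaces \<open>a \<subseteq> h\<close> and the basis
  \<open>\<alpha> 1, \<dots>, \<alpha> l\<close> of the roots, numbered along the Dynkin diagram.\<close>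

definition satake_setting ::
    "'a::real_vector set \<Rightarrow> 'a bracket \<Rightarrow> 'a set \<Rightarrow> 'a set \<Rightarrow> nat \<Rightarrow> (nat \<Rightarrow> 'a cform) \<Rightarrow> bool" where
  "satake_setting L br a h l \<alpha> \<longleftrightarrow>
     maximal_split_abelian L br a \<and> maximal_abelian_subalgebra L br h \<and> a \<subseteq> h \<and>
     inj_on \<alpha> {1..l} \<and> root_basis (roots L br h) (\<alpha> ` {1..l}) \<and>
     root_basis (zero_restr_roots L br a h) (\<alpha> ` {1..l} \<inter> zero_restr_roots L br a h) \<and>
     positive_system a (restricted_roots L br a h)
       (restr a ` (positive_roots L br h l \<alpha> - zero_restr_roots L br a h)) \<and>
     chain_labelled (roots L br h) l \<alpha>"

definition white ::
    "'a::real_vector set \<Rightarrow> 'a bracket \<Rightarrow> 'a set \<Rightarrow> 'a set \<Rightarrow> nat \<Rightarrow> (nat \<Rightarrow> 'a cform) \<Rightarrow> nat set" where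
  "white L br a h l \<alpha> = {i \<in> {1..l}. \<alpha> i \<notin> zero_restr_roots L br a h}"

definition arrow ::
    "'a::real_vector set \<Rightarrow> 'a bracket \<Rightarrow> 'a set \<Rightarrow> 'a set \<Rightarrow> nat \<Rightarrow> (nat \<Rightarrow> 'a cform) \<Rightarrow>
      nat \<Rightarrow> nat \<Rightarrow> bool" where
  "arrow L br a h l \<alpha> i j \<longleftrightarrow> i \<in> white L br a h l \<alpha> \<and> j \<in> white L br a h l \<alpha> \<and> i \<noteq> j \<and>
     restr a (\<alpha> i) = restr a (\<alpha> j)"

section \<open>The subspaces \<open>\<B>\<^sub>I\<close>\<close>

text \<open>The index sets for which \<open>\<B>\<^sub>I\<close> is considered.\<close>

definition admissible ::
    "'a::real_vector set \<Rightarrow> 'a bracket \<Rightarrow> 'a set \<Rightarrow> 'a set \<Rightarrow> nat \<Rightarrow> (nat \<Rightarrow> 'a cform) \<Rightarrow>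
      nat set \<Rightarrow> bool" where
  "admissible L br a h l \<alpha> I \<longleftrightarrow> I \<noteq> {} \<and> I \<subseteq> white L br a h l \<alpha> \<and>
     (\<forall>i\<in>I. \<forall>j. arrow L br a h l \<alpha> i j \<longrightarrow> j \<in> I)"

definition maximal_root_coeffs :: "'a cform set \<Rightarrow> nat \<Rightarrow> (nat \<Rightarrow> 'a cform) \<Rightarrow> (nat \<Rightarrow> int) \<Rightarrow> bool" where
  "maximal_root_coeffs R l \<alpha> m \<longleftrightarrow> comb l \<alpha> m \<in> R \<and>
     (\<forall>p. comb l \<alpha> p \<in> R \<longrightarrow> (\<forall>i\<in>{1..l}. p i \<le> m i))"

definition PhiI :: "'a cform set \<Rightarrow> nat \<Rightarrow> (nat \<Rightarrow> 'a cform) \<Rightarrow> nat set \<Rightarrow> 'a cform set" where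
  "PhiI R l \<alpha> I = {\<beta> \<in> R. \<exists>m p. maximal_root_coeffs R l \<alpha> m \<and> \<beta> = comb l \<alpha> p \<and>
     (\<forall>j\<in>I. p j = m j)}"

text \<open>Restricted root spaces for distinct restrictions are independent, so that the span of their
  union is the direct sum over the distinct restrictions.\<close>

definition BI ::
    "'a::real_vector set \<Rightarrow> 'a bracket \<Rightarrow> 'a set \<Rightarrow> 'a set \<Rightarrow> nat \<Rightarrow> (nat \<Rightarrow> 'a cform) \<Rightarrow>
      nat set \<Rightarrow> 'a set" where
  "BI L br a h l \<alpha> I =
     span (\<Union>\<beta>\<in>PhiI (roots L br h) l \<alpha> I. restricted_space L br a (restr a \<beta>))"

end

theory Submission
  imports Defs "HOL-Computational_Algebra.Fundamental_Theorem_Algebra"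
begin

text \<open>Both algebras are the trace zero fixed points of an antilinear involution of \<open>gl\<^sub>n(\<complex>)\<close>, \<open>n = l + 1\<close>.
  A non-zero abelian inner ideal of \<open>sl\<^sub>n(\<complex>)\<close> consists of the matrices with range in a subspace \<open>U\<close> and
  vanishing on a subspace \<open>W \<supseteq> U\<close>: its elements square to zero since
  \<open>(ad z)\<^sup>3 = 0\<close>, and it is spanned by its matrices of rank one. Complexifying, an abelian inner ideal of
  \<open>su\<^sub>p\<^sub>,\<^sub>q\<close> comes from an isotropic \<open>U\<close> with \<open>W = U\<^sup>\<bottom>\<close>, and Witt's theorem leaves \<open>dim U \<le> p\<close> as the only
  invariant; an abelian inner ideal of \<open>sl\<^sub>m(H)\<close> comes from a flag \<open>U \<subseteq> W\<close> of quaternionic subspaces, determined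
  up to conjugation by the two dimensions.

  To compare with \<open>\<B>\<^sub>I\<close>, the Killing form and the Cartan involution show that \<open>h\<close> consists of commuting
  semisimple matrices, so a change of basis makes \<open>h\<close> diagonal and the roots become differences of coordinates.
  The chain of simple roots numbers the basis vectors, up to reversal. The involution permutes the eigenlines,
  and positivity on \<open>a\<close> locates that permutation in the numbering: the first \<open>p\<close> indices are paired with the
  last \<open>p\<close> ones for \<open>su\<^sub>p\<^sub>,\<^sub>q\<close>, and \<open>2i - 1\<close> with \<open>2i\<close> for \<open>sl\<^sub>m(H)\<close>. So \<open>\<B>\<^sub>I\<close> is the inner ideal of the
  flag spanned by initial segments of the basis.\<close>

text \<open>For \<open>z\<close> in an abelian inner ideal \<open>B\<close>,
  \<open>[z,[z,y]]\<close> lies in \<open>B\<close> and so commutes with \<open>z\<close>; this is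
  why \<open>(ad z)^3 = 0\<close>. Two obstacles shape the rest. First, \<open>h\<close> is only
  maximal abelian, so its diagonalisability has to be earned: an element commuting with
  \<open>a\<close> is \<open>u + v\<close> with \<open>u\<close> in \<open>a\<close> and
  \<open>v\<close> fixed by the Cartan involution, which makes its \<open>ad\<close> normal for a
  positive definite form, and tensoring with a left eigenvector carries semisimplicity from
  \<open>ad\<close> down to the matrix. Second, the labelling knows only the diagram, so the pairing
  of eigenlines has to be located by a regular element of \<open>a\<close>: it decreases weakly
  along the chain and takes opposite values on paired lines for \<open>su\<close>, equal values for
  \<open>sl_m(H)\<close>. For \<open>su\<close> a line may be paired with itself; maximality of
  \<open>a\<close> forces all such lines to have the same sign, and the signature then makes the
  first \<open>p\<close> values positive. Finally a single element of \<open>a\<close>, with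
  eigenvalue 2 on exactly the root spaces of \<open>\<Phi>_I\<close>, exhibits \<open>\<B>_I\<close>
  as an eigenspace of \<open>ad\<close>.\<close>

section \<open>Matrix algebra over the complex numbers\<close>

definition cscaleM :: "complex \<Rightarrow> complex^'n^'m \<Rightarrow> complex^'n^'m" (infixr "*\<^sub>C" 75) where
  "c *\<^sub>C A = (\<chi> i j. c * A $ i $ j)"

definition outer :: "complex^'n \<Rightarrow> complex^'m \<Rightarrow> complex^'m^'n" where
  "outer u w = (\<chi> i j. u $ i * w $ j)"

definition diagm :: "('n \<Rightarrow> complex) \<Rightarrow> complex^'n^'n" where
  "diagm d = (\<chi> i j. if i = j then d i else 0)"

definition munit :: "'n \<Rightarrow> 'n \<Rightarrow> complex^'n^'n" where
  "munit a b = (\<chi> i j. if i = a \<and> j = b then 1 else 0)"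

text \<open>Bilinear, without conjugation: the first argument acts as a linear form, so annihilators
  are complex subspaces.\<close>

definition dotp :: "complex^'n \<Rightarrow> complex^'n \<Rightarrow> complex" where
  "dotp w v = (\<Sum>i\<in>UNIV. w $ i * v $ i)"

lemma cscaleM_nth [simp]: "(c *\<^sub>C A) $ i $ j = c * A $ i $ j"
  by (simp add: cscaleM_def)

lemma diagm_nth: "diagm d $ i $ j = (if i = j then d i else 0)"
  by (simp add: diagm_def)

lemma munit_nth: "munit a b $ i $ j = (if i = a \<and> j = b then 1 else 0)"
  by (simp add: munit_def)

lemma outer_nth [simp]: "outer u w $ i $ j = u $ i * w $ j"
  by (simp add: outer_def)

lemma matrix_mult_nth: "(A ** B) $ i $ j = (\<Sum>k\<in>UNIV. A $ i $ k * B $ k $ j)"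
  by (simp add: matrix_matrix_mult_def)

lemma matrix_vector_nth: "(A *v x) $ i = (\<Sum>j\<in>UNIV. A $ i $ j * x $ j)"
  by (simp add: matrix_vector_mult_def)

lemma mat_eq_iff: "(A :: 'a^'n^'m) = B \<longleftrightarrow> (\<forall>i j. A $ i $ j = B $ i $ j)"
  by (auto simp: vec_eq_iff)

lemma cscaleM_simps [simp]:
  "0 *\<^sub>C A = 0" "1 *\<^sub>C A = A" "c *\<^sub>C 0 = 0" "c *\<^sub>C d *\<^sub>C A = (c * d) *\<^sub>C A"
  "(- 1) *\<^sub>C A = - A" "of_real r *\<^sub>C A = r *\<^sub>R A" "c *\<^sub>C (- A) = - (c *\<^sub>C A)" "(- c) *\<^sub>C A = - (c *\<^sub>C A)"
  by (simp_all add: mat_eq_iff) (simp add: scaleR_conv_of_real)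

lemma cscaleM_distrib:
  "c *\<^sub>C (A + B) = c *\<^sub>C A + c *\<^sub>C B" "c *\<^sub>C (A - B) = c *\<^sub>C A - c *\<^sub>C B"
  "(c + d) *\<^sub>C A = c *\<^sub>C A + d *\<^sub>C A" "(c - d) *\<^sub>C A = c *\<^sub>C A - d *\<^sub>C A"
  by (auto simp: mat_eq_iff algebra_simps)

lemma cscaleM_mult [simp]:
  "(c *\<^sub>C A) ** B = c *\<^sub>C (A ** B)" "A ** (c *\<^sub>C B) = c *\<^sub>C (A ** B)"
  by (auto simp: mat_eq_iff matrix_mult_nth sum_distrib_left mult_ac)

lemma scaleR_matrix_mult [simp]:
  fixes A :: "complex^'n^'m" and B :: "complex^'k^'n"
  shows "(r *\<^sub>R A) ** B = r *\<^sub>R (A ** B)" "A ** (r *\<^sub>R B) = r *\<^sub>R (A ** B)"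
  by (simp_all add: mat_eq_iff matrix_mult_nth scaleR_sum_right)

lemma cscaleM_vec [simp]: "(c *\<^sub>C A) *v x = c *s (A *v x)"
  by (auto simp: vec_eq_iff matrix_vector_nth sum_distrib_left mult_ac)

lemma cscaleM_eq_0: "c *\<^sub>C A = 0 \<longleftrightarrow> c = 0 \<or> A = 0"
  by (auto simp: mat_eq_iff)

lemma trace_zero [simp]: "trace (0 :: complex^'n^'n) = 0"
  by (simp add: trace_def)

lemma trace_cscaleM [simp]: "trace (c *\<^sub>C A) = c * trace A"
  by (simp add: trace_def sum_distrib_left)

lemma trace_minus [simp]: "trace (- A :: 'a::comm_ring_1^'n^'n) = - trace A"
  by (simp add: trace_def sum_negf)

lemma matrix_sub_ldistrib: "(A :: 'a::ring_1^'n^'m) ** (B - C) = A ** B - A ** C"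
  by (auto simp: mat_eq_iff matrix_mult_nth sum_subtractf algebra_simps)

lemma matrix_sub_rdistrib: "((B :: 'a::ring_1^'n^'m) - C) ** A = B ** A - C ** A"
  by (auto simp: mat_eq_iff matrix_mult_nth sum_subtractf algebra_simps)

lemma matrix_add_rdistrib': "((B :: 'a::ring_1^'n^'m) + C) ** A = B ** A + C ** A"
  by (auto simp: mat_eq_iff matrix_mult_nth sum.distrib algebra_simps)

lemma matrix_neg_mult [simp]:
  "(- (A :: 'a::ring_1^'n^'m)) ** B = - (A ** B)" "A ** (- B) = - (A ** B)"
  by (auto simp: mat_eq_iff matrix_mult_nth sum_negf)

lemmas matrix_ring_simps = matrix_add_ldistrib matrix_add_rdistrib' matrix_sub_ldistrib
  matrix_sub_rdistrib matrix_mul_assoc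

lemma comm_bracket_add:
  "comm_bracket (x + y) z = comm_bracket x z + comm_bracket y z"
  "comm_bracket x (y + z) = comm_bracket x y + comm_bracket x z"
  by (simp_all add: comm_bracket_def matrix_ring_simps)

lemma comm_bracket_diff:
  "comm_bracket (x - y) z = comm_bracket x z - comm_bracket y z"
  "comm_bracket x (y - z) = comm_bracket x y - comm_bracket x z"
  by (simp_all add: comm_bracket_def matrix_ring_simps)

lemma comm_bracket_cscaleM [simp]:
  "comm_bracket (c *\<^sub>C x) y = c *\<^sub>C comm_bracket x y"
  "comm_bracket x (c *\<^sub>C y) = c *\<^sub>C comm_bracket x y"
  by (simp_all add: comm_bracket_def cscaleM_distrib)

lemma comm_bracket_scaleR [simp]:
  fixes x y :: "complex^'n^'n"
  shows "comm_bracket (r *\<^sub>R x) y = r *\<^sub>R comm_bracket x y"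
  "comm_bracket x (r *\<^sub>R y) = r *\<^sub>R comm_bracket x y"
  using comm_bracket_cscaleM[where c = "complex_of_real r"] by simp_all

lemma comm_bracket_0 [simp]: "comm_bracket 0 x = 0" "comm_bracket x 0 = 0" "comm_bracket x x = 0"
  by (simp_all add: comm_bracket_def)

lemma comm_bracket_uminus [simp]: "comm_bracket (- x) y = - comm_bracket x y"
  "comm_bracket x (- y) = - comm_bracket x y"
  by (simp_all add: comm_bracket_def)

lemma comm_bracket_skew: "comm_bracket x y = - comm_bracket y x"
  by (simp add: comm_bracket_def)

lemma comm_bracket_jacobi:
  "comm_bracket (comm_bracket x y) z = comm_bracket x (comm_bracket y z) - comm_bracket y (comm_bracket x z)"
  by (simp add: comm_bracket_def matrix_ring_simps)

lemma trace_comm_bracket [simp]: "trace (comm_bracket x y :: complex^'n^'n) = 0"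
  by (simp add: comm_bracket_def trace_sub trace_mul_sym[of x y])

lemma trace_diagm: "trace (diagm d) = (\<Sum>i\<in>UNIV. d i)"
  by (simp add: trace_def diagm_nth)

lemma sum_delta2: "(\<Sum>k\<in>UNIV. (if i = k then f k else 0) * g k) = f i * (g i :: 'a::semiring_0)" for i :: "'n::finite"
proof -
  have "(\<Sum>k\<in>UNIV. (if i = k then f k else 0) * g k) = (\<Sum>k\<in>UNIV. if k = i then f k * g k else 0)"
    by (rule sum.cong) auto
  then show ?thesis by simp
qed

lemma sum_delta3: "(\<Sum>k\<in>UNIV. g k * (if k = i then f k else 0)) = g i * (f i :: 'a::semiring_0)" for i :: "'n::finite"
proof -
  have "(\<Sum>k\<in>UNIV. g k * (if k = i then f k else 0)) = (\<Sum>k\<in>UNIV. if k = i then g k * f k else 0)"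
    by (rule sum.cong) auto
  then show ?thesis by simp
qed

lemma diagm_mult: "(diagm d ** A) $ i $ j = d i * A $ i $ j"
  by (simp add: matrix_mult_nth diagm_nth sum_delta2)

lemma mult_diagm: "(A ** diagm d) $ i $ j = A $ i $ j * d j"
  by (simp add: matrix_mult_nth diagm_nth sum_delta3)

lemma comm_bracket_diagm: "comm_bracket (diagm d) A $ i $ j = (d i - d j) * A $ i $ j"
  by (simp add: comm_bracket_def diagm_mult mult_diagm algebra_simps)

lemma outer_mult_vec: "outer u w *v v = dotp w v *s u"
  by (simp add: vec_eq_iff matrix_vector_nth dotp_def sum_distrib_left sum_distrib_right mult_ac)

lemma mult_outer: "A ** outer u w = outer (A *v u) w"
  by (simp add: mat_eq_iff matrix_mult_nth matrix_vector_nth sum_distrib_left sum_distrib_right mult_ac)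

lemma outer_mult: "outer u w ** A = outer u (w v* A)"
  by (simp add: mat_eq_iff matrix_mult_nth vector_matrix_mult_def sum_distrib_left sum_distrib_right mult_ac)

lemma outer_mult_outer: "outer u w ** outer u' w' = dotp w u' *\<^sub>C outer u w'"
  by (simp add: mat_eq_iff matrix_mult_nth dotp_def sum_distrib_left sum_distrib_right mult_ac)

lemma trace_outer: "trace (outer u w) = dotp w u"
  by (simp add: trace_def dotp_def mult.commute)

lemma outer_eq_0: "outer u w = 0 \<longleftrightarrow> u = 0 \<or> w = 0"
  by (auto simp: mat_eq_iff vec_eq_iff)

lemma outer_linear:
  "outer (u + u') w = outer u w + outer u' w" "outer u (w + w') = outer u w + outer u w'"
  "outer (c *s u) w = c *\<^sub>C outer u w" "outer u (c *s w) = c *\<^sub>C outer u w"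
  "outer (u - u') w = outer u w - outer u' w" "outer u (w - w') = outer u w - outer u w'"
  by (auto simp: mat_eq_iff algebra_simps)

lemma dotp_linear:
  "dotp (u + u') w = dotp u w + dotp u' w" "dotp u (w + w') = dotp u w + dotp u w'"
  "dotp (c *s u) w = c * dotp u w" "dotp u (c *s w) = c * dotp u w"
  by (auto simp: dotp_def sum.distrib sum_distrib_left algebra_simps)

lemma dotp_matrix: "dotp (w v* A) v = dotp w (A *v v)"
proof -
  have "dotp (w v* A) v = (\<Sum>i\<in>UNIV. \<Sum>j\<in>UNIV. w $ j * A $ j $ i * v $ i)"
    by (simp add: dotp_def vector_matrix_mult_def sum_distrib_right)
  also have "\<dots> = (\<Sum>j\<in>UNIV. \<Sum>i\<in>UNIV. w $ j * A $ j $ i * v $ i)"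
    by (rule sum.swap)
  also have "\<dots> = dotp w (A *v v)"
    by (simp add: dotp_def matrix_vector_nth sum_distrib_left mult_ac)
  finally show ?thesis .
qed

lemma dotp_axis: "dotp (axis i 1) v = v $ i" "dotp v (axis i 1) = v $ i"
  by (auto simp: dotp_def axis_def if_distrib if_distribR cong: if_cong)

lemma ex_dotp_1: "w \<noteq> 0 \<Longrightarrow> \<exists>v. dotp w v = 1"
proof -
  assume "w \<noteq> 0"
  then obtain i where "w $ i \<noteq> 0" by (auto simp: vec_eq_iff)
  then have "dotp w ((1 / w $ i) *s axis i 1) = 1" by (simp add: dotp_linear dotp_axis)
  then show ?thesis by blast
qed

lemma matrix_axis: "(A *v axis k 1) $ i = (A $ i $ k :: complex)"
  by (simp add: matrix_vector_nth axis_def if_distrib cong: if_cong)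

lemma mult_sum_outer: "A ** B = (\<Sum>k\<in>UNIV. outer (A *v axis k 1) (axis k 1 v* B))"
  by (simp add: mat_eq_iff matrix_vector_nth vector_matrix_mult_def matrix_mult_nth axis_def if_distrib if_distribR
      cong: if_cong)

text \<open>\<open>y\<close> is the matrix of a linear section of \<open>z\<close> over its range.
  Later \<open>z = z ** (y ** z)\<close> splits \<open>z\<close> into columns of \<open>z\<close>
  times rows of \<open>z\<close>.\<close>

lemma ex_regular_inverse: "\<exists>y::complex^'n^'n. z ** y ** z = z" for z :: "complex^'n^'n"
proof -
  have lin: "Vector_Spaces.linear (*s) (*s) ((*v) z)" by simp
  obtain g where g: "Vector_Spaces.linear (*s) (*s) g" "\<forall>v\<in>range ((*v) z). z *v (g v) = v"
    using vec.linear_exists_right_inverse_on[OF lin vec.subspace_UNIV] by blast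
  have "z *v (matrix g *v (z *v v)) = z *v v" for v
    using g matrix_works[of g "z *v v"] by simp
  then have "z ** matrix g ** z = z"
    by (simp add: matrix_eq flip: matrix_vector_mul_assoc)
  then show ?thesis by blast
qed

text \<open>Write \<open>z\<close> as \<open>z ** y ** z\<close>; cyclicity of the trace brings the
  two factors \<open>z\<close> together, without any eigenvalues.\<close>

lemma trace_square_zero: "z ** z = 0 \<Longrightarrow> trace z = 0" for z :: "complex^'n^'n"
proof -
  assume z: "z ** z = 0"
  obtain y where y: "z ** y ** z = z" using ex_regular_inverse by blast
  have "trace z = trace (z ** (y ** z))" using y by (simp add: matrix_mul_assoc)
  also have "\<dots> = trace (y ** z ** z)" by (rule trace_mul_sym)
  also have "\<dots> = 0" using z by (simp flip: matrix_mul_assoc add: trace_def)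
  finally show ?thesis .
qed

section \<open>Eigenvectors\<close>

text \<open>The vector \<open>p(A) v\<close> by Horner's scheme, which makes the algebraic rules
  accessible to induction on \<open>pCons\<close>.\<close>

definition pact :: "complex poly \<Rightarrow> complex^'n^'n \<Rightarrow> complex^'n \<Rightarrow> complex^'n" where
  "pact p A v = fold_coeffs (\<lambda>c w. c *s v + A *v w) p 0"

lemma pact_0 [simp]: "pact 0 A v = 0"
  by (simp add: pact_def)

lemma pact_pCons [simp]: "pact (pCons c p) A v = c *s v + A *v pact p A v"
  by (cases "p = 0 \<and> c = 0") (auto simp: pact_def)

lemma pact_add: "pact (p + q) A v = pact p A v + pact q A v"
  by (induction p q rule: poly_induct2) (auto simp: algebra_simps vec.scale_left_distrib)

lemma pact_smult: "pact (smult c p) A v = c *s pact p A v"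
  by (induction p) (auto simp: vec.scale_right_distrib vector_scalar_commute)

lemma pact_vadd: "pact p A (v + w) = pact p A v + pact p A w"
  by (induction p) (auto simp: algebra_simps vec.scale_right_distrib)

lemma pact_vscale: "pact p A (c *s v) = c *s pact p A v"
  by (induction p) (auto simp: vec.scale_right_distrib vector_scalar_commute mult.commute)

lemma pact_vdiff: "pact p A (v - w) = pact p A v - pact p A w"
  using pact_vadd[of p A "v - w" w] by (simp add: algebra_simps)

lemma pact_mult: "pact (p * q) A v = pact p A (pact q A v)"
  by (induction p) (auto simp: pact_add pact_smult)

lemma pact_in: "vec.subspace S \<Longrightarrow> (\<And>w. w \<in> S \<Longrightarrow> A *v w \<in> S) \<Longrightarrow> v \<in> S \<Longrightarrow> pact p A v \<in> S"
  by (induction p) (auto simp: vec.subspace_0 vec.subspace_add vec.subspace_scale)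

lemma pact_monom: "pact (monom c i) A v = c *s (((*v) A ^^ i) v)"
  by (induction i) (auto simp: monom_Suc monom_0 vector_scalar_commute)

lemma pact_sum: "pact (\<Sum>i\<in>I. f i) A v = (\<Sum>i\<in>I. pact (f i) A v)"
  by (induction I rule: infinite_finite_induct) (auto simp: pact_add)

lemma pact_diff: "pact (p - q) A v = pact p A v - pact q A v"
  using pact_add[of "p - q" q A v] by (simp add: algebra_simps)

text \<open>The \<open>CARD('n) + 1\<close> vectors \<open>v, A v, A^2 v, ...\<close> satisfy a
  linear relation, whose coefficients form the polynomial.\<close>

lemma ex_annihilator: "\<exists>p. p \<noteq> 0 \<and> pact p A v = 0" for A :: "complex^'n^'n"
proof -
  define f where "f i = ((*v) A ^^ i) v" for i
  let ?N = "{..CARD('n)}"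
  show ?thesis
  proof (cases "inj_on f ?N")
    \<comment> \<open>A repetition would disappear in the image set, so it is treated apart: it
      gives a difference of two monomials.\<close>
    case False
    then obtain i j where ij: "i \<noteq> j" "f i = f j" by (auto simp: inj_on_def)
    let ?p = "monom 1 i - monom 1 j :: complex poly"
    have "coeff ?p i = 1" using ij by simp
    then have "?p \<noteq> 0" by (metis coeff_0 zero_neq_one)
    moreover have "pact ?p A v = 0" using ij by (simp add: pact_diff pact_monom f_def)
    ultimately show ?thesis by blast
  next
    case True
    then have "card (f ` ?N) = Suc (CARD('n))" by (simp add: card_image)
    then have "vec.dim (UNIV :: (complex^'n) set) < card (f ` ?N)" using vec_dim_card[where 'a=complex and 'n='n] by linarith
    then have "vec.dependent (f ` ?N)"
      using vec.independent_card_le_dim[of "f ` ?N" UNIV] by auto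
    then obtain t u where t: "finite t" "t \<subseteq> f ` ?N" "(\<Sum>w\<in>t. u w *s w) = 0" "\<exists>w\<in>t. u w \<noteq> 0"
      unfolding vec.dependent_explicit by blast
    define I where "I = {i\<in>?N. f i \<in> t}"
    have bij: "bij_betw f I t"
      using True t(2) by (auto simp: bij_betw_def I_def inj_on_def)
    define p where "p = (\<Sum>i\<in>I. monom (u (f i)) i)"
    obtain i0 where i0: "i0 \<in> I" "u (f i0) \<noteq> 0" using t(4) bij by (auto simp: bij_betw_def)
    have "coeff p i0 = (\<Sum>i\<in>I. if i = i0 then u (f i) else 0)"
      by (auto simp: p_def coeff_sum coeff_monom intro!: sum.cong)
    also have "\<dots> = u (f i0)" using i0 by (simp add: I_def)
    finally have "p \<noteq> 0" using i0 by auto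
    moreover have "pact p A v = (\<Sum>i\<in>I. u (f i) *s f i)"
      by (simp add: p_def pact_sum pact_monom f_def)
    then have "pact p A v = 0"
      using t(3) sum.reindex_bij_betw[OF bij, of "\<lambda>w. u w *s w"] by simp
    ultimately show ?thesis by blast
  qed
qed

lemma pact_linear_factor: "pact [:- \<mu>, 1:] A v = A *v v - \<mu> *s v"
  by simp

text \<open>Induction on the degree of a polynomial annihilating a non-zero vector \<open>v\<close>:
  for a root \<open>\<mu>\<close> either \<open>v\<close> is an eigenvector or
  \<open>(A - \<mu>) v\<close> is non-zero and annihilated by the quotient.\<close>

lemma ex_eigenvector:
  fixes A :: "complex^'n^'n"
  shows "\<exists>v \<mu>. v \<noteq> 0 \<and> A *v v = \<mu> *s v"
proof -
  have "v \<noteq> 0 \<Longrightarrow> p \<noteq> 0 \<Longrightarrow> pact p A v = 0 \<Longrightarrow> \<exists>v \<mu>. v \<noteq> 0 \<and> A *v v = \<mu> *s v" for p v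
  proof (induction "degree p" arbitrary: p v)
    case 0
    then obtain c where "p = [:c:]" "c \<noteq> 0" by (metis degree_0_id pCons_0_0 degree_eq_zeroE)
    then show ?case using 0 by simp
  next
    case (Suc d)
    then have "\<not> constant (poly p)" by (simp add: constant_degree)
    then obtain \<mu> where "poly p \<mu> = 0" using fundamental_theorem_of_algebra by blast
    then obtain q where q: "p = q * [:- \<mu>, 1:]" by (metis poly_eq_0_iff_dvd dvdE mult.commute)
    have "q \<noteq> 0" using q Suc by auto
    have "degree q = d" using Suc(2) \<open>q \<noteq> 0\<close> by (simp add: q degree_mult_eq del: mult_pCons_right)
    show ?case
    proof (cases "A *v v - \<mu> *s v = 0")
      case True then show ?thesis using Suc by auto
    next
      case False
      have "pact q A (A *v v - \<mu> *s v) = 0"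
        using Suc(5) pact_linear_factor[of \<mu> A v] unfolding q pact_mult by simp
      then show ?thesis using Suc(1)[OF _ False \<open>q \<noteq> 0\<close>] \<open>degree q = d\<close> by blast
    qed
  qed
  moreover have "axis undefined 1 \<noteq> (0::complex^'n)" by (simp add: axis_eq_0_iff)
  ultimately show ?thesis using ex_annihilator by metis
qed

lemma ex_left_eigenvector:
  fixes A :: "complex^'n^'n"
  shows "\<exists>w \<mu>. w \<noteq> 0 \<and> w v* A = \<mu> *s w"
  using ex_eigenvector[of "transpose A"] by (simp)

text \<open>The kernels of \<open>(A - \<mu>)^2\<close> and \<open>A - \<mu>\<close> agree, so there
  is no Jordan block of size two. This is the form in which normality of \<open>ad\<close> delivers
  semisimplicity.\<close>

definition semisimple :: "complex^'n^'n \<Rightarrow> bool" where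
  "semisimple A \<longleftrightarrow> (\<forall>\<mu> v. A *v (A *v v - \<mu> *s v) = \<mu> *s (A *v v - \<mu> *s v) \<longrightarrow> A *v v = \<mu> *s v)"

text \<open>The invariant subspace \<open>S\<close> is carried along so that, for commuting
  matrices, the eigenvectors found stay inside a joint eigenspace of the matrices treated
  before.\<close>

lemma semisimple_eigen_span:
  fixes A :: "complex^'n^'n"
  assumes ss: "semisimple A" and S: "vec.subspace S" "\<And>w. w \<in> S \<Longrightarrow> A *v w \<in> S" and v: "v \<in> S"
  shows "v \<in> vec.span {w\<in>S. \<exists>\<mu>. A *v w = \<mu> *s w}" (is "_ \<in> vec.span ?E")
proof -
  have "v \<in> S \<Longrightarrow> p \<noteq> 0 \<Longrightarrow> pact p A v = 0 \<Longrightarrow> v \<in> vec.span ?E" for p v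
  proof (induction "degree p" arbitrary: p v)
    case 0
    then obtain c where "p = [:c:]" "c \<noteq> 0" by (metis degree_eq_zeroE pCons_0_0)
    then have "v = 0" using 0 by simp
    then show ?case by (simp add: vec.span_zero)
  next
    case (Suc d)
    then have "\<not> constant (poly p)" by (simp add: constant_degree)
    then obtain \<mu> where "poly p \<mu> = 0" using fundamental_theorem_of_algebra by blast
    then obtain q where q: "p = [:- \<mu>, 1:] * q" by (metis poly_eq_0_iff_dvd dvdE)
    have "q \<noteq> 0" using q Suc by auto
    have dq: "degree q = d" using Suc(2) \<open>q \<noteq> 0\<close> by (simp add: q degree_mult_eq del: mult_pCons_left)
    define u where "u = pact q A v"
    have "u \<in> S" unfolding u_def by (intro pact_in S Suc)
    have Au: "A *v u = \<mu> *s u"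
      using Suc(5) pact_linear_factor[of \<mu> A u] unfolding q pact_mult u_def by simp
    have uE: "u \<in> vec.span ?E" using Au \<open>u \<in> S\<close> by (intro vec.span_base) auto
    show ?case
    proof (cases "poly q \<mu> = 0")
      \<comment> \<open>At a double root, \<open>u = (A - \<mu>) x\<close> lies in the kernel of
        \<open>A - \<mu>\<close>; semisimplicity gives \<open>u = 0\<close>, so \<open>q\<close>
        annihilates \<open>v\<close> already.\<close>
      case True
      then obtain r where r: "q = [:- \<mu>, 1:] * r" by (metis poly_eq_0_iff_dvd dvdE)
      define x where "x = pact r A v"
      have u: "u = A *v x - \<mu> *s x"
        using pact_linear_factor[of \<mu> A x] unfolding u_def r pact_mult x_def by simp
      have "A *v x = \<mu> *s x" using ss Au unfolding semisimple_def u by blast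
      then have "pact q A v = 0" using u u_def by simp
      then show ?thesis using Suc(1)[of q v] dq \<open>q \<noteq> 0\<close> Suc(3) by simp
    next
      case False
      have "pact s A u = poly s \<mu> *s u" for s
        by (induction s) (auto simp: Au vector_scalar_commute vec.scale_left_distrib mult.commute)
      then have qu: "pact q A u = poly q \<mu> *s u" .
      \<comment> \<open>Removes the \<open>\<mu>\<close>-component of \<open>v\<close>:
        \<open>q\<close> multiplies \<open>u\<close> by \<open>poly q \<mu>\<close>, hence
        annihilates \<open>v'\<close>.\<close>
      define v' where "v' = v - (1 / poly q \<mu>) *s u"
      have "v' \<in> S" unfolding v'_def using S(1) Suc(3) \<open>u \<in> S\<close>
        by (intro vec.subspace_diff vec.subspace_scale)
      moreover have "pact q A v' = 0" using False qu
        by (simp add: v'_def pact_vdiff pact_vscale flip: u_def)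
      ultimately have "v' \<in> vec.span ?E" using Suc(1)[of q v'] dq \<open>q \<noteq> 0\<close> by simp
      then have "v' + (1 / poly q \<mu>) *s u \<in> vec.span ?E"
        using uE by (intro vec.span_add vec.span_scale)
      then show ?thesis by (simp add: v'_def)
    qed
  qed
  then show ?thesis using v ex_annihilator by blast
qed

text \<open>A joint eigenspace of \<open>F\<close> is invariant under \<open>A\<close>, which
  commutes with \<open>F\<close>, so every joint eigenvector splits inside it into eigenvectors of
  \<open>A\<close>.\<close>

lemma joint_eigen_span:
  fixes F :: "(complex^'n^'n) set"
  assumes "finite F" "\<And>A. A \<in> F \<Longrightarrow> semisimple A" "\<And>A B. A \<in> F \<Longrightarrow> B \<in> F \<Longrightarrow> A ** B = B ** A"
  shows "vec.span {w. \<forall>A\<in>F. \<exists>\<mu>. A *v w = \<mu> *s w} = UNIV"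
  using assms
proof (induction F rule: finite_induct)
  case empty
  then show ?case by simp
next
  case (insert A F)
  let ?E = "{w. \<forall>A\<in>F. \<exists>\<mu>. A *v w = \<mu> *s w}"
  let ?E' = "{w. \<forall>A\<in>insert A F. \<exists>\<mu>. A *v w = \<mu> *s w}"
  have "?E \<subseteq> vec.span ?E'"
  proof
    fix w assume "w \<in> ?E"
    then obtain \<mu> where \<mu>: "\<And>B. B \<in> F \<Longrightarrow> B *v w = \<mu> B *s w" by (auto intro: that dest!: bchoice)
    define S where "S = {v. \<forall>B\<in>F. B *v v = \<mu> B *s v}"
    have S: "vec.subspace S"
      by (auto simp: S_def vec.subspace_def algebra_simps vec.scale_right_distrib vector_scalar_commute mult.commute)
    have "A *v v \<in> S" if "v \<in> S" for v
    proof -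
      have "B *v (A *v v) = \<mu> B *s (A *v v)" if "B \<in> F" for B
      proof -
        have "B *v (A *v v) = A *v (B *v v)" using insert.prems(2)[of A B] that
          by (simp add: matrix_vector_mul_assoc)
        then show ?thesis using \<open>v \<in> S\<close> that by (simp add: S_def vector_scalar_commute)
      qed
      then show ?thesis by (simp add: S_def)
    qed
    then have "w \<in> vec.span {v\<in>S. \<exists>\<mu>. A *v v = \<mu> *s v}"
      using semisimple_eigen_span[OF _ S, of A w] insert.prems \<mu> by (auto simp: S_def)
    moreover have "{v\<in>S. \<exists>\<mu>. A *v v = \<mu> *s v} \<subseteq> ?E'" by (auto simp: S_def)
    ultimately show "w \<in> vec.span ?E'" using vec.span_mono by blast
  qed
  moreover have "vec.span ?E = UNIV" using insert by simp
  ultimately show ?case using vec.span_minimal[OF _ vec.subspace_span, of ?E ?E'] by auto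
qed

lemma joint_diagonalise:
  fixes F :: "(complex^'n^'n) set"
  assumes "finite F" "\<And>A. A \<in> F \<Longrightarrow> semisimple A" "\<And>A B. A \<in> F \<Longrightarrow> B \<in> F \<Longrightarrow> A ** B = B ** A"
  shows "\<exists>(P::complex^'n^'n) Q. P ** Q = mat 1 \<and> Q ** P = mat 1 \<and> (\<forall>A\<in>F. \<exists>d. Q ** A ** P = diagm d)"
proof -
  let ?E = "{w. \<forall>A\<in>F. \<exists>\<mu>. A *v w = \<mu> *s w}"
  have "vec.span ?E = UNIV" using joint_eigen_span[OF assms] .
  obtain B where B: "B \<subseteq> ?E" "vec.independent B" "?E \<subseteq> vec.span B" "card B = vec.dim ?E"
    using vec.basis_exists by blast
  have spB: "vec.span B = UNIV"
    using \<open>vec.span ?E = UNIV\<close> B(3) vec.span_minimal[OF B(3) vec.subspace_span] by auto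
  have "card B = CARD('n)"
    using vec.dim_eq_card_independent[OF B(2)] vec.dim_span[of B]
    unfolding spB vec_dim_card by simp
  moreover have "finite B" using B(2) vec.finiteI_independent by blast
  ultimately obtain f where f: "bij_betw f (UNIV::'n set) B"
    using finite_same_card_bij[of "UNIV::'n set" B] by auto
  define P :: "complex^'n^'n" where "P = (\<chi> i j. f j $ i)"
  have col: "column j P = f j" for j by (simp add: P_def column_def)
  have "columns P = B" using f by (auto simp: columns_def col bij_betw_def)
  then obtain Q where Q: "P ** Q = mat 1" using matrix_right_invertible_span_columns[of P] spB by auto
  then have QP: "Q ** P = mat 1" by (simp add: matrix_left_right_inverse)
  have "\<exists>d. Q ** A ** P = diagm d" if "A \<in> F" for A
  proof -
    have "\<exists>\<mu>. A *v f j = \<mu> *s f j" for j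
      using that B(1) f by (auto simp: bij_betw_def)
    then obtain d where d: "\<And>j. A *v f j = d j *s f j" by metis
    have "A ** P = P ** diagm d"
    proof -
      have "(A ** P) $ i $ j = (P ** diagm d) $ i $ j" for i j
      proof -
        have "(A ** P) $ i $ j = (A *v f j) $ i" by (simp add: matrix_mult_nth matrix_vector_nth P_def)
        then show ?thesis by (simp add: d mult_diagm P_def)
      qed
      then show ?thesis by (simp add: mat_eq_iff)
    qed
    then have "Q ** A ** P = diagm d" using QP
      by (metis matrix_mul_assoc matrix_mul_lid)
    then show ?thesis by blast
  qed
  then show ?thesis using Q QP by (intro exI[of _ P] exI[of _ Q]) auto
qed

section \<open>Traces on a subspace and the Killing form\<close>

text \<open>Brackets and automorphisms are controlled on the carrier only, so linearity is relative
  to \<open>V\<close> and includes stability of \<open>V\<close>.\<close>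

definition linear_on :: "'a::real_vector set \<Rightarrow> ('a \<Rightarrow> 'a) \<Rightarrow> bool" where
  "linear_on V f \<longleftrightarrow> (\<forall>x\<in>V. \<forall>y\<in>V. f (x + y) = f x + f y) \<and> (\<forall>c. \<forall>x\<in>V. f (c *\<^sub>R x) = c *\<^sub>R f x) \<and> f ` V \<subseteq> V"

lemma linear_onI:
  assumes "\<And>x y. x \<in> V \<Longrightarrow> y \<in> V \<Longrightarrow> f (x + y) = f x + f y" "\<And>c x. x \<in> V \<Longrightarrow> f (c *\<^sub>R x) = c *\<^sub>R f x"
    "\<And>x. x \<in> V \<Longrightarrow> f x \<in> V"
  shows "linear_on V f"
  using assms by (auto simp: linear_on_def)

lemma linear_onD:
  assumes "linear_on V f" "x \<in> V"
  shows "f x \<in> V" "y \<in> V \<Longrightarrow> f (x + y) = f x + f y" "f (c *\<^sub>R x) = c *\<^sub>R f x"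
  using assms by (auto simp: linear_on_def)

lemma linear_on_sum:
  assumes f: "linear_on V f" and V: "subspace V" and I: "finite I" "\<And>i. i \<in> I \<Longrightarrow> x i \<in> V"
  shows "f (\<Sum>i\<in>I. c i *\<^sub>R x i) = (\<Sum>i\<in>I. c i *\<^sub>R f (x i))"
  using I
proof (induction I rule: finite_induct)
  case empty
  have "f (0 *\<^sub>R 0) = 0 *\<^sub>R f 0" using f subspace_0[OF V] unfolding linear_on_def by blast
  then show ?case by simp
next
  case (insert i I)
  have "(\<Sum>i\<in>I. c i *\<^sub>R x i) \<in> V" using V insert by (intro subspace_sum subspace_scale) auto
  moreover have "c i *\<^sub>R x i \<in> V" using V insert by (intro subspace_scale) auto
  ultimately show ?case using f insert by (simp add: linear_on_def)
qed

lemma linear_on_comp: "linear_on V f \<Longrightarrow> linear_on V g \<Longrightarrow> linear_on V (\<lambda>x. f (g x))"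
  by (auto simp: linear_on_def image_subset_iff)

locale fin_subspace =
  fixes V :: "'a::real_vector set"
  assumes subV: "subspace V" and finV: "\<And>B. independent B \<Longrightarrow> B \<subseteq> V \<Longrightarrow> finite B"
begin

text \<open>The same choice as inside \<open>trace_on\<close>, so that \<open>trace_on_eq\<close> is
  a mere unfolding.\<close>

definition "tbasis = (SOME B. independent B \<and> span B = V)"

lemma tbasis: "independent tbasis" "span tbasis = V" "tbasis \<subseteq> V" "finite tbasis"
proof -
  have "\<exists>B. independent B \<and> span B = V"
    using basis_exists[of V] span_eq_iff[of V] subV span_mono[of _ V] by (metis subset_antisym)
  then have "independent tbasis \<and> span tbasis = V" unfolding tbasis_def by (rule someI_ex)
  then show "independent tbasis" "span tbasis = V" by auto
  then show "tbasis \<subseteq> V" using span_superset by blast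
  with \<open>independent tbasis\<close> show "finite tbasis" by (intro finV)
qed

lemma trace_on_eq: "trace_on V f = (\<Sum>b\<in>tbasis. representation tbasis (f b) b)"
  by (simp add: trace_on_def tbasis_def Let_def)

lemma trace_on_cong: "(\<And>x. x \<in> V \<Longrightarrow> f x = g x) \<Longrightarrow> trace_on V f = trace_on V g"
  unfolding trace_on_eq using tbasis(3) by (intro sum.cong) auto

lemma rep_expand: "v \<in> V \<Longrightarrow> (\<Sum>b\<in>tbasis. representation tbasis v b *\<^sub>R b) = v"
  using sum_representation_eq[OF tbasis(1), of v tbasis] tbasis by simp

lemma rep_sum: 
  assumes "\<And>i. i \<in> I \<Longrightarrow> x i \<in> V" "finite I"
  shows "representation tbasis (\<Sum>i\<in>I. c i *\<^sub>R x i) b = (\<Sum>i\<in>I. c i * representation tbasis (x i) b)"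
proof -
  have "representation tbasis (\<Sum>i\<in>I. c i *\<^sub>R x i) b = (\<Sum>i\<in>I. representation tbasis (c i *\<^sub>R x i) b)"
    using assms tbasis subV by (subst representation_sum) (auto intro: subspace_scale)
  also have "\<dots> = (\<Sum>i\<in>I. c i * representation tbasis (x i) b)"
    using assms tbasis by (intro sum.cong) (auto simp: representation_scale)
  finally show ?thesis .
qed

lemma trace_on_add:
  assumes "linear_on V f" "linear_on V g"
  shows "trace_on V (\<lambda>x. f x + g x) = trace_on V f + trace_on V g"
  unfolding trace_on_eq sum.distrib[symmetric]
proof (rule sum.cong[OF refl])
  fix b assume "b \<in> tbasis"
  then have "b \<in> V" using tbasis by blast
  then show "representation tbasis (f b + g b) b = representation tbasis (f b) b + representation tbasis (g b) b"
    using tbasis linear_onD[OF assms(1)] linear_onD[OF assms(2)] by (simp add: representation_add)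
qed

lemma trace_on_scale:
  assumes "linear_on V f"
  shows "trace_on V (\<lambda>x. c *\<^sub>R f x) = c * trace_on V f"
  unfolding trace_on_eq sum_distrib_left
proof (rule sum.cong[OF refl])
  fix b assume "b \<in> tbasis"
  then have "b \<in> V" using tbasis by blast
  then show "representation tbasis (c *\<^sub>R f b) b = c * representation tbasis (f b) b"
    using tbasis linear_onD[OF assms(1)] by (simp add: representation_scale)
qed

text \<open>In coordinates both traces are the same double sum of products of matrix coefficients,
  with the summations exchanged.\<close>

lemma trace_on_cyclic:
  assumes f: "linear_on V f" and g: "linear_on V g"
  shows "trace_on V (\<lambda>x. f (g x)) = trace_on V (\<lambda>x. g (f x))"
proof -
  let ?r = "representation tbasis"
  have *: "trace_on V (\<lambda>x. f (g x)) = (\<Sum>b\<in>tbasis. \<Sum>c\<in>tbasis. ?r (g b) c * ?r (f c) b)"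
    if f: "linear_on V f" and g: "linear_on V g" for f g
    unfolding trace_on_eq
  proof (rule sum.cong[OF refl])
    fix b assume "b \<in> tbasis"
    then have gb: "g b \<in> V" using linear_onD(1)[OF g] tbasis(3) by blast
    have "f (g b) = (\<Sum>c\<in>tbasis. ?r (g b) c *\<^sub>R f c)"
      using linear_on_sum[OF f subV tbasis(4), of "\<lambda>x. x" "?r (g b)"] tbasis(3) rep_expand[OF gb] by auto
    then show "?r (f (g b)) b = (\<Sum>c\<in>tbasis. ?r (g b) c * ?r (f c) b)"
      using linear_onD(1)[OF f] tbasis by (simp, intro rep_sum) auto
  qed
  show ?thesis unfolding *[OF f g] *[OF g f]
    by (subst sum.swap) (simp add: mult.commute)
qed

end

text \<open>\<open>L\<close> is the set of trace zero fixed points of the antilinear involution \<open>sg\<close> of \<open>gl\<^sub>n(\<complex>)\<close>, embedded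
  by \<open>psi\<close>; for \<open>su\<^sub>p\<^sub>,\<^sub>q\<close> the embedding is a change of basis, for \<open>sl\<^sub>m(H)\<close> it writes a quaternionic
  matrix as a complex one of twice the size.\<close>

locale real_form =
  fixes L :: "'a::real_vector set" and lb :: "'a bracket"
    and psi :: "'a \<Rightarrow> complex^'n^'n" and sg :: "complex^'n^'n \<Rightarrow> complex^'n^'n"
  assumes psi_linear: "linear psi" and psi_inj: "inj psi"
    and psi_lb: "psi (lb x y) = comm_bracket (psi x) (psi y)"
    and psi_L: "psi ` L = {z. trace z = 0 \<and> sg z = z}"
    and sg_add: "sg (z + w) = sg z + sg w" and sg_cscaleM: "sg (c *\<^sub>C z) = cnj c *\<^sub>C sg z"
    and sg_sg: "sg (sg z) = z" and sg_trace: "trace z = 0 \<Longrightarrow> trace (sg z) = 0"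
    and sg_bracket: "sg (comm_bracket z w) = comm_bracket (sg z) (sg w)"
begin

lemma psi_add: "psi (x + y) = psi x + psi y" and psi_scale: "psi (c *\<^sub>R x) = c *\<^sub>R psi x"
  and psi_0: "psi 0 = 0" and psi_diff: "psi (x - y) = psi x - psi y" and psi_minus: "psi (- x) = - psi x"
  using psi_linear by (simp_all add: linear_add linear_scale linear_0 linear_diff linear_neg)

lemma psi_eq: "psi x = psi y \<longleftrightarrow> x = y"
  using psi_inj by (auto simp: inj_def)

lemma psi_eq_0: "psi x = 0 \<longleftrightarrow> x = 0"
  using psi_eq[of x 0] by (simp add: psi_0)

lemmas psi_hom = psi_add psi_scale psi_0 psi_diff psi_minus psi_lb

lemma L_iff: "x \<in> L \<longleftrightarrow> trace (psi x) = 0 \<and> sg (psi x) = psi x"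
proof -
  have "x \<in> L \<longleftrightarrow> psi x \<in> psi ` L" using psi_eq by auto
  then show ?thesis by (simp add: psi_L)
qed

lemma sg_0 [simp]: "sg 0 = 0" using sg_cscaleM[of 0 0] by simp

lemma sg_minus: "sg (- z) = - sg z" using sg_cscaleM[of "-1" z] by simp

lemma sg_diff: "sg (z - w) = sg z - sg w" using sg_add[of z "- w"] by (simp add: sg_minus)

lemma sg_scaleR: "sg (c *\<^sub>R z) = c *\<^sub>R sg z"
  using sg_cscaleM[of "complex_of_real c" z] by simp

lemma subspace_L: "subspace L"
proof -
  have "trace (r *\<^sub>R A) = r *\<^sub>R trace A" for r and A :: "complex^'n^'n"
    by (simp add: trace_def scaleR_sum_right)
  then show ?thesis by (auto simp: subspace_def L_iff psi_hom sg_add sg_scaleR trace_add)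
qed

lemma lb_in_L: "x \<in> L \<Longrightarrow> y \<in> L \<Longrightarrow> lb x y \<in> L"
  by (simp add: L_iff psi_lb sg_bracket)

lemma lb_simps:
  "lb (x + y) z = lb x z + lb y z" "lb z (x + y) = lb z x + lb z y"
  "lb (x - y) z = lb x z - lb y z" "lb z (x - y) = lb z x - lb z y"
  "lb (c *\<^sub>R x) y = c *\<^sub>R lb x y" "lb x (c *\<^sub>R y) = c *\<^sub>R lb x y"
  "lb (- x) y = - lb x y" "lb x (- y) = - lb x y" "lb 0 x = 0" "lb x 0 = 0" "lb x x = 0"
  by (simp_all add: psi_hom comm_bracket_add comm_bracket_diff flip: psi_eq)

lemma lb_skew: "lb x y = - lb y x"
proof -
  have "psi (lb x y) = psi (- lb y x)" unfolding psi_hom by (rule comm_bracket_skew)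
  then show ?thesis by (simp only: psi_eq)
qed

lemma lb_jacobi: "lb (lb x y) z = lb x (lb y z) - lb y (lb x z)"
  by (simp add: psi_hom comm_bracket_jacobi flip: psi_eq)

sublocale fin_subspace L
proof
  show "subspace L" by (rule subspace_L)
  fix B :: "'a set" assume "independent B"
  then have "independent (psi ` B)"
    using psi_linear psi_inj by (simp add: linear_independent_injective_image inj_on_subset)
  then have "finite (psi ` B)" by (rule independent_imp_finite)
  then show "finite B" using psi_inj by (meson finite_imageD inj_on_subset subset_UNIV)
qed

lemma linear_on_lb: "x \<in> L \<Longrightarrow> linear_on L (lb x)"
  by (rule linear_onI) (auto simp: lb_simps lb_in_L)

lemma linear_on_lb2: "x \<in> L \<Longrightarrow> y \<in> L \<Longrightarrow> linear_on L (\<lambda>z. lb x (lb y z))"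
  by (rule linear_on_comp[of _ "lb x" "lb y"]) (auto intro: linear_on_lb)

lemma killing_add: "x \<in> L \<Longrightarrow> y \<in> L \<Longrightarrow> z \<in> L \<Longrightarrow> killing L lb (x + y) z = killing L lb x z + killing L lb y z"
  unfolding killing_def lb_simps by (intro trace_on_add linear_on_lb2)

lemma killing_scale: "x \<in> L \<Longrightarrow> z \<in> L \<Longrightarrow> killing L lb (c *\<^sub>R x) z = c * killing L lb x z"
  unfolding killing_def lb_simps by (intro trace_on_scale linear_on_lb2)

lemma killing_sym: "x \<in> L \<Longrightarrow> y \<in> L \<Longrightarrow> killing L lb x y = killing L lb y x"
  unfolding killing_def by (intro trace_on_cyclic linear_on_lb)

text \<open>By Jacobi the left side is the trace of \<open>ad x ad y ad z - ad y ad x ad z\<close>;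
  cyclicity moves \<open>ad y\<close> in the second product to the end.\<close>

lemma killing_invariant:
  assumes "x \<in> L" "y \<in> L" "z \<in> L"
  shows "killing L lb (lb x y) z = killing L lb x (lb y z)"
proof -
  have lin3: "linear_on L (\<lambda>w. lb a (lb b (lb c w)))" if "a \<in> L" "b \<in> L" "c \<in> L" for a b c
    using linear_on_comp[OF linear_on_lb linear_on_lb2] that by blast
  have diff: "trace_on L (\<lambda>w. f w - g w) = trace_on L f - trace_on L g" if "linear_on L f" "linear_on L g" for f g
  proof -
    have "linear_on L (\<lambda>w. (-1) *\<^sub>R g w)"
      by (rule linear_onI) (use that subV in \<open>auto simp: linear_onD subspace_neg\<close>)
    then show ?thesis using trace_on_add[of f "\<lambda>w. (-1) *\<^sub>R g w"] trace_on_scale[of g "-1"] that by simp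
  qed
  have "killing L lb (lb x y) z = trace_on L (\<lambda>w. lb x (lb y (lb z w)) - lb y (lb x (lb z w)))"
    unfolding killing_def by (simp add: lb_jacobi)
  also have "\<dots> = trace_on L (\<lambda>w. lb x (lb y (lb z w))) - trace_on L (\<lambda>w. lb y (lb x (lb z w)))"
    using assms by (intro diff lin3)
  also have "trace_on L (\<lambda>w. lb y (lb x (lb z w))) = trace_on L (\<lambda>w. lb x (lb z (lb y w)))"
    using trace_on_cyclic[OF linear_on_lb linear_on_lb2] assms by blast
  also have "trace_on L (\<lambda>w. lb x (lb y (lb z w))) - trace_on L (\<lambda>w. lb x (lb z (lb y w)))
      = trace_on L (\<lambda>w. lb x (lb y (lb z w)) - lb x (lb z (lb y w)))"
    using assms by (intro diff[symmetric] lin3)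
  also have "\<dots> = killing L lb x (lb y z)"
    unfolding killing_def by (simp add: lb_jacobi lb_simps)
  finally show ?thesis .
qed

text \<open>An automorphism conjugates \<open>ad x\<close> into \<open>ad (\<phi> x)\<close>, and
  cyclicity of the trace cancels \<open>\<phi>\<close> against its inverse \<open>\<rho>\<close> on
  \<open>L\<close>.\<close>

lemma killing_automorphism:
  assumes th: "lie_automorphism L lb \<phi>" and "x \<in> L" "y \<in> L"
  shows "killing L lb (\<phi> x) (\<phi> y) = killing L lb x y"
proof -
  have bij: "bij_betw \<phi> L L" using th by (simp add: lie_automorphism_def)
  define \<rho> where "\<rho> = the_inv_into L \<phi>"
  have \<rho>: "\<And>x. x \<in> L \<Longrightarrow> \<rho> x \<in> L" "\<And>x. x \<in> L \<Longrightarrow> \<phi> (\<rho> x) = x" "\<And>x. x \<in> L \<Longrightarrow> \<rho> (\<phi> x) = x"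
    using bij unfolding \<rho>_def bij_betw_def by (auto simp: the_inv_into_into f_the_inv_into_f the_inv_into_f_f)
  have phi: "\<And>x. x \<in> L \<Longrightarrow> \<phi> x \<in> L" using bij by (auto simp: bij_betw_def)
  have lphi: "linear_on L \<phi>" using th phi by (auto simp: lie_automorphism_def intro!: linear_onI)
  have inj: "\<And>x y. x \<in> L \<Longrightarrow> y \<in> L \<Longrightarrow> \<phi> x = \<phi> y \<Longrightarrow> x = y" using bij by (auto simp: bij_betw_def inj_on_def)
  have lrho: "linear_on L \<rho>"
  proof (rule linear_onI)
    fix x y assume xy: "x \<in> L" "y \<in> L"
    show "\<rho> (x + y) = \<rho> x + \<rho> y"
      by (rule inj) (use lphi xy \<rho> subV in \<open>auto simp: linear_on_def subspace_add\<close>)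
    fix c show "\<rho> (c *\<^sub>R x) = c *\<^sub>R \<rho> x"
      by (rule inj) (use lphi xy \<rho> subV in \<open>auto simp: linear_on_def subspace_scale\<close>)
  qed (use \<rho> in auto)
  have "killing L lb (\<phi> x) (\<phi> y) = trace_on L (\<lambda>z. \<phi> (lb x (lb y (\<rho> z))))"
    unfolding killing_def
  proof (rule trace_on_cong)
    fix z assume z: "z \<in> L"
    have "lb (\<phi> x) (lb (\<phi> y) (\<phi> (\<rho> z))) = \<phi> (lb x (lb y (\<rho> z)))"
      using th assms z \<rho> by (simp add: lie_automorphism_def lb_in_L)
    then show "lb (\<phi> x) (lb (\<phi> y) z) = \<phi> (lb x (lb y (\<rho> z)))" using z \<rho> by simp
  qed
  also have "\<dots> = trace_on L (\<lambda>z. lb x (lb y (\<rho> (\<phi> z))))"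
    using trace_on_cyclic[OF lphi linear_on_comp[OF linear_on_lb2 lrho]] assms by blast
  also have "\<dots> = killing L lb x y"
    unfolding killing_def by (rule trace_on_cong) (simp add: \<rho>)
  finally show ?thesis .
qed

lemma abelian_iff: "abelian lb S \<longleftrightarrow> (\<forall>x\<in>S. \<forall>y\<in>S. lb x y = 0)"
proof -
  have "span A = {0} \<longleftrightarrow> A \<subseteq> {0}" for A :: "'a set"
    by (metis span_superset span_minimal subspace_single_0 span_zero empty_subsetI insert_subset subset_antisym)
  then have "abelian lb S \<longleftrightarrow> {lb x y |x y. x \<in> S \<and> y \<in> S} \<subseteq> {0}"
    unfolding abelian_def bracket_space_def .
  then show ?thesis by blast
qed

end

section \<open>Cartan involutions and diagonalisation\<close>

context real_form begin

text \<open>With \<open>iq\<close>, the real and imaginary part of a trace zero matrix with respect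
  to the real form fixed by \<open>sg\<close>.\<close>

definition rp :: "complex^'n^'n \<Rightarrow> 'a" where
  "rp z = inv psi ((1/2) *\<^sub>C (z + sg z))"

definition iq :: "complex^'n^'n \<Rightarrow> 'a" where
  "iq z = inv psi ((- \<i>/2) *\<^sub>C (z - sg z))"

lemma cnj_half: "cnj (\<i>/2) = - \<i>/2" "cnj (1/2) = 1/2" "cnj (- \<i>/2) = \<i>/2"
  by (auto simp: complex_eq_iff)

lemma rp_iq:
  assumes "trace z = 0"
  shows "rp z \<in> L" "iq z \<in> L" "psi (rp z) = (1/2) *\<^sub>C (z + sg z)" "psi (iq z) = (- \<i>/2) *\<^sub>C (z - sg z)"
    "z = psi (rp z) + \<i> *\<^sub>C psi (iq z)"
proof -
  let ?r = "(1/2) *\<^sub>C (z + sg z)" and ?i = "(- \<i>/2) *\<^sub>C (z - sg z)"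
  have "?r \<in> psi ` L"
    using assms sg_trace[OF assms] unfolding psi_L
    by (simp add: trace_add sg_cscaleM sg_add sg_sg cnj_half add.commute)
  then obtain x where x: "x \<in> L" "?r = psi x" by auto
  have "?i \<in> psi ` L"
    using assms sg_trace[OF assms] unfolding psi_L
    by (simp add: trace_sub sg_cscaleM sg_minus sg_diff sg_sg cnj_half) (simp add: mat_eq_iff algebra_simps)
  then obtain y where y: "y \<in> L" "?i = psi y" by auto
  have "rp z = x" "iq z = y" unfolding rp_def iq_def x y using psi_inj by auto
  then show "rp z \<in> L" "iq z \<in> L" and r: "psi (rp z) = ?r" and i: "psi (iq z) = ?i" using x y by auto
  show "z = psi (rp z) + \<i> *\<^sub>C psi (iq z)" unfolding r i
    by (simp add: mat_eq_iff field_simps)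
qed

text \<open>Applying the antilinear \<open>sg\<close> changes the sign of the imaginary part only;
  half the sum of the two equations isolates \<open>psi x\<close>.\<close>

lemma complexification_unique:
  assumes "x \<in> L" "y \<in> L" "x' \<in> L" "y' \<in> L" "psi x + \<i> *\<^sub>C psi y = psi x' + \<i> *\<^sub>C psi y'"
  shows "x = x'" "y = y'"
proof -
  have "sg (psi x + \<i> *\<^sub>C psi y) = sg (psi x' + \<i> *\<^sub>C psi y')" using assms(5) by simp
  then have s: "psi x - \<i> *\<^sub>C psi y = psi x' - \<i> *\<^sub>C psi y'"
    using assms(1-4) by (simp add: sg_add sg_cscaleM L_iff)
  have "psi x = psi x'"
    unfolding mat_eq_iff
  proof (intro allI)
    fix i j show "psi x $ i $ j = psi x' $ i $ j"
      using arg_cong[OF s, of "\<lambda>A. A $ i $ j"] arg_cong[OF assms(5), of "\<lambda>A. A $ i $ j"] by simp algebra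
  qed
  then show "x = x'" by (simp add: psi_eq)
  then have "\<i> *\<^sub>C (psi y - psi y') = 0" using assms(5) by (simp add: cscaleM_distrib)
  then show "y = y'" by (simp add: cscaleM_eq_0 psi_eq)
qed

lemma trace_psi: "x \<in> L \<Longrightarrow> trace (psi x) = 0" by (simp add: L_iff)

lemma trace_complexification: "x \<in> L \<Longrightarrow> y \<in> L \<Longrightarrow> trace (psi x + \<i> *\<^sub>C psi y) = 0"
  by (simp add: trace_add trace_psi)

lemma rp_iq_eq:
  assumes "x \<in> L" "y \<in> L"
  shows "rp (psi x + \<i> *\<^sub>C psi y) = x" "iq (psi x + \<i> *\<^sub>C psi y) = y"
  using complexification_unique[of "rp (psi x + \<i> *\<^sub>C psi y)" "iq (psi x + \<i> *\<^sub>C psi y)" x y]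
    rp_iq[OF trace_complexification[OF assms]] assms by auto

lemma rp_iq_eqI:
  assumes "x \<in> L" "y \<in> L" "z = psi x + \<i> *\<^sub>C psi y"
  shows "rp z = x" "iq z = y"
  using rp_iq_eq[OF assms(1,2)] assms(3) by auto

lemma rp_iq_add:
  assumes "trace z = 0" "trace w = 0"
  shows "rp (z + w) = rp z + rp w" "iq (z + w) = iq z + iq w"
proof -
  have "z + w = psi (rp z + rp w) + \<i> *\<^sub>C psi (iq z + iq w)"
    using arg_cong2[OF rp_iq(5)[OF assms(1)] rp_iq(5)[OF assms(2)], of "(+)"]
    by (simp only: psi_hom cscaleM_distrib ac_simps)
  then show "rp (z + w) = rp z + rp w" "iq (z + w) = iq z + iq w"
    using rp_iq assms subV by (intro rp_iq_eqI; simp add: subspace_add)+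
qed

lemma rp_iq_cscaleM:
  assumes "trace z = 0"
  shows "rp (c *\<^sub>C z) = Re c *\<^sub>R rp z - Im c *\<^sub>R iq z" "iq (c *\<^sub>C z) = Re c *\<^sub>R iq z + Im c *\<^sub>R rp z"
proof -
  have "c *\<^sub>C (psi (rp z) + \<i> *\<^sub>C psi (iq z)) = psi (Re c *\<^sub>R rp z - Im c *\<^sub>R iq z) + \<i> *\<^sub>C psi (Re c *\<^sub>R iq z + Im c *\<^sub>R rp z)"
    by (simp add: psi_hom mat_eq_iff complex_eq_iff algebra_simps)
  then have "c *\<^sub>C z = psi (Re c *\<^sub>R rp z - Im c *\<^sub>R iq z) + \<i> *\<^sub>C psi (Re c *\<^sub>R iq z + Im c *\<^sub>R rp z)"
    using rp_iq(5)[OF assms, symmetric] by simp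
  then show "rp (c *\<^sub>C z) = Re c *\<^sub>R rp z - Im c *\<^sub>R iq z" "iq (c *\<^sub>C z) = Re c *\<^sub>R iq z + Im c *\<^sub>R rp z"
    using rp_iq assms subV by (intro rp_iq_eqI; simp add: subspace_add subspace_diff subspace_scale)+
qed

lemma rp_iq_bracket:
  assumes "trace z = 0" "k \<in> L"
  shows "rp (comm_bracket (psi k) z) = lb k (rp z)" "iq (comm_bracket (psi k) z) = lb k (iq z)"
proof -
  have "comm_bracket (psi k) z = comm_bracket (psi k) (psi (rp z) + \<i> *\<^sub>C psi (iq z))"
    using rp_iq(5)[OF assms(1), symmetric] by simp
  also have "\<dots> = psi (lb k (rp z)) + \<i> *\<^sub>C psi (lb k (iq z))"
    by (simp add: comm_bracket_add psi_lb)
  finally show "rp (comm_bracket (psi k) z) = lb k (rp z)" "iq (comm_bracket (psi k) z) = lb k (iq z)"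
    using rp_iq assms by (intro rp_iq_eqI; simp add: lb_in_L)+
qed

text \<open>A change of basis alters \<open>psi\<close> and \<open>sg\<close> but leaves
  \<open>L\<close>, its bracket, \<open>a\<close> and \<open>h\<close> alone, so \<open>h\<close>
  may later be taken diagonal.\<close>

lemma real_form_conj:
  assumes PQ: "(P :: complex^'n^'n) ** Q = mat 1" "Q ** P = mat 1"
  shows "real_form L lb (\<lambda>x. Q ** psi x ** P) (\<lambda>z. Q ** sg (P ** z ** Q) ** P)"
proof -
  have QP: "Q ** (P ** z ** Q) ** P = z" "P ** (Q ** z ** P) ** Q = z" for z :: "complex^'n^'n"
  proof -
    have "Q ** (P ** z ** Q) ** P = (Q ** P) ** z ** (Q ** P)" by (simp only: matrix_mul_assoc)
    then show "Q ** (P ** z ** Q) ** P = z" by (simp add: PQ)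
    have "P ** (Q ** z ** P) ** Q = (P ** Q) ** z ** (P ** Q)" by (simp only: matrix_mul_assoc)
    then show "P ** (Q ** z ** P) ** Q = z" by (simp add: PQ)
  qed
  have br: "comm_bracket (Q ** z ** P) (Q ** w ** P) = Q ** comm_bracket z w ** P"
    "comm_bracket (P ** z ** Q) (P ** w ** Q) = P ** comm_bracket z w ** Q" for z w :: "complex^'n^'n"
  proof -
    have "Q ** z ** P ** (Q ** w ** P) = Q ** z ** (P ** Q) ** w ** P" for z w by (simp only: matrix_mul_assoc)
    then show "comm_bracket (Q ** z ** P) (Q ** w ** P) = Q ** comm_bracket z w ** P"
      by (simp add: comm_bracket_def PQ matrix_ring_simps)
    have "P ** z ** Q ** (P ** w ** Q) = P ** z ** (Q ** P) ** w ** Q" for z w by (simp only: matrix_mul_assoc)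
    then show "comm_bracket (P ** z ** Q) (P ** w ** Q) = P ** comm_bracket z w ** Q"
      by (simp add: comm_bracket_def PQ matrix_ring_simps)
  qed
  have tr: "trace (Q ** z ** P) = trace z" "trace (P ** z ** Q) = trace z" for z :: "complex^'n^'n"
  proof -
    show "trace (Q ** z ** P) = trace z" by (subst trace_mul_sym) (simp add: matrix_mul_assoc PQ)
    show "trace (P ** z ** Q) = trace z" by (subst trace_mul_sym) (simp add: matrix_mul_assoc PQ)
  qed
  show ?thesis
  proof (rule real_form.intro)
    show "linear (\<lambda>x. Q ** psi x ** P)"
      by (rule linearI) (simp_all only: psi_hom matrix_add_ldistrib matrix_add_rdistrib' scaleR_matrix_mult)
    show "inj (\<lambda>x. Q ** psi x ** P)"
    proof (rule injI)
      fix x y assume "Q ** psi x ** P = Q ** psi y ** P"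
      then have "P ** (Q ** psi x ** P) ** Q = P ** (Q ** psi y ** P) ** Q" by simp
      then show "x = y" unfolding QP psi_eq .
    qed
    show "Q ** psi (lb x y) ** P = comm_bracket (Q ** psi x ** P) (Q ** psi y ** P)" for x y
      by (simp add: psi_lb br)
    have "(\<lambda>x. Q ** psi x ** P) ` L = (\<lambda>z. Q ** z ** P) ` (psi ` L)" by (simp add: image_image)
    also have "\<dots> = {z. trace z = 0 \<and> Q ** sg (P ** z ** Q) ** P = z}"
      unfolding psi_L
    proof (intro set_eqI iffI)
      fix w assume "w \<in> (\<lambda>z. Q ** z ** P) ` {z. trace z = 0 \<and> sg z = z}"
      then show "w \<in> {z. trace z = 0 \<and> Q ** sg (P ** z ** Q) ** P = z}" by (auto simp: QP tr)
    next
      fix w assume "w \<in> {z. trace z = 0 \<and> Q ** sg (P ** z ** Q) ** P = z}"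
      then have w: "trace w = 0" "Q ** sg (P ** w ** Q) ** P = w" by auto
      have "sg (P ** w ** Q) = P ** w ** Q" using arg_cong[OF w(2), of "\<lambda>z. P ** z ** Q"] by (simp add: QP)
      then show "w \<in> (\<lambda>z. Q ** z ** P) ` {z. trace z = 0 \<and> sg z = z}"
        using w by (intro image_eqI[of _ _ "P ** w ** Q"]) (auto simp: QP tr)
    qed
    finally show "(\<lambda>x. Q ** psi x ** P) ` L = {z. trace z = 0 \<and> Q ** sg (P ** z ** Q) ** P = z}" .
  next
    fix z w :: "complex^'n^'n" and c
    show "Q ** sg (P ** (z + w) ** Q) ** P = Q ** sg (P ** z ** Q) ** P + Q ** sg (P ** w ** Q) ** P"
      by (simp add: matrix_add_ldistrib matrix_add_rdistrib' sg_add)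
    show "Q ** sg (P ** (c *\<^sub>C z) ** Q) ** P = cnj c *\<^sub>C (Q ** sg (P ** z ** Q) ** P)"
      by (simp add: sg_cscaleM)
    show "Q ** sg (P ** (Q ** sg (P ** z ** Q) ** P) ** Q) ** P = z" by (simp only: QP sg_sg)
    show "trace (Q ** sg (P ** z ** Q) ** P) = 0" if "trace z = 0" using that by (simp only: tr sg_trace)
    show "Q ** sg (P ** comm_bracket z w ** Q) ** P
        = comm_bracket (Q ** sg (P ** z ** Q) ** P) (Q ** sg (P ** w ** Q) ** P)"
      by (simp only: br sg_bracket flip: br(2))
  qed
qed

end

locale cartan_pair = real_form L lb psi sg
  for L :: "'a::real_vector set" and lb :: "'a bracket"
    and psi :: "'a \<Rightarrow> complex^'n^'n" and sg :: "complex^'n^'n \<Rightarrow> complex^'n^'n" +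
  fixes a h :: "'a set" and th :: "'a \<Rightarrow> 'a"
  assumes a_max: "maximal_split_abelian L lb a" and th_cartan: "cartan_involution L lb th"
    and th_a: "x \<in> a \<Longrightarrow> th x = - x" and h_max: "maximal_abelian_subalgebra L lb h" and ah: "a \<subseteq> h"
begin

lemma sub_a: "subspace a" "a \<subseteq> L" and a_comm: "x \<in> a \<Longrightarrow> y \<in> a \<Longrightarrow> lb x y = 0"
  using a_max by (auto simp: maximal_split_abelian_def split_abelian_def abelian_iff)

lemma sub_h: "subspace h" "h \<subseteq> L" and h_comm: "x \<in> h \<Longrightarrow> y \<in> h \<Longrightarrow> lb x y = 0"
  using h_max by (auto simp: maximal_abelian_subalgebra_def abelian_iff)

lemma th_auto: "lie_automorphism L lb th" and th_th: "x \<in> L \<Longrightarrow> th (th x) = x"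
  and th_neg: "x \<in> L \<Longrightarrow> x \<noteq> 0 \<Longrightarrow> killing L lb x (th x) < 0"
  using th_cartan by (auto simp: cartan_involution_def)

lemma th_hom: "x \<in> L \<Longrightarrow> th x \<in> L" "x \<in> L \<Longrightarrow> y \<in> L \<Longrightarrow> th (x + y) = th x + th y"
  "x \<in> L \<Longrightarrow> th (c *\<^sub>R x) = c *\<^sub>R th x" "x \<in> L \<Longrightarrow> y \<in> L \<Longrightarrow> th (lb x y) = lb (th x) (th y)"
  using th_auto by (auto simp: lie_automorphism_def bij_betw_def)

text \<open>The standard scalar product attached to a Cartan involution; its positivity is the sign
  condition in \<open>cartan_involution\<close>.\<close>

definition ip :: "'a \<Rightarrow> 'a \<Rightarrow> real" where
  "ip x y = - killing L lb x (th y)"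

lemma ip_sym: "x \<in> L \<Longrightarrow> y \<in> L \<Longrightarrow> ip x y = ip y x"
  using killing_automorphism[OF th_auto, of x "th y"] killing_sym[of "th x" y] by (simp add: ip_def th_hom th_th)

lemma ip_add: "x \<in> L \<Longrightarrow> y \<in> L \<Longrightarrow> z \<in> L \<Longrightarrow> ip (x + y) z = ip x z + ip y z"
  by (simp add: ip_def killing_add th_hom)

lemma ip_scale: "x \<in> L \<Longrightarrow> z \<in> L \<Longrightarrow> ip (c *\<^sub>R x) z = c * ip x z"
  by (simp add: ip_def killing_scale th_hom)

lemma ip_add2: "x \<in> L \<Longrightarrow> y \<in> L \<Longrightarrow> z \<in> L \<Longrightarrow> ip z (x + y) = ip z x + ip z y"
  using subV by (simp add: ip_sym[of z] ip_add subspace_add)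

lemma ip_scale2: "x \<in> L \<Longrightarrow> z \<in> L \<Longrightarrow> ip z (c *\<^sub>R x) = c * ip z x"
  using subV by (simp add: ip_sym[of z] ip_scale subspace_scale)

lemma ip_pos: "x \<in> L \<Longrightarrow> x \<noteq> 0 \<Longrightarrow> ip x x > 0"
  using th_neg by (simp add: ip_def)

text \<open>Invariance of the Killing form makes \<open>- ad (th k)\<close> the adjoint of
  \<open>ad k\<close>; the next results draw on this for \<open>ad\<close> of \<open>u\<close> in
  \<open>a\<close> and of \<open>v\<close> fixed by \<open>th\<close>.\<close>

lemma ip_lb:
  assumes "k \<in> L" "x \<in> L" "y \<in> L"
  shows "ip (lb k x) y = - ip x (lb (th k) y)"
proof -
  have "ip (lb k x) y = - killing L lb (- lb x k) (th y)" by (simp add: ip_def lb_skew[of k])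
  also have "\<dots> = killing L lb (lb x k) (th y)"
    using killing_scale[of "lb x k" "th y" "-1"] assms by (simp add: lb_in_L th_hom)
  also have "\<dots> = killing L lb x (lb k (th y))"
    using assms by (intro killing_invariant) (auto simp: th_hom)
  also have "lb k (th y) = th (lb (th k) y)" using assms by (simp add: th_hom th_th)
  finally show ?thesis by (simp add: ip_def)
qed

text \<open>On vectors with \<open>th x = - x\<close> the Killing form coincides with
  \<open>ip\<close>, so \<open>a\<close> enlarged by \<open>u\<close> is again split abelian, and
  maximality of \<open>a\<close> applies.\<close>

lemma a_maximal:
  assumes u: "u \<in> L" "th u = - u" "\<And>k. k \<in> a \<Longrightarrow> lb u k = 0"
  shows "u \<in> a"
proof -
  define a' where "a' = {k + c *\<^sub>R u | k c. k \<in> a}"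
  have sub: "subspace a'"
    unfolding subspace_def
  proof (intro conjI ballI allI)
    show "0 \<in> a'" unfolding a'_def using subspace_0[OF sub_a(1)] by force
    fix x y assume "x \<in> a'" "y \<in> a'"
    then obtain k c k' c' where *: "x = k + c *\<^sub>R u" "y = k' + c' *\<^sub>R u" "k \<in> a" "k' \<in> a" by (auto simp: a'_def)
    then have "x + y = (k + k') + (c + c') *\<^sub>R u" by (simp add: algebra_simps)
    then show "x + y \<in> a'" unfolding a'_def using * sub_a(1) by (blast intro: subspace_add)
    fix r have "r *\<^sub>R x = r *\<^sub>R k + (r * c) *\<^sub>R u" using * by (simp add: algebra_simps)
    then show "r *\<^sub>R x \<in> a'" unfolding a'_def using * sub_a(1) by (blast intro: subspace_scale)
  qed
  have subL: "a' \<subseteq> L" using sub_a(2) u(1) subV by (auto simp: a'_def intro!: subspace_add subspace_scale)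
  have th': "th x = - x" if "x \<in> a'" for x
    using that u sub_a(2) subV by (auto simp: a'_def th_hom th_a subset_iff subspace_scale)
  have "lb x y = 0" if xy: "x \<in> a'" "y \<in> a'" for x y
  proof -
    obtain k c k' c' where *: "x = k + c *\<^sub>R u" "y = k' + c' *\<^sub>R u" "k \<in> a" "k' \<in> a"
      using xy by (auto simp: a'_def)
    have "lb k u = 0" using u(3)[of k] * lb_skew[of k u] by simp
    then show ?thesis using * u(3) by (simp add: lb_simps a_comm)
  qed
  moreover have "killing L lb x x > 0" if "x \<in> a'" "x \<noteq> 0" for x
  proof -
    have "x \<in> L" using that subL by blast
    then have "killing L lb x x = ip x x"
      using killing_scale[of x x "-1"] killing_sym[of x "- x"] th'[OF that(1)] subspace_neg[OF subV]
      by (simp add: ip_def)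
    then show ?thesis using ip_pos \<open>x \<in> L\<close> that by simp
  qed
  ultimately have "split_abelian L lb a'"
    unfolding split_abelian_def using sub subL th' th_cartan by (auto simp: abelian_iff)
  moreover have "a \<subseteq> a'" by (force simp: a'_def)
  ultimately have "a' = a" using a_max by (simp add: maximal_split_abelian_def)
  moreover have "0 + 1 *\<^sub>R u \<in> a'" unfolding a'_def using subspace_0[OF sub_a(1)] by blast
  ultimately show ?thesis by simp
qed

text \<open>Take the parts of \<open>x\<close> on which \<open>th\<close> is \<open>-1\<close> and
  \<open>1\<close>. Since \<open>th\<close> is \<open>-1\<close> on \<open>a\<close>, the first part
  also commutes with \<open>a\<close> and falls under \<open>a_maximal\<close>.\<close>

lemma centralizer_split:
  assumes x: "x \<in> L" "\<And>k. k \<in> a \<Longrightarrow> lb x k = 0"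
  obtains u v where "u \<in> a" "v \<in> L" "th v = v" "x = u + v"
proof -
  define u where "u = (1/2) *\<^sub>R (x - th x)"
  define v where "v = (1/2) *\<^sub>R (x + th x)"
  have uv: "u \<in> L" "v \<in> L" using x subV by (auto simp: u_def v_def th_hom intro!: subspace_scale subspace_add subspace_diff)
  have thd: "th (x - y) = th x - th y" if "x \<in> L" "y \<in> L" for x y
    using th_hom(2)[of x "(-1) *\<^sub>R y"] th_hom(3)[of y "-1"] that subV by (simp add: subspace_neg)
  have "th u = - u" using x subV by (simp add: u_def th_hom thd th_th subspace_diff flip: scaleR_minus_right)
  moreover have "lb u k = 0" if "k \<in> a" for k
  proof -
    have "k \<in> L" using that sub_a by blast
    have "lb (th x) k = th (lb x (th k))" using x \<open>k \<in> L\<close> by (simp add: th_hom th_th)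
    also have "\<dots> = th 0" using x(2)[of k] that by (simp add: th_a lb_simps)
    also have "\<dots> = 0" using th_hom(3)[OF x(1), of 0] by simp
    finally show ?thesis using x(2)[OF that] by (simp add: u_def lb_simps)
  qed
  ultimately have "u \<in> a" using a_maximal uv by blast
  moreover have "th v = v" using x subV by (simp add: v_def th_hom th_th subspace_add add.commute)
  moreover have "x = u + v" by (simp add: u_def v_def flip: scaleR_add_right)
  ultimately show ?thesis using that uv by blast
qed

text \<open>The real part of the Hermitian extension of \<open>ip\<close> to trace zero matrices.
  Complex scalars change sides with a conjugation, and definiteness survives.\<close>

definition Q :: "complex^'n^'n \<Rightarrow> complex^'n^'n \<Rightarrow> real" where
  "Q z w = ip (rp z) (rp w) + ip (iq z) (iq w)"

lemma Q_add: "trace z = 0 \<Longrightarrow> trace z' = 0 \<Longrightarrow> trace w = 0 \<Longrightarrow> Q (z + z') w = Q z w + Q z' w"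
  by (simp add: Q_def rp_iq_add ip_add rp_iq)

lemma Q_sym: "trace z = 0 \<Longrightarrow> trace w = 0 \<Longrightarrow> Q z w = Q w z"
  by (simp add: Q_def ip_sym rp_iq)

lemma Q_diff: "trace z = 0 \<Longrightarrow> trace z' = 0 \<Longrightarrow> trace w = 0 \<Longrightarrow> Q (z - z') w = Q z w - Q z' w"
  using Q_add[of "z - z'" z' w] by (simp add: trace_sub)

lemma Q_diff2: "trace z = 0 \<Longrightarrow> trace z' = 0 \<Longrightarrow> trace w = 0 \<Longrightarrow> Q w (z - z') = Q w z - Q w z'"
  using Q_diff[of z z' w] by (simp add: Q_sym[of w] trace_sub)

lemma Q_0: "trace w = 0 \<Longrightarrow> Q 0 w = 0" "trace w = 0 \<Longrightarrow> Q w 0 = 0"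
  using Q_diff[of 0 0 w] Q_diff2[of 0 0 w] by simp_all

lemma Q_uminus: "trace z = 0 \<Longrightarrow> trace w = 0 \<Longrightarrow> Q w (- z) = - Q w z"
  using Q_diff2[of 0 z w] by (simp add: Q_0)

lemma Q_cscaleM: "trace z = 0 \<Longrightarrow> trace w = 0 \<Longrightarrow> Q (c *\<^sub>C z) w = Q z (cnj c *\<^sub>C w)"
proof -
  assume zw: "trace z = 0" "trace w = 0"
  have sub: "ip (x - y) v = ip x v - ip y v" "ip v (x - y) = ip v x - ip v y" if "x \<in> L" "y \<in> L" "v \<in> L" for x y v
    using ip_add[of "x - y" y v] ip_add2[of "x - y" y v] that subV by (simp_all add: subspace_diff)
  note [simp] = rp_iq(1,2)[OF zw(1)] rp_iq(1,2)[OF zw(2)]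
  note sc [simp] = subspace_scale[OF subV]
  show ?thesis
    by (simp add: Q_def rp_iq_cscaleM zw sub ip_add ip_add2 ip_scale ip_scale2 algebra_simps)
qed

lemma Q_self:
  assumes z: "trace z = 0"
  shows "Q z (c *\<^sub>C z) = Re c * Q z z"
proof -
  have sub: "ip v (x - y) = ip v x - ip v y" if "x \<in> L" "y \<in> L" "v \<in> L" for x y v
    using ip_add2[of "x - y" y v] that subV by (simp add: subspace_diff)
  note [simp] = rp_iq(1,2)[OF z] subspace_scale[OF subV]
  show ?thesis
    by (simp add: Q_def rp_iq_cscaleM z sub ip_add2 ip_scale2 algebra_simps)
       (simp add: ip_sym[of "rp z" "iq z"])
qed

lemma Q_pos: "trace z = 0 \<Longrightarrow> Q z z = 0 \<Longrightarrow> z = 0"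
proof -
  assume z: "trace z = 0" "Q z z = 0"
  have nn: "ip x x \<ge> 0" if "x \<in> L" for x
    using ip_pos[OF that] ip_scale[of 0 0 0] subspace_0[OF subV] by (cases "x = 0") auto
  have zero: "x = 0" if "x \<in> L" "ip x x = 0" for x using ip_pos[of x] that by fastforce
  have "ip (rp z) (rp z) = 0" "ip (iq z) (iq z) = 0"
    using nn[OF rp_iq(1)[OF z(1)]] nn[OF rp_iq(2)[OF z(1)]] z(2) by (simp_all add: Q_def)
  then have "rp z = 0" "iq z = 0" using zero rp_iq[OF z(1)] by blast+
  then show "z = 0" using rp_iq(5)[OF z(1)] by (simp add: psi_0)
qed

lemma Q_bracket:
  assumes "k \<in> L" "trace z = 0" "trace w = 0"
  shows "Q (comm_bracket (psi k) z) w = - Q z (comm_bracket (psi (th k)) w)"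
  using assms by (simp add: Q_def rp_iq_bracket ip_lb rp_iq th_hom)

text \<open>\<open>ad y\<close> is normal for the Hermitian form \<open>Q\<close>, since \<open>y\<close> commutes with \<open>th y\<close>.\<close>

lemma ad_semisimple:
  assumes y: "y \<in> h" and z: "trace z = 0"
    and N: "comm_bracket (psi y) (comm_bracket (psi y) z - \<mu> *\<^sub>C z) = \<mu> *\<^sub>C (comm_bracket (psi y) z - \<mu> *\<^sub>C z)"
  shows "comm_bracket (psi y) z = \<mu> *\<^sub>C z"
proof -
  have yL: "y \<in> L" using y sub_h by blast
  obtain u v where uv: "u \<in> a" "v \<in> L" "th v = v" "y = u + v"
    using centralizer_split[OF yL h_comm[OF y]] ah by blast
  have uL: "u \<in> L" using uv sub_a by blast
  have thy: "th y = - u + v" using uv uL by (simp add: th_hom th_a)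
  \<comment> \<open>Here \<open>y = u + v\<close> and \<open>th y = - u + v\<close>, where
    \<open>u\<close> and \<open>v\<close> commute because \<open>y\<close> commutes with
    \<open>u\<close>, an element of \<open>h\<close>.\<close>
  have yth: "comm_bracket (psi y) (psi (th y)) = 0"
  proof -
    have "lb y u = 0" using h_comm y uv(1) ah by blast
    then have "lb v u = 0" using uv(4) by (simp add: lb_simps)
    then have "lb u v = 0" using lb_skew[of u v] by simp
    then have "lb (u + v) (- u + v) = 0" using \<open>lb v u = 0\<close> by (simp add: lb_simps del: add_uminus_conv_diff)
    then have "lb y (th y) = 0" using arg_cong2[OF uv(4) thy, of lb] by simp
    then show ?thesis by (simp flip: psi_lb add: psi_0)
  qed
  \<comment> \<open>\<open>M\<close> is \<open>ad y - \<mu>\<close> and \<open>M'\<close> its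
    adjoint for \<open>Q\<close>; the assumption says that \<open>M\<close> annihilates
    \<open>M z\<close>.\<close>
  define M where "M w = comm_bracket (psi y) w - \<mu> *\<^sub>C w" for w
  define M' where "M' w = - comm_bracket (psi (th y)) w - cnj \<mu> *\<^sub>C w" for w
  have trM: "trace w = 0 \<Longrightarrow> trace (M w) = 0" and trM': "trace w = 0 \<Longrightarrow> trace (M' w) = 0" for w
    by (simp_all add: M_def M'_def trace_sub)
  have adj: "Q (M w) x = Q w (M' x)" if "trace w = 0" "trace x = 0" for w x
  proof -
    have "Q w (- comm_bracket (psi (th y)) x) = - Q w (comm_bracket (psi (th y)) x)"
      using that by (simp add: Q_uminus)
    then show ?thesis using that yL
      by (simp add: M_def M'_def Q_diff Q_diff2 Q_cscaleM Q_bracket)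
  qed
  have comm: "M (M' w) = M' (M w)" for w
  proof -
    have "comm_bracket (psi y) (comm_bracket (psi (th y)) w) = comm_bracket (psi (th y)) (comm_bracket (psi y) w)"
      using comm_bracket_jacobi[of "psi y" "psi (th y)" w] yth by simp
    then show ?thesis by (simp add: M_def M'_def comm_bracket_diff cscaleM_distrib mult.commute)
  qed
  have MM: "M (M z) = 0" using N by (simp add: M_def)
  \<comment> \<open>Normality used twice: \<open>M M z = 0\<close> gives \<open>M' M z = 0\<close>,
    because the norm of \<open>M' w\<close> is \<open>Q (M' (M w)) w\<close>; then the norm of
    \<open>M z\<close> is \<open>Q z (M' (M z)) = 0\<close>.\<close>
  let ?w = "M z"
  have "Q (M' ?w) (M' ?w) = Q (M (M' ?w)) ?w"
    using adj[of "M' ?w" ?w] trM trM' z by simp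
  also have "M (M' ?w) = M' (M ?w)" by (rule comm)
  also have "M' (M ?w) = 0" by (simp add: MM M'_def)
  also have "Q 0 ?w = 0" using Q_0 trM z by simp
  finally have "M' ?w = 0" using Q_pos trM trM' z by simp
  then have "Q ?w ?w = Q z 0" using adj[of z ?w] z trM by simp
  also have "\<dots> = 0" using Q_0 z by simp
  finally have "?w = 0" using Q_pos trM z by simp
  then show ?thesis by (simp add: M_def)
qed

text \<open>Since \<open>th u = - u\<close>, \<open>ad u\<close> is self-adjoint for
  \<open>Q\<close>. Pairing with \<open>\<i> z\<close> instead of \<open>z\<close> makes the
  real-valued \<open>Q\<close> show the imaginary part of \<open>\<mu>\<close>.\<close>

lemma ad_a_real:
  assumes u: "u \<in> a" and z: "trace z = 0" "z \<noteq> 0" and \<mu>: "comm_bracket (psi u) z = \<mu> *\<^sub>C z"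
  shows "Im \<mu> = 0"
proof -
  have uL: "u \<in> L" using u sub_a by blast
  have iz: "comm_bracket (psi u) (\<i> *\<^sub>C z) = \<mu> *\<^sub>C \<i> *\<^sub>C z" using \<mu> by (simp add: mult.commute)
  have "Q (\<mu> *\<^sub>C z) (\<i> *\<^sub>C z) = - Q z (comm_bracket (psi (- u)) (\<i> *\<^sub>C z))"
    using Q_bracket[OF uL z(1), of "\<i> *\<^sub>C z"] z by (simp add: \<mu> th_a[OF u])
  also have "\<dots> = - Q z (- (\<mu> *\<^sub>C \<i> *\<^sub>C z))" unfolding psi_minus comm_bracket_uminus iz ..
  also have "\<dots> = Q z (\<mu> *\<^sub>C \<i> *\<^sub>C z)"
    using z by (simp add: Q_uminus)
  finally have "Q z (cnj \<mu> *\<^sub>C \<i> *\<^sub>C z) = Q z (\<mu> *\<^sub>C \<i> *\<^sub>C z)" using z by (simp add: Q_cscaleM)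
  then have "Q z ((\<mu> - cnj \<mu>) *\<^sub>C \<i> *\<^sub>C z) = 0"
    using z by (simp only: cscaleM_distrib) (simp add: Q_diff2)
  moreover have "(\<mu> - cnj \<mu>) *\<^sub>C \<i> *\<^sub>C z = of_real (- 2 * Im \<mu>) *\<^sub>C z"
    by (simp add: complex_diff_cnj mult.assoc del: of_real_mult)
  ultimately have "Q z (of_real (- 2 * Im \<mu>) *\<^sub>C z) = 0" by simp
  then have "- 2 * Im \<mu> * Q z z = 0" unfolding Q_self[OF z(1)] by simp
  then show ?thesis using Q_pos z by auto
qed

text \<open>Since \<open>th v = v\<close>, \<open>ad v\<close> is skew-adjoint for
  \<open>Q\<close>.\<close>

lemma ad_compact_imaginary:
  assumes v: "v \<in> L" "th v = v" and z: "trace z = 0" "z \<noteq> 0" and \<mu>: "comm_bracket (psi v) z = \<mu> *\<^sub>C z"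
  shows "Re \<mu> = 0"
proof -
  have "Q (\<mu> *\<^sub>C z) z = - Q z (\<mu> *\<^sub>C z)" using Q_bracket[OF v(1) z(1) z(1)] v \<mu> by simp
  also have "Q (\<mu> *\<^sub>C z) z = Q z (\<mu> *\<^sub>C z)" using z by (simp add: Q_sym)
  finally have "Q z (\<mu> *\<^sub>C z) = 0" by simp
  then have "Re \<mu> * Q z z = 0" unfolding Q_self[OF z(1)] .
  then show ?thesis using Q_pos z by auto
qed

text \<open>For a left eigenvector \<open>w\<close> with eigenvalue \<open>\<nu>\<close>,
  \<open>ad y - (\<mu> - \<nu>)\<close> acts on \<open>outer v w\<close> as
  \<open>psi y - \<mu>\<close> acts on \<open>v\<close>; so \<open>ad_semisimple\<close> descends to
  the matrix.\<close>

lemma semisimple_h: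
  assumes y: "y \<in> h"
  shows "semisimple (psi y)"
  unfolding semisimple_def
proof (intro allI impI)
  fix \<mu> v
  assume 2: "psi y *v (psi y *v v - \<mu> *s v) = \<mu> *s (psi y *v v - \<mu> *s v)"
  obtain w \<nu> where w: "w \<noteq> 0" "w v* psi y = \<nu> *s w" using ex_left_eigenvector by blast
  define N where "N z = comm_bracket (psi y) z - (\<mu> - \<nu>) *\<^sub>C z" for z
  have N: "N (outer x w) = outer (psi y *v x - \<mu> *s x) w" for x
    by (simp add: N_def comm_bracket_def mult_outer outer_mult w outer_linear cscaleM_distrib)
  let ?z = "outer v w"
  have NN: "N (N ?z) = 0" unfolding N 2 by (simp add: outer_eq_0)
  \<comment> \<open>\<open>ad_semisimple\<close> needs trace zero. If \<open>\<mu>\<close> and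
    \<open>\<nu>\<close> differ, applying \<open>N\<close> scales the trace by a non-zero factor, so
    the trace vanishes; if they agree, a scalar matrix, central for the bracket, is
    subtracted.\<close>
  have "N ?z = 0"
  proof (cases "\<mu> = \<nu>")
    case False
    have tr: "trace (N z) = - (\<mu> - \<nu>) * trace z" for z by (simp add: N_def trace_sub algebra_simps)
    then have "trace (N z) = 0 \<Longrightarrow> trace z = 0" for z using False by simp
    then have "trace ?z = 0" using NN by (metis trace_zero)
    then show ?thesis using ad_semisimple[OF y, of ?z "\<mu> - \<nu>"] NN by (simp add: N_def)
  next
    case True
    define z0 where "z0 = ?z - (trace ?z / of_nat CARD('n)) *\<^sub>C mat 1"
    have "trace z0 = 0" by (simp add: z0_def trace_sub trace_I)
    have "comm_bracket (psi y) z0 = N ?z"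
      using True by (simp add: z0_def N_def comm_bracket_diff) (simp add: comm_bracket_def)
    then show ?thesis using ad_semisimple[OF y \<open>trace z0 = 0\<close>, of 0] NN True by (simp add: N_def)
  qed
  then show "psi y *v v = \<mu> *s v" using w by (simp add: N outer_eq_0)
qed

lemma h_diagonalisable:
  "\<exists>(P::complex^'n^'n) (R::complex^'n^'n). P ** R = mat 1 \<and> R ** P = mat 1 \<and> (\<forall>y\<in>h. \<exists>d. R ** psi y ** P = diagm d)"
proof -
  obtain B where B: "B \<subseteq> h" "independent B" "h \<subseteq> span B" by (rule basis_exists[of h])
  have BL: "B \<subseteq> L" using B(1) sub_h(2) by (rule order_trans)
  have fin: "finite (psi ` B)" using finV[OF B(2) BL] by (rule finite_imageI)
  have ss: "semisimple A" if "A \<in> psi ` B" for A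
  proof -
    from that obtain y where "y \<in> B" "A = psi y" by (rule imageE)
    then show ?thesis using semisimple_h[of y] B(1) by auto
  qed
  have comm: "A ** A' = A' ** A" if AA: "A \<in> psi ` B" "A' \<in> psi ` B" for A A'
  proof -
    obtain x where x: "A = psi x" "x \<in> B" using AA(1) by (rule imageE)
    obtain y where y: "A' = psi y" "y \<in> B" using AA(2) by (rule imageE)
    have "lb x y = 0" using x y B(1) by (intro h_comm) auto
    then have "comm_bracket A A' = 0" using psi_lb[of x y] by (simp add: x y psi_0)
    then show ?thesis by (simp add: comm_bracket_def)
  qed
  obtain P R :: "complex^'n^'n" where PR: "P ** R = mat 1" "R ** P = mat 1"
    "\<forall>A\<in>psi ` B. \<exists>d. R ** A ** P = diagm d"
    using joint_diagonalise[of "psi ` B", OF fin] ss comm by metis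
  have "\<exists>d. R ** psi y ** P = diagm d" if "y \<in> h" for y
  proof -
    have "y \<in> span B" using B that by blast
    then show ?thesis
    proof (induction rule: span_induct_alt)
      case base
      have "R ** psi 0 ** P = diagm (\<lambda>_. 0)" by (simp add: psi_0 mat_eq_iff diagm_nth)
      then show ?case by blast
    next
      case (step c x y)
      obtain d where d1: "R ** psi x ** P = diagm d" using PR(3) step(1) by blast
      obtain d' where d2: "R ** psi y ** P = diagm d'" using step(2) by blast
      have "R ** psi (c *\<^sub>R x + y) ** P = c *\<^sub>R (R ** psi x ** P) + R ** psi y ** P"
        by (simp add: psi_hom matrix_ring_simps)
      also have "\<dots> = diagm (\<lambda>i. of_real c * d i + d' i)"
        unfolding d1 d2 by (simp add: mat_eq_iff diagm_nth) (simp add: scaleR_conv_of_real)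
      finally show ?case by blast
    qed
  qed
  then show ?thesis using PR by blast
qed

end

section \<open>Elementwise form of inner ideals, and the complexified algebra\<close>

context real_form begin

lemma inner_ideal_iff:
  "inner_ideal L lb B \<longleftrightarrow> subspace B \<and> B \<subseteq> L \<and> (\<forall>x\<in>B. \<forall>y\<in>B. \<forall>w\<in>L. lb x (lb y w) \<in> B)"
proof
  assume *: "inner_ideal L lb B"
  have "lb x (lb y w) \<in> B" if "x \<in> B" "y \<in> B" "w \<in> L" for x y w
  proof -
    have "lb y w \<in> bracket_space lb B L"
      unfolding bracket_space_def by (rule span_base) (use that in blast)
    then have "lb x (lb y w) \<in> bracket_space lb B (bracket_space lb B L)"
      unfolding bracket_space_def[of lb B "bracket_space lb B L"] by (intro span_base) (use that in blast)
    then show ?thesis using * by (auto simp: inner_ideal_def)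
  qed
  then show "subspace B \<and> B \<subseteq> L \<and> (\<forall>x\<in>B. \<forall>y\<in>B. \<forall>w\<in>L. lb x (lb y w) \<in> B)"
    using * by (auto simp: inner_ideal_def)
next
  assume *: "subspace B \<and> B \<subseteq> L \<and> (\<forall>x\<in>B. \<forall>y\<in>B. \<forall>w\<in>L. lb x (lb y w) \<in> B)"
  have 1: "lb x v \<in> B" if "x \<in> B" "v \<in> bracket_space lb B L" for x v
    using that(2) unfolding bracket_space_def
  proof (induction rule: span_induct_alt)
    case base then show ?case using * by (simp add: lb_simps subspace_0)
  next
    case (step c u v)
    then obtain y w where "u = lb y w" "y \<in> B" "w \<in> L" by blast
    then have "lb x u \<in> B" using * that by blast
    then show ?case using * step by (simp add: lb_simps subspace_add subspace_scale)
  qed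
  have "bracket_space lb B (bracket_space lb B L) \<subseteq> B"
    unfolding bracket_space_def[of lb B "bracket_space lb B L"]
    by (rule span_minimal) (use 1 * in blast)+
  then show "inner_ideal L lb B" using * by (simp add: inner_ideal_def)
qed

lemma nonzero_abelian_inner_ideal_iff:
  "nonzero_abelian_inner_ideal L lb B \<longleftrightarrow> subspace B \<and> B \<subseteq> L \<and>
     (\<forall>x\<in>B. \<forall>y\<in>B. \<forall>w\<in>L. lb x (lb y w) \<in> B) \<and> (\<forall>x\<in>B. \<forall>y\<in>B. lb x y = 0) \<and> B \<noteq> {0}"
  by (auto simp: nonzero_abelian_inner_ideal_def inner_ideal_iff abelian_iff)

lemma rp_psi: "x \<in> L \<Longrightarrow> rp (psi x) = x"
  by (rule rp_iq_eqI[of x 0]) (simp_all add: subspace_0[OF subV] psi_0)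

lemma rp_sum: "finite I \<Longrightarrow> (\<And>i. i \<in> I \<Longrightarrow> trace (f i) = 0) \<Longrightarrow> rp (\<Sum>i\<in>I. f i) = (\<Sum>i\<in>I. rp (f i)) \<and> trace (\<Sum>i\<in>I. f i) = 0"
proof (induction I rule: finite_induct)
  case empty
  show ?case using rp_psi[of 0] subspace_0[OF subV] by (simp add: psi_0)
next
  case (insert i I)
  then show ?case by (simp add: rp_iq_add trace_add)
qed

text \<open>Identifies the formal complexification \<open>L \<times> L\<close>, in which the roots
  are defined, with the trace zero matrices.\<close>

definition Psi :: "'a \<times> 'a \<Rightarrow> complex^'n^'n" where
  "Psi z = psi (fst z) + \<i> *\<^sub>C psi (snd z)"

lemma Psi_cbracket: "Psi (cbracket lb k x) = comm_bracket (Psi k) (Psi x)"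
  by (simp add: Psi_def cbracket_def psi_hom comm_bracket_add cscaleM_distrib)

lemma Psi_cscale: "Psi (cscale c z) = c *\<^sub>C Psi z"
  by (simp add: Psi_def cscale_def psi_hom mat_eq_iff complex_eq_iff algebra_simps)

lemma Psi_add: "Psi (z + w) = Psi z + Psi w"
  by (simp add: Psi_def psi_hom cscaleM_distrib)

lemma Psi_eq_0: "z \<in> L \<times> L \<Longrightarrow> Psi z = 0 \<longleftrightarrow> z = 0"
  using complexification_unique[of "fst z" "snd z" 0 0] subspace_0[OF subV]
  by (auto simp: Psi_def psi_0 prod_eq_iff)

lemma Psi_inj: "z \<in> L \<times> L \<Longrightarrow> w \<in> L \<times> L \<Longrightarrow> Psi z = Psi w \<Longrightarrow> z = w"
  using complexification_unique[of "fst z" "snd z" "fst w" "snd w"]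
  by (simp add: Psi_def prod_eq_iff mem_Times_iff)

lemma Psi_rp_iq: "trace z = 0 \<Longrightarrow> Psi (rp z, iq z) = z"
  using rp_iq(5)[of z] by (simp add: Psi_def)

end

section \<open>Roots and the subspace a when h is diagonal\<close>

locale diag_pair = cartan_pair L lb psi sg a h th
  for L :: "'a::real_vector set" and lb :: "'a bracket"
    and psi :: "'a \<Rightarrow> complex^'n^'n" and sg :: "complex^'n^'n \<Rightarrow> complex^'n^'n"
    and a h :: "'a set" and th :: "'a \<Rightarrow> 'a" +
  assumes h_diag: "y \<in> h \<Longrightarrow> \<exists>d. psi y = diagm d"
begin

text \<open>Adjoining \<open>x\<close> to \<open>h\<close> keeps it abelian, so maximality puts
  \<open>x\<close> into \<open>h\<close>.\<close>

lemma h_centralizer: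
  assumes x: "x \<in> L" "\<And>k. k \<in> h \<Longrightarrow> lb k x = 0"
  shows "x \<in> h"
proof -
  let ?h = "span (insert x h)"
  have sp: "span h = h" using sub_h(1) by (simp add: span_eq_iff)
  have el: "\<exists>k c. k \<in> h \<and> y = k + c *\<^sub>R x" if "y \<in> ?h" for y
    using that unfolding span_breakdown_eq sp by (metis diff_add_cancel)
  have "lb y z = 0" if "y \<in> ?h" "z \<in> ?h" for y z
  proof -
    obtain k c k' c' where *: "k \<in> h" "y = k + c *\<^sub>R x" "k' \<in> h" "z = k' + c' *\<^sub>R x" using el \<open>y \<in> ?h\<close> \<open>z \<in> ?h\<close> by blast
    have "lb x k' = 0" using x(2)[of k'] * lb_skew[of x k'] by simp
    then show ?thesis using * x(2) h_comm by (simp add: lb_simps)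
  qed
  then have ab: "abelian lb ?h" by (simp add: abelian_iff)
  have sub: "?h \<subseteq> L" by (rule span_minimal) (use x sub_h subV in auto)
  have "h \<subseteq> ?h" using span_superset[of "insert x h"] by (meson insert_subset)
  then have "?h = h" using h_max ab sub unfolding maximal_abelian_subalgebra_def by (metis subspace_span)
  then show ?thesis using span_base[of x "insert x h"] by simp
qed

lemma diag_comm: "comm_bracket (diagm d) (diagm d') = 0"
  by (simp add: mat_eq_iff comm_bracket_diagm) (simp add: diagm_nth)

lemma diagm_in_h: "x \<in> L \<Longrightarrow> psi x = diagm d \<Longrightarrow> x \<in> h"
proof (rule h_centralizer)
  fix k assume x: "x \<in> L" "psi x = diagm d" and "k \<in> h"
  then obtain d' where "psi k = diagm d'" using h_diag by blast
  then have "psi (lb k x) = 0" using x by (simp add: psi_lb diag_comm)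
  then show "lb k x = 0" by (simp add: psi_eq_0)
qed

text \<open>Diagonal matrices commute with \<open>h\<close>, hence so do their real and imaginary
  parts, which therefore lie in \<open>h\<close>. Thus \<open>h\<close> is as large as a Cartan
  subalgebra.\<close>

lemma diag_in_Psi_h:
  assumes "(\<Sum>i\<in>UNIV. d i) = 0"
  shows "\<exists>k\<in>h \<times> h. Psi k = diagm d"
proof -
  have tr: "trace (diagm d) = 0" using assms by (simp add: trace_diagm)
  have k: "comm_bracket (psi k) (diagm d) = 0" if "k \<in> h" for k
    using h_diag[OF that] by (auto simp: diag_comm)
  have rp0: "rp 0 = 0" "iq 0 = 0"
    using rp_iq_eqI[of 0 0 0] subspace_0[OF subV] by (simp_all add: psi_0)
  have "rp (diagm d) \<in> h"
    by (rule h_centralizer) (use rp_iq[OF tr] rp_iq_bracket(1)[OF tr] k rp0 sub_h(2) in \<open>auto simp flip: rp_iq_bracket(1)[OF tr]\<close>)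
  moreover have "iq (diagm d) \<in> h"
    by (rule h_centralizer) (use rp_iq[OF tr] rp_iq_bracket(2)[OF tr] k rp0 sub_h(2) in \<open>auto simp flip: rp_iq_bracket(2)[OF tr]\<close>)
  ultimately have "(rp (diagm d), iq (diagm d)) \<in> h \<times> h" by simp
  then show ?thesis using Psi_rp_iq[OF tr] by blast
qed

lemma Psi_h_diag: "k \<in> h \<times> h \<Longrightarrow> Psi k = diagm (\<lambda>i. Psi k $ i $ i)"
proof -
  assume "k \<in> h \<times> h"
  then obtain d d' where "psi (fst k) = diagm d" "psi (snd k) = diagm d'"
    using h_diag[of "fst k"] h_diag[of "snd k"] by auto
  then show ?thesis by (simp add: Psi_def mat_eq_iff diagm_nth)
qed

text \<open>The usual root, \<open>i\<close>-th minus \<open>j\<close>-th diagonal coordinate, cut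
  off outside \<open>h \<times> h\<close> as the encoding of complex forms demands.\<close>

definition rt :: "'n \<Rightarrow> 'n \<Rightarrow> 'a cform" where
  "rt i j = (\<lambda>z. if z \<in> h \<times> h then Psi z $ i $ i - Psi z $ j $ j else 0)"

text \<open>The indicator of \<open>S\<close>, shifted by its mean to have trace zero; the shift
  cancels in differences. Evaluation at such points tells roots apart.\<close>

lemma ind_test: "\<exists>z\<in>h \<times> h. \<forall>i j. rt i j z = of_bool (i \<in> S) - of_bool (j \<in> S)"
proof -
  define d where "d i = of_bool (i \<in> S) - of_nat (card S) / (of_nat (CARD('n)) :: complex)" for i :: 'n
  have "(\<Sum>i\<in>UNIV. of_bool (i \<in> S)) = (of_nat (card S) :: complex)"
    by (simp add: of_bool_def sum.If_cases)
  then have "(\<Sum>i\<in>UNIV. d i) = 0" by (simp add: d_def sum_subtractf)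
  then obtain z where z: "z \<in> h \<times> h" "Psi z = diagm d" using diag_in_Psi_h by blast
  then show ?thesis by (intro bexI[of _ z]) (auto simp: rt_def diagm_nth d_def)
qed

lemma roots_eq: "roots L lb h = {rt i j | i j. i \<noteq> j}"
proof (intro set_eqI iffI)
  fix \<beta> assume "\<beta> \<in> roots L lb h"
  then obtain x where b: "\<beta> \<in> complex_dual h" "\<beta> \<noteq> (\<lambda>z. 0)" and x: "x \<in> L \<times> L" "x \<noteq> 0"
    and ev: "\<And>k. k \<in> h \<times> h \<Longrightarrow> cbracket lb k x = cscale (\<beta> k) x" by (auto simp: roots_def)
  have off: "\<beta> z = 0" if "z \<notin> h \<times> h" for z using b(1) that unfolding complex_dual_def by blast
  have ev': "(Psi k $ i $ i - Psi k $ j $ j) * Psi x $ i $ j = \<beta> k * Psi x $ i $ j" if k: "k \<in> h \<times> h" for k i j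
  proof -
    have "comm_bracket (Psi k) (Psi x) = \<beta> k *\<^sub>C Psi x"
      using arg_cong[OF ev[OF k], of Psi] by (simp only: Psi_cbracket Psi_cscale)
    then have "comm_bracket (diagm (\<lambda>i. Psi k $ i $ i)) (Psi x) $ i $ j = \<beta> k * Psi x $ i $ j"
      using Psi_h_diag[OF k] by simp
    then show ?thesis by (simp add: comm_bracket_diagm)
  qed
  have "Psi x \<noteq> 0" using x Psi_eq_0 by blast
  then obtain i j where ij: "Psi x $ i $ j \<noteq> 0" by (auto simp: mat_eq_iff)
  \<comment> \<open>A single non-zero entry of the root vector determines the root, because
    bracketing with a diagonal matrix scales each entry separately.\<close>
  have eq: "\<beta> = rt i j"
    using ev'[of _ i j] ij off by (auto simp: rt_def fun_eq_iff)
  moreover have "i \<noteq> j" using b(2) eq by (auto simp: rt_def)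
  ultimately show "\<beta> \<in> {rt i j | i j. i \<noteq> j}" by blast
next
  fix \<beta> assume "\<beta> \<in> {rt i j | i j. i \<noteq> j}"
  then obtain i j where ij: "i \<noteq> j" "\<beta> = rt i j" by blast
  have hh: "z + w \<in> h \<times> h" "cscale c z \<in> h \<times> h" if "z \<in> h \<times> h" "w \<in> h \<times> h" for z w c
    using that sub_h(1) by (auto simp: mem_Times_iff cscale_def subspace_add subspace_diff subspace_scale)
  have dual: "\<beta> \<in> complex_dual h"
    unfolding complex_dual_def mem_Collect_eq
  proof (intro conjI ballI allI impI)
    fix z w c assume z: "z \<in> h \<times> h"
    show "\<beta> (z + w) = \<beta> z + \<beta> w" if "w \<in> h \<times> h"
      using z that hh(1)[OF z that] by (simp add: ij(2) rt_def Psi_add del: mem_Sigma_iff)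
    show "\<beta> (cscale c z) = c * \<beta> z"
      using z hh(2)[OF z z] by (simp add: ij(2) rt_def Psi_cscale algebra_simps del: mem_Sigma_iff)
  qed (simp add: ij(2) rt_def del: mem_Sigma_iff)
  obtain z where "\<forall>i' j'. rt i' j' z = of_bool (i' \<in> {i}) - of_bool (j' \<in> {i})" using ind_test[of "{i}"] by blast
  then have "\<beta> z = 1" using ij by simp
  then have nz: "\<beta> \<noteq> (\<lambda>z. 0)" by auto
  have tr: "trace (munit i j) = 0" using ij by (auto simp: trace_def munit_nth intro!: sum.neutral)
  \<comment> \<open>The root vector for \<open>rt i j\<close> is the matrix unit
    \<open>munit i j\<close>.\<close>
  let ?x = "(rp (munit i j), iq (munit i j))"
  have xL: "?x \<in> L \<times> L" using rp_iq[OF tr] by simp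
  have Px: "Psi ?x = munit i j" by (rule Psi_rp_iq[OF tr])
  have "munit i j \<noteq> 0" by (auto simp: mat_eq_iff munit_nth)
  then have "?x \<noteq> 0" using Px Psi_eq_0[OF xL] by metis
  moreover have "cbracket lb k ?x = cscale (\<beta> k) ?x" if k: "k \<in> h \<times> h" for k
  proof -
    have cL: "cbracket lb k ?x \<in> L \<times> L" "cscale (\<beta> k) ?x \<in> L \<times> L"
      using xL k sub_h(2) subV by (auto simp: cbracket_def cscale_def mem_Times_iff
        intro!: subspace_add subspace_diff subspace_scale lb_in_L)
    have "Psi (cbracket lb k ?x) = comm_bracket (diagm (\<lambda>i. Psi k $ i $ i)) (munit i j)"
      unfolding Psi_cbracket Px using Psi_h_diag[OF k] by simp
    also have "\<dots> = \<beta> k *\<^sub>C munit i j"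
      using k by (auto simp: mat_eq_iff comm_bracket_diagm ij(2) rt_def munit_nth)
    also have "\<dots> = Psi (cscale (\<beta> k) ?x)" unfolding Psi_cscale Px ..
    finally show ?thesis using cL by (rule Psi_inj[rotated 2])
  qed
  ultimately show "\<beta> \<in> roots L lb h" using dual nz xL unfolding roots_def by blast
qed

text \<open>Eigenvalues of \<open>ad\<close> are real on \<open>a\<close> and imaginary on the part
  fixed by \<open>th\<close>. So a real diagonal element of \<open>L\<close> has in
  \<open>centralizer_split\<close> a second part that is scalar of trace zero.\<close>

lemma a_eq: "x \<in> a \<longleftrightarrow> x \<in> L \<and> (\<exists>d. psi x = diagm (\<lambda>i. complex_of_real (d i)))"
proof
  have bd: "comm_bracket (diagm d) (munit i j) = (d i - d j) *\<^sub>C munit i j" for d i j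
    by (auto simp: mat_eq_iff comm_bracket_diagm munit_nth)
  have mu: "trace (munit i j) = 0" "munit i j \<noteq> 0" if "i \<noteq> j" for i j
    using that by (auto simp: trace_def munit_nth mat_eq_iff intro!: sum.neutral)
  {
    assume x: "x \<in> a"
    then have xL: "x \<in> L" using sub_a by blast
    obtain d where d: "psi x = diagm d" using h_diag x ah by blast
    have re: "Im (d i) = Im (d j)" for i j
      using ad_a_real[OF x mu, of i j "d i - d j"] bd d by (cases "i = j") auto
    have "(\<Sum>j\<in>UNIV. d j) = 0" using trace_psi[OF xL] d by (simp add: trace_diagm)
    then have "0 = (\<Sum>j\<in>UNIV. Im (d j))" by (simp flip: Im_sum)
    moreover have "(\<Sum>j\<in>UNIV. Im (d j)) = (\<Sum>j\<in>(UNIV::'n set). Im (d i))" for i by (rule sum.cong) (auto intro: re)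
    ultimately have "Im (d i) = 0" for i by simp
    then have "psi x = diagm (\<lambda>i. complex_of_real (Re (d i)))"
      unfolding d by (simp add: mat_eq_iff diagm_nth complex_eq_iff)
    then show "x \<in> L \<and> (\<exists>d. psi x = diagm (\<lambda>i. complex_of_real (d i)))" using xL by (intro conjI exI)
  }
  assume "x \<in> L \<and> (\<exists>d. psi x = diagm (\<lambda>i. complex_of_real (d i)))"
  then obtain d where x: "x \<in> L" "psi x = diagm (\<lambda>i. complex_of_real (d i))" by blast
  then have xh: "x \<in> h" by (rule diagm_in_h)
  obtain u v where uv: "u \<in> a" "v \<in> L" "th v = v" "x = u + v"
    using centralizer_split[OF x(1) h_comm[OF xh]] ah by blast
  obtain e where e: "psi u = diagm e" using h_diag uv(1) ah by blast
  have vd: "psi v = diagm (\<lambda>i. complex_of_real (d i) - e i)"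
  proof -
    have "psi v = psi x - psi u" using uv(4) by (simp add: psi_hom)
    then show ?thesis using x(2) e by (simp add: mat_eq_iff diagm_nth)
  qed
  let ?f = "\<lambda>i. complex_of_real (d i) - e i"
  \<comment> \<open>A difference of diagonal entries of \<open>psi v\<close> is real, as a
    difference of such entries of \<open>psi x\<close> and \<open>psi u\<close>, and imaginary,
    since \<open>th v = v\<close>.\<close>
  have "?f i = ?f j" for i j
  proof (cases "i = j")
    case False
    have "Im (e i - e j) = 0" by (rule ad_a_real[OF uv(1) mu(1)[OF False] mu(2)[OF False]]) (simp add: e bd)
    moreover have "Re (?f i - ?f j) = 0"
      by (rule ad_compact_imaginary[OF uv(2,3) mu(1)[OF False] mu(2)[OF False]]) (simp add: vd bd)
    ultimately show ?thesis by (simp add: complex_eq_iff)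
  qed simp
  note const = this
  have "(\<Sum>i\<in>UNIV. ?f i) = 0" using trace_psi[OF uv(2)] vd by (simp only: trace_diagm)
  then have "?f i = 0" for i
  proof -
    have "(\<Sum>j\<in>UNIV. ?f j) = (\<Sum>j\<in>(UNIV::'n set). ?f i)" by (rule sum.cong) (simp_all add: const)
    also have "\<dots> = of_nat CARD('n) * ?f i" by simp
    finally show ?thesis using \<open>(\<Sum>i\<in>UNIV. ?f i) = 0\<close> by simp
  qed
  then have "psi v = 0" unfolding vd by (simp add: mat_eq_iff diagm_nth)
  then show "x \<in> a" using uv by (simp add: psi_eq_0)
qed

lemma a_real: "x \<in> a \<Longrightarrow> Im (psi x $ i $ i) = 0" "x \<in> a \<Longrightarrow> psi x = diagm (\<lambda>i. complex_of_real (Re (psi x $ i $ i)))"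
  using a_eq[of x] by (auto simp: diagm_nth)

lemma a_bracket:
  assumes "x \<in> a"
  shows "comm_bracket (psi x) z $ i $ j = (psi x $ i $ i - psi x $ j $ j) * z $ i $ j"
  using a_real(2)[OF assms] comm_bracket_diagm[of "\<lambda>i. complex_of_real (Re (psi x $ i $ i))" z i j] a_real(1)[OF assms]
  by (simp add: complex_is_Real_iff)

lemma restr_rt: "x \<in> a \<Longrightarrow> restr a (rt i j) x = psi x $ i $ i - psi x $ j $ j"
  using ah subspace_0[OF sub_h(1)] by (auto simp: restr_def rt_def Psi_def psi_0)

end

section \<open>Numbering the basis vectors along a chain of differences\<close>

text \<open>When each head meets the next tail, \<open>A 1, ..., A l, B l\<close> is the numbering.
  The last head is new: meeting some \<open>A i\<close> would force \<open>i = l - 1\<close> and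
  produce two opposite edges, which \<open>nb\<close> forbids.\<close>

lemma chain_index_aux:
  fixes A B :: "nat \<Rightarrow> 'n::finite"
  assumes inj: "inj_on A {1..l}" and ne: "\<And>i. i \<in> {1..l} \<Longrightarrow> A i \<noteq> B i"
    and adj: "\<And>i j. i \<in> {1..l} \<Longrightarrow> j \<in> {1..l} \<Longrightarrow> i \<noteq> j \<Longrightarrow> A i = B j \<Longrightarrow> i = Suc j \<or> j = Suc i"
    and nb: "\<And>i j. i \<in> {1..l} \<Longrightarrow> j \<in> {1..l} \<Longrightarrow> i \<noteq> j \<Longrightarrow> \<not> (A i = B j \<and> B i = A j)"
    and chain: "\<And>i. 1 \<le> i \<Longrightarrow> i < l \<Longrightarrow> B i = A (Suc i)"
    and card: "CARD('n) = l + 1" and l: "1 \<le> l"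
  shows "\<exists>s. bij_betw s {1..l+1} (UNIV::'n set) \<and> (\<forall>i\<in>{1..l}. A i = s i \<and> B i = s (i + 1))"
proof -
  define s where "s i = (if i \<le> l then A i else B l)" for i
  have neq: "B l \<noteq> A i" if i: "i \<in> {1..l}" for i
  proof
    assume e: "B l = A i"
    then have "i \<noteq> l" using ne[of l] l by auto
    then have "i = Suc l \<or> l = Suc i" using adj[of i l] i l e by auto
    then have "l = Suc i" using i by auto
    then have "B i = A l" using chain[of i] i by auto
    then show False using nb[of i l] i l e \<open>i \<noteq> l\<close> by auto
  qed
  have "inj_on s {1..l+1}"
  proof (rule inj_onI)
    fix i j assume ij: "i \<in> {1..l+1}" "j \<in> {1..l+1}" "s i = s j"
    show "i = j"
    proof (cases "i \<le> l")
      case True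
      then have i: "i \<in> {1..l}" using ij by simp
      show ?thesis
      proof (cases "j \<le> l")
        case True
        then show ?thesis using inj_onD[OF inj _ i, of j] ij \<open>i \<le> l\<close> by (simp add: s_def)
      next
        case False
        then show ?thesis using neq[OF i] ij \<open>i \<le> l\<close> by (simp add: s_def)
      qed
    next
      case False
      show ?thesis
      proof (cases "j \<le> l")
        case True
        then have "j \<in> {1..l}" using ij by simp
        then show ?thesis using neq[of j] ij \<open>\<not> i \<le> l\<close> True by (simp add: s_def)
      next
        case False
        then show ?thesis using ij \<open>\<not> i \<le> l\<close> by simp
      qed
    qed
  qed
  moreover have "s ` {1..l+1} = UNIV"
    using calculation card by (intro card_subset_eq) (auto simp: card_image)
  ultimately have "bij_betw s {1..l+1} UNIV" by (simp add: bij_betw_def)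
  moreover have "A i = s i \<and> B i = s (i + 1)" if "i \<in> {1..l}" for i
    using that chain[of i] by (cases "i = l") (auto simp: s_def)
  ultimately show ?thesis by blast
qed

text \<open>The first edge fixes the orientation and injectivity propagates it:
  \<open>B i = A (i + 1)\<close> and \<open>A (i + 1) = B (i + 2)\<close> would give
  \<open>B i = B (i + 2)\<close>. A chain oriented the other way is read backwards.\<close>

lemma chain_index:
  fixes A B :: "nat \<Rightarrow> 'n::finite"
  assumes inj: "inj_on A {1..l}" "inj_on B {1..l}" and ne: "\<And>i. i \<in> {1..l} \<Longrightarrow> A i \<noteq> B i"
    and adj: "\<And>i j. i \<in> {1..l} \<Longrightarrow> j \<in> {1..l} \<Longrightarrow> i \<noteq> j \<Longrightarrow> (A i = B j \<or> B i = A j) \<longleftrightarrow> (i = Suc j \<or> j = Suc i)"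
    and nb: "\<And>i j. i \<in> {1..l} \<Longrightarrow> j \<in> {1..l} \<Longrightarrow> i \<noteq> j \<Longrightarrow> \<not> (A i = B j \<and> B i = A j)"
    and card: "CARD('n) = l + 1" and l: "1 \<le> l"
  shows "\<exists>s rev. bij_betw s {1..l+1} (UNIV::'n set) \<and>
    (\<forall>i\<in>{1..l}. A i = s (if rev then l + 1 - i else i) \<and> B i = s ((if rev then l + 1 - i else i) + 1))"
proof -
  consider "\<And>i. 1 \<le> i \<Longrightarrow> i < l \<Longrightarrow> B i = A (Suc i)" | "\<And>i. 1 \<le> i \<Longrightarrow> i < l \<Longrightarrow> A i = B (Suc i)"
  proof (cases "l = 1 \<or> B 1 = A 2")
    case True
    have "B i = A (Suc i)" if "1 \<le> i" "i < l" for i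
      using that
    proof (induction i rule: dec_induct)
      case base then show ?case using True by (auto simp: numeral_2_eq_2)
    next
      case (step i)
      have "A (Suc i) = B (Suc (Suc i)) \<or> B (Suc i) = A (Suc (Suc i))" using adj[of "Suc i" "Suc (Suc i)"] step by auto
      moreover have "B i \<noteq> B (Suc (Suc i))" using inj_onD[OF inj(2), of i "Suc (Suc i)"] step by auto
      ultimately show ?case using step by auto
    qed
    then show ?thesis using that by blast
  next
    case False
    have "A i = B (Suc i)" if "1 \<le> i" "i < l" for i
      using that
    proof (induction i rule: dec_induct)
      case base
      have "A 1 = B 2 \<or> B 1 = A 2" using adj[of 1 2] base by auto
      then show ?case using False by (auto simp: numeral_2_eq_2)
    next
      case (step i)
      have "A (Suc i) = B (Suc (Suc i)) \<or> B (Suc i) = A (Suc (Suc i))" using adj[of "Suc i" "Suc (Suc i)"] step by auto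
      moreover have "A i \<noteq> A (Suc (Suc i))" using inj_onD[OF inj(1), of i "Suc (Suc i)"] step by auto
      ultimately show ?case using step by auto
    qed
    then show ?thesis using that by blast
  qed
  then show ?thesis
  proof cases
    case 1
    obtain s where "bij_betw s {1..l+1} (UNIV::'n set)" "\<forall>i\<in>{1..l}. A i = s i \<and> B i = s (i + 1)"
      using chain_index_aux[OF inj(1) ne _ nb 1 card l] adj by blast
    then show ?thesis by (intro exI[of _ s] exI[of _ False]) auto
  next
    case 2
    have ne': "i \<in> {1..l} \<Longrightarrow> B i \<noteq> A i" for i using ne[of i] by auto
    have adj': "i \<in> {1..l} \<Longrightarrow> j \<in> {1..l} \<Longrightarrow> i \<noteq> j \<Longrightarrow> B i = A j \<Longrightarrow> i = Suc j \<or> j = Suc i" for i j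
      using adj[of i j] by blast
    have nb': "i \<in> {1..l} \<Longrightarrow> j \<in> {1..l} \<Longrightarrow> i \<noteq> j \<Longrightarrow> \<not> (B i = A j \<and> A i = B j)" for i j using nb by blast
    obtain s where s: "bij_betw s {1..l+1} (UNIV::'n set)" "\<forall>i\<in>{1..l}. B i = s i \<and> A i = s (i + 1)"
      using chain_index_aux[OF inj(2) ne' adj' nb' 2 card l] by blast
    have r: "bij_betw (\<lambda>i. l + 2 - i) {1..l+1} {1..l+1}"
      by (rule bij_betwI[where g = "\<lambda>i. l + 2 - i"]) auto
    have "bij_betw (s \<circ> (\<lambda>i. l + 2 - i)) {1..l+1} UNIV" using bij_betw_trans[OF r s(1)] .
    moreover have "A i = (s \<circ> (\<lambda>i. l + 2 - i)) (l + 1 - i) \<and> B i = (s \<circ> (\<lambda>i. l + 2 - i)) (l + 1 - i + 1)" if "i \<in> {1..l}" for i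
    proof -
      have "l + 2 - (l + 1 - i) = i + 1" "l + 2 - (l + 1 - i + 1) = i" using that by auto
      then show ?thesis using s(2) that by simp
    qed
    ultimately show ?thesis by (intro exI[of _ "s \<circ> (\<lambda>i. l + 2 - i)"] exI[of _ True]) simp
  qed
qed

section \<open>Labelled Satake diagrams\<close>

locale labelled = diag_pair L lb psi sg a h th
  for L :: "'a::real_vector set" and lb :: "'a bracket"
    and psi :: "'a \<Rightarrow> complex^'n^'n" and sg :: "complex^'n^'n \<Rightarrow> complex^'n^'n"
    and a h :: "'a set" and th :: "'a \<Rightarrow> 'a" +
  fixes l :: nat and \<alpha> :: "nat \<Rightarrow> 'a cform"
  assumes setting: "satake_setting L lb a h l \<alpha>" and card_n: "CARD('n) = l + 1" and l_pos: "1 \<le> l"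
begin

abbreviation "R \<equiv> roots L lb h"

lemma alpha_inj: "inj_on \<alpha> {1..l}" and basis: "root_basis R (\<alpha> ` {1..l})"
  and pos_sys: "positive_system a (restricted_roots L lb a h)
       (restr a ` (positive_roots L lb h l \<alpha> - zero_restr_roots L lb a h))"
  and chain: "chain_labelled R l \<alpha>"
  using setting by (auto simp: satake_setting_def)

text \<open>Its coefficients \<open>1\<close> and \<open>- k\<close> have opposite signs. Hence
  strings through simple roots go in one direction, and Cartan integers merely count the roots
  \<open>\<alpha> i + k \<alpha> j\<close>.\<close>

lemma alpha_diff_not_root:
  assumes ij: "i \<in> {1..l}" "j \<in> {1..l}" "i \<noteq> j" and k: "1 \<le> k"
  shows "(\<lambda>z. \<alpha> i z - of_nat k * \<alpha> j z) \<notin> R"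
proof
  let ?b = "\<lambda>z. \<alpha> i z - of_nat k * \<alpha> j z" and ?D = "\<alpha> ` {1..l}"
  assume "?b \<in> R"
  then obtain c :: "'a cform \<Rightarrow> int" where c: "?b = (\<lambda>z. \<Sum>\<delta>\<in>?D. of_int (c \<delta>) * \<delta> z)"
    "(\<forall>\<delta>\<in>?D. 0 \<le> c \<delta>) \<or> (\<forall>\<delta>\<in>?D. c \<delta> \<le> 0)"
    using basis unfolding root_basis_def by blast
  have ne: "\<alpha> i \<noteq> \<alpha> j" using inj_onD[OF alpha_inj _ ij(1,2)] ij(3) by blast
  define c' :: "'a cform \<Rightarrow> real" where
    "c' \<delta> = of_int (c \<delta>) - (if \<delta> = \<alpha> i then 1 else 0) + (if \<delta> = \<alpha> j then of_nat k else 0)" for \<delta>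
  have D: "finite ?D" "\<alpha> i \<in> ?D" "\<alpha> j \<in> ?D" using ij by auto
  have "(\<Sum>\<delta>\<in>?D. of_real (c' \<delta>) * \<delta> z) = 0" for z
  proof -
    have t1: "(\<Sum>\<delta>\<in>?D. (if \<delta> = \<alpha> i then 1 else 0) * \<delta> z) = \<alpha> i z"
      using D by (simp add: if_distrib if_distribR cong: if_cong)
    have t2: "(\<Sum>\<delta>\<in>?D. (if \<delta> = \<alpha> j then of_nat k else 0) * \<delta> z) = of_nat k * \<alpha> j z"
      using D by (simp add: if_distrib if_distribR cong: if_cong)
    have "(\<Sum>\<delta>\<in>?D. of_real (c' \<delta>) * \<delta> z)
        = (\<Sum>\<delta>\<in>?D. of_int (c \<delta>) * \<delta> z - (if \<delta> = \<alpha> i then 1 else 0) * \<delta> z + (if \<delta> = \<alpha> j then of_nat k else 0) * \<delta> z)"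
      by (rule sum.cong) (auto simp: c'_def algebra_simps)
    also have "\<dots> = ?b z - \<alpha> i z + of_nat k * \<alpha> j z"
      unfolding sum.distrib sum_subtractf t1 t2 using fun_cong[OF c(1), of z] by simp
    finally show ?thesis by simp
  qed
  then have "\<forall>\<delta>\<in>?D. c' \<delta> = 0" using basis unfolding root_basis_def by blast
  then have "c' (\<alpha> i) = 0" "c' (\<alpha> j) = 0" using D by auto
  then have "c (\<alpha> i) = 1" "c (\<alpha> j) = - int k" using ne by (auto simp: c'_def)
  moreover have "(0 \<le> c (\<alpha> i) \<and> 0 \<le> c (\<alpha> j)) \<or> (c (\<alpha> i) \<le> 0 \<and> c (\<alpha> j) \<le> 0)"
    using c(2) D(2,3) by blast
  ultimately show False using k by auto
qed

lemma alpha_roots: "k \<in> {1..l} \<Longrightarrow> \<exists>i j. i \<noteq> j \<and> \<alpha> k = rt i j"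
proof -
  assume "k \<in> {1..l}"
  then have "\<alpha> k \<in> R" using basis unfolding root_basis_def by blast
  then show ?thesis unfolding roots_eq by blast
qed

text \<open>Write each simple root as \<open>rt (A k) (B k)\<close>. Two simple roots are neighbours
  iff their sum is a root, that is, iff a head of one is the tail of the other.\<close>

lemma ex_index:
  "\<exists>s rev. bij_betw s {1..l+1} (UNIV::'n set) \<and>
     (\<forall>i\<in>{1..l}. \<alpha> i = rt (s (if rev then l + 1 - i else i)) (s ((if rev then l + 1 - i else i) + 1)))"
proof -
  obtain A B where AB: "\<And>k. k \<in> {1..l} \<Longrightarrow> A k \<noteq> B k \<and> \<alpha> k = rt (A k) (B k)"
    using alpha_roots by metis
  have add: "rt i j z + rt j k z = rt i k z" "rt i j z = - rt j i z" for i j k z by (auto simp: rt_def)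
  have rtR: "rt i j \<in> R" if "i \<noteq> j" for i j using that unfolding roots_eq by blast
  have neq: "A i \<noteq> A j" "B i \<noteq> B j" if ij: "i \<in> {1..l}" "j \<in> {1..l}" "i \<noteq> j" for i j
  proof -
    have ne: "\<alpha> i \<noteq> \<alpha> j" using inj_onD[OF alpha_inj _ ij(1,2)] ij(3) by blast
    have *: "(\<lambda>z. \<alpha> i z - \<alpha> j z) \<notin> R" using alpha_diff_not_root[OF ij, of 1] by simp
    show "A i \<noteq> A j"
    proof
      assume e: "A i = A j"
      then have "B i \<noteq> B j" using ne AB ij by metis
      moreover have "(\<lambda>z. \<alpha> i z - \<alpha> j z) = rt (B j) (B i)" using AB[OF ij(1)] AB[OF ij(2)] e by (auto simp: rt_def)
      ultimately show False using * rtR by metis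
    qed
    show "B i \<noteq> B j"
    proof
      assume e: "B i = B j"
      then have "A i \<noteq> A j" using ne AB ij by metis
      moreover have "(\<lambda>z. \<alpha> i z - \<alpha> j z) = rt (A i) (A j)" using AB[OF ij(1)] AB[OF ij(2)] e by (auto simp: rt_def)
      ultimately show False using * rtR by metis
    qed
  qed
  have nb: "\<not> (A i = B j \<and> B i = A j)" if ij: "i \<in> {1..l}" "j \<in> {1..l}" "i \<noteq> j" for i j
  proof
    assume e: "A i = B j \<and> B i = A j"
    let ?D = "\<alpha> ` {1..l}"
    have ne: "\<alpha> i \<noteq> \<alpha> j" using inj_onD[OF alpha_inj _ ij(1,2)] ij(3) by blast
    have D: "finite ?D" "\<alpha> i \<in> ?D" "\<alpha> j \<in> ?D" using ij by auto
    define c :: "'a cform \<Rightarrow> real" where "c \<delta> = (if \<delta> = \<alpha> i then 1 else 0) + (if \<delta> = \<alpha> j then 1 else 0)" for \<delta>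
    have "(\<Sum>\<delta>\<in>?D. of_real (c \<delta>) * \<delta> z) = 0" for z
    proof -
      have "(\<Sum>\<delta>\<in>?D. of_real (c \<delta>) * \<delta> z)
          = (\<Sum>\<delta>\<in>?D. (if \<delta> = \<alpha> i then \<delta> z else 0) + (if \<delta> = \<alpha> j then \<delta> z else 0))"
        by (rule sum.cong) (auto simp: c_def)
      also have "\<dots> = \<alpha> i z + \<alpha> j z" using D by (simp add: sum.distrib)
      also have "\<dots> = 0" using AB[OF ij(1)] AB[OF ij(2)] e by (simp add: add(2)[of "A j"])
      finally show ?thesis .
    qed
    then have "\<forall>\<delta>\<in>?D. c \<delta> = 0" using basis unfolding root_basis_def by blast
    then show False using D ne by (auto simp: c_def)
  qed
  have adj: "(A i = B j \<or> B i = A j) \<longleftrightarrow> (i = Suc j \<or> j = Suc i)" if ij: "i \<in> {1..l}" "j \<in> {1..l}" "i \<noteq> j" for i j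
  proof -
    let ?K = "{k::nat. 1 \<le> k \<and> (\<lambda>z. \<alpha> i z + of_nat k * \<alpha> j z) \<in> R}"
    have e0: "{k::nat. 1 \<le> k \<and> (\<lambda>z. \<alpha> i z - of_nat k * \<alpha> j z) \<in> R} = {}"
      using alpha_diff_not_root[OF ij] by blast
    then have ci: "cartan_integer R (\<alpha> i) (\<alpha> j) = - int (card ?K)"
      unfolding cartan_integer_def e0 by simp
    have ch: "cartan_integer R (\<alpha> i) (\<alpha> j) = (if i = Suc j \<or> j = Suc i then - 1 else 0)"
      using chain ij unfolding chain_labelled_def by blast
    \<comment> \<open>Roots take only the values -1, 0, 1 at these points. At \<open>z\<close>,
      \<open>\<alpha> i + k \<alpha> j\<close> would give \<open>1 + k\<close> for disconnected
      edges; at \<open>w\<close> or \<open>w'\<close>, connected edges give \<open>k\<close> up to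
      sign, whence \<open>k = 1\<close>.\<close>
    obtain z where z: "\<forall>p q. rt p q z = of_bool (p \<in> {A i, A j}) - of_bool (q \<in> {A i, A j})"
      using ind_test[of "{A i, A j}"] by blast
    obtain w where w: "\<forall>p q. rt p q w = of_bool (p \<in> {A j}) - of_bool (q \<in> {A j})"
      using ind_test[of "{A j}"] by blast
    obtain w' where w': "\<forall>p q. rt p q w' = of_bool (p \<in> {B j}) - of_bool (q \<in> {B j})"
      using ind_test[of "{B j}"] by blast
    have bound: "\<beta> z' \<in> {-1, 0, 1}" if "\<beta> \<in> R" "z' \<in> {z, w, w'}" for \<beta> z'
      using that z w w' unfolding roots_eq by auto
    show ?thesis
    proof
      assume e: "A i = B j \<or> B i = A j"
      have "(\<lambda>z. \<alpha> i z + of_nat 1 * \<alpha> j z) \<in> R"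
      proof (cases "A i = B j")
        case True
        then have "B i \<noteq> A j" using nb[OF ij] by blast
        moreover have "(\<lambda>z. \<alpha> i z + of_nat 1 * \<alpha> j z) = rt (A j) (B i)"
          using AB[OF ij(1)] AB[OF ij(2)] True by (auto simp: rt_def)
        ultimately show ?thesis using rtR by metis
      next
        case False
        then have e': "B i = A j" using e by blast
        have "(\<lambda>z. \<alpha> i z + of_nat 1 * \<alpha> j z) = rt (A i) (B j)"
          using AB[OF ij(1)] AB[OF ij(2)] e' by (auto simp: rt_def)
        then show ?thesis using rtR False by metis
      qed
      then have 1: "1 \<in> ?K" by simp
      have "k = 1" if "k \<in> ?K" for k
      proof -
        let ?b = "\<lambda>z. \<alpha> i z + of_nat k * \<alpha> j z"
        have k: "1 \<le> k" "?b \<in> R" using that by auto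
        show ?thesis
        proof (cases "A i = B j")
          case True
          then have "B i \<noteq> A j" using nb[OF ij] by blast
          then have "?b w = of_nat k" using AB[OF ij(1)] AB[OF ij(2)] neq[OF ij] w by auto
          then have "(of_nat k :: complex) \<in> {-1, 0, 1}" using bound[OF k(2), of w] by simp
          then have "real k \<in> {-1, 0, 1}" by (auto simp: complex_eq_iff)
          then show ?thesis using k by auto
        next
          case False
          then have e': "B i = A j" using e by blast
          then have "?b w' = - of_nat k" using False AB[OF ij(1)] AB[OF ij(2)] neq[OF ij] w' by auto
          then have "- (of_nat k :: complex) \<in> {-1, 0, 1}" using bound[OF k(2), of w'] by simp
          then have "real k \<in> {-1, 0, 1}" by (auto simp: complex_eq_iff)
          then show ?thesis using k by auto
        qed
      qed
      then have "?K = {1}" using 1 by blast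
      then have "cartan_integer R (\<alpha> i) (\<alpha> j) = - 1" unfolding ci by simp
      then show "i = Suc j \<or> j = Suc i" using ch by (auto split: if_splits)
    next
      assume "i = Suc j \<or> j = Suc i"
      then have "card ?K \<noteq> 0" using ch ci by auto
      then have "?K \<noteq> {}" by (metis card.empty)
      then obtain k where k: "k \<in> ?K" by blast
      show "A i = B j \<or> B i = A j"
      proof (rule ccontr)
        assume n: "\<not> (A i = B j \<or> B i = A j)"
        let ?b = "\<lambda>z. \<alpha> i z + of_nat k * \<alpha> j z"
        have "?b z = 1 + of_nat k" using AB[OF ij(1)] AB[OF ij(2)] neq[OF ij] n z by auto
        moreover have "?b \<in> R" using k by blast
        ultimately have "(1 + of_nat k :: complex) \<in> {-1, 0, 1}" using bound[of ?b z] by simp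
        then have "1 + real k \<in> {-1, 0, 1}" by (auto simp: complex_eq_iff)
        then show False using k by auto
      qed
    qed
  qed
  have injA: "inj_on A {1..l}" "inj_on B {1..l}" using neq by (meson inj_onI)+
  have ne: "i \<in> {1..l} \<Longrightarrow> A i \<noteq> B i" for i using AB by blast
  obtain s rev where s: "bij_betw s {1..l+1} (UNIV::'n set)"
    "\<forall>i\<in>{1..l}. A i = s (if rev then l + 1 - i else i) \<and> B i = s ((if rev then l + 1 - i else i) + 1)"
    using chain_index[OF injA ne adj nb card_n l_pos] by blast
  have "\<alpha> i = rt (s (if rev then l + 1 - i else i)) (s ((if rev then l + 1 - i else i) + 1))" if "i \<in> {1..l}" for i
    using AB[OF that] s(2) that by metis
  then show ?thesis using s(1) by (intro exI[of _ s] exI[of _ rev]) simp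
qed

definition "sr = (SOME p. bij_betw (fst p) {1..l+1} (UNIV::'n set) \<and>
     (\<forall>i\<in>{1..l}. \<alpha> i = rt ((fst p) (if snd p then l + 1 - i else i)) ((fst p) ((if snd p then l + 1 - i else i) + 1))))"

definition "s = fst sr"

text \<open>Translates a label of the diagram into a position along \<open>s\<close>. The chain
  condition cannot tell a labelling from its reversal, while \<open>s\<close> is always oriented so
  that \<open>rt (s i) (s j)\<close> is positive for \<open>i < j\<close>.\<close>

definition "rho i = (if snd sr then l + 1 - i else i)" for i :: nat

lemma s_bij: "bij_betw s {1..l+1} UNIV" and alpha_eq: "i \<in> {1..l} \<Longrightarrow> \<alpha> i = rt (s (rho i)) (s (rho i + 1))"
proof -
  have "\<exists>p. bij_betw (fst p) {1..l+1} (UNIV::'n set) \<and>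
     (\<forall>i\<in>{1..l}. \<alpha> i = rt ((fst p) (if snd p then l + 1 - i else i)) ((fst p) ((if snd p then l + 1 - i else i) + 1)))"
    using ex_index by simp
  from someI_ex[OF this, folded sr_def]
  show "bij_betw s {1..l+1} UNIV" "i \<in> {1..l} \<Longrightarrow> \<alpha> i = rt (s (rho i)) (s (rho i + 1))"
    by (auto simp: s_def rho_def)
qed

lemma rho: "i \<in> {1..l} \<Longrightarrow> rho i \<in> {1..l}" "i \<in> {1..l} \<Longrightarrow> rho (rho i) = i"
  by (auto simp: rho_def)

lemma rho_cases: "(\<forall>i. rho i = i) \<or> (\<forall>i. rho i = l + 1 - i)"
  by (simp add: rho_def)

lemma s_inj: "i \<in> {1..l+1} \<Longrightarrow> j \<in> {1..l+1} \<Longrightarrow> s i = s j \<longleftrightarrow> i = j"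
  using s_bij by (auto simp: bij_betw_def inj_on_def)

lemma s_surj: "\<exists>i\<in>{1..l+1}. x = s i"
  using s_bij by (auto simp: bij_betw_def)

text \<open>\<open>z\<close> is the fundamental coweight at position \<open>k\<close>: among the
  simple roots only \<open>rt (s k) (s (k + 1))\<close> is non-zero there, so it reads off
  coefficients.\<close>

lemma seg_test:
  obtains z where "\<And>i j. i \<in> {1..l+1} \<Longrightarrow> j \<in> {1..l+1} \<Longrightarrow> rt (s i) (s j) z = of_bool (i \<le> k) - of_bool (j \<le> k)"
proof -
  obtain z where z: "\<forall>p q. rt p q z = of_bool (p \<in> s ` {i\<in>{1..l+1}. i \<le> k}) - of_bool (q \<in> s ` {i\<in>{1..l+1}. i \<le> k})"
    using ind_test by blast
  have "s i \<in> s ` {i\<in>{1..l+1}. i \<le> k} \<longleftrightarrow> i \<le> k" if "i \<in> {1..l+1}" for i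
    using that s_inj by auto
  then show ?thesis using that[of z] z by simp
qed

lemma comb_eq: "comb l \<alpha> c = (\<lambda>z. \<Sum>k\<in>{1..l}. of_int (c (rho k)) * rt (s k) (s (k + 1)) z)"
proof
  fix z
  have "bij_betw rho {1..l} {1..l}" by (rule bij_betwI[where g = rho]) (use rho in auto)
  then have "(\<Sum>k\<in>{1..l}. of_int (c (rho k)) * rt (s k) (s (k + 1)) z)
      = (\<Sum>k\<in>{1..l}. of_int (c (rho (rho k))) * rt (s (rho k)) (s (rho k + 1)) z)"
    by (rule sum.reindex_bij_betw[symmetric])
  also have "\<dots> = comb l \<alpha> c z"
    unfolding comb_def by (rule sum.cong) (use rho alpha_eq in auto)
  finally show "comb l \<alpha> c z = (\<Sum>k\<in>{1..l}. of_int (c (rho k)) * rt (s k) (s (k + 1)) z)" by simp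
qed

lemma comb_segment:
  assumes ij: "1 \<le> i" "i < j" "j \<le> l + 1"
  shows "comb l \<alpha> (\<lambda>k. of_bool (i \<le> rho k \<and> rho k < j)) = rt (s i) (s j)"
proof
  fix z
  have "comb l \<alpha> (\<lambda>k. of_bool (i \<le> rho k \<and> rho k < j)) z
      = (\<Sum>k\<in>{1..l}. (if k \<in> {i..<j} then rt (s k) (s (k + 1)) z else 0))"
    unfolding comb_eq by (rule sum.cong) (auto simp: rho)
  also have "\<dots> = (\<Sum>k\<in>{1..l} \<inter> {i..<j}. rt (s k) (s (k + 1)) z)"
    by (rule sum.inter_restrict[symmetric]) simp
  also have "{1..l} \<inter> {i..<j} = {i..<j}" using ij by auto
  also have "(\<Sum>k\<in>{i..<j}. rt (s k) (s (k + 1)) z) = rt (s i) (s j) z"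
    using ij(2)
  proof (induction j rule: less_induct)
    case (less j)
    show ?case
    proof (cases "i = j - 1")
      case True
      then have "{i..<j} = {i}" "i + 1 = j" using less by auto
      then show ?thesis by simp
    next
      case False
      then have "{i..<j} = insert (j - 1) {i..<j - 1}" "j - 1 + 1 = j" using less(2) by auto
      then have "(\<Sum>k\<in>{i..<j}. rt (s k) (s (k + 1)) z) = rt (s (j - 1)) (s j) z + rt (s i) (s (j - 1)) z"
        using less(1)[of "j - 1"] less(2) False by simp
      then show ?thesis by (simp add: rt_def)
    qed
  qed
  finally show "comb l \<alpha> (\<lambda>k. of_bool (i \<le> rho k \<and> rho k < j)) z = rt (s i) (s j) z" .
qed

lemma comb_coeff:
  assumes e: "comb l \<alpha> p = rt (s i) (s j)" and ij: "i \<in> {1..l+1}" "j \<in> {1..l+1}" and k: "k \<in> {1..l}"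
  shows "p (rho k) = of_bool (i \<le> k) - of_bool (j \<le> k)"
proof -
  obtain z where z: "\<And>i j. i \<in> {1..l+1} \<Longrightarrow> j \<in> {1..l+1} \<Longrightarrow> rt (s i) (s j) z = of_bool (i \<le> k) - of_bool (j \<le> k)"
    using seg_test[of k] by blast
  have "rt (s i) (s j) z = (\<Sum>m\<in>{1..l}. of_int (p (rho m)) * rt (s m) (s (m + 1)) z)"
    using fun_cong[OF e, of z] unfolding comb_eq by simp
  also have "\<dots> = (\<Sum>m\<in>{1..l}. if m = k then of_int (p (rho m)) else 0)"
    by (rule sum.cong) (auto simp: z)
  also have "\<dots> = of_int (p (rho k))" using k by simp
  finally have "of_int (p (rho k)) = (of_int (of_bool (i \<le> k) - of_bool (j \<le> k)) :: complex)" using z[OF ij] by simp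
  then show ?thesis by (simp only: of_int_eq_iff)
qed

lemma root_cases:
  assumes "\<beta> \<in> R"
  obtains i j where "i \<in> {1..l+1}" "j \<in> {1..l+1}" "i \<noteq> j" "\<beta> = rt (s i) (s j)"
proof -
  obtain x y where xy: "x \<noteq> y" "\<beta> = rt x y" using assms unfolding roots_eq by blast
  obtain i j where "i \<in> {1..l+1}" "j \<in> {1..l+1}" "x = s i" "y = s j" using s_surj by meson
  then show ?thesis using that xy by blast
qed

lemma rt_s_root: "i \<in> {1..l+1} \<Longrightarrow> j \<in> {1..l+1} \<Longrightarrow> i \<noteq> j \<Longrightarrow> rt (s i) (s j) \<in> R"
  using s_inj unfolding roots_eq by blast

text \<open>The maximal root is \<open>rt (s 1) (s (l + 1))\<close>, the sum of all simple roots;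
  \<open>comb_coeff\<close> bounds every coefficient of a root by 1.\<close>

lemma maximal_root_coeffs_iff: "maximal_root_coeffs R l \<alpha> m \<longleftrightarrow> (\<forall>k\<in>{1..l}. m k = 1)"
proof -
  have le1: "p k \<le> 1" if p: "comb l \<alpha> p \<in> R" "k \<in> {1..l}" for p k
  proof -
    obtain i j where "i \<in> {1..l+1}" "j \<in> {1..l+1}" "comb l \<alpha> p = rt (s i) (s j)" using root_cases[OF p(1)] by metis
    then show ?thesis using comb_coeff[of p i j "rho k"] rho p(2) by (simp add: of_bool_def)
  qed
  have one: "comb l \<alpha> m = rt (s 1) (s (l + 1))" if m: "\<forall>k\<in>{1..l}. m k = 1" for m
  proof -
    have "comb l \<alpha> m = comb l \<alpha> (\<lambda>k. of_bool (1 \<le> rho k \<and> rho k < l + 1))"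
      unfolding comb_def
    proof (intro ext sum.cong refl)
      fix z k assume k: "k \<in> {1..l}"
      then have "rho k \<in> {1..l}" "m k = 1" using rho(1) m by blast+
      then show "of_int (m k) * \<alpha> k z = of_int (of_bool (1 \<le> rho k \<and> rho k < l + 1)) * \<alpha> k z" by auto
    qed
    then show ?thesis using comb_segment[of 1 "l + 1"] l_pos by simp
  qed
  have oneR: "comb l \<alpha> m \<in> R" if "\<forall>k\<in>{1..l}. m k = 1" for m
    using one[OF that] rt_s_root[of 1 "l + 1"] l_pos by simp
  show ?thesis
  proof
    assume m: "maximal_root_coeffs R l \<alpha> m"
    then have "1 \<le> m k" if "k \<in> {1..l}" for k
      using oneR[of "\<lambda>_. 1"] that unfolding maximal_root_coeffs_def by auto
    moreover have "m k \<le> 1" if "k \<in> {1..l}" for k using m le1 that unfolding maximal_root_coeffs_def by blast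
    ultimately show "\<forall>k\<in>{1..l}. m k = 1" by force
  next
    assume m: "\<forall>k\<in>{1..l}. m k = 1"
    then show "maximal_root_coeffs R l \<alpha> m"
      unfolding maximal_root_coeffs_def using oneR le1 by auto
  qed
qed

text \<open>The coefficient of \<open>rt (s i) (s j)\<close> at position \<open>k\<close> is
  \<open>[i \<le> k] - [j \<le> k]\<close>, which is 1 exactly for \<open>i \<le> k < j\<close>;
  this is imposed at \<open>k = p\<close> and \<open>k = q\<close>.\<close>

lemma PhiI_eq:
  assumes st: "1 \<le> p" "p \<le> q" "q \<le> l"
  shows "PhiI R l \<alpha> {rho p, rho q} = {rt (s i) (s j) | i j. 1 \<le> i \<and> i \<le> p \<and> q < j \<and> j \<le> l + 1}"
proof (intro set_eqI iffI)
  fix \<beta> assume "\<beta> \<in> PhiI R l \<alpha> {rho p, rho q}"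
  then obtain m c where b: "\<beta> \<in> R" "maximal_root_coeffs R l \<alpha> m" "\<beta> = comb l \<alpha> c" "\<forall>j\<in>{rho p, rho q}. c j = m j"
    unfolding PhiI_def by blast
  have "rho p \<in> {1..l}" "rho q \<in> {1..l}" using rho(1) st by auto
  then have c: "c (rho p) = 1" "c (rho q) = 1" using b(2,4) unfolding maximal_root_coeffs_iff by auto
  obtain i j where ij: "i \<in> {1..l+1}" "j \<in> {1..l+1}" "\<beta> = rt (s i) (s j)" using root_cases[OF b(1)] by metis
  have "c (rho p) = of_bool (i \<le> p) - of_bool (j \<le> p)" "c (rho q) = of_bool (i \<le> q) - of_bool (j \<le> q)"
    using comb_coeff[of c i j] ij b(3) st by auto
  then have "i \<le> p" "q < j" using c by (auto simp: of_bool_def split: if_splits)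
  then show "\<beta> \<in> {rt (s i) (s j) | i j. 1 \<le> i \<and> i \<le> p \<and> q < j \<and> j \<le> l + 1}" using ij by auto
next
  fix \<beta> assume "\<beta> \<in> {rt (s i) (s j) | i j. 1 \<le> i \<and> i \<le> p \<and> q < j \<and> j \<le> l + 1}"
  then obtain i j where ij: "1 \<le> i" "i \<le> p" "q < j" "j \<le> l + 1" "\<beta> = rt (s i) (s j)" by blast
  let ?c = "\<lambda>k. of_bool (i \<le> rho k \<and> rho k < j) :: int"
  have "\<beta> = comb l \<alpha> ?c" using comb_segment[of i j] ij st by simp
  moreover have "\<forall>j\<in>{rho p, rho q}. ?c j = 1" using rho(2)[of p] rho(2)[of q] ij st by auto
  moreover have "\<beta> \<in> R" using rt_s_root[of i j] ij st by simp
  moreover have "maximal_root_coeffs R l \<alpha> (\<lambda>_. 1)" by (simp add: maximal_root_coeffs_iff)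
  ultimately show "\<beta> \<in> PhiI R l \<alpha> {rho p, rho q}"
    unfolding PhiI_def by (intro CollectI conjI exI[of _ "\<lambda>_. 1"] exI[of _ ?c])
qed

text \<open>The witness of the positive system. Its diagonal decreases strictly along the chain,
  except between positions that no element of \<open>a\<close> separates.\<close>

lemma ex_regular:
  obtains k where "k \<in> a" "\<And>i j. 1 \<le> i \<Longrightarrow> i < j \<Longrightarrow> j \<le> l + 1 \<Longrightarrow>
    (\<forall>x\<in>a. psi x $ s i $ s i = psi x $ s j $ s j) \<or> Re (psi k $ s i $ s i) > Re (psi k $ s j $ s j)"
proof -
  let ?P = "restr a ` (positive_roots L lb h l \<alpha> - zero_restr_roots L lb a h)"
  obtain k where k: "k \<in> a" "?P = {\<mu> \<in> restricted_roots L lb a h. 0 < Re (\<mu> k)}"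
    using pos_sys unfolding positive_system_def by blast
  have "(\<forall>x\<in>a. psi x $ s i $ s i = psi x $ s j $ s j) \<or> Re (psi k $ s i $ s i) > Re (psi k $ s j $ s j)"
    if ij: "1 \<le> i" "i < j" "j \<le> l + 1" for i j
  proof (cases "rt (s i) (s j) \<in> zero_restr_roots L lb a h")
    case True
    then have z: "restr a (rt (s i) (s j)) = (\<lambda>x. 0)" by (simp add: zero_restr_roots_def)
    have "psi x $ s i $ s i = psi x $ s j $ s j" if "x \<in> a" for x
      using restr_rt[OF that, of "s i" "s j"] z by simp
    then show ?thesis by blast
  next
    case False
    have "rt (s i) (s j) \<in> R" using rt_s_root[of i j] ij by simp
    then have "rt (s i) (s j) \<in> positive_roots L lb h l \<alpha>"
      unfolding positive_roots_def using comb_segment[OF ij, symmetric] by (intro CollectI conjI exI) auto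
    then have "restr a (rt (s i) (s j)) \<in> ?P" using False by blast
    then have "0 < Re (restr a (rt (s i) (s j)) k)" using k(2) by auto
    then show ?thesis using restr_rt[OF k(1)] by simp
  qed
  then show ?thesis using that k(1) by blast
qed

definition supported :: "nat \<Rightarrow> nat \<Rightarrow> 'a set" where
  "supported p q = {x\<in>L. \<forall>i\<in>{1..l+1}. \<forall>j\<in>{1..l+1}. psi x $ s i $ s j \<noteq> 0 \<longrightarrow> i \<le> p \<and> q < j}"

text \<open>\<open>D\<close> lies in \<open>a\<close> and has the diagonal \<open>[i \<le> p] + [i \<le> q]\<close> along the chain, up to a constant; so it
  separates \<open>\<Phi>\<^sub>I\<close> from the other roots, for \<open>I = {p, q}\<close>.\<close>

context
  fixes p q :: nat and D :: 'a and c :: real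
  assumes pq: "1 \<le> p" "p \<le> q" "q \<le> l" and D: "D \<in> a"
    and Dd: "\<And>i. i \<in> {1..l+1} \<Longrightarrow> psi D $ s i $ s i = of_real (of_bool (i \<le> p) + of_bool (i \<le> q) - c)"
begin

text \<open>A simple root is non-zero at \<open>D\<close> exactly when its position is one of the
  two jumps \<open>p\<close>, \<open>q\<close> of the diagonal. This shows whiteness and, as arrows
  join equal restrictions, closure.\<close>

lemma D_admissible: "admissible L lb a h l \<alpha> {rho p, rho q}"
proof -
  have pql: "p \<in> {1..l}" "q \<in> {1..l}" using pq by auto
  have val: "restr a (\<alpha> k) D \<noteq> 0 \<longleftrightarrow> k \<in> {rho p, rho q}" if k: "k \<in> {1..l}" for k
  proof -
    have r: "rho k \<in> {1..l}" using rho k by blast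
    have "restr a (\<alpha> k) D = of_real ((of_bool (rho k \<le> p) + of_bool (rho k \<le> q)) - (of_bool (rho k + 1 \<le> p) + of_bool (rho k + 1 \<le> q)))"
      using restr_rt[OF D] alpha_eq[OF k] Dd[of "rho k"] Dd[of "rho k + 1"] r by simp
    then have "restr a (\<alpha> k) D \<noteq> 0 \<longleftrightarrow> rho k = p \<or> rho k = q" by (auto simp: of_bool_def split: if_splits)
    also have "\<dots> \<longleftrightarrow> k \<in> {rho p, rho q}" using rho(2)[OF k] rho(2)[OF pql(1)] rho(2)[OF pql(2)] by auto
    finally show ?thesis .
  qed
  have sub: "{rho p, rho q} \<subseteq> {1..l}" using rho(1) pql by auto
  have "k \<in> white L lb a h l \<alpha>" if "k \<in> {rho p, rho q}" for k
    using val[of k] that sub by (auto simp: white_def zero_restr_roots_def)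
  moreover have "j \<in> {rho p, rho q}" if i: "i \<in> {rho p, rho q}" "arrow L lb a h l \<alpha> i j" for i j
  proof -
    have "j \<in> {1..l}" "restr a (\<alpha> i) = restr a (\<alpha> j)" using i by (auto simp: arrow_def white_def)
    then show ?thesis using val[of i] val[of j] i(1) sub by auto
  qed
  ultimately show ?thesis by (auto simp: admissible_def)
qed

text \<open>The diagonal of \<open>D\<close> drops once after \<open>p\<close> and once after
  \<open>q\<close>; a total drop of 2 requires crossing both.\<close>

lemma D_weight:
  assumes ij: "i \<in> {1..l+1}" "j \<in> {1..l+1}"
  shows "psi D $ s i $ s i - psi D $ s j $ s j = 2 \<longleftrightarrow> i \<le> p \<and> q < j"
proof -
  have "psi D $ s i $ s i - psi D $ s j $ s j = of_real ((of_bool (i \<le> p) + of_bool (i \<le> q)) - (of_bool (j \<le> p) + of_bool (j \<le> q)))"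
    using Dd ij by simp
  also have "\<dots> = 2 \<longleftrightarrow> (of_bool (i \<le> p) + of_bool (i \<le> q)) - (of_bool (j \<le> p) + of_bool (j \<le> q)) = (2::real)"
    by (simp add: complex_eq_iff)
  also have "\<dots> \<longleftrightarrow> i \<le> p \<and> q < j" using pq by (auto simp: of_bool_def split: if_splits)
  finally show ?thesis .
qed

lemma supported_iff: "x \<in> supported p q \<longleftrightarrow> x \<in> L \<and> lb D x = 2 *\<^sub>R x"
proof -
  have "lb D x = 2 *\<^sub>R x \<longleftrightarrow> comm_bracket (psi D) (psi x) = 2 *\<^sub>R psi x"
    by (simp flip: psi_lb psi_scale add: psi_eq)
  also have "\<dots> \<longleftrightarrow> (\<forall>i\<in>{1..l+1}. \<forall>j\<in>{1..l+1}. comm_bracket (psi D) (psi x) $ s i $ s j = (2 *\<^sub>R psi x) $ s i $ s j)"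
    unfolding mat_eq_iff using s_surj by metis
  also have "\<dots> \<longleftrightarrow> (\<forall>i\<in>{1..l+1}. \<forall>j\<in>{1..l+1}. psi x $ s i $ s j \<noteq> 0 \<longrightarrow> i \<le> p \<and> q < j)"
  proof (intro ball_cong refl)
    fix i j assume ij: "i \<in> {1..l+1}" "j \<in> {1..l+1}"
    have "comm_bracket (psi D) (psi x) $ s i $ s j = (2 *\<^sub>R psi x) $ s i $ s j \<longleftrightarrow>
        (psi D $ s i $ s i - psi D $ s j $ s j) * psi x $ s i $ s j = 2 * psi x $ s i $ s j"
      by (simp add: a_bracket[OF D] scaleR_conv_of_real[where 'a = complex])
    also have "\<dots> \<longleftrightarrow> (psi x $ s i $ s j \<noteq> 0 \<longrightarrow> i \<le> p \<and> q < j)" using D_weight[OF ij] by auto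
    finally show "comm_bracket (psi D) (psi x) $ s i $ s j = (2 *\<^sub>R psi x) $ s i $ s j \<longleftrightarrow>
      (psi x $ s i $ s j \<noteq> 0 \<longrightarrow> i \<le> p \<and> q < j)" .
  qed
  finally show ?thesis by (auto simp: supported_def)
qed

lemma rp_in_supported:
  assumes "trace z = 0" "comm_bracket (psi D) z = 2 *\<^sub>R z"
  shows "rp z \<in> supported p q" "iq z \<in> supported p q"
proof -
  have DL: "D \<in> L" using D sub_a by blast
  have z2: "2 *\<^sub>R z = (2::complex) *\<^sub>C z" by (simp add: mat_eq_iff scaleR_conv_of_real[where 'a = complex])
  have "lb D (rp z) = 2 *\<^sub>R rp z" "lb D (iq z) = 2 *\<^sub>R iq z"
    using rp_iq_bracket[OF assms(1) DL] assms(2) rp_iq_cscaleM[OF assms(1), of 2] by (simp_all add: z2)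
  then show "rp z \<in> supported p q" "iq z \<in> supported p q" using rp_iq[OF assms(1)] by (auto simp: supported_iff)
qed

lemma subspace_supported: "subspace (supported p q)"
  using subV unfolding supported_iff[abs_def] subspace_def
  by (auto simp: supported_iff lb_simps scaleR_add_right)

text \<open>Both sides are tested by \<open>D\<close>: restrictions from \<open>\<Phi>_I\<close>
  take the value 2 there, which bounds the span. Conversely, cut \<open>psi x\<close> into multiples
  of matrix units and take real parts.\<close>

lemma BI_eq: "BI L lb a h l \<alpha> {rho p, rho q} = supported p q"
proof
  let ?U = "\<Union>\<beta>\<in>PhiI R l \<alpha> {rho p, rho q}. restricted_space L lb a (restr a \<beta>)"
  have "?U \<subseteq> supported p q"
  proof
    fix x assume "x \<in> ?U"
    then obtain i j where ij: "1 \<le> i" "i \<le> p" "q < j" "j \<le> l + 1"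
      and x: "x \<in> restricted_space L lb a (restr a (rt (s i) (s j)))"
      unfolding PhiI_eq[OF pq] by blast
    have "lb D x = Re (restr a (rt (s i) (s j)) D) *\<^sub>R x" "x \<in> L" using x D by (auto simp: restricted_space_def)
    moreover have "restr a (rt (s i) (s j)) D = 2"
      using restr_rt[OF D] D_weight[of i j] ij pq by simp
    ultimately show "x \<in> supported p q" by (simp add: supported_iff)
  qed
  then show "BI L lb a h l \<alpha> {rho p, rho q} \<subseteq> supported p q"
    unfolding BI_def by (rule span_minimal[OF _ subspace_supported])
  show "supported p q \<subseteq> BI L lb a h l \<alpha> {rho p, rho q}"
  proof
    fix x assume x: "x \<in> supported p q"
    define y where "y ij = psi x $ fst ij $ snd ij *\<^sub>C munit (fst ij) (snd ij)" for ij
    have xL: "x \<in> L" using x by (simp add: supported_def)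
    have off: "psi x $ s i $ s j = 0" if "i \<in> {1..l+1}" "j \<in> {1..l+1}" "\<not> (i \<le> p \<and> q < j)" for i j
      using x that unfolding supported_def by blast
    have diag0: "psi x $ i $ i = 0" for i using s_surj[of i] off pq by fastforce
    have tr: "trace (y ij) = 0" for ij
      using diag0 by (cases "fst ij = snd ij") (auto simp: y_def trace_def munit_nth intro!: sum.neutral)
    have "psi x = (\<Sum>ij\<in>UNIV. y ij)"
      unfolding mat_eq_iff
    proof (intro allI)
      fix i j
      have "(\<Sum>ij\<in>UNIV. y ij) $ i $ j = (\<Sum>ij\<in>UNIV. if ij = (i, j) then psi x $ i $ j else 0)"
        unfolding sum_component by (rule sum.cong) (auto simp: y_def munit_nth)
      then show "psi x $ i $ j = (\<Sum>ij\<in>UNIV. y ij) $ i $ j" by simp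
    qed
    then have "x = rp (\<Sum>ij\<in>UNIV. y ij)" using rp_psi[OF xL] by simp
    also have "\<dots> = (\<Sum>ij\<in>UNIV. rp (y ij))" using rp_sum[of UNIV y] tr by simp
    also have "\<dots> \<in> BI L lb a h l \<alpha> {rho p, rho q}"
      unfolding BI_def
    proof (rule span_sum)
      fix ij :: "'n \<times> 'n"
      obtain i j where ij: "i \<in> {1..l+1}" "j \<in> {1..l+1}" "ij = (s i, s j)"
        using s_surj[of "fst ij"] s_surj[of "snd ij"] by (metis prod.collapse)
      show "rp (y ij) \<in> span ?U"
      proof (cases "i \<le> p \<and> q < j")
        case False
        then have "y ij = 0" using off ij by (simp add: y_def)
        then show ?thesis using rp_psi[of 0] subspace_0[OF subV] by (simp add: psi_0 span_zero)
      next
        case True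
        \<comment> \<open>Roots are real on \<open>a\<close>, so the real part of a complex root
          vector is still an eigenvector for \<open>a\<close>, although not for
          \<open>h\<close>.\<close>
        have "lb k (rp (y ij)) = Re (restr a (rt (s i) (s j)) k) *\<^sub>R rp (y ij)" if k: "k \<in> a" for k
        proof -
          have kL: "k \<in> L" using k sub_a by blast
          define d where "d = psi k $ s i $ s i - psi k $ s j $ s j"
          have "comm_bracket (psi k) (y ij) = d *\<^sub>C y ij"
            unfolding mat_eq_iff
          proof (intro allI)
            fix i' j'
            show "comm_bracket (psi k) (y ij) $ i' $ j' = (d *\<^sub>C y ij) $ i' $ j'"
              by (auto simp: a_bracket[OF k] y_def munit_nth ij(3) d_def)
          qed
          then have "lb k (rp (y ij)) = rp (d *\<^sub>C y ij)" using rp_iq_bracket(1)[OF tr kL, of ij] by simp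
          also have "\<dots> = Re d *\<^sub>R rp (y ij)"
            using rp_iq_cscaleM(1)[OF tr, of d ij] a_real(1)[OF k] by (simp add: d_def)
          finally show ?thesis using restr_rt[OF k] by (simp add: d_def)
        qed
        then have "rp (y ij) \<in> restricted_space L lb a (restr a (rt (s i) (s j)))"
          using rp_iq(1)[OF tr] by (simp add: restricted_space_def)
        moreover have "rt (s i) (s j) \<in> PhiI R l \<alpha> {rho p, rho q}"
          unfolding PhiI_eq[OF pq] using ij True by auto
        ultimately show ?thesis by (intro span_base) blast
      qed
    qed
    finally show "x \<in> BI L lb a h l \<alpha> {rho p, rho q}" .
  qed
qed

text \<open>Row indices at most \<open>p\<close> never meet column indices above \<open>q\<close>,
  so products of two supported matrices vanish and the double bracket is
  \<open>-(x w y + y w x)\<close>, supported in the same block.\<close>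

lemma BI_nonzero_abelian_inner_ideal: "nonzero_abelian_inner_ideal L lb (BI L lb a h l \<alpha> {rho p, rho q})"
  unfolding BI_eq nonzero_abelian_inner_ideal_iff
proof (intro conjI ballI)
  show "subspace (supported p q)" by (rule subspace_supported)
  show "supported p q \<subseteq> L" by (auto simp: supported_def)
  have ss: "\<exists>i\<in>{1..l+1}. \<exists>j\<in>{1..l+1}. a' = s i \<and> b' = s j" for a' b' using s_surj by metis
  have row: "psi x $ a' $ b' = 0" if "x \<in> supported p q" "a' \<notin> s ` {1..p}" for x a' b'
    using that ss[of a' b'] unfolding supported_def by fastforce
  have col: "psi x $ a' $ b' = 0" if "x \<in> supported p q" "b' \<notin> s ` {q+1..l+1}" for x a' b'
    using that ss[of a' b'] unfolding supported_def by fastforce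
  have disj: "s ` {1..p} \<inter> s ` {q+1..l+1} = {}" using s_inj pq by fastforce
  have zero: "psi x ** psi y = 0" if "x \<in> supported p q" "y \<in> supported p q" for x y
    unfolding mat_eq_iff matrix_mult_nth
  proof (intro allI)
    fix i j
    have "psi x $ i $ k * psi y $ k $ j = 0" for k
      using row[OF that(2), of k j] col[OF that(1), of k i] disj by (cases "k \<in> s ` {1..p}") auto
    then have "(\<Sum>k\<in>UNIV. psi x $ i $ k * psi y $ k $ j) = 0" by (intro sum.neutral ballI)
    then show "(\<Sum>k\<in>UNIV. psi x $ i $ k * psi y $ k $ j) = 0 $ i $ j" by simp
  qed
  show "lb x y = 0" if "x \<in> supported p q" "y \<in> supported p q" for x y
    using zero[OF that] zero[OF that(2,1)] by (simp add: psi_lb comm_bracket_def flip: psi_eq_0)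
  fix x y w assume xy: "x \<in> supported p q" "y \<in> supported p q" "w \<in> L"
  have "psi (lb x (lb y w)) = - (psi x ** psi w ** psi y + psi y ** psi w ** psi x)"
    using zero[OF xy(1,2)] zero[OF xy(2,1)]
    by (simp add: psi_lb comm_bracket_def matrix_ring_simps) (simp flip: matrix_mul_assoc)
  moreover have "(psi x ** psi w ** psi y) $ a' $ b' = 0" if "x \<in> supported p q" "y \<in> supported p q" "a' \<notin> s ` {1..p} \<or> b' \<notin> s ` {q+1..l+1}" for x y a' b'
    unfolding matrix_mult_nth using row[OF that(1)] col[OF that(2)] that(3) by (auto intro!: sum.neutral)
  ultimately have e: "psi (lb x (lb y w)) $ a' $ b' = 0" if "a' \<notin> s ` {1..p} \<or> b' \<notin> s ` {q+1..l+1}" for a' b'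
    using xy that by simp
  have injs: "inj_on s {1..l+1}" using s_bij by (simp add: bij_betw_def)
  have "x \<in> L" "y \<in> L" using xy by (simp_all add: supported_def)
  then have "lb x (lb y w) \<in> L" using xy(3) by (intro lb_in_L)
  then show "lb x (lb y w) \<in> supported p q"
    unfolding supported_def
  proof (intro CollectI conjI ballI impI)
    fix i j assume ij: "i \<in> {1..l+1}" "j \<in> {1..l+1}" and "psi (lb x (lb y w)) $ s i $ s j \<noteq> 0"
    then have "s i \<in> s ` {1..p}" "s j \<in> s ` {q+1..l+1}" using e[of "s i" "s j"] by blast+
    then show "i \<le> p" "q < j"
      using inj_on_image_mem_iff[OF injs ij(1), of "{1..p}"] inj_on_image_mem_iff[OF injs ij(2), of "{q+1..l+1}"] pq by auto
  qed
next
  \<comment> \<open>The root vector of the maximal root supplies a non-zero real or imaginary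
    part.\<close>
  have tr: "trace (munit (s 1) (s (l + 1))) = 0"
    using s_inj[of 1 "l + 1"] l_pos by (auto simp: trace_def munit_nth intro!: sum.neutral)
  have "comm_bracket (psi D) (munit (s 1) (s (l + 1))) = 2 *\<^sub>R munit (s 1) (s (l + 1))"
    using D_weight[of 1 "l + 1"] pq
    by (auto simp: mat_eq_iff a_bracket[OF D] munit_nth) (simp add: scaleR_conv_of_real)
  note * = rp_in_supported[OF tr this]
  have "munit (s 1) (s (l + 1)) \<noteq> 0" by (auto simp: mat_eq_iff munit_nth)
  then have "rp (munit (s 1) (s (l + 1))) \<noteq> 0 \<or> iq (munit (s 1) (s (l + 1))) \<noteq> 0"
    using rp_iq(5)[OF tr] by (auto simp: psi_0)
  then show "supported p q \<noteq> {0}" using * by blast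
qed

end

end

section \<open>Abelian inner ideals of the complex special linear algebra\<close>

lemma outer_zero [simp]: "outer 0 w = 0" "outer u 0 = 0"
  by (simp_all add: outer_eq_0)

text \<open>\<open>v\<close> represents a linear form that vanishes on a basis of \<open>S\<close>
  and is 1 at \<open>x\<close>.\<close>

lemma double_annihilator:
  fixes S :: "(complex^'n) set"
  assumes S: "vec.subspace S" and x: "x \<notin> S"
  shows "\<exists>v. dotp x v \<noteq> 0 \<and> (\<forall>w\<in>S. dotp w v = 0)"
proof -
  obtain B where B: "B \<subseteq> S" "vec.independent B" "S \<subseteq> vec.span B" by (rule vec.basis_exists[of S])
  have xB: "x \<notin> vec.span B" using x vec.span_minimal[OF B(1) S] by blast
  then have ind: "vec.independent (insert x B)" using B(2) by (simp add: vec.independent_insert)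
  have xnB: "x \<notin> B" using xB vec.span_base by blast
  obtain f :: "complex^'n \<Rightarrow> complex^1" where f: "Vector_Spaces.linear (*s) (*s) f"
    "\<forall>b\<in>insert x B. f b = (if b = x then 1 else 0)"
    using vec.linear_independent_extend[OF ind, of "\<lambda>b. if b = x then 1 else 0"] by blast
  define v :: "complex^'n" where "v = (\<chi> k. f (axis k 1) $ 1)"
  have fv: "f w $ 1 = dotp w v" for w
  proof -
    have "f w = matrix f *v w" using matrix_works[OF f(1)] by simp
    then show ?thesis by (simp add: matrix_vector_nth matrix_def dotp_def v_def mult.commute)
  qed
  have "dotp w v = 0" if "w \<in> S" for w
  proof -
    have "w \<in> vec.span B" using B that by blast
    then show ?thesis
    proof (induction rule: vec.span_induct_alt)
      case base then show ?case by (simp add: dotp_def)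
    next
      case (step c b y)
      have "f b = 0" using f(2) step(1) xnB by auto
      then have "dotp b v = 0" using fv[of b] by simp
      then show ?case using step by (simp add: dotp_linear)
    qed
  qed
  moreover have "dotp x v = 1" using fv[of x] f(2) by simp
  ultimately show ?thesis by (intro exI[of _ v]) auto
qed

text \<open>Applied to \<open>v w\<close> with \<open>w\<close> a left eigenvector, \<open>(ad z)\<^sup>3 = 0\<close> gives \<open>(z - \<mu>)\<^sup>3 = 0\<close>; then
  \<open>(z - \<mu>)\<^sup>2 y (z - \<mu>)\<^sup>2 = 0\<close> for all \<open>y\<close>.\<close>

lemma ad_cube_zero_square_zero:
  fixes z :: "complex^'n^'n"
  assumes tr: "trace z = 0" and ad: "\<And>y. comm_bracket z (comm_bracket z (comm_bracket z y)) = 0"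
  shows "z ** z = 0"
proof -
  obtain w \<mu> where w: "w \<noteq> 0" "w v* z = \<mu> *s w" using ex_left_eigenvector by blast
  \<comment> \<open>Shifting by \<open>\<mu>\<close> does not affect \<open>ad\<close> and makes
    \<open>w\<close> a left null vector, so \<open>ad t\<close> acts on \<open>outer v w\<close>
    through \<open>v\<close> alone.\<close>
  define t where "t = z - \<mu> *\<^sub>C mat 1"
  have ct: "comm_bracket z y = comm_bracket t y" for y
    by (simp add: t_def comm_bracket_diff) (simp add: comm_bracket_def)
  have "w v* t = w v* z - w v* (\<mu> *\<^sub>C mat 1)" by (simp add: t_def vector_matrix_mult_diff_rdistrib)
  also have "w v* (\<mu> *\<^sub>C mat 1) = \<mu> *s w"
    by (simp add: vec_eq_iff vector_matrix_mult_def mat_def if_distrib cong: if_cong)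
  finally have wt: "w v* t = 0" using w by simp
  have "comm_bracket t (outer v w) = outer (t *v v) w" for v
    by (simp add: comm_bracket_def mult_outer outer_mult wt)
  then have "outer (t *v (t *v (t *v v))) w = 0" for v using ad[of "outer v w"] by (simp add: ct)
  then have "t *v (t *v (t *v v)) = 0" for v using w(1) unfolding outer_eq_0 by blast
  then have "t ** t ** t = 0" by (simp add: matrix_eq flip: matrix_vector_mul_assoc)
  then have t3: "t ** t ** t = 0" "\<And>y. y ** t ** t ** t = 0"
    using matrix_mul_assoc[of _ "t ** t" t] by (simp_all flip: matrix_mul_assoc)
  have "t ** t ** y ** t ** t = 0" for y
  proof -
    \<comment> \<open>The cube of \<open>ad t\<close> has the binomial coefficients 1, -3, 3, -1;
      one more factor \<open>t\<close> on the left leaves only the term with coefficient 3.\<close>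
    have "0 = t ** comm_bracket t (comm_bracket t (comm_bracket t y))" using ad[of y] by (simp add: ct)
    also have "\<dots> = (t ** t ** t) ** t ** y - ((t ** t ** t) ** y ** t + (t ** t ** t) ** y ** t + (t ** t ** t) ** y ** t)
        + (t ** t ** y ** t ** t + t ** t ** y ** t ** t + t ** t ** y ** t ** t) - t ** (y ** t ** t ** t)"
      by (simp only: comm_bracket_def matrix_ring_simps mat_eq_iff vector_add_component vector_minus_component)
        (simp add: algebra_simps)
    also have "\<dots> = t ** t ** y ** t ** t + t ** t ** y ** t ** t + t ** t ** y ** t ** t" by (simp only: t3) simp
    also have "\<dots> = 3 *\<^sub>R (t ** t ** y ** t ** t)" by (simp add: mat_eq_iff) (simp add: scaleR_conv_of_real)
    finally show ?thesis by simp
  qed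
  \<comment> \<open>A rank one \<open>y\<close> separates the factors: either \<open>t ** t\<close>
    annihilates all columns or all rows.\<close>
  then have "outer (t *v (t *v u)) (v v* t v* t) = 0" for u v
    by (metis mult_outer outer_mult matrix_mul_assoc)
  then have tt: "t ** t = 0"
  proof -
    assume *: "\<And>u v. outer (t *v (t *v u)) (v v* t v* t) = 0"
    show ?thesis
    proof (rule ccontr)
      assume nz: "t ** t \<noteq> 0"
      then obtain i j where ij: "(t ** t) $ i $ j \<noteq> 0" by (auto simp: mat_eq_iff)
      have "t *v (t *v axis j 1) \<noteq> 0"
      proof
        assume "t *v (t *v axis j 1) = 0"
        then have "((t ** t) *v axis j 1) $ i = 0" by (simp flip: matrix_vector_mul_assoc)
        then show False using ij by (simp add: matrix_vector_nth axis_def if_distrib cong: if_cong)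
      qed
      moreover have "axis i 1 v* t v* t \<noteq> 0"
      proof
        assume "axis i 1 v* t v* t = 0"
        then have "(axis i 1 v* (t ** t)) $ j = 0" by (simp add: vector_matrix_mul_assoc)
        then show False using ij by (simp add: vector_matrix_mult_def axis_def if_distrib if_distribR cong: if_cong)
      qed
      ultimately show False using *[of "axis j 1" "axis i 1"] by (simp add: outer_eq_0)
    qed
  qed
  have "trace t = 0" by (rule trace_square_zero[OF tt])
  then have "\<mu> = 0" using tr by (simp add: t_def trace_sub trace_I)
  then show ?thesis using tt by (simp add: t_def)
qed

text \<open>The hypotheses describe the complexification of a non-zero abelian inner ideal.\<close>

lemma complex_abelian_inner_ideal:
  fixes C :: "(complex^'n^'n) set"
  assumes sub: "\<And>z w. z \<in> C \<Longrightarrow> w \<in> C \<Longrightarrow> z + w \<in> C" "\<And>c z. z \<in> C \<Longrightarrow> c *\<^sub>C z \<in> C"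
    and tr: "\<And>z. z \<in> C \<Longrightarrow> trace z = 0"
    and ab: "\<And>z w. z \<in> C \<Longrightarrow> w \<in> C \<Longrightarrow> comm_bracket z w = 0"
    and inner: "\<And>z w y. z \<in> C \<Longrightarrow> w \<in> C \<Longrightarrow> trace y = 0 \<Longrightarrow> comm_bracket z (comm_bracket w y) \<in> C"
    and nz: "0 \<in> C" "\<exists>z\<in>C. z \<noteq> 0"
  obtains U S where "vec.subspace U" "vec.subspace S" "U \<noteq> {0}" "S \<noteq> {0}" "\<And>u w. u \<in> U \<Longrightarrow> w \<in> S \<Longrightarrow> dotp w u = 0"
    "\<And>u w. u \<in> U \<Longrightarrow> w \<in> S \<Longrightarrow> outer u w \<in> C"
    "\<And>z. z \<in> C \<longleftrightarrow> (\<forall>v. z *v v \<in> U) \<and> (\<forall>v. v v* z \<in> S)"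
proof -
  \<comment> \<open>Scalar matrices are central, so the inner ideal condition extends from trace
    zero \<open>y\<close> to arbitrary \<open>y\<close>.\<close>
  have zero: "comm_bracket z (comm_bracket w y) = comm_bracket z (comm_bracket w (y - (trace y / of_nat CARD('n)) *\<^sub>C mat 1))" for z w y :: "complex^'n^'n"
    by (simp add: comm_bracket_diff) (simp add: comm_bracket_def)
  have inner': "comm_bracket z (comm_bracket w y) \<in> C" if "z \<in> C" "w \<in> C" for z w y
    unfolding zero[of z w y] using that by (intro inner) (simp_all add: trace_sub trace_I)
  have sq: "z ** z = 0" if "z \<in> C" for z
    using that by (intro ad_cube_zero_square_zero tr ab inner')
  \<comment> \<open>Polarisation of \<open>z ** z = 0\<close>, combined with commutativity of
    \<open>C\<close>.\<close>
  have prod0: "z ** w = 0" if zw: "z \<in> C" "w \<in> C" for z w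
  proof -
    have "(z + w) ** (z + w) = 0" using sq sub zw by blast
    then have "z ** w + w ** z = 0" using sq zw by (simp add: matrix_ring_simps add.commute)
    moreover have "z ** w = w ** z" using ab[OF zw] by (simp add: comm_bracket_def)
    ultimately have "2 *\<^sub>R (z ** w) = 0" by (simp add: scaleR_2)
    then show ?thesis by simp
  qed
  \<comment> \<open>\<open>C\<close> is closed under the Jordan triple product, the shape in which
    inner ideals are used from here on.\<close>
  have triple: "z ** y ** w + w ** y ** z \<in> C" if zw: "z \<in> C" "w \<in> C" for z w y
  proof -
    have "comm_bracket z (comm_bracket w y) = - (z ** y ** w + w ** y ** z)"
      using prod0[OF zw] prod0[OF zw(2,1)]
      by (simp add: comm_bracket_def matrix_ring_simps) (simp flip: matrix_mul_assoc)
    then have "(- 1) *\<^sub>C comm_bracket z (comm_bracket w y) = z ** y ** w + w ** y ** z" by simp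
    then show ?thesis using sub(2)[OF inner'[OF zw], of "-1" y] by simp
  qed
  have diag: "z ** y ** z \<in> C" if "z \<in> C" for z y
  proof -
    have "(1/2) *\<^sub>C (z ** y ** z + z ** y ** z) \<in> C" using triple[OF that that] sub by blast
    moreover have "(1/2) *\<^sub>C (z ** y ** z + z ** y ** z) = z ** y ** z" by (simp add: mat_eq_iff)
    ultimately show ?thesis by simp
  qed
  have rank1: "outer (z *v x) (y v* z) \<in> C" if "z \<in> C" for z x y
    using diag[OF that, of "outer x y"] by (simp add: mult_outer outer_mult)
  \<comment> \<open>Column and row of two rank one members can be recombined: the triple product
    with \<open>outer a b\<close> keeps \<open>outer u1 w2\<close> if \<open>dotp w1 a = 1\<close>,
    \<open>dotp w2 a = 0\<close>, \<open>dotp b u2 = 1\<close>.\<close>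
  have mix: "outer u1 w2 \<in> C" if o: "outer u1 w1 \<in> C" "outer u2 w2 \<in> C" and n: "w1 \<noteq> 0" "u2 \<noteq> 0" for u1 w1 u2 w2
  proof (cases "\<exists>c. w2 = c *s w1")
    case True
    then show ?thesis using sub(2)[OF o(1)] by (auto simp: outer_linear)
  next
    case False
    obtain k where k: "w1 $ k \<noteq> 0" using n(1) by (auto simp: vec_eq_iff)
    have "w2 \<noteq> (w2 $ k / w1 $ k) *s w1" using False by blast
    then have "\<exists>j. w2 $ j \<noteq> w2 $ k / w1 $ k * w1 $ j" by (simp add: vec_eq_iff)
    then obtain j where j: "w2 $ j * w1 $ k \<noteq> w2 $ k * w1 $ j" using k by (auto simp: field_simps)
    \<comment> \<open>A non-vanishing 2 by 2 minor of \<open>w1\<close> and \<open>w2\<close>;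
      \<open>a\<close> solves the two equations by Cramer's rule.\<close>
    define e where "e = w1 $ k * w2 $ j - w1 $ j * w2 $ k"
    have e: "e \<noteq> 0" using j by (simp add: e_def mult.commute)
    define a where "a = (1 / e) *s ((w2 $ j) *s axis k 1 + (- (w2 $ k)) *s axis j (1::complex))"
    have "dotp w1 a = 1 / e * (w2 $ j * w1 $ k - w2 $ k * w1 $ j)"
      unfolding a_def dotp_linear dotp_axis by simp
    also have "\<dots> = 1" using e by (simp add: e_def mult.commute)
    finally have a1: "dotp w1 a = 1" .
    have a2: "dotp w2 a = 0" unfolding a_def dotp_linear dotp_axis by simp
    obtain b where b: "dotp b u2 = 1"
      using ex_dotp_1[OF n(2)] by (auto simp: dotp_def mult.commute)
    have "outer u1 w1 ** outer a b ** outer u2 w2 + outer u2 w2 ** outer a b ** outer u1 w1 = outer u1 w2"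
      by (simp add: outer_mult_outer a1 a2 b)
    then show ?thesis using triple[OF o, of "outer a b"] by simp
  qed
  define U where "U = {u. \<exists>w. w \<noteq> 0 \<and> outer u w \<in> C}"
  define S where "S = {w. \<exists>u. u \<noteq> 0 \<and> outer u w \<in> C}"
  have US: "outer u w \<in> C" if "u \<in> U" "w \<in> S" for u w
    using that mix unfolding U_def S_def by blast
  obtain z0 where z0: "z0 \<in> C" "z0 \<noteq> 0" using nz by blast
  have zcol: "\<exists>x. z *v x \<noteq> 0" and zrow: "\<exists>y. y v* z \<noteq> 0" if nz': "z \<noteq> 0" for z :: "complex^'n^'n"
  proof -
    obtain i j where ij: "z $ i $ j \<noteq> 0" using nz' by (auto simp: mat_eq_iff)
    have "(z *v axis j 1) $ i = z $ i $ j" by (simp add: matrix_vector_nth axis_def if_distrib cong: if_cong)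
    then show "\<exists>x. z *v x \<noteq> 0" using ij by (metis zero_index)
    have "(axis i 1 v* z) $ j = z $ i $ j" by (simp add: vector_matrix_mult_def axis_def if_distrib if_distribR cong: if_cong)
    then show "\<exists>y. y v* z \<noteq> 0" using ij by (metis zero_index)
  qed
  obtain x0 y0 where xy0: "z0 *v x0 \<noteq> 0" "y0 v* z0 \<noteq> 0" using zcol zrow z0 by blast
  have u0: "z0 *v x0 \<in> U" and w0: "y0 v* z0 \<in> S"
    using rank1[OF z0(1)] xy0 unfolding U_def S_def by blast+
  have subU: "vec.subspace U"
    unfolding vec.subspace_def
  proof (intro conjI ballI allI)
    have "outer 0 (y0 v* z0) \<in> C" using nz(1) by simp
    then show "0 \<in> U" unfolding U_def using xy0 by blast
    fix x y assume "x \<in> U" "y \<in> U"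
    then have "outer (x + y) (y0 v* z0) \<in> C" using US[OF _ w0] sub by (simp add: outer_linear)
    then show "x + y \<in> U" unfolding U_def using xy0 by blast
    fix c have "outer (c *s x) (y0 v* z0) \<in> C" using US[OF _ w0] sub \<open>x \<in> U\<close> by (simp add: outer_linear)
    then show "c *s x \<in> U" unfolding U_def using xy0 by blast
  qed
  have subS: "vec.subspace S"
    unfolding vec.subspace_def
  proof (intro conjI ballI allI)
    have "outer (z0 *v x0) 0 \<in> C" using nz(1) by simp
    then show "0 \<in> S" unfolding S_def using xy0 by blast
    fix x y assume "x \<in> S" "y \<in> S"
    then have "outer (z0 *v x0) (x + y) \<in> C" using US[OF u0] sub by (simp add: outer_linear)
    then show "x + y \<in> S" unfolding S_def using xy0 by blast
    fix c have "outer (z0 *v x0) (c *s x) \<in> C" using US[OF u0] sub \<open>x \<in> S\<close> by (simp add: outer_linear)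
    then show "c *s x \<in> S" unfolding S_def using xy0 by blast
  qed
  have orth: "dotp w u = 0" if uw: "u \<in> U" "w \<in> S" for u w
  proof -
    obtain w' where w': "w' \<noteq> 0" "outer u w' \<in> C" using uw(1) unfolding U_def by blast
    obtain u' where u': "u' \<noteq> 0" "outer u' w \<in> C" using uw(2) unfolding S_def by blast
    show ?thesis using prod0[OF u'(2) w'(2)] u' w' by (simp add: outer_mult_outer cscaleM_eq_0 outer_eq_0)
  qed
  have sumC: "(\<Sum>k\<in>K. f k) \<in> C" if "\<And>k. k \<in> K \<Longrightarrow> f k \<in> C" "finite K" for K :: "'n set" and f
    using that(2,1) by (induction K rule: finite_induct) (auto simp: nz sub)
  have mem: "z \<in> C \<longleftrightarrow> (\<forall>v. z *v v \<in> U) \<and> (\<forall>v. v v* z \<in> S)" for z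
  proof
    assume z: "z \<in> C"
    show "(\<forall>v. z *v v \<in> U) \<and> (\<forall>v. v v* z \<in> S)"
    proof (cases "z = 0")
      case True then show ?thesis using vec.subspace_0[OF subU] vec.subspace_0[OF subS] by simp
    next
      case False
      then show ?thesis using rank1[OF z] zcol[OF False] zrow[OF False] unfolding U_def S_def by blast
    qed
  next
    \<comment> \<open>The factorisation \<open>z = z ** (y ** z)\<close> is a sum of columns of
      \<open>z\<close> times rows of \<open>z\<close>, each in \<open>C\<close> by
      \<open>US\<close>.\<close>
    assume z: "(\<forall>v. z *v v \<in> U) \<and> (\<forall>v. v v* z \<in> S)"
    obtain y where y: "z ** y ** z = z" using ex_regular_inverse by blast
    have "z = z ** (y ** z)" using y by (simp add: matrix_mul_assoc)
    also have "\<dots> = (\<Sum>k\<in>UNIV. outer (z *v axis k 1) (axis k 1 v* (y ** z)))" by (rule mult_sum_outer)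
    also have "\<dots> \<in> C"
    proof (rule sumC)
      fix k :: 'n
      have "axis k 1 v* (y ** z) = (axis k 1 v* y) v* z" by (simp add: vector_matrix_mul_assoc)
      then show "outer (z *v axis k 1) (axis k 1 v* (y ** z)) \<in> C" using z US by simp
    qed simp
    finally show "z \<in> C" .
  qed
  have "U \<noteq> {0}" "S \<noteq> {0}" using u0 w0 xy0 by blast+
  then show ?thesis using that[OF subU subS _ _ orth US mem] by blast
qed

context real_form begin

definition "complexify B = {psi x + \<i> *\<^sub>C psi y | x y. x \<in> B \<and> y \<in> B}"

lemma psi_mem_complexify:
  assumes "subspace B" "B \<subseteq> L" "x \<in> L"
  shows "psi x \<in> complexify B \<longleftrightarrow> x \<in> B"
proof
  assume "x \<in> B"
  moreover have "psi x = psi x + \<i> *\<^sub>C psi 0" by (simp add: psi_0)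
  ultimately show "psi x \<in> complexify B" unfolding complexify_def using subspace_0[OF assms(1)] by blast
next
  assume "psi x \<in> complexify B"
  then obtain u v where uv: "u \<in> B" "v \<in> B" "psi x = psi u + \<i> *\<^sub>C psi v" unfolding complexify_def by blast
  have "psi x + \<i> *\<^sub>C psi 0 = psi u + \<i> *\<^sub>C psi v" using uv by (simp add: psi_0)
  then have "x = u" using complexification_unique(1)[of x 0 u v] assms uv subspace_0[OF subV] by blast
  then show "x \<in> B" using uv by simp
qed

lemma sg_complexify:
  assumes B: "subspace B" "B \<subseteq> L" and z: "z \<in> complexify B"
  shows "sg z \<in> complexify B"
proof -
  obtain x y where xy: "x \<in> B" "y \<in> B" "z = psi x + \<i> *\<^sub>C psi y" using z unfolding complexify_def by blast
  have "sg z = psi x + \<i> *\<^sub>C psi (- y)"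
    using xy B(2) by (auto simp: sg_add sg_cscaleM psi_minus L_iff subset_iff)
  then show ?thesis using xy B(1) subspace_neg unfolding complexify_def by blast
qed

text \<open>The complexification of \<open>B\<close> is stable under \<open>sg\<close>. The last two
  conclusions record this on rank one members; each real form turns it into its own condition on
  \<open>U\<close> and \<open>S\<close>.\<close>

lemma abelian_inner_ideal_form:
  assumes "nonzero_abelian_inner_ideal L lb B"
  obtains U S where "vec.subspace U" "vec.subspace S" "U \<noteq> {0}" "S \<noteq> {0}"
    "\<And>u w. u \<in> U \<Longrightarrow> w \<in> S \<Longrightarrow> dotp w u = 0"
    "\<And>x. x \<in> B \<longleftrightarrow> x \<in> L \<and> (\<forall>v. psi x *v v \<in> U) \<and> (\<forall>v. v v* psi x \<in> S)"
    "\<And>u w v. u \<in> U \<Longrightarrow> w \<in> S \<Longrightarrow> sg (outer u w) *v v \<in> U"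
    "\<And>u w v. u \<in> U \<Longrightarrow> w \<in> S \<Longrightarrow> v v* sg (outer u w) \<in> S"
proof -
  from assms have B: "subspace B" "B \<subseteq> L" "\<And>x y w. x \<in> B \<Longrightarrow> y \<in> B \<Longrightarrow> w \<in> L \<Longrightarrow> lb x (lb y w) \<in> B"
    "\<And>x y. x \<in> B \<Longrightarrow> y \<in> B \<Longrightarrow> lb x y = 0" "B \<noteq> {0}"
    unfolding nonzero_abelian_inner_ideal_iff by blast+
  let ?C = "complexify B"
  have mk: "psi x + \<i> *\<^sub>C psi y \<in> ?C" if "x \<in> B" "y \<in> B" for x y
    using that unfolding complexify_def by blast
  have C0: "0 \<in> ?C" using mk[of 0 0] subspace_0[OF B(1)] by (simp add: psi_0)
  have add: "z + w \<in> ?C" if zw: "z \<in> ?C" "w \<in> ?C" for z w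
  proof -
    obtain x y x' y' where xy: "x \<in> B" "y \<in> B" "z = psi x + \<i> *\<^sub>C psi y" "x' \<in> B" "y' \<in> B" "w = psi x' + \<i> *\<^sub>C psi y'"
      using zw unfolding complexify_def by blast
    have "z + w = psi (x + x') + \<i> *\<^sub>C psi (y + y')" by (simp add: xy psi_add cscaleM_distrib)
    then show ?thesis using xy mk subspace_add[OF B(1)] by metis
  qed
  have scale: "c *\<^sub>C z \<in> ?C" if z: "z \<in> ?C" for c z
  proof -
    obtain x y where xy: "x \<in> B" "y \<in> B" "z = psi x + \<i> *\<^sub>C psi y" using z unfolding complexify_def by blast
    have "c *\<^sub>C z = psi (Re c *\<^sub>R x - Im c *\<^sub>R y) + \<i> *\<^sub>C psi (Re c *\<^sub>R y + Im c *\<^sub>R x)"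
      unfolding xy by (simp add: psi_hom mat_eq_iff complex_eq_iff algebra_simps)
    then show ?thesis
      using mk[of "Re c *\<^sub>R x - Im c *\<^sub>R y" "Re c *\<^sub>R y + Im c *\<^sub>R x"] xy B(1)
      by (simp add: subspace_add subspace_diff subspace_scale)
  qed
  have tr: "trace z = 0" if "z \<in> ?C" for z
    using that B(2) trace_complexification unfolding complexify_def by blast
  have ab: "comm_bracket z w = 0" if zw: "z \<in> ?C" "w \<in> ?C" for z w
  proof -
    obtain x y x' y' where xy: "x \<in> B" "y \<in> B" "z = psi x + \<i> *\<^sub>C psi y" "x' \<in> B" "y' \<in> B" "w = psi x' + \<i> *\<^sub>C psi y'"
      using zw unfolding complexify_def by blast
    then show ?thesis by (simp add: comm_bracket_add B(4) psi_0 flip: psi_lb)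
  qed
  have inner: "comm_bracket z (comm_bracket w y) \<in> ?C" if zw: "z \<in> ?C" "w \<in> ?C" "trace y = 0" for z w y
  proof -
    obtain x1 y1 x2 y2 where xy: "x1 \<in> B" "y1 \<in> B" "z = psi x1 + \<i> *\<^sub>C psi y1" "x2 \<in> B" "y2 \<in> B" "w = psi x2 + \<i> *\<^sub>C psi y2"
      using zw unfolding complexify_def by blast
    have part: "comm_bracket (psi u) (comm_bracket (psi v) (psi k)) \<in> ?C" if "u \<in> B" "v \<in> B" "k \<in> L" for u v k
      using mk[of "lb u (lb v k)" 0] B(3)[OF that] subspace_0[OF B(1)] by (simp add: psi_0 psi_lb)
    have yL: "rp y \<in> L" "iq y \<in> L" "y = psi (rp y) + \<i> *\<^sub>C psi (iq y)" using rp_iq[OF zw(3)] by blast+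
    have "comm_bracket z (comm_bracket w (psi (rp y) + \<i> *\<^sub>C psi (iq y))) \<in> ?C"
      unfolding xy comm_bracket_add comm_bracket_cscaleM cscaleM_distrib
      by (intro add scale part xy yL(1,2))
    then show ?thesis using yL(3) by metis
  qed
  have nz: "\<exists>z\<in>?C. z \<noteq> 0"
  proof -
    obtain x where "x \<in> B" "x \<noteq> 0" using B(5) subspace_0[OF B(1)] by blast
    then show ?thesis using psi_mem_complexify[OF B(1,2)] B(2) psi_eq_0 by (meson subsetD)
  qed
  show ?thesis
  proof (rule complex_abelian_inner_ideal[of ?C, OF add scale tr ab inner C0 nz])
  fix U S :: "(complex^'n) set"
  assume US: "vec.subspace U" "vec.subspace S" "U \<noteq> {0}" "S \<noteq> {0}"
    "\<And>u w. u \<in> U \<Longrightarrow> w \<in> S \<Longrightarrow> dotp w u = 0"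
    "\<And>u w. u \<in> U \<Longrightarrow> w \<in> S \<Longrightarrow> outer u w \<in> ?C"
    "\<And>z. z \<in> ?C \<longleftrightarrow> (\<forall>v. z *v v \<in> U) \<and> (\<forall>v. v v* z \<in> S)"
  have mem: "x \<in> B \<longleftrightarrow> x \<in> L \<and> (\<forall>v. psi x *v v \<in> U) \<and> (\<forall>v. v v* psi x \<in> S)" for x
    using psi_mem_complexify[OF B(1,2)] B(2) US(7)[of "psi x"] by blast
  have sgC: "sg (outer u w) \<in> ?C" if "u \<in> U" "w \<in> S" for u w
    using sg_complexify[OF B(1,2) US(6)[OF that]] .
  show thesis
    by (rule that[OF US(1-5) mem]) (use sgC US(7) in blast)+
  qed
qed

end

section \<open>Conjugacy\<close>

context real_form begin

lemma lie_automorphism_linear_on: "lie_automorphism L lb \<phi> \<Longrightarrow> linear_on L \<phi>"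
  by (auto simp: lie_automorphism_def bij_betw_def intro!: linear_onI)

text \<open>Conjugation by \<open>g\<close> preserves traces and, by hypothesis, the fixed points of
  \<open>sg\<close>, hence the image of \<open>L\<close> under \<open>psi\<close>;
  \<open>inv psi\<close> brings it back to \<open>L\<close>.\<close>

lemma conj_automorphism:
  assumes g: "g ** g' = mat 1" "g' ** g = mat 1" and sg: "\<And>z. sg (g ** z ** g') = g ** sg z ** g'"
  defines "\<phi> \<equiv> \<lambda>x. inv psi (g ** psi x ** g')"
  shows "lie_automorphism L lb \<phi>" "x \<in> L \<Longrightarrow> psi (\<phi> x) = g ** psi x ** g'" "x \<in> L \<Longrightarrow> \<phi> x \<in> L"
proof -
  have gg: "g ** (g' ** z ** g) ** g' = z" "g' ** (g ** z ** g') ** g = z" for z :: "complex^'n^'n"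
  proof -
    have "g ** (g' ** z ** g) ** g' = (g ** g') ** z ** (g ** g')" by (simp only: matrix_mul_assoc)
    then show "g ** (g' ** z ** g) ** g' = z" by (simp add: g)
    have "g' ** (g ** z ** g') ** g = (g' ** g) ** z ** (g' ** g)" by (simp only: matrix_mul_assoc)
    then show "g' ** (g ** z ** g') ** g = z" by (simp add: g)
  qed
  have tr: "trace (g ** z ** g') = trace z" for z :: "complex^'n^'n"
    by (subst trace_mul_sym) (simp add: matrix_mul_assoc g)
  have sg': "sg (g' ** z ** g) = g' ** sg z ** g" for z
    using arg_cong[OF sg[of "g' ** z ** g"], of "\<lambda>z. g' ** z ** g"] by (simp only: gg)
  have br: "comm_bracket (g ** z ** g') (g ** w ** g') = g ** comm_bracket z w ** g'" for z w :: "complex^'n^'n"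
  proof -
    have "g ** z ** g' ** (g ** w ** g') = g ** z ** (g' ** g) ** w ** g'" for z w by (simp only: matrix_mul_assoc)
    then show ?thesis by (simp add: comm_bracket_def g matrix_ring_simps)
  qed
  have ex: "\<exists>y\<in>L. psi y = g ** psi x ** g'" if "x \<in> L" for x
  proof -
    have "g ** psi x ** g' \<in> psi ` L" using that unfolding psi_L by (simp add: tr sg L_iff)
    then show ?thesis by auto
  qed
  have eq: "\<phi> x = y" if "psi y = g ** psi x ** g'" for x y
    unfolding \<phi>_def that[symmetric] using psi_inj by (rule inv_f_f)
  have psi\<phi>: "psi (\<phi> x) = g ** psi x ** g' \<and> \<phi> x \<in> L" if "x \<in> L" for x
    using ex[OF that] eq by metis
  then show "x \<in> L \<Longrightarrow> psi (\<phi> x) = g ** psi x ** g'" "x \<in> L \<Longrightarrow> \<phi> x \<in> L" by auto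
  have tr': "trace (g' ** z ** g) = trace z" for z :: "complex^'n^'n"
    by (subst trace_mul_sym) (simp add: matrix_mul_assoc g)
  have "inj_on \<phi> L"
  proof (rule inj_onI)
    fix x y assume "x \<in> L" "y \<in> L" "\<phi> x = \<phi> y"
    then have "g ** psi x ** g' = g ** psi y ** g'" using psi\<phi> by metis
    then have "g' ** (g ** psi x ** g') ** g = g' ** (g ** psi y ** g') ** g" by simp
    then show "x = y" unfolding gg psi_eq .
  qed
  moreover have "\<phi> ` L = L"
  proof
    show "\<phi> ` L \<subseteq> L" using psi\<phi> by auto
    show "L \<subseteq> \<phi> ` L"
    proof
      fix y assume y: "y \<in> L"
      have "g' ** psi y ** g \<in> psi ` L" using y unfolding psi_L by (simp add: tr' sg' L_iff)
      then obtain x where x: "x \<in> L" "psi x = g' ** psi y ** g" by auto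
      have "\<phi> x = y" by (rule eq) (simp add: x gg)
      then show "y \<in> \<phi> ` L" using x by blast
    qed
  qed
  ultimately have "bij_betw \<phi> L L" by (simp add: bij_betw_def)
  moreover have "\<phi> (x + y) = \<phi> x + \<phi> y" if "x \<in> L" "y \<in> L" for x y
    by (rule eq) (use that psi\<phi> in \<open>simp add: psi_add matrix_ring_simps\<close>)
  moreover have "\<phi> (c *\<^sub>R x) = c *\<^sub>R \<phi> x" if "x \<in> L" for x c
    by (rule eq) (use that psi\<phi> in \<open>simp add: psi_scale\<close>)
  moreover have "\<phi> (lb x y) = lb (\<phi> x) (\<phi> y)" if "x \<in> L" "y \<in> L" for x y
    by (rule eq) (use that psi\<phi> in \<open>simp add: psi_lb br\<close>)
  ultimately show "lie_automorphism L lb \<phi>" unfolding lie_automorphism_def by blast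
qed

lemma conjugate_refl: "conjugate L lb B B"
  unfolding conjugate_def lie_automorphism_def by (intro exI[of _ "\<lambda>x. x"]) (simp add: bij_betw_def)

lemma conjugate_trans:
  assumes "B \<subseteq> L" "conjugate L lb B B'" "conjugate L lb B' B''"
  shows "conjugate L lb B B''"
proof -
  obtain \<phi> \<phi>' where \<phi>: "lie_automorphism L lb \<phi>" "\<phi> ` B = B'" "lie_automorphism L lb \<phi>'" "\<phi>' ` B' = B''"
    using assms unfolding conjugate_def by blast
  have m: "x \<in> L \<Longrightarrow> \<phi> x \<in> L" for x using \<phi>(1) by (auto simp: lie_automorphism_def bij_betw_def)
  have "bij_betw (\<phi>' \<circ> \<phi>) L L" using \<phi>(1,3) by (auto simp: lie_automorphism_def intro: bij_betw_trans)
  then have "lie_automorphism L lb (\<phi>' \<circ> \<phi>)"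
    using \<phi>(1,3) m by (simp add: lie_automorphism_def)
  moreover have "(\<phi>' \<circ> \<phi>) ` B = B''" unfolding \<phi>(4)[symmetric] \<phi>(2)[symmetric] by (simp add: image_comp)
  ultimately show ?thesis unfolding conjugate_def by blast
qed

lemma conjugate_sym:
  assumes "B \<subseteq> L" "conjugate L lb B B'"
  shows "conjugate L lb B' B"
proof -
  obtain \<phi> where \<phi>: "lie_automorphism L lb \<phi>" "\<phi> ` B = B'"
    using assms unfolding conjugate_def by blast
  have bij: "bij_betw \<phi> L L" using \<phi>(1) by (simp add: lie_automorphism_def)
  define \<rho> where "\<rho> = the_inv_into L \<phi>"
  have \<rho>: "\<And>x. x \<in> L \<Longrightarrow> \<rho> x \<in> L" "\<And>x. x \<in> L \<Longrightarrow> \<phi> (\<rho> x) = x" "\<And>x. x \<in> L \<Longrightarrow> \<rho> (\<phi> x) = x"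
    using bij unfolding \<rho>_def bij_betw_def by (auto simp: the_inv_into_into f_the_inv_into_f the_inv_into_f_f)
  have inj: "\<And>x y. x \<in> L \<Longrightarrow> y \<in> L \<Longrightarrow> \<phi> x = \<phi> y \<Longrightarrow> x = y" using bij by (auto simp: bij_betw_def inj_on_def)
  have "bij_betw \<rho> L L" using bij unfolding \<rho>_def by (rule bij_betw_the_inv_into)
  moreover have "\<rho> (x + y) = \<rho> x + \<rho> y" if "x \<in> L" "y \<in> L" for x y
    by (rule inj) (use \<phi>(1) that \<rho> subV in \<open>auto simp: lie_automorphism_def subspace_add\<close>)
  moreover have "\<rho> (c *\<^sub>R x) = c *\<^sub>R \<rho> x" if "x \<in> L" for x c
    by (rule inj) (use \<phi>(1) that \<rho> subV in \<open>auto simp: lie_automorphism_def subspace_scale\<close>)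
  moreover have "\<rho> (lb x y) = lb (\<rho> x) (\<rho> y)" if "x \<in> L" "y \<in> L" for x y
    by (rule inj) (use \<phi>(1) that \<rho> lb_in_L in \<open>auto simp: lie_automorphism_def\<close>)
  ultimately have "lie_automorphism L lb \<rho>" unfolding lie_automorphism_def by blast
  moreover have "\<rho> ` B' = B"
    unfolding \<phi>(2)[symmetric] image_image using \<rho>(3) assms(1) by (force simp: subset_iff)
  ultimately show ?thesis unfolding conjugate_def by blast
qed

end

text \<open>An automorphism is linear on \<open>L\<close> only. It is replaced by a globally linear
  map agreeing with it on a basis of \<open>L\<close>, which makes dimension a conjugacy
  invariant.\<close>

lemma dim_linear_on_image:
  fixes f :: "'a::euclidean_space \<Rightarrow> 'a"
  assumes f: "linear_on L f" "inj_on f L" and L: "subspace L" and B: "subspace B" "B \<subseteq> L"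
  shows "dim (f ` B) = dim B"
proof -
  obtain C where C: "C \<subseteq> L" "independent C" "L \<subseteq> span C" by (rule basis_exists[of L])
  obtain g where g: "linear g" "\<forall>x\<in>C. g x = f x" using linear_independent_extend[OF C(2)] by blast
  have gf: "g x = f x" if "x \<in> L" for x
  proof -
    have "x \<in> span C" using that C by blast
    then have "x \<in> L \<and> g x = f x"
    proof (induction rule: span_induct_alt)
      case base
      have "f (0 *\<^sub>R 0) = 0 *\<^sub>R f 0" using f(1) subspace_0[OF L] unfolding linear_on_def by blast
      then show ?case using g(1) subspace_0[OF L] by (simp add: linear_0)
    next
      case (step c x y)
      have "x \<in> L" using step C by blast
      then show ?case using step g f(1) L
        by (simp add: linear_add linear_scale linear_on_def subspace_add subspace_scale)
    qed
    then show ?thesis by blast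
  qed
  have "inj_on g (span B)"
  proof (rule inj_onI)
    fix x y assume "x \<in> span B" "y \<in> span B" and e: "g x = g y"
    moreover have "span B = B" using B(1) by (simp add: span_eq_iff)
    ultimately have "x \<in> L" "y \<in> L" using B(2) by auto
    then show "x = y" using e gf inj_onD[OF f(2)] by simp
  qed
  then have "dim (g ` B) = dim B" using g(1) by (rule dim_image_eq[rotated])
  moreover have "g ` B = f ` B" using gf B(2) by (intro image_cong) auto
  ultimately show ?thesis by simp
qed

section \<open>Orthonormal families\<close>

definition cdot :: "complex^'k \<Rightarrow> complex^'k \<Rightarrow> complex" where
  "cdot x y = (\<Sum>i\<in>UNIV. x $ i * cnj (y $ i))"

lemma cdot_linear:
  "cdot (x + y) z = cdot x z + cdot y z" "cdot (x - y) z = cdot x z - cdot y z" "cdot (c *s x) z = c * cdot x z"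
  "cdot z (x + y) = cdot z x + cdot z y" "cdot z (c *s x) = cnj c * cdot z x" "cdot 0 z = 0" "cdot z 0 = 0"
  by (simp_all add: cdot_def sum.distrib sum_subtractf sum_distrib_left algebra_simps)

lemma cdot_sum: "cdot (\<Sum>i\<in>I. f i) z = (\<Sum>i\<in>I. cdot (f i) z)"
  by (induction I rule: infinite_finite_induct) (simp_all add: cdot_linear)

lemma cdot_cnj: "cdot y x = cnj (cdot x y)"
  by (simp add: cdot_def mult.commute)

lemma cdot_self: "cdot x x = of_real (\<Sum>i\<in>UNIV. (cmod (x $ i))\<^sup>2)"
  unfolding cdot_def of_real_sum complex_norm_square ..

lemma cdot_self_pos: "x \<noteq> 0 \<Longrightarrow> \<exists>r>0. cdot x x = of_real r"
proof -
  assume "x \<noteq> 0"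
  then obtain i where "x $ i \<noteq> 0" by (auto simp: vec_eq_iff)
  then have "0 < (\<Sum>i\<in>UNIV. (cmod (x $ i))\<^sup>2)" by (intro sum_pos2[of _ i]) auto
  then show ?thesis using cdot_self by blast
qed

text \<open>Orthonormality is measured after \<open>F\<close>, later a projection onto a definite
  part, while the vectors stay in an isotropic subspace on which \<open>F\<close> is
  injective.\<close>

definition onf :: "(complex^'n \<Rightarrow> complex^'k) \<Rightarrow> nat \<Rightarrow> (nat \<Rightarrow> complex^'n) \<Rightarrow> bool" where
  "onf F m f \<longleftrightarrow> (\<forall>i<m. \<forall>j<m. cdot (F (f i)) (F (f j)) = (if i = j then 1 else 0))"

lemma onf_coeff:
  assumes F: "Vector_Spaces.linear (*s) (*s) F" and f: "onf F m f" and j: "j < m"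
  shows "cdot (F (\<Sum>i<m. c i *s f i)) (F (f j)) = c j"
proof -
  have "F (\<Sum>i<m. c i *s f i) = (\<Sum>i<m. c i *s F (f i))"
    using F by (simp add: vec.linear_sum vec.linear_scale)
  then have "cdot (F (\<Sum>i<m. c i *s f i)) (F (f j)) = (\<Sum>i<m. c i * cdot (F (f i)) (F (f j)))"
    by (simp add: cdot_sum cdot_linear)
  also have "\<dots> = (\<Sum>i<m. if i = j then c i else 0)"
    by (rule sum.cong) (use f j in \<open>auto simp: onf_def\<close>)
  finally show ?thesis using j by simp
qed

lemma onf_inj: "onf F m f \<Longrightarrow> inj_on f {..<m}"
proof (rule inj_onI)
  fix i j assume f: "onf F m f" and ij: "i \<in> {..<m}" "j \<in> {..<m}" "f i = f j"
  have "cdot (F (f i)) (F (f j)) = (if i = j then 1 else 0)" "cdot (F (f i)) (F (f i)) = 1"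
    using f ij(1,2) by (auto simp: onf_def)
  then show "i = j" using ij(3) by (auto split: if_splits)
qed

lemma onf_independent:
  fixes f :: "nat \<Rightarrow> complex^'n"
  assumes F: "Vector_Spaces.linear (*s) (*s) F" and f: "onf F m f"
  shows "vec.independent (f ` {..<m})"
proof
  assume "vec.dependent (f ` {..<m})"
  then obtain u where u: "\<exists>v\<in>f ` {..<m}. u v \<noteq> 0" "(\<Sum>v\<in>f ` {..<m}. u v *s v) = 0"
    unfolding vec.dependent_finite[OF finite_imageI[OF finite_lessThan]] by blast
  then obtain j where j: "j < m" "u (f j) \<noteq> 0" by auto
  have "(\<Sum>i<m. u (f i) *s f i) = 0" using u(2) by (simp add: sum.reindex[OF onf_inj[OF f]])
  then have "u (f j) = cdot (F 0) (F (f j))" using onf_coeff[OF F f j(1), of "\<lambda>i. u (f i)"] by simp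
  then show False using j(2) F by (simp add: vec.linear_0 cdot_linear)
qed

lemma onf_dim:
  assumes "Vector_Spaces.linear (*s) (*s) F" "onf F m f"
  shows "vec.dim (vec.span (f ` {..<m})) = m"
  using onf_independent[OF assms] onf_inj[OF assms(2)]
  by (simp add: vec.dim_eq_card_independent card_image)

text \<open>Gram-Schmidt for the form pulled back along \<open>F\<close>; injectivity on
  \<open>U\<close> makes it definite there.\<close>

lemma onf_extend_step:
  fixes F :: "complex^'n \<Rightarrow> complex^'k"
  assumes F: "Vector_Spaces.linear (*s) (*s) F" and U: "vec.subspace U" and inj: "\<And>x. x \<in> U \<Longrightarrow> F x = 0 \<Longrightarrow> x = 0"
    and f: "onf F m f" "\<And>i. i < m \<Longrightarrow> f i \<in> U" and m: "m < vec.dim U"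
  shows "\<exists>y\<in>U. onf F (Suc m) (f(m := y))"
proof -
  have "vec.span (f ` {..<m}) \<noteq> U" using onf_dim[OF F f(1)] m by auto
  moreover have "vec.span (f ` {..<m}) \<subseteq> U" using f(2) U by (intro vec.span_minimal) auto
  ultimately obtain x where x: "x \<in> U" "x \<notin> vec.span (f ` {..<m})" by blast
  define s where "s = (\<Sum>i<m. cdot (F x) (F (f i)) *s f i)"
  define y where "y = x - s"
  have sp: "s \<in> vec.span (f ` {..<m})" unfolding s_def
    by (intro vec.span_sum vec.span_scale vec.span_base) auto
  have sU: "s \<in> U" unfolding s_def using f(2) U by (intro vec.subspace_sum vec.subspace_scale) auto
  have yU: "y \<in> U" unfolding y_def using x sU U by (intro vec.subspace_diff)
  have "y \<noteq> 0" using x(2) sp by (auto simp: y_def)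
  then have "F y \<noteq> 0" using inj[OF yU] by blast
  then obtain r where r: "r > 0" "cdot (F y) (F y) = of_real r" using cdot_self_pos by blast
  have orth: "cdot (F y) (F (f j)) = 0" if "j < m" for j
    using onf_coeff[OF F f(1) that, of "\<lambda>i. cdot (F x) (F (f i))"] F
    by (simp add: y_def s_def vec.linear_diff cdot_linear)
  have orth': "cdot (F (f j)) (F y) = 0" if "j < m" for j using orth[OF that] cdot_cnj[of "F (f j)" "F y"] by simp
  define k where "k = 1 / sqrt r"
  have k: "k * (k * r) = 1" using r(1) by (simp add: k_def field_simps)
  define z where "z = (of_real k :: complex) *s y"
  have "cdot (F z) (F z) = of_real k * (of_real k * of_real r)"
    using F r(2) by (simp add: z_def vec.linear_scale cdot_linear)
  also have "\<dots> = 1" using k by (metis of_real_mult of_real_1)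
  finally have zz: "cdot (F z) (F z) = 1" .
  have zf: "cdot (F z) (F (f j)) = 0" "cdot (F (f j)) (F z) = 0" if "j < m" for j
    using F orth[OF that] orth'[OF that] by (simp_all add: z_def vec.linear_scale cdot_linear)
  have "onf F (Suc m) (f(m := z))"
    using f(1) zz zf by (auto simp: onf_def less_Suc_eq)
  moreover have "z \<in> U" unfolding z_def using yU U by (intro vec.subspace_scale)
  ultimately show ?thesis by blast
qed

lemma onf_extend:
  fixes F :: "complex^'n \<Rightarrow> complex^'k"
  assumes F: "Vector_Spaces.linear (*s) (*s) F" and U: "vec.subspace U" and inj: "\<And>x. x \<in> U \<Longrightarrow> F x = 0 \<Longrightarrow> x = 0"
    and f: "onf F m f" "\<And>i. i < m \<Longrightarrow> f i \<in> U" and m: "m \<le> vec.dim U"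
  shows "\<exists>g. onf F (vec.dim U) g \<and> (\<forall>i<vec.dim U. g i \<in> U) \<and> (\<forall>i<m. g i = f i)"
  using f m
proof (induction "vec.dim U - m" arbitrary: m f)
  case 0
  then show ?case by (intro exI[of _ f]) auto
next
  case (Suc d)
  then have m: "m < vec.dim U" by simp
  have "\<exists>y\<in>U. onf F (Suc m) (f(m := y))"
    by (intro onf_extend_step F U inj Suc(3,4) m)
  then obtain y where y: "y \<in> U" "onf F (Suc m) (f(m := y))" by (rule bexE)
  have "\<exists>g. onf F (vec.dim U) g \<and> (\<forall>i<vec.dim U. g i \<in> U) \<and> (\<forall>i<Suc m. g i = (f(m := y)) i)"
  proof (rule Suc(1)[OF _ y(2)])
    show "d = vec.dim U - Suc m" using Suc(2) by simp
    show "Suc m \<le> vec.dim U" using m by simp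
    show "(f(m := y)) i \<in> U" if "i < Suc m" for i using that Suc(4)[of i] y(1) by (cases "i = m") auto
  qed
  then obtain g where g: "onf F (vec.dim U) g" "\<forall>i<vec.dim U. g i \<in> U" "\<forall>i<Suc m. g i = (f(m := y)) i"
    by (elim exE conjE)
  have "\<forall>i<m. g i = f i" using g(3) by simp
  then show ?case using g(1,2) by (intro exI[of _ g] conjI)
qed

lemma onf_span:
  assumes F: "Vector_Spaces.linear (*s) (*s) F" and U: "vec.subspace U"
    and f: "onf F (vec.dim U) f" "\<And>i. i < vec.dim U \<Longrightarrow> f i \<in> U"
  shows "vec.span (f ` {..<vec.dim U}) = U"
proof (rule vec.subspace_dim_equal)
  show "vec.span (f ` {..<vec.dim U}) \<subseteq> U" using f(2) U by (intro vec.span_minimal) auto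
  show "vec.dim U \<le> vec.dim (vec.span (f ` {..<vec.dim U}))" using onf_dim[OF F f(1)] by simp
qed (use U in auto)

text \<open>Complete \<open>f\<close> to an orthonormal basis and take it as the columns, in the
  order prescribed by \<open>\<pi>\<close>.\<close>

lemma ex_unitary:
  fixes f :: "nat \<Rightarrow> complex^'k" and \<pi> :: "nat \<Rightarrow> 'k"
  assumes f: "onf (\<lambda>x. x) m f" and \<pi>: "bij_betw \<pi> {..<CARD('k)} UNIV" and m: "m \<le> CARD('k)"
  shows "\<exists>A::complex^'k^'k. (\<forall>x y. cdot (A *v x) (A *v y) = cdot x y) \<and> (\<forall>i<m. A *v axis (\<pi> i) 1 = f i)"
proof -
  have lin: "Vector_Spaces.linear (*s) (*s) (\<lambda>x::complex^'k. x)" by (simp add: vec.linear_ident)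
  obtain g where g: "onf (\<lambda>x. x) CARD('k) g" "\<forall>i<m. g i = f i"
    using onf_extend[OF lin vec.subspace_UNIV _ f] m unfolding vec_dim_card by auto
  define \<kappa> where "\<kappa> = the_inv_into {..<CARD('k)} \<pi>"
  have k: "\<kappa> a < CARD('k)" "\<pi> (\<kappa> a) = a" for a
    using \<pi> the_inv_into_into[of \<pi> "{..<CARD('k)}" a] f_the_inv_into_f[of \<pi> "{..<CARD('k)}" a]
    unfolding bij_betw_def \<kappa>_def by auto
  have k2: "\<kappa> (\<pi> i) = i" if "i < CARD('k)" for i
    using \<pi> that unfolding bij_betw_def \<kappa>_def by (simp add: the_inv_into_f_f)
  have kinj: "\<kappa> a = \<kappa> b \<longleftrightarrow> a = b" for a b using k(2) by metis
  define A :: "complex^'k^'k" where "A = (\<chi> i j. g (\<kappa> j) $ i)"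
  have Ax: "A *v x = (\<Sum>j\<in>UNIV. x $ j *s g (\<kappa> j))" for x
    by (simp add: vec_eq_iff matrix_vector_nth A_def mult.commute)
  have "cdot (A *v x) (A *v y) = cdot x y" for x y
  proof -
    have gg: "cdot (g (\<kappa> i)) (g (\<kappa> j)) = (if i = j then 1 else 0)" for i j
      using g(1) k kinj by (simp add: onf_def)
    have 1: "cdot (A *v x) (g (\<kappa> j)) = x $ j" for x j
      unfolding Ax cdot_sum cdot_linear gg by (simp add: if_distrib cong: if_cong)
    have "cdot (A *v x) (A *v y) = (\<Sum>i\<in>UNIV. x $ i * cdot (g (\<kappa> i)) (A *v y))"
      unfolding Ax[of x] cdot_sum cdot_linear ..
    also have "\<dots> = (\<Sum>i\<in>UNIV. x $ i * cnj (y $ i))"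
      by (rule sum.cong) (simp_all add: cdot_cnj[of "g _"] 1)
    finally show ?thesis by (simp add: cdot_def)
  qed
  moreover have "A *v axis (\<pi> i) 1 = f i" if "i < m" for i
  proof -
    have "A *v axis (\<pi> i) 1 = g (\<kappa> (\<pi> i))"
      by (simp add: vec_eq_iff matrix_vector_nth A_def axis_def if_distrib cong: if_cong)
    then show ?thesis using k2 g(2) that m by simp
  qed
  ultimately show ?thesis by blast
qed

section \<open>Abelian inner ideals of the special unitary algebra\<close>

definition eps :: "'p + 'q \<Rightarrow> complex" where
  "eps i = (case i of Inl _ \<Rightarrow> 1 | Inr _ \<Rightarrow> - 1)"

lemma eps_simps [simp]: "eps (Inl a) = 1" "eps (Inr b) = - 1" "eps i * eps i = 1" "cnj (eps i) = eps i"
  "eps i * (eps i * c) = c" "eps i \<noteq> 0"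
  by (auto simp: eps_def split: sum.splits)

text \<open>Minus the adjoint for the form of signature \<open>(p, q)\<close>; its fixed points are
  the skew matrices.\<close>

definition sgU :: "complex^('p::finite + 'q::finite)^('p + 'q) \<Rightarrow> complex^('p + 'q)^('p + 'q)" where
  "sgU z = (\<chi> i j. - (eps i * eps j * cnj (z $ j $ i)))"

text \<open>The antilinear identification of vectors with linear forms given by the Hermitian form
  \<open>hf\<close>.\<close>

definition jc :: "complex^('p::finite + 'q::finite) \<Rightarrow> complex^('p + 'q)" where
  "jc v = (\<chi> i. eps i * cnj (v $ i))"

definition hf :: "complex^('p::finite + 'q::finite) \<Rightarrow> complex^('p + 'q) \<Rightarrow> complex" where
  "hf u v = dotp (jc v) u"

lemma sgU_nth: "sgU z $ i $ j = - (eps i * eps j * cnj (z $ j $ i))"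
  by (simp add: sgU_def)

lemma jc_nth: "jc v $ i = eps i * cnj (v $ i)"
  by (simp add: jc_def)

lemma Ipq_diagm: "Ipq = diagm eps"
  by (auto simp: Ipq_def diagm_def eps_def vec_eq_iff)

lemma su_iff: "x \<in> su_algebra \<longleftrightarrow> trace x = 0 \<and> sgU x = x"
proof -
  have e: "eps i * z + cnj w * eps j = 0 \<longleftrightarrow> - (eps i * eps j * cnj w) = z" for i j :: "'a + 'b" and z w
  proof
    assume "eps i * z + cnj w * eps j = 0"
    then have "eps i * (eps i * z + cnj w * eps j) = 0" by simp
    then have "z + eps i * (cnj w * eps j) = 0" by (simp add: distrib_left del: mult_eq_0_iff)
    then have "z = - (eps i * (cnj w * eps j))" by (simp only: eq_neg_iff_add_eq_0)
    then show "- (eps i * eps j * cnj w) = z" by (simp add: mult_ac)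
  next
    assume "- (eps i * eps j * cnj w) = z"
    then show "eps i * z + cnj w * eps j = 0" by (simp flip: \<open>- (eps i * eps j * cnj w) = z\<close> add: mult.assoc)
  qed
  have "Ipq ** x + conj_transpose x ** Ipq = 0 \<longleftrightarrow> sgU x = x"
    unfolding Ipq_diagm mat_eq_iff
    by (simp add: diagm_mult mult_diagm conj_transpose_def sgU_nth e)
  then show ?thesis by (simp add: su_algebra_def)
qed

lemma sgU_mult: "sgU (z ** w) = - (sgU w ** sgU z)"
proof -
  have "(sgU w ** sgU z) $ i $ j = eps i * eps j * cnj ((z ** w) $ j $ i)" for i j
  proof -
    have "(sgU w ** sgU z) $ i $ j = (\<Sum>k\<in>UNIV. (eps k * eps k) * (eps i * eps j * (cnj (w $ k $ i) * cnj (z $ j $ k))))"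
      unfolding matrix_mult_nth sgU_nth by (rule sum.cong) (simp_all add: mult_ac)
    also have "\<dots> = eps i * eps j * cnj ((z ** w) $ j $ i)"
      by (simp add: matrix_mult_nth sum_distrib_left mult_ac)
    finally show ?thesis .
  qed
  then show ?thesis by (simp add: mat_eq_iff sgU_nth)
qed

lemma sgU_hom: "sgU (z + w) = sgU z + sgU w" "sgU (z - w) = sgU z - sgU w" "sgU (c *\<^sub>C z) = cnj c *\<^sub>C sgU z" "sgU (- z) = - sgU z"
  by (auto simp: mat_eq_iff sgU_nth algebra_simps)

interpretation su: real_form "su_algebra :: (complex^('p::finite + 'q::finite)^('p + 'q)) set" comm_bracket "\<lambda>x. x" sgU
proof (rule real_form.intro)
  fix z w :: "complex^('p + 'q)^('p + 'q)" and c
  show "linear (\<lambda>x :: complex^('p + 'q)^('p + 'q). x)" by (rule linear_ident)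
  show "inj (\<lambda>x :: complex^('p + 'q)^('p + 'q). x)" by simp
  show "(\<lambda>x. x) ` (su_algebra :: (complex^('p + 'q)^('p + 'q)) set) = {z. trace z = 0 \<and> sgU z = z}" by (auto simp: su_iff)
  show "sgU (z + w) = sgU z + sgU w" "sgU (c *\<^sub>C z) = cnj c *\<^sub>C sgU z" by (simp_all add: sgU_hom)
  show "sgU (sgU z) = z" by (simp add: mat_eq_iff sgU_nth mult_ac)
  show "trace (sgU z) = 0" if "trace z = 0"
  proof -
    have "trace (sgU z) = - cnj (trace z)" by (simp add: trace_def sgU_nth sum_negf)
    then show ?thesis using that by simp
  qed
  show "sgU (comm_bracket z w) = comm_bracket (sgU z) (sgU w)"
    by (simp add: comm_bracket_def sgU_hom sgU_mult)
qed simp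

lemma jc_jc [simp]: "jc (jc v) = v"
  by (simp add: vec_eq_iff jc_nth)

lemma jc_linear: "jc (u + v) = jc u + jc v" "jc (c *s v) = cnj c *s jc v" "jc 0 = 0" "jc (- v) = - jc v"
  by (simp_all add: vec_eq_iff jc_nth algebra_simps)

lemma sgU_outer: "sgU (outer u w) = - outer (jc w) (jc u)"
  by (simp add: mat_eq_iff sgU_nth jc_nth mult_ac)

text \<open>Translates the action on rows into the action on columns. For fixed points of
  \<open>sgU\<close>, conditions on rows thus follow from conditions on columns.\<close>

lemma row_sgU: "v v* z = - jc (sgU z *v jc v)"
proof -
  have "jc (sgU z *v jc v) $ j = - (v v* z) $ j" for j
  proof -
    have "jc (sgU z *v jc v) $ j = (\<Sum>k\<in>UNIV. - ((eps j * eps j) * (eps k * eps k) * (v $ k * z $ k $ j)))"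
      unfolding jc_nth matrix_vector_nth sgU_nth cnj_sum sum_distrib_left
      by (rule sum.cong) (simp_all only: complex_cnj_mult complex_cnj_minus complex_cnj_cnj eps_simps(4) mult_ac minus_mult_left minus_mult_right)
    then show ?thesis by (simp add: vector_matrix_mult_def sum_negf mult.commute)
  qed
  then show ?thesis by (simp add: vec_eq_iff)
qed

lemma hf_adjoint: "hf (z *v v) w = - hf v (sgU z *v w)"
  unfolding hf_def dotp_matrix[symmetric] row_sgU[of "jc w"] jc_jc
  by (simp add: dotp_def sum_negf)

lemma hf_linear: "hf (u + u') v = hf u v + hf u' v" "hf v (u + u') = hf v u + hf v u'"
  "hf (c *s u) v = c * hf u v" "hf v (c *s u) = cnj c * hf v u" "hf 0 v = 0" "hf v 0 = 0"
  by (simp_all add: hf_def jc_linear dotp_linear) (simp_all add: dotp_def jc_nth)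

lemma hf_cnj: "hf v u = cnj (hf u v)"
  by (simp add: hf_def dotp_def jc_nth mult_ac)

lemma hf_nondegenerate: "(\<And>v. hf v u = 0) \<Longrightarrow> u = 0"
proof -
  assume "\<And>v. hf v u = 0"
  then have "jc u $ i = 0" for i unfolding hf_def by (metis dotp_axis(2))
  then show "u = 0" by (simp add: vec_eq_iff jc_nth)
qed

lemma su_skew: "x \<in> su_algebra \<Longrightarrow> hf (x *v v) w = - hf v (x *v w)"
  using hf_adjoint[of x v w] by (simp add: su_iff)

definition isotropic :: "(complex^('p::finite + 'q::finite)) set \<Rightarrow> bool" where
  "isotropic U \<longleftrightarrow> vec.subspace U \<and> (\<forall>u\<in>U. \<forall>v\<in>U. hf u v = 0)"

text \<open>No condition on a kernel is imposed: by skewness, a range in \<open>U\<close> forces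
  vanishing on the orthogonal complement of \<open>U\<close>.\<close>

definition range_ideal :: "(complex^('p::finite + 'q::finite)) set \<Rightarrow> (complex^('p + 'q)^('p + 'q)) set" where
  "range_ideal U = {x\<in>su_algebra. \<forall>v. x *v v \<in> U}"

lemma abelian_inner_ideal_su:
  fixes B :: "(complex^('p::finite + 'q::finite)^('p + 'q)) set"
  assumes "nonzero_abelian_inner_ideal su_algebra comm_bracket B"
  shows "\<exists>U. isotropic U \<and> U \<noteq> {0} \<and> B = range_ideal U"
proof (rule su.abelian_inner_ideal_form[OF assms])
  fix U S :: "(complex^('p + 'q)) set"
  assume US: "vec.subspace U" "vec.subspace S" "U \<noteq> {0}" "S \<noteq> {0}"
    "\<And>u w. u \<in> U \<Longrightarrow> w \<in> S \<Longrightarrow> dotp w u = 0"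
    "\<And>x. x \<in> B \<longleftrightarrow> x \<in> su_algebra \<and> (\<forall>v. x *v v \<in> U) \<and> (\<forall>v. v v* x \<in> S)"
    "\<And>u w v. u \<in> U \<Longrightarrow> w \<in> S \<Longrightarrow> sgU (outer u w) *v v \<in> U"
    "\<And>u w v. u \<in> U \<Longrightarrow> w \<in> S \<Longrightarrow> v v* sgU (outer u w) \<in> S"
  obtain w0 where w0: "w0 \<in> S" "w0 \<noteq> 0" using US(2,4) vec.subspace_0 by blast
  \<comment> \<open>\<open>sgU\<close> turns \<open>outer u w0\<close> into
    \<open>- outer (jc w0) (jc u)\<close>, whose rows are multiples of \<open>jc u\<close>. So
    \<open>S\<close> contains \<open>jc\<close> of \<open>U\<close>, and orthogonality of
    \<open>U\<close> and \<open>S\<close> becomes isotropy.\<close>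
  have jU: "jc u \<in> S" if u: "u \<in> U" for u
  proof -
    have "jc w0 \<noteq> 0" using w0 jc_jc[of w0] jc_linear(3) by metis
    then obtain v where v: "dotp (jc w0) v = 1" using ex_dotp_1 by blast
    have "v v* sgU (outer u w0) = - (dotp (jc w0) v *s jc u)"
      by (simp add: sgU_outer vec_eq_iff vector_matrix_mult_def dotp_def sum_distrib_left sum_distrib_right sum_negf mult_ac)
    then have "- jc u \<in> S" using US(8)[OF u w0(1), of v] v by simp
    then show ?thesis using vec.subspace_neg[OF US(2)] by fastforce
  qed
  have "hf u v = 0" if "u \<in> U" "v \<in> U" for u v
    unfolding hf_def using US(5) jU that by blast
  then have "isotropic U" using US(1) by (simp add: isotropic_def)
  moreover have "B = range_ideal U"
  proof -
    have "v v* x \<in> S" if x: "x \<in> su_algebra" "\<forall>v. x *v v \<in> U" for x v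
    proof -
      have "v v* x = - jc (x *v jc v)" using row_sgU[of v x] x(1) by (simp add: su_iff)
      then show ?thesis using jU x(2) vec.subspace_neg[OF US(2)] by simp
    qed
    then show ?thesis using US(6) unfolding range_ideal_def by blast
  qed
  ultimately show ?thesis using US(3) by blast
qed

text \<open>\<open>outer u (jc u)\<close> is self-adjoint for \<open>hf\<close>; the factor
  \<open>\<i>\<close> makes it skew, and isotropy of \<open>u\<close> gives trace zero.\<close>

lemma i_outer_in_range_ideal:
  assumes U: "isotropic U" and u: "u \<in> U"
  shows "\<i> *\<^sub>C outer u (jc u) \<in> range_ideal U"
proof -
  have "hf u u = 0" using U u by (simp add: isotropic_def)
  then have "\<i> *\<^sub>C outer u (jc u) \<in> su_algebra"
    by (simp add: su_iff trace_outer hf_def sgU_hom sgU_outer)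
  moreover have "(\<i> *\<^sub>C outer u (jc u)) *v v \<in> U" for v
    using U u by (simp add: isotropic_def outer_mult_vec vec.subspace_scale)
  ultimately show ?thesis by (simp add: range_ideal_def)
qed

lemma range_ideal_inner:
  fixes U :: "(complex^('p::finite + 'q::finite)) set"
  assumes U: "isotropic U" "U \<noteq> {0}"
  shows "nonzero_abelian_inner_ideal su_algebra comm_bracket (range_ideal U)"
  unfolding su.nonzero_abelian_inner_ideal_iff
proof (intro conjI ballI)
  have sU: "vec.subspace U" using U by (simp add: isotropic_def)
  have smul: "c *\<^sub>R v \<in> U" if "v \<in> U" for c v
  proof -
    have "c *\<^sub>R v = complex_of_real c *s v" by (simp add: vec_eq_iff) (simp add: scaleR_conv_of_real)
    then show ?thesis using sU that by (simp add: vec.subspace_scale)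
  qed
  have cR: "(c *\<^sub>R x) *v v = c *\<^sub>R (x *v v)" for c and x :: "complex^('p + 'q)^('p + 'q)" and v
    by (simp add: vec_eq_iff matrix_vector_nth scaleR_sum_right)
  show "subspace (range_ideal U)"
    using su.subV sU smul
    by (auto simp: subspace_def range_ideal_def vec.subspace_0 matrix_vector_mult_add_rdistrib vec.subspace_add cR)
  show "range_ideal U \<subseteq> su_algebra" by (auto simp: range_ideal_def)
  \<comment> \<open>By skewness \<open>hf w (x y v) = - hf (x w) (y v)\<close>, and both arguments
    on the right lie in the isotropic \<open>U\<close>.\<close>
  have zero: "x ** y = 0" if xy: "x \<in> range_ideal U" "y \<in> range_ideal U" for x y
  proof -
    have "x *v (y *v v) = 0" for v
    proof (rule hf_nondegenerate)
      fix w
      have "hf w (x *v (y *v v)) = - hf (x *v w) (y *v v)" using su_skew[of x w] xy by (simp add: range_ideal_def)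
      also have "\<dots> = 0" using U xy by (simp add: isotropic_def range_ideal_def)
      finally show "hf w (x *v (y *v v)) = 0" .
    qed
    then show ?thesis by (simp add: matrix_eq flip: matrix_vector_mul_assoc)
  qed
  show "comm_bracket x y = 0" if "x \<in> range_ideal U" "y \<in> range_ideal U" for x y
    using zero[OF that] zero[OF that(2,1)] by (simp add: comm_bracket_def)
  fix x y w :: "complex^('p + 'q)^('p + 'q)" assume xy: "x \<in> range_ideal U" "y \<in> range_ideal U" "w \<in> su_algebra"
  have "comm_bracket x (comm_bracket y w) = - (x ** w ** y + y ** w ** x)"
    using zero[OF xy(1,2)] zero[OF xy(2,1)]
    by (simp add: comm_bracket_def matrix_ring_simps) (simp flip: matrix_mul_assoc)
  moreover have neg: "(- A) *v v = - (A *v v)" for A :: "complex^('p + 'q)^('p + 'q)" and v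
    by (simp add: vec_eq_iff matrix_vector_nth sum_negf)
  ultimately have "comm_bracket x (comm_bracket y w) *v v = - (x *v (w *v (y *v v)) + y *v (w *v (x *v v)))" for v
    by (simp only: neg matrix_vector_mult_add_rdistrib matrix_vector_mul_assoc matrix_mul_assoc)
  moreover have "- (x *v (w *v (y *v v)) + y *v (w *v (x *v v))) \<in> U" for v
    using xy sU by (intro vec.subspace_neg vec.subspace_add) (auto simp: range_ideal_def)
  moreover have "comm_bracket x (comm_bracket y w) \<in> su_algebra"
    using xy by (intro su.lb_in_L) (auto simp: range_ideal_def)
  ultimately show "comm_bracket x (comm_bracket y w) \<in> range_ideal U" by (simp add: range_ideal_def)
next
  obtain u where u: "u \<in> U" "u \<noteq> 0" using U vec.subspace_0 by (auto simp: isotropic_def)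
  have "jc u \<noteq> 0" using u jc_jc[of u] jc_linear(3) by metis
  then have "\<i> *\<^sub>C outer u (jc u) \<noteq> 0" using u by (simp add: cscaleM_eq_0 outer_eq_0)
  then show "range_ideal U \<noteq> {0}" using i_outer_in_range_ideal[OF U(1) u(1)] by blast
qed

lemma range_ideal_strict:
  assumes U: "isotropic U'" "vec.subspace U" "U \<subset> U'"
  shows "range_ideal U \<subset> range_ideal U'"
proof -
  obtain u where u: "u \<in> U'" "u \<notin> U" using U(3) by blast
  let ?x = "\<i> *\<^sub>C outer u (jc u)"
  have "u \<noteq> 0" using u(2) vec.subspace_0[OF U(2)] by blast
  then have "jc u \<noteq> 0" using jc_jc[of u] jc_linear(3) by metis
  then obtain v where v: "dotp (jc u) v = 1" using ex_dotp_1 by blast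
  have "?x *v ((- \<i>) *s v) = u"
    by (simp only: cscaleM_vec outer_mult_vec dotp_linear v) simp
  then have "?x *v ((- \<i>) *s v) \<notin> U" using u(2) by (simp only: not_False_eq_True)
  then have "?x \<notin> range_ideal U" unfolding range_ideal_def by blast
  moreover have "range_ideal U \<subseteq> range_ideal U'" using U(3) by (auto simp: range_ideal_def)
  ultimately show ?thesis using i_outer_in_range_ideal[OF U(1) u(1)] by blast
qed

definition p1 :: "complex^('p::finite + 'q::finite) \<Rightarrow> complex^'p" where
  "p1 v = (\<chi> a. v $ Inl a)"

definition p2 :: "complex^('p::finite + 'q::finite) \<Rightarrow> complex^'q" where
  "p2 v = (\<chi> b. v $ Inr b)"

lemma p_nth [simp]: "p1 v $ a = v $ Inl a" "p2 v $ b = v $ Inr b"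
  by (simp_all add: p1_def p2_def)

lemma p_linear: "Vector_Spaces.linear (*s) (*s) p1" "Vector_Spaces.linear (*s) (*s) p2"
  by (simp_all add: Vector_Spaces.linear_iff vec.vector_space_axioms vec_eq_iff)

lemma p_0 [simp]: "p1 0 = 0" "p2 0 = 0"
  by (simp_all add: vec_eq_iff)

lemma sum_Plus: "(\<Sum>i\<in>(UNIV :: ('p::finite + 'q::finite) set). f i) = (\<Sum>a\<in>UNIV. f (Inl a)) + (\<Sum>b\<in>UNIV. f (Inr b))"
  unfolding UNIV_Plus_UNIV[symmetric] by (subst sum.Plus) auto

lemma hf_cdot: "hf u v = cdot (p1 u) (p1 v) - cdot (p2 u) (p2 v)"
  by (simp add: hf_def dotp_def jc_nth cdot_def sum_Plus mult.commute sum_negf)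

lemma cdot_eq_0: "cdot x x = 0 \<Longrightarrow> x = 0"
  using cdot_self_pos[of x] by auto

lemma vec_Plus_eq_iff: "u = v \<longleftrightarrow> p1 u = p1 v \<and> p2 u = p2 v"
  by (auto simp: vec_eq_iff) (metis sum.exhaust)

text \<open>On an isotropic vector the two definite norms coincide, so each projection is injective
  on \<open>U\<close>. This bounds the dimension by both \<open>p\<close> and
  \<open>q\<close>.\<close>

lemma isotropic_p_inj:
  assumes "isotropic U" "x \<in> U"
  shows "p1 x = 0 \<Longrightarrow> x = 0" "p2 x = 0 \<Longrightarrow> x = 0"
proof -
  have "cdot (p1 x) (p1 x) = cdot (p2 x) (p2 x)"
    using assms hf_cdot[of x x] by (simp add: isotropic_def)
  then show "p1 x = 0 \<Longrightarrow> x = 0" "p2 x = 0 \<Longrightarrow> x = 0"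
    using cdot_eq_0 by (auto simp: vec_Plus_eq_iff[of x 0] cdot_linear)
qed

lemma dim_le_of_inj:
  fixes F :: "complex^'n \<Rightarrow> complex^'k"
  assumes F: "Vector_Spaces.linear (*s) (*s) F" and U: "vec.subspace U" and inj: "\<And>x. x \<in> U \<Longrightarrow> F x = 0 \<Longrightarrow> x = 0"
  shows "vec.dim U \<le> CARD('k)"
proof -
  have "inj_on F (vec.span U)"
  proof (rule inj_onI)
    fix x y assume xy: "x \<in> vec.span U" "y \<in> vec.span U" "F x = F y"
    have sp: "vec.span U = U" using U by (simp only: vec.span_eq_iff)
    have "x - y \<in> U" using xy(1,2) unfolding sp by (rule vec.subspace_diff[OF U])
    moreover have "F (x - y) = 0" using F xy by (simp add: vec.linear_diff)
    ultimately show "x = y" using inj by fastforce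
  qed
  then have "vec.dim (F ` U) = vec.dim U" using F by (intro vec.dim_image_eq)
  then show ?thesis using vec.dim_subset[of "F ` U" UNIV] unfolding vec_dim_card by simp
qed

lemma isotropic_dim:
  fixes U :: "(complex^('p::finite + 'q::finite)) set"
  assumes "isotropic U"
  shows "vec.dim U \<le> CARD('p)" "vec.dim U \<le> CARD('q)"
  using assms isotropic_p_inj[OF assms] by (auto intro!: dim_le_of_inj[OF p_linear(1)] dim_le_of_inj[OF p_linear(2)] simp: isotropic_def)

lemma isotropic_span:
  assumes "\<And>u v. u \<in> S \<Longrightarrow> v \<in> S \<Longrightarrow> hf u v = 0"
  shows "isotropic (vec.span S)"
proof -
  have 1: "hf u v = 0" if "u \<in> vec.span S" "v \<in> S" for u v
    using that(1) by (induction rule: vec.span_induct_alt) (use assms that(2) in \<open>auto simp: hf_linear\<close>)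
  have "hf u v = 0" if "u \<in> vec.span S" "v \<in> vec.span S" for u v
    using that(2) by (induction rule: vec.span_induct_alt) (use 1 that(1) in \<open>auto simp: hf_linear\<close>)
  then show ?thesis by (simp add: isotropic_def)
qed

definition enum :: "nat \<Rightarrow> 'a::finite" where
  "enum = (SOME f. bij_betw f {..<CARD('a)} UNIV)"

lemma enum_bij: "bij_betw (enum :: nat \<Rightarrow> 'a::finite) {..<CARD('a)} UNIV"
proof -
  have "\<exists>f. bij_betw f {..<CARD('a)} (UNIV :: 'a set)"
    using ex_bij_betw_nat_finite[of "UNIV :: 'a set"] by (simp add: atLeast0LessThan)
  then show ?thesis unfolding enum_def by (rule someI_ex)
qed

lemma enum_inj: "i < CARD('a) \<Longrightarrow> j < CARD('a) \<Longrightarrow> (enum i :: 'a::finite) = enum j \<longleftrightarrow> i = j"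
  using enum_bij[where 'a='a] by (auto simp: bij_betw_def inj_on_def)

text \<open>The sum of a positive and a negative unit vector is isotropic. Indices start at
  0.\<close>

definition std_vec :: "nat \<Rightarrow> complex^('p::finite + 'q::finite)" where
  "std_vec i = axis (Inl (enum i)) 1 + axis (Inr (enum i)) 1"

definition std_iso :: "nat \<Rightarrow> (complex^('p::finite + 'q::finite)) set" where
  "std_iso t = vec.span (std_vec ` {..<t})"

lemma p_std_vec: "p1 (std_vec i) = axis (enum i) 1" "p2 (std_vec i) = axis (enum i) 1"
  by (auto simp: vec_eq_iff std_vec_def axis_def)

lemma cdot_axis: "cdot (axis i 1) (axis j 1) = (if i = j then 1 else 0)"
proof -
  have "cdot (axis i 1) (axis j 1) = (\<Sum>k\<in>UNIV. if k = i then cnj (axis j 1 $ i) else 0)"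
    unfolding cdot_def by (rule sum.cong) (auto simp: axis_def)
  then show ?thesis by (simp add: axis_def)
qed

lemma std_iso:
  assumes t: "t \<le> CARD('p)" "CARD('p) \<le> CARD('q)"
  shows "isotropic (std_iso t :: (complex^('p::finite + 'q::finite)) set)"
    "vec.dim (std_iso t :: (complex^('p::finite + 'q::finite)) set) = t"
proof -
  let ?s = "std_vec :: nat \<Rightarrow> complex^('p + 'q)"
  show "isotropic (std_iso t :: (complex^('p + 'q)) set)"
    unfolding std_iso_def
  proof (rule isotropic_span)
    fix u v assume "u \<in> ?s ` {..<t}" "v \<in> ?s ` {..<t}"
    then obtain i j where "i < t" "j < t" "u = ?s i" "v = ?s j" by blast
    then show "hf u v = 0"
      using enum_inj[of i j, where 'a='p] enum_inj[of i j, where 'a='q] t by (simp add: hf_cdot p_std_vec cdot_axis)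
  qed
  have "onf p1 t ?s" using enum_inj[where 'a='p] t by (auto simp: onf_def p_std_vec cdot_axis)
  then show "vec.dim (std_iso t :: (complex^('p + 'q)) set) = t"
    unfolding std_iso_def using onf_dim[OF p_linear(1)] by blast
qed

text \<open>An isotropic subspace is the graph of an isometry between subspaces of the two definite parts, so it
  can be moved into standard position by a block diagonal unitary matrix.\<close>

lemma isotropic_move:
  fixes U :: "(complex^('p::finite + 'q::finite)) set"
  assumes U: "isotropic U"
  shows "\<exists>(g :: complex^('p + 'q)^('p + 'q)) (g' :: complex^('p + 'q)^('p + 'q)). g ** g' = mat 1 \<and> g' ** g = mat 1 \<and> (\<forall>u v. hf (g *v u) (g *v v) = hf u v) \<and>
    (\<lambda>v. g *v v) ` std_iso (vec.dim U) = U"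
proof -
  define t where "t = vec.dim U"
  have t: "t \<le> CARD('p)" "t \<le> CARD('q)" using isotropic_dim[OF U] by (simp_all add: t_def)
  have sU: "vec.subspace U" using U by (simp add: isotropic_def)
  obtain f where f: "onf p1 t f" "\<And>i. i < t \<Longrightarrow> f i \<in> U"
    using onf_extend[OF p_linear(1) sU isotropic_p_inj(1)[OF U], of 0 undefined] unfolding t_def
    by (auto simp: onf_def)
  have o1: "onf (\<lambda>x. x) t (\<lambda>i. p1 (f i))" using f(1) by (simp add: onf_def)
  \<comment> \<open>The second projections come out orthonormal by themselves, because
    \<open>hf\<close> vanishes on \<open>U\<close>.\<close>
  have o2: "onf (\<lambda>x. x) t (\<lambda>i. p2 (f i))"
    unfolding onf_def
  proof (intro allI impI)
    fix i j assume ij: "i < t" "j < t"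
    have "hf (f i) (f j) = 0" using U f(2) ij by (simp add: isotropic_def)
    then show "cdot (p2 (f i)) (p2 (f j)) = (if i = j then 1 else 0)"
      using f(1) ij by (simp add: hf_cdot onf_def)
  qed
  obtain A :: "complex^'p^'p" where A: "\<And>x y. cdot (A *v x) (A *v y) = cdot x y" "\<And>i. i < t \<Longrightarrow> A *v axis (enum i) 1 = p1 (f i)"
    using ex_unitary[OF o1 enum_bij t(1)] by blast
  obtain A' :: "complex^'q^'q" where A': "\<And>x y. cdot (A' *v x) (A' *v y) = cdot x y" "\<And>i. i < t \<Longrightarrow> A' *v axis (enum i) 1 = p2 (f i)"
    using ex_unitary[OF o2 enum_bij t(2)] by blast
  define g :: "complex^('p + 'q)^('p + 'q)" where
    "g = (\<chi> i j. case i of Inl a \<Rightarrow> (case j of Inl b \<Rightarrow> A $ a $ b | Inr _ \<Rightarrow> 0)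
                          | Inr a \<Rightarrow> (case j of Inl _ \<Rightarrow> 0 | Inr b \<Rightarrow> A' $ a $ b))"
  have pg: "p1 (g *v v) = A *v p1 v" "p2 (g *v v) = A' *v p2 v" for v
    by (simp_all add: vec_eq_iff matrix_vector_nth g_def sum_Plus)
  have hg: "hf (g *v u) (g *v v) = hf u v" for u v by (simp add: hf_cdot pg A A')
  have "v = 0" if "g *v v = 0" for v
  proof (rule hf_nondegenerate)
    fix w show "hf w v = 0" using hg[of w v] that by (simp add: hf_linear)
  qed
  then obtain g' where g': "g' ** g = mat 1" using matrix_left_invertible_ker[of g] by blast
  then have gg': "g ** g' = mat 1" by (simp add: matrix_left_right_inverse)
  have gs: "g *v std_vec i = f i" if "i < t" for i
    using that by (simp add: vec_Plus_eq_iff pg p_std_vec A A')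
  have "(\<lambda>v. g *v v) ` std_iso t = vec.span ((\<lambda>v. g *v v) ` (std_vec ` {..<t}))"
    unfolding std_iso_def by (rule vec.linear_span_image[symmetric]) simp
  also have "(\<lambda>v. g *v v) ` (std_vec ` {..<t}) = f ` {..<t}" using gs by (auto simp: image_image)
  also have "vec.span (f ` {..<t}) = U" using onf_span[OF p_linear(1) sU, of f] f by (simp add: t_def)
  finally show ?thesis using g' gg' hg unfolding t_def by (intro exI[of _ g] exI[of _ g'] conjI allI) simp_all
qed

lemma range_ideal_sub: "range_ideal U \<subseteq> su_algebra"
  by (auto simp: range_ideal_def)

text \<open>For an isometry \<open>g\<close> of \<open>hf\<close>, \<open>sgU g\<close> is minus its
  inverse, so conjugation by \<open>g\<close> commutes with \<open>sgU\<close> and moves ranges by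
  \<open>g\<close>.\<close>

lemma range_ideal_std_conj:
  fixes U :: "(complex^('p::finite + 'q::finite)) set"
  assumes U: "isotropic U"
  shows "conjugate su_algebra comm_bracket (range_ideal (std_iso (vec.dim U))) (range_ideal U)"
proof -
  obtain g g' :: "complex^('p + 'q)^('p + 'q)" where g: "g ** g' = mat 1" "g' ** g = mat 1"
    "\<And>u v. hf (g *v u) (g *v v) = hf u v" "(\<lambda>v. g *v v) ` std_iso (vec.dim U) = U"
    using isotropic_move[OF U] by blast
  have "hf v (- (sgU g *v (g *v w)) - w) = 0" for v w
  proof -
    have "hf v w = - hf v (sgU g *v (g *v w))" using g(3)[of v w] hf_adjoint[of g v "g *v w"] by simp
    then show ?thesis
      using hf_linear(2)[of v "- (sgU g *v (g *v w)) - w" w] hf_linear(2)[of v "- (sgU g *v (g *v w))" "sgU g *v (g *v w)"]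
      by (simp add: hf_linear)
  qed
  then have "- (sgU g *v (g *v w)) - w = 0" for w by (rule hf_nondegenerate)
  then have sgg: "sgU g *v (g *v w) = - w" for w by (metis add.inverse_inverse right_minus_eq)
  have "sgU g *v w = (- g') *v w" for w
  proof -
    have "sgU g *v (g *v (g' *v w)) = - (g' *v w)" by (rule sgg)
    also have "g *v (g' *v w) = w" by (simp add: matrix_vector_mul_assoc g)
    finally show ?thesis by (simp add: vec_eq_iff matrix_vector_nth sum_negf)
  qed
  then have s1: "sgU g = - g'" by (simp add: matrix_eq)
  have "sgU (sgU g) = sgU (- g')" by (simp add: s1)
  then have s2: "sgU g' = - g" by (simp add: su.sg_sg sgU_hom)
  have sg: "sgU (g ** z ** g') = g ** sgU z ** g'" for z
    by (simp add: sgU_mult s1 s2 matrix_mul_assoc)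
  note c = su.conj_automorphism[OF g(1,2) sg]
  let ?f = "\<lambda>x. inv (\<lambda>x. x) (g ** x ** g')"
  have "?f ` range_ideal (std_iso (vec.dim U)) = range_ideal U"
  proof (intro set_eqI iffI)
    fix y assume "y \<in> ?f ` range_ideal (std_iso (vec.dim U))"
    then obtain x where x: "x \<in> range_ideal (std_iso (vec.dim U))" "y = ?f x" by blast
    then have xL: "x \<in> su_algebra" by (simp add: range_ideal_def)
    have y: "y = g ** x ** g'" "y \<in> su_algebra" using c(2,3)[OF xL] x(2) by simp_all
    have "y *v v \<in> U" for v
    proof -
      have "y *v v = g *v (x *v (g' *v v))" by (simp add: y matrix_vector_mul_assoc matrix_mul_assoc)
      moreover have "x *v (g' *v v) \<in> std_iso (vec.dim U)" using x by (simp add: range_ideal_def)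
      ultimately show ?thesis using g(4) by blast
    qed
    then show "y \<in> range_ideal U" using y by (simp add: range_ideal_def)
  next
    fix y assume y: "y \<in> range_ideal U"
    then have "y \<in> ?f ` su_algebra" using c(1) unfolding lie_automorphism_def bij_betw_def range_ideal_def by blast
    then obtain x where x: "x \<in> su_algebra" "y = ?f x" by blast
    then have yx: "y = g ** x ** g'" using c(2) by simp
    have "x *v v \<in> std_iso (vec.dim U)" for v
    proof -
      have "y ** g = g ** x" by (simp add: yx g(2) flip: matrix_mul_assoc)
      then have "g *v (x *v v) = y *v (g *v v)" by (simp add: matrix_vector_mul_assoc)
      then have "g *v (x *v v) \<in> (\<lambda>v. g *v v) ` std_iso (vec.dim U)" using y g(4) by (simp add: range_ideal_def)
      then obtain w where w: "w \<in> std_iso (vec.dim U)" "g *v (x *v v) = g *v w" by blast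
      have "g' *v (g *v (x *v v)) = g' *v (g *v w)" using w by simp
      then have "x *v v = w" by (simp only: matrix_vector_mul_assoc matrix_mul_assoc g matrix_vector_mul_lid matrix_mul_lid)
      then show ?thesis using w by simp
    qed
    then show "y \<in> ?f ` range_ideal (std_iso (vec.dim U))" using x by (auto simp: range_ideal_def)
  qed
  then show ?thesis unfolding conjugate_def using c(1) by blast
qed

lemma range_ideal_conj:
  fixes U U' :: "(complex^('p::finite + 'q::finite)) set"
  assumes U: "isotropic U" "isotropic U'" "vec.dim U = vec.dim U'"
  shows "conjugate su_algebra comm_bracket (range_ideal U) (range_ideal U')"
proof -
  have "conjugate su_algebra comm_bracket (range_ideal U) (range_ideal (std_iso (vec.dim U)))"
    by (rule su.conjugate_sym[OF range_ideal_sub range_ideal_std_conj[OF U(1)]])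
  then show ?thesis
    using su.conjugate_trans[OF range_ideal_sub _ range_ideal_std_conj[OF U(2)], of U] U(3) by simp
qed

text \<open>Conjugate subspaces have equal real dimension, which a strict inclusion
  excludes.\<close>

lemma not_conjugate_psubset:
  fixes B B' :: "(complex^('p::finite + 'q::finite)^('p + 'q)) set"
  assumes B: "subspace B" "subspace B'" "B' \<subseteq> su_algebra" "B \<subset> B'"
  shows "\<not> conjugate su_algebra comm_bracket B B'"
proof
  assume "conjugate su_algebra comm_bracket B B'"
  then obtain \<phi> where \<phi>: "lie_automorphism su_algebra comm_bracket \<phi>" "\<phi> ` B = B'" unfolding conjugate_def by blast
  have inj: "inj_on \<phi> su_algebra" using \<phi>(1) by (simp add: lie_automorphism_def bij_betw_def)
  have "dim (\<phi> ` B) = dim B"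
    using dim_linear_on_image[OF su.lie_automorphism_linear_on[OF \<phi>(1)] inj su.subV B(1)] B(3,4) by blast
  moreover have "dim B < dim B'"
  proof (rule dim_psubset)
    have sp: "span B = B" "span B' = B'" using B(1,2) by (simp_all only: span_eq_iff)
    show "span B \<subset> span B'" unfolding sp by (rule B(4))
  qed
  ultimately show False using \<phi>(2) by simp
qed

lemma std_iso_strict:
  assumes "s < t" "t \<le> CARD('p)" "CARD('p) \<le> CARD('q)"
  shows "(std_iso s :: (complex^('p::finite + 'q::finite)) set) \<subset> std_iso t"
proof -
  have "(std_iso s :: (complex^('p + 'q)) set) \<subseteq> std_iso t"
    unfolding std_iso_def using assms by (intro vec.span_mono image_mono) auto
  moreover have "(std_iso s :: (complex^('p + 'q)) set) \<noteq> std_iso t"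
    using std_iso(2)[of s, where 'p='p and 'q='q] std_iso(2)[of t, where 'p='p and 'q='q] assms by auto
  ultimately show ?thesis by blast
qed

text \<open>The classes are counted with the standard isotropic subspaces, so the count does not
  presuppose a Satake setting. The dimension of \<open>U\<close>, from 1 to \<open>p\<close>, labels
  the class.\<close>

lemma card_classes_su:
  assumes pq: "CARD('p) \<le> CARD('q)"
  shows "card (abelian_inner_ideal_classes (su_algebra :: (complex^('p::finite + 'q::finite)^('p + 'q)) set) comm_bracket) = CARD('p)"
proof -
  let ?L = "su_algebra :: (complex^('p + 'q)^('p + 'q)) set"
  let ?N = "nonzero_abelian_inner_ideal ?L comm_bracket" and ?c = "conjugate ?L comm_bracket"
  let ?r = "{(B, B'). ?N B \<and> ?N B' \<and> ?c B B'}"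
  let ?B = "\<lambda>t. range_ideal (std_iso t) :: (complex^('p + 'q)^('p + 'q)) set"
  let ?F = "\<lambda>t. ?r `` {?B t}"
  have N: "?N (?B t)" if t: "t \<in> {1..CARD('p)}" for t
  proof -
    have i: "isotropic (std_iso t :: (complex^('p + 'q)) set)" "vec.dim (std_iso t :: (complex^('p + 'q)) set) = t"
      using std_iso[of t, where 'p='p and 'q='q] t pq by auto
    have "vec.dim {0 :: complex^('p + 'q)} = 0" by simp
    then have "std_iso t \<noteq> {0 :: complex^('p + 'q)}" using i(2) t by (metis atLeastAtMost_iff not_one_le_zero)
    then show ?thesis using range_ideal_inner[OF i(1)] by blast
  qed
  have nsub: "B \<subseteq> ?L" "subspace B" if "?N B" for B
    using that unfolding su.nonzero_abelian_inner_ideal_iff by blast+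
  have eq: "?F s \<noteq> ?F t" if st: "s \<in> {1..CARD('p)}" "t \<in> {1..CARD('p)}" "s < t" for s t
  proof
    assume e: "?F s = ?F t"
    have "?B t \<in> ?F t" using N[OF st(2)] su.conjugate_refl by blast
    then have "?c (?B s) (?B t)" using e by blast
    moreover have "?B s \<subset> ?B t"
      using st pq std_iso[of s, where 'p='p and 'q='q] std_iso[of t, where 'p='p and 'q='q]
      by (intro range_ideal_strict std_iso_strict) (auto simp: isotropic_def)
    ultimately show False using not_conjugate_psubset[of "?B s" "?B t"] nsub N st by blast
  qed
  have inj: "inj_on ?F {1..CARD('p)}"
  proof (rule inj_onI)
    fix s t assume "s \<in> {1..CARD('p)}" "t \<in> {1..CARD('p)}" "?F s = ?F t"
    then show "s = t" using eq[of s t] eq[of t s] by (cases s t rule: linorder_cases) auto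
  qed
  have "abelian_inner_ideal_classes ?L comm_bracket = ?F ` {1..CARD('p)}"
  proof (intro set_eqI iffI)
    fix X assume "X \<in> abelian_inner_ideal_classes ?L comm_bracket"
    then obtain B where B: "?N B" "X = ?r `` {B}" unfolding abelian_inner_ideal_classes_def by (auto elim: quotientE)
    obtain U where U: "isotropic U" "U \<noteq> {0}" "B = range_ideal U" using abelian_inner_ideal_su[OF B(1)] by blast
    let ?t = "vec.dim U"
    have "?t \<noteq> 0" using U(1,2) vec.dim_eq_0[of U] vec.subspace_0[of U] by (auto simp: isotropic_def)
    then have "1 \<le> ?t" by linarith
    then have t: "?t \<in> {1..CARD('p)}" using isotropic_dim(1)[OF U(1)] by (simp only: atLeastAtMost_iff)
    have c: "?c (?B ?t) B" using range_ideal_std_conj[OF U(1)] U(3) by simp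
    have c': "?c B (?B ?t)" by (rule su.conjugate_sym[OF range_ideal_sub c])
    have "X = ?F ?t"
    proof (intro set_eqI iffI)
      fix B' assume "B' \<in> X"
      then have "?N B'" "?c B B'" using B by auto
      then show "B' \<in> ?F ?t" using N[OF t] su.conjugate_trans[OF range_ideal_sub c] by blast
    next
      fix B' assume "B' \<in> ?F ?t"
      then have "?N B'" "?c (?B ?t) B'" by auto
      then show "B' \<in> X" using B su.conjugate_trans[OF nsub(1)[OF B(1)] c'] by blast
    qed
    then show "X \<in> ?F ` {1..CARD('p)}" using t by blast
  next
    fix X assume "X \<in> ?F ` {1..CARD('p)}"
    then obtain t where t: "t \<in> {1..CARD('p)}" "X = ?F t" by blast
    then show "X \<in> abelian_inner_ideal_classes ?L comm_bracket"
      unfolding abelian_inner_ideal_classes_def t(2) using N[OF t(1)] by (intro quotientI) simp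
  qed
  then show ?thesis using card_image[OF inj] by simp
qed

section \<open>The Satake setting of the special unitary algebra\<close>

text \<open>Serves to locate the partners of the first \<open>t\<close> positions, which form an
  upward closed set of size \<open>t\<close>.\<close>

lemma up_closed_segment:
  fixes S :: "nat set"
  assumes S: "S \<subseteq> {1..n}" "card S = t" and up: "\<And>i j. i \<in> S \<Longrightarrow> i < j \<Longrightarrow> j \<le> n \<Longrightarrow> j \<in> S"
  shows "S = {n + 1 - t..n}"
proof (cases "S = {}")
  case True
  then show ?thesis using S(2) by auto
next
  case False
  have fin: "finite S" using S(1) by (rule finite_subset) simp
  define m where "m = Min S"
  have m: "m \<in> S" using fin False by (simp add: m_def)
  have "S = {m..n}"
  proof (intro set_eqI iffI)
    fix j assume "j \<in> S"
    then show "j \<in> {m..n}" using S(1) fin by (auto simp: m_def)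
  next
    fix j assume "j \<in> {m..n}"
    then show "j \<in> S" using up[OF m, of j] m by (cases "j = m") auto
  qed
  moreover have "1 \<le> m" "m \<le> n" using m S(1) by auto
  ultimately show ?thesis using S(2) by auto
qed

text \<open>The span of the first \<open>t\<close> columns \<open>s 1, \<dots>, s t\<close> of \<open>P\<close>, in terms of the inverse \<open>R\<close> of \<open>P\<close>.\<close>

definition column_flag :: "complex^'n^'n \<Rightarrow> (nat \<Rightarrow> 'n) \<Rightarrow> nat \<Rightarrow> (complex^'n) set" where
  "column_flag R s t = {v. \<forall>i\<in>{1..CARD('n)}. t < i \<longrightarrow> (R *v v) $ s i = 0}"

lemma subspace_column_flag: "vec.subspace (column_flag R s t)"
  by (auto simp: vec.subspace_def column_flag_def matrix_vector_right_distrib vector_scalar_commute)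

lemma column_flag_mono: "t \<le> t' \<Longrightarrow> column_flag R s t \<subseteq> column_flag R s t'"
  by (auto simp: column_flag_def)

lemma dim_column_flag:
  fixes P R :: "complex^'n^'n"
  assumes PR: "P ** R = mat 1" "R ** P = mat 1" and s: "bij_betw s {1..CARD('n)} UNIV" and t: "t \<le> CARD('n)"
  shows "vec.dim (column_flag R s t) = t"
proof -
  let ?W = "{v :: complex^'n. \<forall>x. x \<notin> s ` {1..t} \<longrightarrow> v $ x = 0}"
  have PRv: "P *v (R *v v) = v" "R *v (P *v v) = v" for v by (simp_all add: matrix_vector_mul_assoc PR)
  have injs: "inj_on s {1..CARD('n)}" using s by (simp add: bij_betw_def)
  have sub: "{1..t} \<subseteq> {1..CARD('n)}" using t by auto
  have W: "v \<in> ?W \<longleftrightarrow> (\<forall>i\<in>{1..CARD('n)}. t < i \<longrightarrow> v $ s i = 0)" for v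
  proof
    assume v: "v \<in> ?W"
    show "\<forall>i\<in>{1..CARD('n)}. t < i \<longrightarrow> v $ s i = 0"
    proof (intro ballI impI)
      fix i assume i: "i \<in> {1..CARD('n)}" "t < i"
      then have "s i \<notin> s ` {1..t}" using inj_on_image_mem_iff[OF injs i(1) sub] by simp
      then show "v $ s i = 0" using v by blast
    qed
  next
    assume v: "\<forall>i\<in>{1..CARD('n)}. t < i \<longrightarrow> v $ s i = 0"
    show "v \<in> ?W"
    proof (intro CollectI allI impI)
      fix x assume x: "x \<notin> s ` {1..t}"
      have "x \<in> s ` {1..CARD('n)}" using s by (simp only: bij_betw_def UNIV_I)
      then obtain i where i: "i \<in> {1..CARD('n)}" "x = s i" by blast
      then have "t < i" using x by force
      then show "v $ x = 0" using v i by blast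
    qed
  qed
  have im: "column_flag R s t = (\<lambda>v. P *v v) ` ?W"
  proof (intro set_eqI iffI)
    fix v assume "v \<in> column_flag R s t"
    then have "R *v v \<in> ?W" unfolding W column_flag_def by blast
    then have "P *v (R *v v) \<in> (\<lambda>v. P *v v) ` ?W" by (rule imageI)
    then show "v \<in> (\<lambda>v. P *v v) ` ?W" by (simp only: PRv)
  next
    fix v assume "v \<in> (\<lambda>v. P *v v) ` ?W"
    then obtain w where w: "w \<in> ?W" "v = P *v w" by blast
    then show "v \<in> column_flag R s t" using W[of w] by (simp only: column_flag_def PRv mem_Collect_eq)
  qed
  have linP: "Vector_Spaces.linear (*s) (*s) ((*v) P)" by simp
  have inj: "inj_on ((*v) P) (vec.span ?W)" by (rule inj_onI) (metis PRv(2))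
  have "vec.dim (column_flag R s t) = vec.dim ?W" unfolding im using linP inj by (rule vec.dim_image_eq)
  also have "\<dots> = card (s ` {1..t})" by (rule dim_substandard_cart)
  also have "\<dots> = t" using inj_on_subset[OF injs sub] by (simp add: card_image)
  finally show ?thesis .
qed

lemma range_in_column_flag:
  fixes P R :: "complex^'n^'n"
  assumes PR: "P ** R = mat 1" "R ** P = mat 1" and s: "bij_betw s {1..CARD('n)} UNIV"
  shows "(\<forall>v. x *v v \<in> column_flag R s t) \<longleftrightarrow>
    (\<forall>i\<in>{1..CARD('n)}. \<forall>j\<in>{1..CARD('n)}. (R ** x ** P) $ s i $ s j \<noteq> 0 \<longrightarrow> i \<le> t)"
proof
  assume f: "\<forall>v. x *v v \<in> column_flag R s t"
  show "\<forall>i\<in>{1..CARD('n)}. \<forall>j\<in>{1..CARD('n)}. (R ** x ** P) $ s i $ s j \<noteq> 0 \<longrightarrow> i \<le> t"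
  proof (intro ballI impI, rule ccontr)
    fix i j assume ij: "i \<in> {1..CARD('n)}" "(R ** x ** P) $ s i $ s j \<noteq> 0" "\<not> i \<le> t"
    have "x *v (P *v axis (s j) 1) \<in> column_flag R s t" using f by blast
    then have "(R *v (x *v (P *v axis (s j) 1))) $ s i = 0" using ij by (simp add: column_flag_def)
    moreover have "R *v (x *v (P *v axis (s j) 1)) = (R ** x ** P) *v axis (s j) 1"
      by (simp only: matrix_vector_mul_assoc matrix_mul_assoc)
    ultimately have "((R ** x ** P) *v axis (s j) 1) $ s i = 0" by (simp only:)
    then show False using ij(2) by (simp only: matrix_axis)
  qed
next
  assume f: "\<forall>i\<in>{1..CARD('n)}. \<forall>j\<in>{1..CARD('n)}. (R ** x ** P) $ s i $ s j \<noteq> 0 \<longrightarrow> i \<le> t"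
  show "\<forall>v. x *v v \<in> column_flag R s t"
    unfolding column_flag_def
  proof (intro allI CollectI ballI impI)
    fix v i assume i: "i \<in> {1..CARD('n)}" "t < i"
    have "(R ** x ** P) $ s i $ y = 0" for y
    proof -
      have "y \<in> s ` {1..CARD('n)}" using s by (simp only: bij_betw_def UNIV_I)
      then obtain j where "j \<in> {1..CARD('n)}" "y = s j" by blast
      then show ?thesis using f i by fastforce
    qed
    then have "((R ** x ** P) *v (R *v v)) $ s i = 0" by (simp add: matrix_vector_nth)
    moreover have "(R ** x ** P) *v (R *v v) = R *v (x *v ((P ** R) *v v))"
      by (simp only: matrix_vector_mul_assoc matrix_mul_assoc)
    ultimately show "(R *v (x *v v)) $ s i = 0" by (simp add: PR)
  qed
qed

context labelled begin

definition pos :: "'n \<Rightarrow> nat" where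
  "pos x = the_inv_into {1..l+1} s x"

lemma pos: "pos x \<in> {1..l+1}" "s (pos x) = x" "i \<in> {1..l+1} \<Longrightarrow> pos (s i) = i"
  using s_bij the_inv_into_into[of s "{1..l+1}" x "{1..l+1}"] f_the_inv_into_f[of s "{1..l+1}" x] the_inv_into_f_f[of s "{1..l+1}" i]
  unfolding pos_def bij_betw_def by auto

lemma pos_inj: "pos x = pos y \<longleftrightarrow> x = y"
  using pos(2) by metis

end

text \<open>\<open>P\<close> diagonalises \<open>h\<close>, and its columns \<open>e i\<close> are the common eigenvectors.\<close>

locale conj_labelled = labelled L lb "\<lambda>x. R ** psi x ** P" "\<lambda>z. R ** sg (P ** z ** R) ** P" a h th l \<alpha>
  for L :: "'a::real_vector set" and lb :: "'a bracket"
    and psi :: "'a \<Rightarrow> complex^'n^'n" and sg :: "complex^'n^'n \<Rightarrow> complex^'n^'n"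
    and P R :: "complex^'n^'n" and a h :: "'a set" and th and l \<alpha> +
  assumes PR: "P ** R = mat 1" "R ** P = mat 1"
begin

definition e :: "'n \<Rightarrow> complex^'n" where
  "e i = P *v axis i 1"

lemma P_expand: "P *v v = (\<Sum>i\<in>UNIV. v $ i *s e i)"
proof -
  have "e i $ k = P $ k $ i" for i k unfolding e_def by (rule matrix_axis)
  then show ?thesis by (simp add: vec_eq_iff matrix_vector_nth mult.commute)
qed

lemma PRv: "P *v (R *v v) = v" "R *v (P *v v) = v"
  by (simp_all add: matrix_vector_mul_assoc PR)

lemma R_e: "(R *v e i) $ j = (if j = i then 1 else 0)"
  unfolding e_def PRv by (simp add: axis_def)

lemma e_nz: "e i \<noteq> 0"
proof
  assume "e i = 0"
  then have "R *v (P *v axis i 1) = 0" by (simp add: e_def)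
  then show False by (simp add: PRv axis_eq_0_iff)
qed

lemma conj_id: "R ** (P ** z ** R) ** P = z" "P ** (R ** z ** P) ** R = z" for z :: "complex^'n^'n"
proof -
  have "R ** (P ** z ** R) ** P = (R ** P) ** z ** (R ** P)" by (simp only: matrix_mul_assoc)
  then show "R ** (P ** z ** R) ** P = z" by (simp add: PR)
  have "P ** (R ** z ** P) ** R = (P ** R) ** z ** (P ** R)" by (simp only: matrix_mul_assoc)
  then show "P ** (R ** z ** P) ** R = z" by (simp add: PR)
qed

lemma diag_eigen: "R ** z ** P = diagm d \<Longrightarrow> z *v e i = d i *s e i"
proof -
  assume d: "R ** z ** P = diagm d"
  have "P ** diagm d = (P ** R) ** z ** P" by (simp only: matrix_mul_assoc flip: d)
  then have zP: "P ** diagm d = z ** P" by (simp add: PR)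
  have "z *v e i = (z ** P) *v axis i 1" by (simp only: e_def matrix_vector_mul_assoc)
  also have "\<dots> = P *v (diagm d *v axis i 1)" by (simp only: matrix_vector_mul_assoc flip: zP)
  also have "diagm d *v axis i 1 = d i *s axis i 1"
    by (simp add: vec_eq_iff matrix_axis diagm_nth) (simp add: axis_def)
  finally show ?thesis by (simp add: e_def vector_scalar_commute)
qed

text \<open>The complexification of \<open>h\<close> contains all trace zero diagonal matrices, in
  particular one separating two given coordinates.\<close>

lemma h_separates:
  assumes "\<And>k. k \<in> h \<Longrightarrow> (R ** psi k ** P) $ i $ i = (R ** psi k ** P) $ j $ j"
  shows "i = j"
proof -
  obtain z where z: "z \<in> h \<times> h" "\<forall>x y. rt x y z = of_bool (x \<in> {i}) - of_bool (y \<in> {i})"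
    using ind_test[of "{i}"] by blast
  have "fst z \<in> h" "snd z \<in> h" using z(1) by auto
  then have "rt i j z = 0" using assms z(1) by (simp add: rt_def Psi_def)
  then show ?thesis using z(2) by (auto split: if_splits simp: of_bool_def)
qed

abbreviation "flag \<equiv> column_flag R s"

lemma s_bij': "bij_betw s {1..CARD('n)} UNIV"
  using s_bij card_n by simp

end

locale su_labelled = conj_labelled "su_algebra :: (complex^('p::finite + 'q::finite)^('p + 'q)) set" comm_bracket
    "\<lambda>x. x" sgU P R a h th l \<alpha>
  for P R :: "complex^('p::finite + 'q::finite)^('p + 'q)"
    and a h :: "(complex^('p + 'q)^('p + 'q)) set" and th and l \<alpha> +
  assumes pq: "CARD('p) \<le> CARD('q)"
begin

lemma hf_sum: "hf (\<Sum>i\<in>I. f i) v = (\<Sum>i\<in>I. hf (f i) v)" "hf v (\<Sum>i\<in>I. f i) = (\<Sum>i\<in>I. hf v (f i))"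
  by (induction I rule: infinite_finite_induct) (simp_all add: hf_linear)

lemma hf_sum2: "hf (\<Sum>i\<in>I. u i *s f i) (\<Sum>j\<in>J. v j *s f' j) = (\<Sum>i\<in>I. \<Sum>j\<in>J. u i * (cnj (v j) * hf (f i) (f' j)))"
  unfolding hf_sum(1) unfolding hf_linear(3) hf_sum(2) unfolding hf_linear(4) sum_distrib_left ..

text \<open>The Gram matrix of the Hermitian form in the eigenbasis of \<open>h\<close>.\<close>

definition gm :: "'p + 'q \<Rightarrow> 'p + 'q \<Rightarrow> complex" where
  "gm i j = hf (e i) (e j)"

lemma gm_cnj: "gm j i = cnj (gm i j)"
  unfolding gm_def by (rule hf_cnj)

lemma hf_P: "hf (P *v u) (P *v v) = (\<Sum>i\<in>UNIV. \<Sum>j\<in>UNIV. u $ i * cnj (v $ j) * gm i j)"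
proof -
  have 1: "hf (P *v u) (P *v v) = (\<Sum>i\<in>UNIV. u $ i * hf (e i) (P *v v))"
    unfolding P_expand[of u] hf_sum(1) hf_linear(3) ..
  have 2: "hf w (P *v v) = (\<Sum>j\<in>UNIV. cnj (v $ j) * hf w (e j))" for w
    unfolding P_expand[of v] hf_sum(2) hf_linear(4) ..
  show ?thesis unfolding 1 unfolding 2 gm_def by (simp add: sum_distrib_left mult_ac)
qed

lemma hf_Pe: "hf (P *v u) (e j) = (\<Sum>k\<in>UNIV. u $ k * gm k j)" "hf (e i) (P *v v) = (\<Sum>k\<in>UNIV. cnj (v $ k) * gm i k)"
  unfolding P_expand hf_sum hf_linear gm_def by (rule refl)+

text \<open>Skewness of \<open>k\<close> relates the eigenvalues of any two non-orthogonal
  eigenvectors; as \<open>h\<close> separates coordinates, each row of \<open>gm\<close> has at most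
  one non-zero entry.\<close>

lemma h_eigen:
  assumes "k \<in> h"
  shows "gm i j * ((R ** k ** P) $ i $ i + cnj ((R ** k ** P) $ j $ j)) = 0"
proof -
  obtain d where d: "R ** k ** P = diagm d" using h_diag[OF assms] by blast
  note ev = diag_eigen[OF d]
  have "k \<in> su_algebra" using assms sub_h by blast
  then have "hf (k *v e i) (e j) = - hf (e i) (k *v e j)" by (rule su_skew)
  then show ?thesis by (simp add: ev hf_linear gm_def d diagm_nth algebra_simps eq_neg_iff_add_eq_0)
qed

lemma gm_unique:
  assumes "gm i j \<noteq> 0" "gm i j' \<noteq> 0"
  shows "j = j'"
proof -
  have "cnj ((R ** k ** P) $ j $ j) = cnj ((R ** k ** P) $ j' $ j')" if "k \<in> h" for k
    using h_eigen[OF that, of i j] h_eigen[OF that, of i j'] assms by (simp add: add_eq_0_iff)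
  then have "(R ** k ** P) $ j $ j = (R ** k ** P) $ j' $ j'" if "k \<in> h" for k using that complex_cnj_cancel_iff by blast
  then show ?thesis by (rule h_separates)
qed

lemma gm_ex: "\<exists>j. gm i j \<noteq> 0"
proof (rule ccontr)
  assume n: "\<nexists>j. gm i j \<noteq> 0"
  have "e i = 0"
  proof (rule hf_nondegenerate)
    fix v
    have "hf v (e i) = hf (\<Sum>j\<in>UNIV. (R *v v) $ j *s e j) (e i)" using P_expand[of "R *v v"] by (simp add: PRv)
    also have "\<dots> = (\<Sum>j\<in>UNIV. (R *v v) $ j * gm j i)" by (simp add: hf_sum hf_linear gm_def)
    also have "\<dots> = 0" using n gm_cnj[of _ i] by (intro sum.neutral) simp
    finally show "hf v (e i) = 0" .
  qed
  then show False using e_nz by blast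
qed

text \<open>The eigenline paired with line \<open>i\<close> by \<open>hf\<close>. Fixed points are
  the anisotropic lines; the others form hyperbolic pairs.\<close>

definition tau :: "'p + 'q \<Rightarrow> 'p + 'q" where
  "tau i = (THE j. gm i j \<noteq> 0)"

lemma gm_tau: "gm i j \<noteq> 0 \<longleftrightarrow> j = tau i"
proof -
  obtain k where k: "gm i k \<noteq> 0" using gm_ex[of i] by (rule exE)
  have "tau i = k" unfolding tau_def by (rule the_equality) (rule k, rule gm_unique[OF _ k])
  then show ?thesis using k gm_unique[OF k, of j] by auto
qed

lemma gm_0: "j \<noteq> tau i \<Longrightarrow> gm i j = 0"
  using gm_tau by blast

lemma tau_tau [simp]: "tau (tau i) = i"
  using gm_tau[of i "tau i"] gm_tau[of "tau i" i] gm_cnj[of "tau i" i] by simp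

lemma gm_real: "tau i = i \<Longrightarrow> Im (gm i i) = 0"
  using gm_cnj[of i i] by (simp add: complex_eq_iff)

text \<open>Skewness is checked on pairs of basis vectors, where only the Gram entries
  \<open>gm (tau j) j\<close> and \<open>gm i (tau i)\<close> survive.\<close>

lemma su_coordinates:
  assumes "trace z = 0" "\<And>i j. z $ tau j $ i * gm (tau j) j = - (cnj (z $ tau i $ j) * gm i (tau i))"
  shows "P ** z ** R \<in> su_algebra"
proof -
  let ?x = "P ** z ** R"
  have tr: "trace ?x = 0" using assms(1) by (subst trace_mul_sym) (simp add: matrix_mul_assoc PR)
  have Pe: "hf (P *v (z *v u)) (P *v v) = - hf (P *v u) (P *v (z *v v))" for u v
  proof -
    have 1: "hf (P *v (z *v axis i 1)) (P *v axis j 1) = - hf (P *v axis i 1) (P *v (z *v axis j 1))" for i j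
    proof -
      have zi: "(z *v axis i 1) $ k = z $ k $ i" for i k
        by (rule matrix_axis)
      have "hf (P *v (z *v axis i 1)) (P *v axis j 1) = (\<Sum>k\<in>UNIV. z $ k $ i * gm k j)"
        unfolding e_def[symmetric] hf_Pe zi ..
      also have "\<dots> = (\<Sum>k\<in>UNIV. if k = tau j then z $ tau j $ i * gm (tau j) j else 0)"
        by (rule sum.cong) (use gm_0[of j] tau_tau in \<open>auto, metis\<close>)
      also have "\<dots> = z $ tau j $ i * gm (tau j) j" by simp
      also have "\<dots> = - (cnj (z $ tau i $ j) * gm i (tau i))" by (rule assms(2))
      also have "cnj (z $ tau i $ j) * gm i (tau i) = (\<Sum>k\<in>UNIV. if k = tau i then cnj (z $ tau i $ j) * gm i (tau i) else 0)" by simp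
      also have "\<dots> = (\<Sum>k\<in>UNIV. cnj (z $ k $ j) * gm i k)"
        by (rule sum.cong) (use gm_0[of _ i] in auto)
      also have "\<dots> = hf (P *v axis i 1) (P *v (z *v axis j 1))"
        unfolding e_def[symmetric] hf_Pe zi ..
      finally show ?thesis .
    qed
    have lin: "A *v u = (\<Sum>i\<in>UNIV. u $ i *s (A *v axis i 1))" for A :: "complex^('p + 'q)^('p + 'q)" and u
      by (simp add: vec_eq_iff matrix_axis) (simp add: matrix_vector_nth mult.commute)
    have Pz: "P *v (z *v u) = (\<Sum>i\<in>UNIV. u $ i *s (P *v (z *v axis i 1)))" for u
      unfolding matrix_vector_mul_assoc by (rule lin)
    have "hf (P *v (z *v u)) (P *v v) = (\<Sum>i\<in>UNIV. \<Sum>j\<in>UNIV. u $ i * (cnj (v $ j) * hf (P *v (z *v axis i 1)) (P *v axis j 1)))"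
      unfolding Pz[of u] lin[of P v] by (rule hf_sum2)
    also have "\<dots> = - (\<Sum>i\<in>UNIV. \<Sum>j\<in>UNIV. u $ i * (cnj (v $ j) * hf (P *v axis i 1) (P *v (z *v axis j 1))))"
      by (simp add: 1 sum_negf)
    also have "(\<Sum>i\<in>UNIV. \<Sum>j\<in>UNIV. u $ i * (cnj (v $ j) * hf (P *v axis i 1) (P *v (z *v axis j 1)))) = hf (P *v u) (P *v (z *v v))"
      unfolding Pz[of v] lin[of P u] by (rule hf_sum2[symmetric])
    finally show ?thesis .
  qed
  have sk: "hf (?x *v v) w = - hf v (?x *v w)" for v w
    using Pe[of "R *v v" "R *v w"] by (simp add: PRv matrix_vector_mul_assoc[symmetric])
  have "hf v (sgU ?x *v w) = hf v (?x *v w)" for v w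
    using sk[of v w] hf_adjoint[of ?x v w] by simp
  then have "hf v (sgU ?x *v w - ?x *v w) = 0" for v w
    using hf_linear(2)[of v "sgU ?x *v w - ?x *v w" "?x *v w"] by simp
  then have "sgU ?x *v w - ?x *v w = 0" for w by (rule hf_nondegenerate)
  then have "sgU ?x = ?x" by (simp add: matrix_eq)
  then show ?thesis using tr by (simp add: su_iff)
qed

lemma su_coordinates_conv:
  assumes x: "x \<in> su_algebra"
  shows "(R ** x ** P) $ tau j $ i * gm (tau j) j = - (cnj ((R ** x ** P) $ tau i $ j) * gm i (tau i))"
proof -
  let ?z = "R ** x ** P"
  have zi: "(?z *v axis i 1) $ k = ?z $ k $ i" for i k
    by (rule matrix_axis)
  have xP: "P *v (?z *v v) = x *v (P *v v)" for v
    using conj_id(2)[of x] by (simp add: matrix_vector_mul_assoc matrix_mul_assoc PR)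
  have "?z $ tau j $ i * gm (tau j) j = (\<Sum>k\<in>UNIV. if k = tau j then ?z $ tau j $ i * gm (tau j) j else 0)" by simp
  also have "\<dots> = (\<Sum>k\<in>UNIV. ?z $ k $ i * gm k j)"
    by (rule sum.cong) (use gm_0[of j] tau_tau in \<open>auto, metis\<close>)
  also have "\<dots> = hf (P *v (?z *v axis i 1)) (P *v axis j 1)"
    unfolding e_def[symmetric] hf_Pe zi ..
  also have "\<dots> = - hf (P *v axis i 1) (P *v (?z *v axis j 1))"
    unfolding xP by (rule su_skew[OF x])
  also have "hf (P *v axis i 1) (P *v (?z *v axis j 1)) = (\<Sum>k\<in>UNIV. cnj (?z $ k $ j) * gm i k)"
    unfolding e_def[symmetric] hf_Pe zi ..
  also have "\<dots> = (\<Sum>k\<in>UNIV. if k = tau i then cnj (?z $ tau i $ j) * gm i (tau i) else 0)"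
    by (rule sum.cong) (use gm_0[of _ i] in auto)
  also have "\<dots> = cnj (?z $ tau i $ j) * gm i (tau i)" by simp
  finally show ?thesis .
qed

lemma diag_in_a:
  assumes d: "\<And>i. d (tau i) = - d i"
  shows "P ** diagm (\<lambda>i. complex_of_real (d i)) ** R \<in> a"
proof -
  let ?z = "diagm (\<lambda>i. complex_of_real (d i))"
  have bij: "bij_betw tau UNIV UNIV" by (rule bij_betwI[where g = tau]) auto
  have "(\<Sum>i\<in>UNIV. d i) = (\<Sum>i\<in>UNIV. d (tau i))" by (rule sum.reindex_bij_betw[OF bij, symmetric])
  also have "\<dots> = - (\<Sum>i\<in>UNIV. d i)" by (simp add: d sum_negf)
  finally have "(\<Sum>i\<in>UNIV. d i) = 0" by simp
  then have tr: "trace ?z = 0" by (simp add: trace_diagm flip: of_real_sum)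
  have "P ** ?z ** R \<in> su_algebra"
  proof (rule su_coordinates[OF tr])
    fix i j
    show "?z $ tau j $ i * gm (tau j) j = - (cnj (?z $ tau i $ j) * gm i (tau i))"
      using d[of i] by (auto simp: diagm_nth)
  qed
  then show ?thesis using conj_id(1)[of ?z] unfolding a_eq by blast
qed

lemma a_antisym:
  assumes "x \<in> a"
  shows "(R ** x ** P) $ tau i $ tau i = - (R ** x ** P) $ i $ i"
proof -
  have "x \<in> h" using assms ah by blast
  then have "(R ** x ** P) $ i $ i + cnj ((R ** x ** P) $ tau i $ tau i) = 0"
    using h_eigen[of x i "tau i"] gm_tau[of i "tau i"] by simp
  moreover have "cnj ((R ** x ** P) $ tau i $ tau i) = (R ** x ** P) $ tau i $ tau i"
    using a_real(1)[OF assms, of "tau i"] by (simp add: complex_eq_iff)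
  ultimately show ?thesis by (simp add: add_eq_0_iff)
qed

text \<open>Two anisotropic basis vectors of opposite sign would span a hyperbolic plane on which \<open>a\<close> vanishes, and
  its boost would be a hyperbolic element of the centraliser of \<open>a\<close> outside \<open>a\<close>.\<close>

lemma same_sign:
  assumes i: "tau i = i" and j: "tau j = j" and gi: "Re (gm i i) > 0" and gj: "Re (gm j j) < 0"
  shows False
proof -
  have ij: "i \<noteq> j" using gi gj by auto
  \<comment> \<open>With this ratio the off-diagonal matrix \<open>M\<close> satisfies the
    coordinate condition of \<open>su_coordinates\<close>; opposite signs make \<open>c\<close>
    positive.\<close>
  define c where "c = - Re (gm i i) / Re (gm j j)"
  have c: "c > 0" using gi gj by (simp add: c_def divide_pos_neg)
  define gx gy where "gx = Re (gm i i)" and "gy = Re (gm j j)"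
  have gii: "gm i i = of_real gx" "gm j j = of_real gy"
    using gm_real[OF i] gm_real[OF j] by (simp_all add: complex_eq_iff gx_def gy_def)
  have "c * gy = - gx" using gj by (simp add: c_def gx_def gy_def)
  then have cg: "of_real c * gm j j = - gm i i" unfolding gii by (metis of_real_mult of_real_minus)
  define M where "M = munit i j + of_real c *\<^sub>C munit j i"
  have M: "M $ x $ y = (if x = i \<and> y = j then 1 else if x = j \<and> y = i then of_real c else 0)" for x y
    using ij by (auto simp: M_def munit_nth simp del: cscaleM_simps(6))
  have "trace M = 0" using ij by (auto simp: trace_def M intro!: sum.neutral)
  have taui: "tau x = i \<longleftrightarrow> x = i" "tau x = j \<longleftrightarrow> x = j" for x using tau_tau[of x] i j by auto
  define x where "x = P ** M ** R"
  have xL: "x \<in> su_algebra" unfolding x_def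
  proof (rule su_coordinates[OF \<open>trace M = 0\<close>])
    fix p q show "M $ tau q $ p * gm (tau q) q = - (cnj (M $ tau p $ q) * gm p (tau p))"
      using ij cg by (auto simp: M taui i j)
  qed
  have px: "R ** x ** P = M" unfolding x_def by (rule conj_id)
  have zero: "(R ** k ** P) $ i $ i = 0" "(R ** k ** P) $ j $ j = 0" if "k \<in> a" for k
    using a_antisym[OF that, of i] a_antisym[OF that, of j] unfolding i j by (simp_all add: complex_eq_iff)
  have "comm_bracket x k = 0" if k: "k \<in> a" for k
  proof -
    have "comm_bracket (R ** k ** P) M = 0"
      by (auto simp: mat_eq_iff a_bracket[OF k] M zero[OF k])
    then have "R ** comm_bracket k x ** P = 0" using psi_lb[of k x] px by simp
    then have "comm_bracket k x = 0" using psi_eq_0[of "comm_bracket k x"] by simp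
    then show ?thesis using comm_bracket_skew[of x k] by simp
  qed
  then obtain u v where uv: "u \<in> a" "v \<in> su_algebra" "th v = v" "x = u + v"
    using centralizer_split[OF xL] by blast
  \<comment> \<open>\<open>f\<close> is a right eigenvector of \<open>M\<close> with eigenvalue
    \<open>r\<close> and \<open>w\<close> a left one with \<open>- r\<close>, so
    \<open>outer f w\<close> has \<open>ad M\<close>-eigenvalue \<open>2 r\<close>.\<close>
  define r where "r = sqrt c"
  have r: "r > 0" "r * r = c" using c by (simp_all add: r_def)
  define f where "f = axis i 1 + of_real r *s axis j (1::complex)"
  define w where "w = axis j 1 + (- of_real r) *s axis i (1::complex)"
  have fn: "f $ k = (if k = i then 1 else if k = j then of_real r else 0)"
    "w $ k = (if k = j then 1 else if k = i then - of_real r else 0)" for k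
    using ij by (auto simp: f_def w_def axis_def)
  have "dotp w f = (\<Sum>k\<in>UNIV. (if k = j then of_real r else 0) + (if k = i then - of_real r else 0))"
    unfolding dotp_def by (rule sum.cong) (use ij in \<open>auto simp: fn\<close>)
  also have "\<dots> = 0" by (simp add: sum.distrib)
  finally have tr: "trace (outer f w) = 0" by (simp add: trace_outer)
  have "outer f w $ i $ j = 1" by (simp add: fn)
  then have nz: "outer f w \<noteq> 0" by (metis zero_index zero_neq_one)
  have "M *v f = of_real r *s f"
  proof -
    have "(M *v f) $ k = of_real r * f $ k" for k
    proof -
      have "(M *v f) $ k = (\<Sum>y\<in>UNIV. (if y = j then (if k = i then f $ j else 0) else 0) + (if y = i then (if k = j then of_real c * f $ i else 0) else 0))"
        unfolding matrix_vector_nth by (rule sum.cong) (use ij in \<open>auto simp: M\<close>)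
      also have "\<dots> = (if k = i then f $ j else 0) + (if k = j then of_real c * f $ i else 0)" by (simp add: sum.distrib)
      also have "\<dots> = of_real r * f $ k" using ij r(2) by (auto simp: fn simp flip: of_real_mult)
      finally show ?thesis .
    qed
    then show ?thesis by (simp add: vec_eq_iff)
  qed
  moreover have "w v* M = (- of_real r) *s w"
  proof -
    have "(w v* M) $ k = - of_real r * w $ k" for k
    proof -
      have "(w v* M) $ k = (\<Sum>y\<in>UNIV. (if y = i then (if k = j then w $ i else 0) else 0) + (if y = j then (if k = i then of_real c * w $ j else 0) else 0))"
        unfolding vector_matrix_mult_def vec_lambda_beta by (rule sum.cong) (use ij in \<open>auto simp: M\<close>)
      also have "\<dots> = (if k = j then w $ i else 0) + (if k = i then of_real c * w $ j else 0)" by (simp add: sum.distrib)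
      also have "\<dots> = - of_real r * w $ k" using ij r(2) by (auto simp: fn simp flip: of_real_mult)
      finally show ?thesis .
    qed
    then show ?thesis by (simp add: vec_eq_iff)
  qed
  ultimately have MB: "comm_bracket M (outer f w) = (2 * of_real r) *\<^sub>C outer f w"
    by (simp only: comm_bracket_def mult_outer outer_mult outer_linear)
      (simp add: mat_eq_iff algebra_simps, simp add: scaleR_conv_of_real)
  \<comment> \<open>The part \<open>u\<close> in \<open>a\<close> is zero at positions
    \<open>i\<close> and \<open>j\<close>, so the non-zero real eigenvalue \<open>2 r\<close>
    belongs to \<open>v\<close>, whose eigenvalues are imaginary.\<close>
  have "comm_bracket (R ** u ** P) (outer f w) = 0"
    by (auto simp: mat_eq_iff a_bracket[OF uv(1)] fn zero[OF uv(1)])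
  moreover have "R ** v ** P = M - R ** u ** P"
  proof -
    have "R ** (u + v) ** P = M" using px uv(4) by simp
    then have "R ** u ** P + R ** v ** P = M" by (simp add: matrix_ring_simps)
    then show ?thesis by (simp add: eq_diff_eq add.commute)
  qed
  ultimately have "comm_bracket (R ** v ** P) (outer f w) = (2 * of_real r) *\<^sub>C outer f w"
    using MB by (simp add: comm_bracket_diff)
  then have "Re (2 * of_real r) = 0" by (rule ad_compact_imaginary[OF uv(2,3) tr nz])
  then show False using r(1) by simp
qed

text \<open>\<open>C\<close> collects the anisotropic basis vectors and one from each hyperbolic pair; the Hermitian form is
  semidefinite on its span.\<close>

lemma card_nonpositive:
  assumes C: "\<And>i. i \<in> C \<Longrightarrow> tau i \<noteq> i \<Longrightarrow> tau i \<notin> C"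
  shows "card C \<le> CARD('q)"
proof -
  let ?U = "{v :: complex^('p + 'q). \<forall>i. i \<notin> C \<longrightarrow> v $ i = 0}"
  have sU: "vec.subspace ?U" by (auto simp: vec.subspace_def)
  have dU: "vec.dim ?U = card C" by (rule dim_substandard_cart)
  \<comment> \<open>On the span of \<open>C\<close> every hyperbolic pair is represented at most
    once, so only the diagonal terms of the fixed points remain.\<close>
  have hv: "hf (P *v v) (P *v v) = (\<Sum>i\<in>UNIV. if tau i = i then of_real ((cmod (v $ i))\<^sup>2 * Re (gm i i)) else 0)" if v: "v \<in> ?U" for v
  proof -
    have "(\<Sum>j\<in>UNIV. v $ i * cnj (v $ j) * gm i j) = (if tau i = i then of_real ((cmod (v $ i))\<^sup>2 * Re (gm i i)) else 0)" for i
    proof -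
      have "(\<Sum>j\<in>UNIV. v $ i * cnj (v $ j) * gm i j) = (\<Sum>j\<in>UNIV. if j = tau i then v $ i * cnj (v $ tau i) * gm i (tau i) else 0)"
        by (rule sum.cong) (use gm_0[of _ i] in auto)
      also have "\<dots> = v $ i * cnj (v $ tau i) * gm i (tau i)" by simp
      also have "\<dots> = (if tau i = i then of_real ((cmod (v $ i))\<^sup>2 * Re (gm i i)) else 0)"
      proof (cases "tau i = i")
        case True
        have "gm i i = of_real (Re (gm i i))" using gm_real[OF True] by (simp add: complex_eq_iff)
        then show ?thesis using True complex_norm_square[of "v $ i"] by (metis of_real_mult)
      next
        case False
        then have "v $ i = 0 \<or> v $ tau i = 0" using C v by blast
        then show ?thesis using False by auto
      qed
      finally show ?thesis .
    qed
    then show ?thesis unfolding hf_P by simp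
  qed
  have hv': "Re (hf (P *v v) (P *v v)) = (\<Sum>i\<in>UNIV. if tau i = i then (cmod (v $ i))\<^sup>2 * Re (gm i i) else 0)" if "v \<in> ?U" for v
    unfolding hv[OF that] Re_sum by (rule sum.cong) auto
  have P0: "v = 0" if "P *v v = 0" for v using that PRv(2)[of v] by simp
  have lin: "Vector_Spaces.linear (*s) (*s) (\<lambda>v. p1 (P *v v))" "Vector_Spaces.linear (*s) (*s) (\<lambda>v. p2 (P *v v))"
    by (simp_all add: Vector_Spaces.linear_iff vec.vector_space_axioms vec_eq_iff matrix_vector_right_distrib vector_scalar_commute)
  have cd: "Re (cdot x x) \<ge> 0" "Re (cdot x x) = 0 \<Longrightarrow> x = 0" for x :: "complex^'k"
    using cdot_self_pos[of x] by (cases "x = 0"; auto simp: cdot_linear)+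
  \<comment> \<open>By \<open>same_sign\<close> the form is semidefinite on the span; the projection
    to the definite part of that sign is then injective, so the dimension is at most
    \<open>q\<close> or at most \<open>p\<close>.\<close>
  consider "\<And>i. tau i = i \<Longrightarrow> Re (gm i i) \<le> 0" | "\<And>i. tau i = i \<Longrightarrow> Re (gm i i) \<ge> 0"
    using same_sign by (meson not_less)
  then show ?thesis
  proof cases
    case 1
    have "v = 0" if v: "v \<in> ?U" "p2 (P *v v) = 0" for v
    proof -
      have "Re (hf (P *v v) (P *v v)) \<le> 0"
        unfolding hv'[OF v(1)] using 1 by (intro sum_nonpos) (auto intro: mult_nonneg_nonpos)
      then have "Re (cdot (p1 (P *v v)) (p1 (P *v v))) \<le> 0" using v(2) by (simp add: hf_cdot cdot_linear)
      then have "p1 (P *v v) = 0" using cd[of "p1 (P *v v)"] by force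
      then have "P *v v = 0" using v(2) by (simp add: vec_Plus_eq_iff[of "P *v v" 0])
      then show ?thesis by (rule P0)
    qed
    then have "vec.dim ?U \<le> CARD('q)" by (intro dim_le_of_inj[OF lin(2) sU])
    then show ?thesis by (simp only: dU)
  next
    case 2
    have "v = 0" if v: "v \<in> ?U" "p1 (P *v v) = 0" for v
    proof -
      have "Re (hf (P *v v) (P *v v)) \<ge> 0"
        unfolding hv'[OF v(1)] using 2 by (intro sum_nonneg) auto
      then have "Re (cdot (p2 (P *v v)) (p2 (P *v v))) \<le> 0" using v(2) by (simp add: hf_cdot cdot_linear)
      then have "p2 (P *v v) = 0" using cd[of "p2 (P *v v)"] by force
      then have "P *v v = 0" using v(2) by (simp add: vec_Plus_eq_iff[of "P *v v" 0])
      then show ?thesis by (rule P0)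
    qed
    then have "vec.dim ?U \<le> CARD('p)" by (intro dim_le_of_inj[OF lin(1) sU])
    then show ?thesis using pq by (simp only: dU)
  qed
qed

definition T :: "nat \<Rightarrow> nat" where
  "T i = pos (tau (s i))"

lemma T: "T i \<in> {1..l+1}" "s (T i) = tau (s i)" "i \<in> {1..l+1} \<Longrightarrow> T (T i) = i"
proof -
  show "T i \<in> {1..l+1}" unfolding T_def by (rule pos(1))
  show "s (T i) = tau (s i)" unfolding T_def by (rule pos(2))
  show "T (T i) = i" if "i \<in> {1..l+1}" by (simp only: T_def pos(2) tau_tau pos(3)[OF that])
qed

text \<open>The values \<open>K\<close> of a regular element decrease along the chain and change
  sign under \<open>T\<close>. Once the first \<open>p\<close> of them are known to be positive,
  their partners must fill the end of the chain.\<close>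

lemma T_segment:
  assumes t: "t \<le> CARD('p)" and i: "i \<in> {1..l+1}"
  shows "i \<le> t \<longleftrightarrow> l + 1 - t < T i"
proof -
  obtain k where k: "k \<in> a" "\<And>i j. 1 \<le> i \<Longrightarrow> i < j \<Longrightarrow> j \<le> l + 1 \<Longrightarrow>
    (\<forall>x\<in>a. (R ** x ** P) $ s i $ s i = (R ** x ** P) $ s j $ s j) \<or> Re ((R ** k ** P) $ s i $ s i) > Re ((R ** k ** P) $ s j $ s j)"
    using ex_regular by blast
  define K where "K i = Re ((R ** k ** P) $ s i $ s i)" for i
  have KT: "K (T i) = - K i" for i using a_antisym[OF k(1), of "s i"] by (simp add: K_def T)
  \<comment> \<open>If one of the two positions is not fixed, say \<open>b\<close>, the diagonal
    with 1 at \<open>b\<close> and -1 at its partner lies in \<open>a\<close> and separates them; so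
    \<open>K\<close> cannot be constant.\<close>
  have strict: "K i > K j" if ij: "1 \<le> i" "i < j" "j \<le> l + 1" "T i \<noteq> i \<or> T j \<noteq> j" for i j
  proof -
    have m: "i \<in> {1..l+1}" "j \<in> {1..l+1}" using ij by auto
    obtain b where b: "b \<in> {i, j}" "T b \<noteq> b" using ij(4) by blast
    have bm: "b \<in> {1..l+1}" using b m by auto
    have tb: "tau (s b) \<noteq> s b" using b(2) T(2)[of b] s_inj[OF T(1) bm, of b] by auto
    define d where "d x = (if x = s b then 1 else if x = tau (s b) then - 1 else 0 :: real)" for x
    have tx: "tau x = y \<longleftrightarrow> x = tau y" for x y by (metis tau_tau)
    have "d (tau x) = - d x" for x using tb by (auto simp: d_def tx)
    then have x: "P ** diagm (\<lambda>i. complex_of_real (d i)) ** R \<in> a" by (rule diag_in_a)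
    have "d (s i) \<noteq> d (s j)" using b(1) s_inj[OF m] ij(2) by (auto simp: d_def)
    then have "\<not> (\<forall>x\<in>a. (R ** x ** P) $ s i $ s i = (R ** x ** P) $ s j $ s j)"
      using x conj_id(1)[of "diagm (\<lambda>i. complex_of_real (d i))"] by (metis (no_types, lifting) diagm_nth of_real_eq_iff)
    then show ?thesis using k(2)[OF ij(1-3)] by (auto simp: K_def)
  qed
  have mono: "K i \<ge> K j" if ij: "1 \<le> i" "i < j" "j \<le> l + 1" for i j
    using k(2)[OF ij] k(1) by (force simp: K_def)
  have fixed: "T i = i" if "K i = 0" "i \<in> {1..l+1}" for i
  proof (rule ccontr)
    assume n: "T i \<noteq> i"
    have "K (T i) = K i" using KT[of i] that by simp
    moreover have "K i > K (T i) \<or> K (T i) > K i"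
      using strict[of i "T i"] strict[of "T i" i] n T(1)[of i] that(2) by (cases "i < T i") auto
    ultimately show False by simp
  qed
  \<comment> \<open>Positions with \<open>K \<le> 0\<close> contain no full pair, so there are at
    most \<open>q\<close> of them. A failure at \<open>i \<le> p\<close> would make all
    \<open>l + 2 - i > q\<close> positions from \<open>i\<close> on non-positive.\<close>
  have Kpos: "K i > 0" if i: "i \<in> {1..CARD('p)}" for i
  proof (rule ccontr)
    assume n: "\<not> K i > 0"
    let ?C = "{x. K (pos x) \<le> 0}"
    have Cc: "tau x \<notin> ?C" if "x \<in> ?C" "tau x \<noteq> x" for x
    proof -
      have px: "pos x \<in> {1..l+1}" "s (pos x) = x" by (rule pos(1), rule pos(2))
      have Tx: "T (pos x) = pos (tau x)" by (simp add: T_def px)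
      have "K (pos x) \<noteq> 0"
      proof
        assume "K (pos x) = 0"
        then have "pos (tau x) = pos x" using fixed[OF _ px(1)] Tx by simp
        then show False using that(2) by (simp add: pos_inj)
      qed
      then show ?thesis using that(1) KT[of "pos x"] Tx by simp
    qed
    have "card ?C \<le> CARD('q)" by (rule card_nonpositive) (use Cc in blast)
    moreover have "s ` {i..l+1} \<subseteq> ?C"
    proof
      fix x assume "x \<in> s ` {i..l+1}"
      then obtain j where j: "j \<in> {i..l+1}" "x = s j" by blast
      then have "pos x = j" using i by (simp add: pos)
      moreover have "K j \<le> K i" using mono[of i j] i j by (cases "i = j") auto
      ultimately show "x \<in> ?C" using n by simp
    qed
    then have "card (s ` {i..l+1}) \<le> card ?C" by (intro card_mono) simp_all
    moreover have "inj_on s {i..l+1}" using s_bij i by (auto simp: bij_betw_def intro: inj_on_subset)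
    ultimately have "l + 2 - i \<le> CARD('q)" by (simp add: card_image)
    moreover have "CARD('p) + CARD('q) = l + 1" using card_n by simp
    ultimately show False using i unfolding atLeastAtMost_iff by linarith
  qed
  have pl: "CARD('p) \<le> l + 1" using card_n by simp
  have "t \<le> l + 1" using t pl by linarith
  then have sub: "{1..t} \<subseteq> {1..l+1}" unfolding atLeastatMost_subset_iff by simp
  have inj: "inj_on T {1..t}"
  proof (rule inj_onI)
    fix x y assume xy: "x \<in> {1..t}" "y \<in> {1..t}" "T x = T y"
    have m: "x \<in> {1..l+1}" "y \<in> {1..l+1}" by (rule subsetD[OF sub xy(1)], rule subsetD[OF sub xy(2)])
    have "T (T x) = T (T y)" by (rule arg_cong[OF xy(3)])
    then show "x = y" by (simp only: T(3)[OF m(1)] T(3)[OF m(2)])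
  qed
  \<comment> \<open>If \<open>y\<close> lies behind a partner of \<open>b\<close>, then
    \<open>K (T y) \<ge> K b\<close>; since \<open>b\<close> is not fixed, strictness forces
    \<open>T y \<le> b\<close>.\<close>
  have "T ` {1..t} = {l + 1 + 1 - t..l + 1}"
  proof (rule up_closed_segment)
    show "T ` {1..t} \<subseteq> {1..l+1}" using T(1) by blast
    show "card (T ` {1..t}) = t" using inj by (simp add: card_image)
    fix x y assume x: "x \<in> T ` {1..t}" and xy: "x < y" "y \<le> l + 1"
    then obtain b where b: "b \<in> {1..t}" "x = T b" by blast
    have x1: "1 \<le> x" "x \<in> {1..l+1}" and y1: "y \<in> {1..l+1}" using b T(1)[of b] xy by auto
    have Tx: "T x = b" using b T(3) sub by auto
    have Kb: "K b > 0" using Kpos[of b] b t by auto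
    have Ky: "K y \<le> K x" by (rule mono[OF x1(1) xy])
    have Kx: "K x = - K b" using KT[of b] b by simp
    have KTy: "K (T y) \<ge> K b" using KT[of y] Ky Kx by simp
    have "T y \<le> b"
    proof (rule ccontr)
      assume "\<not> T y \<le> b"
      moreover have "T b \<noteq> b" using KT[of b] Kb by auto
      ultimately have "K b > K (T y)" using strict[of b "T y"] T(1)[of y] b by auto
      then show False using KTy by simp
    qed
    then have "T y \<in> {1..t}" using b T(1)[of y] by auto
    then show "y \<in> T ` {1..t}" using T(3)[OF y1] by (metis image_eqI)
  qed
  moreover have "i \<le> t \<longleftrightarrow> T i \<in> T ` {1..t}"
  proof
    assume "T i \<in> T ` {1..t}"
    then obtain b where b: "b \<in> {1..t}" "T i = T b" by blast
    have bm: "b \<in> {1..l+1}" using sub b(1) by (rule subsetD)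
    have "T (T i) = T (T b)" by (rule arg_cong[OF b(2)])
    then have "i = b" by (simp only: T(3)[OF bm] T(3)[OF i])
    then show "i \<le> t" using b(1) by simp
  qed (use i in auto)
  ultimately show ?thesis using T(1)[of i] t pl by auto
qed

text \<open>Diagonal 1 on the first \<open>t\<close> positions, -1 on the last \<open>t\<close> and
  0 between: antisymmetric under the pairing, hence in \<open>a\<close>.\<close>

definition D :: "nat \<Rightarrow> complex^('p + 'q)^('p + 'q)" where
  "D t = P ** diagm (\<lambda>x. complex_of_real (of_bool (pos x \<le> t) + of_bool (pos x \<le> l + 1 - t) - 1)) ** R"

lemma D_in_a: "t \<le> CARD('p) \<Longrightarrow> D t \<in> a"
  unfolding D_def
proof (rule diag_in_a)
  fix x
  assume t: "t \<le> CARD('p)"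
  have px: "pos x \<in> {1..l+1}" "pos (tau x) = T (pos x)"
    using pos(1)[of x] by (simp_all add: T_def pos(2))
  have "pos x \<le> t \<longleftrightarrow> l + 1 - t < pos (tau x)" using T_segment[OF t px(1)] px by simp
  moreover have "pos (tau x) \<le> t \<longleftrightarrow> l + 1 - t < pos x"
    using T_segment[OF t T(1)[of "pos x"]] T(3)[OF px(1)] px(2) by simp
  ultimately show "of_bool (pos (tau x) \<le> t) + of_bool (pos (tau x) \<le> l + 1 - t) - 1
      = - (of_bool (pos x \<le> t) + of_bool (pos x \<le> l + 1 - t) - 1 :: real)"
    by (auto simp: of_bool_def not_le)
qed

lemma D_diag: "i \<in> {1..l+1} \<Longrightarrow> (R ** D t ** P) $ s i $ s i = of_real (of_bool (i \<le> t) + of_bool (i \<le> l + 1 - t) - 1)"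
  unfolding D_def conj_id by (simp add: diagm_nth pos)

lemma flag:
  assumes t: "t \<le> CARD('p)"
  shows "isotropic (flag t)" "vec.dim (flag t) = t"
proof -
  have pl: "2 * t \<le> l + 1" using t pq card_n by simp
  show "vec.dim (flag t) = t" using dim_column_flag[OF PR s_bij'] pl card_n by simp
  have "hf u v = 0" if uv: "u \<in> flag t" "v \<in> flag t" for u v
  proof -
    have z: "(R *v u) $ x * cnj ((R *v v) $ y) * gm x y = 0" for x y
    proof (rule ccontr)
      assume n: "(R *v u) $ x * cnj ((R *v v) $ y) * gm x y \<noteq> 0"
      have "pos x \<le> t"
      proof (rule ccontr)
        assume "\<not> pos x \<le> t"
        then have "(R *v u) $ s (pos x) = 0" using uv(1) pos(1)[of x] unfolding column_flag_def card_n by auto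
        then show False using n by (simp add: pos)
      qed
      moreover have "pos y \<le> t"
      proof (rule ccontr)
        assume "\<not> pos y \<le> t"
        then have "(R *v v) $ s (pos y) = 0" using uv(2) pos(1)[of y] unfolding column_flag_def card_n by auto
        then show False using n by (simp add: pos)
      qed
      moreover have "y = tau x" using n gm_0 by auto
      then have "pos y = T (pos x)" by (simp add: T_def pos)
      ultimately show False using T_segment[OF t pos(1)[of x]] pl by simp
    qed
    have "hf (P *v (R *v u)) (P *v (R *v v)) = 0" unfolding hf_P by (intro sum.neutral ballI z)
    then show ?thesis by (simp add: PRv)
  qed
  then show "isotropic (flag t)" by (simp add: isotropic_def subspace_column_flag)
qed

lemma BI_flag:
  assumes t: "1 \<le> t" "t \<le> CARD('p)"
  shows "BI su_algebra comm_bracket a h l \<alpha> {t, l + 1 - t} = range_ideal (flag t)"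
    "admissible su_algebra comm_bracket a h l \<alpha> {t, l + 1 - t}"
proof -
  have pl: "2 * t \<le> l + 1" using t pq card_n by simp
  have tt: "1 \<le> t" "t \<le> l + 1 - t" "l + 1 - t \<le> l" using t pl by auto
  \<comment> \<open>This index set is invariant under reversing the diagram, so the ambiguity in
    \<open>rho\<close> is harmless here.\<close>
  have I: "{rho t, rho (l + 1 - t)} = {t, l + 1 - t}"
    using rho_cases tt by auto
  note D = D_in_a[OF t(2)] D_diag
  show "admissible su_algebra comm_bracket a h l \<alpha> {t, l + 1 - t}"
    using D_admissible[OF tt D] unfolding I by simp
  have "x \<in> supported t (l + 1 - t) \<longleftrightarrow> x \<in> range_ideal (flag t)" for x
  proof -
    have rows: "(\<forall>v. x *v v \<in> flag t) \<longleftrightarrow> (\<forall>i\<in>{1..l+1}. \<forall>j\<in>{1..l+1}. (R ** x ** P) $ s i $ s j \<noteq> 0 \<longrightarrow> i \<le> t)"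
      using range_in_column_flag[OF PR s_bij', of x t] unfolding card_n .
    \<comment> \<open>Skewness carries entry \<open>(i, j)\<close> to entry
      \<open>(T j, T i)\<close>, so the bound on rows already yields the bound on columns.\<close>
    have cols: "l + 1 - t < j"
      if x: "x \<in> su_algebra" "\<forall>i\<in>{1..l+1}. \<forall>j\<in>{1..l+1}. (R ** x ** P) $ s i $ s j \<noteq> 0 \<longrightarrow> i \<le> t"
        and ij: "i \<in> {1..l+1}" "j \<in> {1..l+1}" "(R ** x ** P) $ s i $ s j \<noteq> 0" for i j
    proof -
      have "(R ** x ** P) $ tau (tau (s i)) $ s j * gm (tau (tau (s i))) (tau (s i)) \<noteq> 0"
        using ij(3) gm_tau[of "s i" "tau (s i)"] by simp
      then have "(R ** x ** P) $ tau (s j) $ tau (s i) \<noteq> 0"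
        unfolding su_coordinates_conv[OF x(1), of "tau (s i)" "s j"] by auto
      then have "T j \<le> t" using x(2) T(1)[of j] T(1)[of i] unfolding T(2)[symmetric] by blast
      then show ?thesis using T_segment[OF t(2) T(1)[of j]] T(3)[OF ij(2)] by simp
    qed
    show ?thesis
      unfolding supported_def range_ideal_def mem_Collect_eq rows using cols by blast
  qed
  then show "BI su_algebra comm_bracket a h l \<alpha> {t, l + 1 - t} = range_ideal (flag t)"
    using BI_eq[OF tt D] unfolding I by blast
qed

lemma flag_strict:
  assumes "t < t'" "t' \<le> CARD('p)"
  shows "flag t \<subset> flag t'"
proof -
  have "flag t \<noteq> flag t'" using flag(2)[of t] flag(2)[of t'] assms by auto
  then show ?thesis using column_flag_mono[of t t'] assms by auto
qed

end

section \<open>Quaternionic matrices as complex matrices\<close>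

text \<open>A quaternion is \<open>a + b j\<close> with complex \<open>a = qa\<close> and \<open>b = qb\<close>.\<close>

definition qa :: "quat \<Rightarrow> complex" where "qa q = Complex (qRe q) (qI q)"
definition qb :: "quat \<Rightarrow> complex" where "qb q = Complex (qJ q) (qK q)"

lemma qab_hom:
  "qa (x + y) = qa x + qa y" "qb (x + y) = qb x + qb y" "qa 0 = 0" "qb 0 = 0"
  "qa (c *\<^sub>R x) = of_real c * qa x" "qb (c *\<^sub>R x) = of_real c * qb x"
  "qa (x - y) = qa x - qa y" "qb (x - y) = qb x - qb y"
  "qa (x * y) = qa x * qa y - qb x * cnj (qb y)" "qb (x * y) = qa x * qb y + qb x * cnj (qa y)"
  by (simp_all add: qa_def qb_def complex_eq_iff plus_quat_def zero_quat_def scaleR_quat_def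
      minus_quat_def times_quat_def)

lemma qab_eq: "x = y \<longleftrightarrow> qa x = qa y \<and> qb x = qb y"
  by (cases x; cases y) (auto simp: qa_def qb_def)

lemma qab_sum: "qa (\<Sum>i\<in>I. f i) = (\<Sum>i\<in>I. qa (f i))" "qb (\<Sum>i\<in>I. f i) = (\<Sum>i\<in>I. qb (f i))"
  by (induction I rule: infinite_finite_induct) (simp_all add: qab_hom)

text \<open>The embedding sending \<open>a + b j\<close> to the block matrix with rows
  \<open>a, b\<close> and \<open>- cnj b, cnj a\<close>.\<close>

definition psiH :: "quat^'m^'m \<Rightarrow> complex^('m::finite + 'm)^('m + 'm)" where
  "psiH x = (\<chi> i j. case i of
      Inl a \<Rightarrow> (case j of Inl b \<Rightarrow> qa (x $ a $ b) | Inr b \<Rightarrow> qb (x $ a $ b))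
    | Inr a \<Rightarrow> (case j of Inl b \<Rightarrow> - cnj (qb (x $ a $ b)) | Inr b \<Rightarrow> cnj (qa (x $ a $ b))))"

lemma psiH_nth [simp]:
  "psiH x $ Inl a $ Inl b = qa (x $ a $ b)" "psiH x $ Inl a $ Inr b = qb (x $ a $ b)"
  "psiH x $ Inr a $ Inl b = - cnj (qb (x $ a $ b))" "psiH x $ Inr a $ Inr b = cnj (qa (x $ a $ b))"
  by (simp_all add: psiH_def)

lemma mat_Plus_eq_iff:
  fixes A B :: "complex^('p::finite + 'q::finite)^('r::finite + 's::finite)"
  shows "A = B \<longleftrightarrow> (\<forall>a b. A $ Inl a $ Inl b = B $ Inl a $ Inl b) \<and> (\<forall>a b. A $ Inl a $ Inr b = B $ Inl a $ Inr b)
    \<and> (\<forall>a b. A $ Inr a $ Inl b = B $ Inr a $ Inl b) \<and> (\<forall>a b. A $ Inr a $ Inr b = B $ Inr a $ Inr b)" (is "_ \<longleftrightarrow> ?R")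
proof
  assume r: ?R
  have "A $ i $ j = B $ i $ j" for i j using r by (cases i; cases j) auto
  then show "A = B" by (simp add: mat_eq_iff)
qed simp

lemma psiH_hom: "psiH (x + y) = psiH x + psiH y" "psiH (x - y) = psiH x - psiH y" "psiH (c *\<^sub>R x) = c *\<^sub>R psiH x"
  by (auto simp: mat_Plus_eq_iff qab_hom scaleR_conv_of_real[where 'a = complex])

lemma psiH_mult: "psiH (x ** y) = psiH x ** psiH y"
  unfolding mat_Plus_eq_iff
  by (simp add: matrix_mult_nth sum_Plus qab_sum qab_hom sum_subtractf sum.distrib sum_negf)

definition fl :: "'m + 'm \<Rightarrow> 'm + 'm" where
  "fl i = (case i of Inl a \<Rightarrow> Inr a | Inr a \<Rightarrow> Inl a)"

lemma fl_simps [simp]: "fl (Inl a) = Inr a" "fl (Inr a) = Inl a" "fl (fl i) = i" "eps (fl i) = - eps i"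
  by (auto simp: fl_def split: sum.splits)

lemma sum_fl: "(\<Sum>i\<in>UNIV. f (fl i)) = (\<Sum>i\<in>(UNIV :: ('m::finite + 'm) set). f i)"
  by (rule sum.reindex_bij_betw) (rule bij_betwI[where g = fl], auto)

text \<open>Conjugation by the quaternionic structure \<open>jq\<close>; its fixed points are the
  matrices commuting with \<open>jq\<close>, as \<open>jq_mult\<close> shows.\<close>

definition sgH :: "complex^('m::finite + 'm)^('m + 'm) \<Rightarrow> complex^('m + 'm)^('m + 'm)" where
  "sgH z = (\<chi> i j. eps i * eps j * cnj (z $ fl i $ fl j))"

text \<open>The antilinear structure map with square -1 that turns the complex vectors into a
  quaternionic space.\<close>

definition jq :: "complex^('m::finite + 'm) \<Rightarrow> complex^('m + 'm)" where
  "jq v = (\<chi> i. eps i * cnj (v $ fl i))"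

lemma sgH_nth: "sgH z $ i $ j = eps i * eps j * cnj (z $ fl i $ fl j)"
  by (simp add: sgH_def)

lemma jq_nth: "jq v $ i = eps i * cnj (v $ fl i)"
  by (simp add: jq_def)

lemma jq_mult: "jq (z *v v) = sgH z *v jq v"
proof -
  have "(sgH z *v jq v) $ i = jq (z *v v) $ i" for i
  proof -
    have "(sgH z *v jq v) $ i = (\<Sum>j\<in>UNIV. eps i * cnj (z $ fl i $ fl j * v $ fl j))"
      unfolding matrix_vector_nth sgH_nth jq_nth by (rule sum.cong) (simp_all add: mult_ac)
    also have "\<dots> = (\<Sum>j\<in>UNIV. eps i * cnj (z $ fl i $ j * v $ j))" by (rule sum_fl)
    also have "\<dots> = jq (z *v v) $ i" by (simp add: jq_nth matrix_vector_nth sum_distrib_left)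
    finally show ?thesis .
  qed
  then show ?thesis by (simp add: vec_eq_iff)
qed

lemma jq_jq [simp]: "jq (jq v) = - v"
  by (simp add: vec_eq_iff jq_nth)

lemma jq_linear: "jq (u + v) = jq u + jq v" "jq (c *s v) = cnj c *s jq v" "jq 0 = 0" "jq (- v) = - jq v"
  by (simp_all add: vec_eq_iff jq_nth algebra_simps)

lemma jq_eq_0: "jq v = 0 \<longleftrightarrow> v = 0"
  using jq_jq[of v] jq_linear(3) by (metis neg_equal_0_iff_equal)

lemma jq_sum: "jq (\<Sum>i\<in>I. f i) = (\<Sum>i\<in>I. jq (f i))"
  by (induction I rule: infinite_finite_induct) (simp_all add: jq_linear)

lemma sgH_eqI:
  assumes "\<And>v. z *v jq v = jq (z *v v)"
  shows "sgH z = z"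
proof -
  have "sgH z *v w = z *v w" for w
    using assms[of "- jq w"] jq_mult[of z "- jq w"] by (simp add: jq_linear)
  then show ?thesis by (simp add: matrix_eq)
qed

lemma sgH_hom: "sgH (z + w) = sgH z + sgH w" "sgH (z - w) = sgH z - sgH w" "sgH (c *\<^sub>C z) = cnj c *\<^sub>C sgH z" "sgH (sgH z) = z"
  by (auto simp: mat_eq_iff sgH_nth algebra_simps)

lemma sgH_mult: "sgH (z ** w) = sgH z ** sgH w"
proof -
  have "sgH (z ** w) *v v = (sgH z ** sgH w) *v v" for v
    using jq_mult[of "z ** w" "- jq v"] jq_mult[of w "- jq v"] jq_mult[of z "w *v (- jq v)"]
    by (simp add: jq_linear flip: matrix_vector_mul_assoc)
  then show ?thesis by (simp add: matrix_eq)
qed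

lemma sgH_outer: "sgH (outer u w) = outer (jq u) (jq w)"
  by (simp add: mat_eq_iff sgH_nth jq_nth mult_ac)

lemma dotp_jq: "dotp (jq w) (jq v) = cnj (dotp w v)"
proof -
  have "dotp (jq w) (jq v) = (\<Sum>i\<in>UNIV. cnj (w $ fl i * v $ fl i))"
    unfolding dotp_def jq_nth by (rule sum.cong) (simp_all add: mult_ac)
  also have "\<dots> = (\<Sum>i\<in>UNIV. cnj (w $ i * v $ i))" by (rule sum_fl)
  finally show ?thesis by (simp add: dotp_def)
qed

lemma trace_psiH: "trace (psiH x) = 2 * of_real (qRe (trace x))"
proof -
  have q: "qRe (\<Sum>i\<in>I. f i) = (\<Sum>i\<in>I. qRe (f i))" for f and I :: "'a set"
    by (induction I rule: infinite_finite_induct) (simp_all add: plus_quat_def zero_quat_def)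
  have "trace (psiH x) = (\<Sum>a\<in>UNIV. qa (x $ a $ a) + cnj (qa (x $ a $ a)))"
    by (simp add: trace_def sum_Plus sum.distrib)
  also have "\<dots> = 2 * of_real (qRe (trace x))"
    by (simp add: trace_def q qa_def complex_eq_iff sum_distrib_left)
  finally show ?thesis .
qed

interpretation slh: real_form "slH_algebra :: (quat^'m::finite^'m) set" comm_bracket psiH sgH
proof (rule real_form.intro)
  show "linear (psiH :: quat^'m^'m \<Rightarrow> _)" by (rule linearI) (simp_all add: psiH_hom)
  show "inj (psiH :: quat^'m^'m \<Rightarrow> _)"
  proof (rule injI)
    fix x y :: "quat^'m^'m" assume "psiH x = psiH y"
    then have "\<forall>a b. qa (x $ a $ b) = qa (y $ a $ b)" "\<forall>a b. qb (x $ a $ b) = qb (y $ a $ b)" by (simp_all add: mat_Plus_eq_iff)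
    then show "x = y" by (simp add: vec_eq_iff qab_eq)
  qed
  show "psiH (comm_bracket x y) = comm_bracket (psiH x) (psiH y)" for x y :: "quat^'m^'m"
    by (simp add: comm_bracket_def psiH_hom psiH_mult)
  show "psiH ` (slH_algebra :: (quat^'m^'m) set) = {z. trace z = 0 \<and> sgH z = z}"
  proof (intro set_eqI iffI)
    fix z assume "z \<in> psiH ` (slH_algebra :: (quat^'m^'m) set)"
    then obtain x :: "quat^'m^'m" where x: "qRe (trace x) = 0" "z = psiH x" by (auto simp: slH_algebra_def)
    have "sgH (psiH x) = psiH x" by (simp add: mat_Plus_eq_iff sgH_nth)
    then show "z \<in> {z. trace z = 0 \<and> sgH z = z}" using x by (simp add: trace_psiH)
  next
    fix z :: "complex^('m + 'm)^('m + 'm)" assume z: "z \<in> {z. trace z = 0 \<and> sgH z = z}"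
    define x :: "quat^'m^'m" where
      "x = (\<chi> a b. Quat (Re (z $ Inl a $ Inl b)) (Im (z $ Inl a $ Inl b)) (Re (z $ Inl a $ Inr b)) (Im (z $ Inl a $ Inr b)))"
    have fx: "eps i * eps j * cnj (z $ fl i $ fl j) = z $ i $ j" for i j
      using z by (simp flip: sgH_nth)
    have "psiH x = z"
      using fx[of "Inr _" "Inl _"] fx[of "Inr _" "Inr _"]
      by (simp add: mat_Plus_eq_iff x_def qa_def qb_def)
    moreover from this have "qRe (trace x) = 0" using z trace_psiH[of x] by auto
    ultimately show "z \<in> psiH ` (slH_algebra :: (quat^'m^'m) set)" by (auto simp: slH_algebra_def)
  qed
  fix z w :: "complex^('m + 'm)^('m + 'm)" and c
  show "sgH (z + w) = sgH z + sgH w" "sgH (c *\<^sub>C z) = cnj c *\<^sub>C sgH z" "sgH (sgH z) = z" by (simp_all add: sgH_hom)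
  show "trace (sgH z) = 0" if "trace z = 0"
  proof -
    have "trace (sgH z) = (\<Sum>i\<in>UNIV. cnj (z $ fl i $ fl i))" by (simp add: trace_def sgH_nth)
    also have "\<dots> = (\<Sum>i\<in>UNIV. cnj (z $ i $ i))" by (rule sum_fl)
    also have "\<dots> = cnj (trace z)" by (simp add: trace_def)
    finally show ?thesis using that by simp
  qed
  show "sgH (comm_bracket z w) = comm_bracket (sgH z) (sgH w)"
    by (simp add: comm_bracket_def sgH_hom sgH_mult)
qed

section \<open>Quaternionic flags\<close>

definition jstable :: "(complex^('m::finite + 'm)) set \<Rightarrow> bool" where
  "jstable X \<longleftrightarrow> vec.subspace X \<and> (\<forall>v\<in>X. jq v \<in> X)"

definition flag_ideal :: "(complex^('m::finite + 'm)) set \<Rightarrow> (complex^('m + 'm)) set \<Rightarrow> (quat^'m^'m) set" where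
  "flag_ideal U W = {x\<in>slH_algebra. (\<forall>v. psiH x *v v \<in> U) \<and> (\<forall>v\<in>W. psiH x *v v = 0)}"

text \<open>\<open>sgH\<close> sends \<open>outer u w\<close> to \<open>outer (jq u) (jq w)\<close>,
  so \<open>U\<close> and \<open>S\<close> are stable under \<open>jq\<close>; the annihilator
  \<open>W\<close> of \<open>S\<close> turns the condition on rows into one on vectors.\<close>

lemma abelian_inner_ideal_slH:
  fixes B :: "(quat^'m::finite^'m) set"
  assumes "nonzero_abelian_inner_ideal slH_algebra comm_bracket B"
  shows "\<exists>U W. jstable U \<and> jstable W \<and> U \<subseteq> W \<and> U \<noteq> {0} \<and> W \<noteq> UNIV \<and> B = flag_ideal U W"
proof (rule slh.abelian_inner_ideal_form[OF assms])
  fix U S :: "(complex^('m + 'm)) set"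
  assume US: "vec.subspace U" "vec.subspace S" "U \<noteq> {0}" "S \<noteq> {0}"
    "\<And>u w. u \<in> U \<Longrightarrow> w \<in> S \<Longrightarrow> dotp w u = 0"
    "\<And>x. x \<in> B \<longleftrightarrow> x \<in> slH_algebra \<and> (\<forall>v. psiH x *v v \<in> U) \<and> (\<forall>v. v v* psiH x \<in> S)"
    "\<And>u w v. u \<in> U \<Longrightarrow> w \<in> S \<Longrightarrow> sgH (outer u w) *v v \<in> U"
    "\<And>u w v. u \<in> U \<Longrightarrow> w \<in> S \<Longrightarrow> v v* sgH (outer u w) \<in> S"
  obtain w0 where w0: "w0 \<in> S" "w0 \<noteq> 0" using US(2,4) vec.subspace_0 by blast
  obtain u0 where u0: "u0 \<in> U" "u0 \<noteq> 0" using US(1,3) vec.subspace_0 by blast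
  have jU: "jq u \<in> U" if u: "u \<in> U" for u
  proof -
    obtain v where v: "dotp (jq w0) v = 1" using ex_dotp_1[of "jq w0"] w0 by (auto simp: jq_eq_0)
    then show ?thesis using US(7)[OF u w0(1), of v] by (simp add: sgH_outer outer_mult_vec)
  qed
  have jS: "jq w \<in> S" if w: "w \<in> S" for w
  proof -
    obtain v where v: "dotp (jq u0) v = 1" using ex_dotp_1[of "jq u0"] u0 by (auto simp: jq_eq_0)
    have "v v* outer (jq u0) (jq w) = dotp (jq u0) v *s jq w"
      by (simp add: vec_eq_iff vector_matrix_mult_def dotp_def sum_distrib_left sum_distrib_right mult_ac)
    then show ?thesis using US(8)[OF u0(1) w, of v] v by (simp add: sgH_outer)
  qed
  define W where "W = {v. \<forall>w\<in>S. dotp w v = 0}"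
  have "jq v \<in> W" if v: "v \<in> W" for v
    unfolding W_def
  proof (intro CollectI ballI)
    fix w assume "w \<in> S"
    then have "dotp (jq w) v = 0" using jS v by (simp add: W_def)
    moreover have "dotp (jq (jq w)) (jq v) = cnj (dotp (jq w) v)" by (rule dotp_jq)
    ultimately have "dotp (- w) (jq v) = 0" by simp
    then show "dotp w (jq v) = 0" by (simp add: dotp_def sum_negf)
  qed
  moreover have "vec.subspace W" by (auto simp: W_def vec.subspace_def dotp_linear) (simp_all add: dotp_def)
  ultimately have "jstable W" by (simp add: jstable_def)
  moreover have "jstable U" using jU US(1) by (simp add: jstable_def)
  moreover have "U \<subseteq> W" using US(5) by (auto simp: W_def)
  moreover have "W \<noteq> UNIV"
  proof -
    obtain v where "dotp w0 v = 1" using ex_dotp_1[OF w0(2)] by blast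
    then have "v \<notin> W" using w0 by (auto simp: W_def intro!: bexI[of _ w0])
    then show ?thesis by blast
  qed
  moreover have "B = flag_ideal U W"
  proof -
    \<comment> \<open>Biduality: a row outside \<open>S\<close> is detected by some vector of
      \<open>W\<close>.\<close>
    have "(\<forall>v. v v* A \<in> S) \<longleftrightarrow> (\<forall>v\<in>W. A *v v = 0)" for A
    proof
      assume A: "\<forall>v. v v* A \<in> S"
      show "\<forall>v\<in>W. A *v v = 0"
      proof
        fix v assume v: "v \<in> W"
        have "dotp y (A *v v) = 0" for y using A v dotp_matrix[of y A v] by (simp add: W_def)
        then have "(A *v v) $ i = 0" for i by (metis dotp_axis(1))
        then show "A *v v = 0" by (simp add: vec_eq_iff)
      qed
    next
      assume A: "\<forall>v\<in>W. A *v v = 0"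
      show "\<forall>v. v v* A \<in> S"
      proof (intro allI, rule ccontr)
        fix y assume "y v* A \<notin> S"
        then obtain v where v: "dotp (y v* A) v \<noteq> 0" "\<forall>w\<in>S. dotp w v = 0" using double_annihilator[OF US(2)] by blast
        then have "A *v v = 0" using A by (simp add: W_def)
        then show False using v(1) by (simp add: dotp_matrix) (simp add: dotp_def)
      qed
    qed
    then show ?thesis unfolding flag_ideal_def using US(6) by blast
  qed
  ultimately show ?thesis using US(3) by blast
qed

definition jpairs :: "(nat \<Rightarrow> complex^('m::finite + 'm)) \<Rightarrow> nat \<Rightarrow> (complex^('m + 'm)) set" where
  "jpairs f k = f ` {..<k} \<union> jq ` f ` {..<k}"

definition jspan :: "(nat \<Rightarrow> complex^('m::finite + 'm)) \<Rightarrow> nat \<Rightarrow> (complex^('m + 'm)) set" where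
  "jspan f k = vec.span (jpairs f k)"

lemma jstable_jspan: "jstable (jspan f k)"
proof -
  have "jq v \<in> jspan f k" if "v \<in> jspan f k" for v
    using that unfolding jspan_def
  proof (induction rule: vec.span_induct_alt)
    case base then show ?case by (simp add: jq_linear vec.span_zero)
  next
    case (step c x y)
    have "jq x \<in> vec.span (jpairs f k)"
    proof (cases "x \<in> f ` {..<k}")
      case True
      then show ?thesis by (intro vec.span_base) (auto simp: jpairs_def)
    next
      case False
      then obtain i where i: "i < k" "x = jq (f i)" using step(1) by (auto simp: jpairs_def)
      have "f i \<in> vec.span (jpairs f k)" using i(1) by (intro vec.span_base) (auto simp: jpairs_def)
      then show ?thesis using vec.span_neg i(2) by simp
    qed
    then show ?case using step by (simp add: jq_linear vec.span_add vec.span_scale)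
  qed
  then show ?thesis by (simp add: jstable_def jspan_def)
qed

text \<open>Adding \<open>cnj c\<close> times \<open>jq y - c y\<close> to its image under
  \<open>jq\<close> leaves \<open>-(1 + |c|^2) y\<close>, and the factor is never zero. So a new
  vector always brings a second dimension.\<close>

lemma jstable_new_pair:
  assumes X: "jstable X" and y: "y \<notin> X"
  shows "jq y - c *s y \<notin> X"
proof
  assume m: "jq y - c *s y \<in> X"
  have sX: "vec.subspace X" using X by (simp add: jstable_def)
  have "jq (jq y - c *s y) \<in> X" using X m by (simp add: jstable_def)
  then have "jq (jq y - c *s y) + cnj c *s (jq y - c *s y) \<in> X" using m sX by (intro vec.subspace_add vec.subspace_scale)
  moreover have "jq (jq y - c *s y) + cnj c *s (jq y - c *s y) = (- (1 + c * cnj c)) *s y"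
  proof -
    have "jq (jq y - c *s y) = - y - cnj c *s jq y"
      using jq_linear(1)[of "jq y" "- (c *s y)"] by (simp add: jq_linear)
    then show ?thesis by (simp add: vec_eq_iff algebra_simps)
  qed
  ultimately have m': "(- (1 + c * cnj c)) *s y \<in> X" by simp
  have "1 + c * cnj c = of_real (1 + (cmod c)\<^sup>2)" by (simp add: complex_norm_square del: of_real_power)
  moreover have "1 + (cmod c)\<^sup>2 > 0" by (simp add: add_pos_nonneg)
  ultimately have k: "1 + c * cnj c \<noteq> 0" by (metis less_irrefl of_real_eq_0_iff)
  have "(- 1 / (1 + c * cnj c)) *s ((- (1 + c * cnj c)) *s y) \<in> X" by (rule vec.subspace_scale[OF sX m'])
  also have "(- 1 / (1 + c * cnj c)) *s ((- (1 + c * cnj c)) *s y) = ((- 1 / (1 + c * cnj c)) * (- (1 + c * cnj c))) *s y"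
    by (rule vec.scale_scale)
  also have "(- 1 / (1 + c * cnj c)) * (- (1 + c * cnj c)) = 1" using k by (simp only: divide_minus_left minus_mult_minus nonzero_eq_divide_eq) simp
  finally show False using y by simp
qed

text \<open>Quaternionic linear independence, stated successively so that each step adds exactly two
  complex dimensions.\<close>

definition jgood :: "(nat \<Rightarrow> complex^('m::finite + 'm)) \<Rightarrow> nat \<Rightarrow> bool" where
  "jgood f k \<longleftrightarrow> (\<forall>i<k. f i \<notin> jspan f i)"

lemma jspan_Suc: "jspan f (Suc k) = vec.span (insert (jq (f k)) (insert (f k) (jpairs f k)))"
  unfolding jspan_def jpairs_def by (rule arg_cong[where f = vec.span]) (auto simp: lessThan_Suc)

lemma dim_jspan: "jgood f k \<Longrightarrow> vec.dim (jspan f k) = 2 * k"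
proof (induction k)
  case 0
  then show ?case by (simp add: jspan_def jpairs_def)
next
  case (Suc k)
  have n: "f k \<notin> vec.span (jpairs f k)" using Suc(2) by (simp add: jgood_def jspan_def)
  have "jq (f k) \<notin> vec.span (insert (f k) (jpairs f k))"
    using jstable_new_pair[OF jstable_jspan, of "f k" f k] n unfolding jspan_def vec.span_breakdown_eq by blast
  then have "vec.dim (jspan f (Suc k)) = vec.dim (jpairs f k) + 2"
    unfolding jspan_Suc vec.dim_span using n by (simp add: vec.dim_insert)
  moreover have "vec.dim (jpairs f k) = 2 * k" using Suc by (simp add: jgood_def jspan_def)
  ultimately show ?case by simp
qed

lemma jspan_cong: "(\<And>i. i < k \<Longrightarrow> f i = g i) \<Longrightarrow> jspan f k = jspan g k"
  unfolding jspan_def jpairs_def image_image by (intro arg_cong[where f = vec.span] arg_cong2[where f = "(\<union>)"] image_cong) auto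

lemma jspan_minimal:
  assumes Y: "jstable Y" and f: "\<And>i. i < k \<Longrightarrow> f i \<in> Y"
  shows "jspan f k \<subseteq> Y"
  unfolding jspan_def by (rule vec.span_minimal) (use assms in \<open>auto simp: jpairs_def jstable_def\<close>)

lemma jgood_extend:
  assumes Y: "jstable Y" and f: "jgood f k" "\<And>i. i < k \<Longrightarrow> f i \<in> Y"
  shows "\<exists>g k'. jgood g k' \<and> (\<forall>i<k. g i = f i) \<and> k \<le> k' \<and> jspan g k' = Y"
  using f
proof (induction "vec.dim Y - 2 * k" arbitrary: f k rule: less_induct)
  case less
  have sub: "jspan f k \<subseteq> Y" using jspan_minimal[OF Y less(3)] .
  show ?case
  proof (cases "jspan f k = Y")
    case True
    then show ?thesis using less(2) by (intro exI[of _ f] exI[of _ k]) simp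
  next
    case False
    then obtain y where y: "y \<in> Y" "y \<notin> jspan f k" using sub by blast
    let ?f = "f(k := y)"
    have c: "jspan ?f i = jspan f i" if "i \<le> k" for i using that by (intro jspan_cong) auto
    have good: "jgood ?f (Suc k)"
      using less(2) y(2) c by (auto simp: jgood_def less_Suc_eq)
    have mem: "?f i \<in> Y" if "i < Suc k" for i using that less(3) y(1) by (auto simp: less_Suc_eq)
    have "jspan ?f (Suc k) \<subseteq> Y" by (rule jspan_minimal[OF Y mem])
    then have "vec.dim (jspan ?f (Suc k)) \<le> vec.dim Y" by (rule vec.dim_subset)
    then have "2 * Suc k \<le> vec.dim Y" unfolding dim_jspan[OF good] .
    then have "vec.dim Y - 2 * Suc k < vec.dim Y - 2 * k" by simp
    then have "\<exists>g k'. jgood g k' \<and> (\<forall>i<Suc k. g i = ?f i) \<and> Suc k \<le> k' \<and> jspan g k' = Y"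
      by (rule less(1)[OF _ good mem])
    then obtain g k' where g: "jgood g k'" "\<forall>i<Suc k. g i = ?f i" "Suc k \<le> k'" "jspan g k' = Y"
      by (elim exE conjE)
    have "\<forall>i<k. g i = f i" using g(2) by simp
    then show ?thesis using g by (intro exI[of _ g] exI[of _ k']) simp
  qed
qed

text \<open>A quaternionic basis of \<open>U\<close> is extended to one of \<open>W\<close> and then
  of the whole space; the flag is recovered from its initial segments.\<close>

lemma ex_adapted:
  fixes U W :: "(complex^('m::finite + 'm)) set"
  assumes U: "jstable U" and W: "jstable W" and UW: "U \<subseteq> W"
  obtains f u w where "jgood f CARD('m)" "u \<le> w" "w \<le> CARD('m)" "jspan f u = U" "jspan f w = W"
    "vec.dim U = 2 * u" "vec.dim W = 2 * w"
proof -
  have "\<exists>g k'. jgood g k' \<and> (\<forall>i<0. g i = f i) \<and> 0 \<le> k' \<and> jspan g k' = U" for f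
    by (rule jgood_extend[OF U]) (simp_all add: jgood_def)
  then obtain f u where f: "jgood f u" "jspan f u = U" by blast
  have fW: "f i \<in> W" if "i < u" for i
  proof -
    have "f i \<in> jspan f u" unfolding jspan_def by (rule vec.span_base) (use that in \<open>auto simp: jpairs_def\<close>)
    then show ?thesis using f UW by blast
  qed
  obtain g w where g: "jgood g w" "\<forall>i<u. g i = f i" "u \<le> w" "jspan g w = W"
    using jgood_extend[OF W f(1) fW] by blast
  have un: "jstable (UNIV :: (complex^('m + 'm)) set)" by (simp add: jstable_def)
  obtain e n where e: "jgood e n" "\<forall>i<w. e i = g i" "w \<le> n" "jspan e n = UNIV"
    using jgood_extend[OF un g(1)] by blast
  have "2 * n = CARD('m + 'm)" using dim_jspan[OF e(1)] unfolding e(4) vec_dim_card by simp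
  then have n: "n = CARD('m)" by simp
  have eu: "jspan e u = U" using jspan_cong[of u e f] e(2) g(2,3) f(2) by simp
  have ew: "jspan e w = W" using jspan_cong[of w e g] e(2) g(4) by simp
  have "jgood e u" "jgood e w" using e(1,3) g(3) by (auto simp: jgood_def)
  then have "vec.dim U = 2 * u" "vec.dim W = 2 * w" using dim_jspan[of e u] dim_jspan[of e w] eu ew by auto
  then show ?thesis using that[of e u w] e(1,3) n g(3) eu ew by blast
qed

definition std_j :: "nat \<Rightarrow> complex^('m::finite + 'm)" where
  "std_j i = axis (Inl (enum i)) 1"

text \<open>\<open>g\<close> must commute with \<open>jq\<close>. As \<open>jq\<close> maps the unit
  vector at \<open>Inl b\<close> to minus the one at \<open>Inr b\<close>, the column at
  \<open>Inr b\<close> is minus \<open>jq\<close> of the column at \<open>Inl b\<close>.\<close>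

lemma ex_quaternionic:
  fixes f :: "nat \<Rightarrow> complex^('m::finite + 'm)"
  assumes f: "jgood f CARD('m)"
  obtains g g' :: "complex^('m + 'm)^('m + 'm)" where "g ** g' = mat 1" "g' ** g = mat 1" "\<And>z. sgH (g ** z ** g') = g ** sgH z ** g'"
    "\<And>k. k \<le> CARD('m) \<Longrightarrow> (\<lambda>v. g *v v) ` jspan std_j k = jspan f k"
proof -
  define \<kappa> :: "'m \<Rightarrow> nat" where "\<kappa> = the_inv_into {..<CARD('m)} enum"
  have \<kappa>: "\<kappa> (enum i) = i" if "i < CARD('m)" for i
    using enum_bij[where 'a='m] that unfolding bij_betw_def \<kappa>_def by (simp add: the_inv_into_f_f)
  define g :: "complex^('m + 'm)^('m + 'm)" where
    "g = (\<chi> i j. case j of Inl b \<Rightarrow> f (\<kappa> b) $ i | Inr b \<Rightarrow> - jq (f (\<kappa> b)) $ i)"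
  have gv: "g *v v = (\<Sum>b\<in>UNIV. v $ Inl b *s f (\<kappa> b)) - (\<Sum>b\<in>UNIV. v $ Inr b *s jq (f (\<kappa> b)))" for v
    by (simp add: vec_eq_iff matrix_vector_nth sum_Plus g_def sum_negf mult.commute)
  have gj: "g *v jq v = jq (g *v v)" for v
  proof -
    have "jq (g *v v) = jq (\<Sum>b\<in>UNIV. v $ Inl b *s f (\<kappa> b)) + jq (- (\<Sum>b\<in>UNIV. v $ Inr b *s jq (f (\<kappa> b))))"
      unfolding gv by (simp flip: jq_linear(1))
    also have "\<dots> = (\<Sum>b\<in>UNIV. cnj (v $ Inl b) *s jq (f (\<kappa> b))) + (\<Sum>b\<in>UNIV. cnj (v $ Inr b) *s f (\<kappa> b))"
      by (simp add: jq_linear jq_sum sum_negf)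
    also have "\<dots> = g *v jq v" unfolding gv by (simp add: jq_nth sum_negf)
    finally show ?thesis ..
  qed
  have gs: "g *v std_j i = f i" if "i < CARD('m)" for i
  proof -
    have "(g *v std_j i) $ x = f (\<kappa> (enum i)) $ x" for x
      by (simp add: matrix_vector_nth std_j_def axis_def if_distrib g_def cong: if_cong)
    then show ?thesis using \<kappa>[OF that] by (simp add: vec_eq_iff)
  qed
  have im: "(\<lambda>v. g *v v) ` jspan std_j k = jspan f k" if k: "k \<le> CARD('m)" for k
  proof -
    have "(\<lambda>v. g *v v) ` jspan std_j k = vec.span ((\<lambda>v. g *v v) ` jpairs std_j k)"
      unfolding jspan_def by (rule vec.linear_span_image[symmetric]) simp
    also have "(\<lambda>v. g *v v) ` jpairs std_j k = jpairs f k"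
    proof -
      have "(\<lambda>v. g *v v) ` std_j ` {..<k} = f ` {..<k}"
        unfolding image_image by (rule image_cong) (use gs k in auto)
      moreover have "(\<lambda>v. g *v v) ` jq ` std_j ` {..<k} = jq ` f ` {..<k}"
        unfolding image_image by (rule image_cong) (use gs gj k in auto)
      ultimately show ?thesis unfolding jpairs_def image_Un by simp
    qed
    finally show ?thesis by (simp add: jspan_def)
  qed
  have "vec.dim (jspan f CARD('m)) = CARD('m + 'm)" using dim_jspan[OF f] by simp
  moreover have sj: "vec.subspace (jspan f CARD('m))" using jstable_jspan[of f] by (simp add: jstable_def)
  ultimately have "jspan f CARD('m) = UNIV"
    using vec.subspace_dim_equal[OF sj vec.subspace_UNIV] unfolding vec_dim_card by simp
  then have "(\<lambda>v. g *v v) ` jspan std_j CARD('m) = UNIV" using im[OF order_refl] by (rule trans[rotated])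
  then have "surj (\<lambda>v. g *v v)" using image_mono[OF subset_UNIV, of "\<lambda>v. g *v v" "jspan std_j CARD('m)"] by (simp add: top_unique)
  then obtain g' where g': "g ** g' = mat 1" using matrix_right_invertible_surjective[of g] by blast
  then have g'': "g' ** g = mat 1" by (simp add: matrix_left_right_inverse)
  have sg: "sgH g = g" by (rule sgH_eqI) (rule gj)
  have one: "sgH (mat 1) = mat 1" by (rule sgH_eqI) simp
  have "g ** sgH g' = mat 1" using sgH_mult[of g g'] by (simp add: sg g' one)
  then have "g' ** (g ** sgH g') = g'" by simp
  then have sg': "sgH g' = g'" by (simp add: matrix_mul_assoc g'')
  show ?thesis
    by (rule that[OF g' g'' _ im]) (simp_all add: sgH_mult sg sg')
qed

lemma flag_ideal_std_conj:
  fixes f :: "nat \<Rightarrow> complex^('m::finite + 'm)"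
  assumes f: "jgood f CARD('m)" and u: "u \<le> CARD('m)" "w \<le> CARD('m)"
  shows "conjugate slH_algebra comm_bracket (flag_ideal (jspan std_j u) (jspan std_j w)) (flag_ideal (jspan f u) (jspan f w))"
proof -
  obtain g g' :: "complex^('m + 'm)^('m + 'm)" where g: "g ** g' = mat 1" "g' ** g = mat 1" "\<And>z. sgH (g ** z ** g') = g ** sgH z ** g'"
    "\<And>k. k \<le> CARD('m) \<Longrightarrow> (\<lambda>v. g *v v) ` jspan std_j k = jspan f k"
    using ex_quaternionic[OF f] by metis
  have gg: "g *v (g' *v v) = v" "g' *v (g *v v) = v" for v by (simp_all add: matrix_vector_mul_assoc g)
  have mem: "v \<in> jspan f k \<longleftrightarrow> g' *v v \<in> jspan std_j k" if k: "k \<le> CARD('m)" for v k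
  proof
    assume "v \<in> jspan f k"
    then obtain y where "y \<in> jspan std_j k" "v = g *v y" unfolding g(4)[OF k, symmetric] by blast
    then show "g' *v v \<in> jspan std_j k" by (simp add: gg)
  next
    assume "g' *v v \<in> jspan std_j k"
    then have "g *v (g' *v v) \<in> jspan f k" unfolding g(4)[OF k, symmetric] by (rule imageI)
    then show "v \<in> jspan f k" by (simp add: gg)
  qed
  note c = slh.conj_automorphism[OF g(1,2,3)]
  let ?f = "\<lambda>x :: quat^'m^'m. inv psiH (g ** psiH x ** g')"
  have iff: "?f x \<in> flag_ideal (jspan f u) (jspan f w) \<longleftrightarrow> x \<in> flag_ideal (jspan std_j u) (jspan std_j w)"
    if x: "x \<in> slH_algebra" for x
  proof -
    have 1: "psiH (?f x) *v v = g *v (psiH x *v (g' *v v))" for v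
      by (simp add: c(2)[OF x] matrix_vector_mul_assoc matrix_mul_assoc)
    have 2: "(\<forall>v. psiH (?f x) *v v \<in> jspan f u) \<longleftrightarrow> (\<forall>v. psiH x *v v \<in> jspan std_j u)"
      unfolding mem[OF u(1)] 1 gg by (metis gg(2))
    have 3: "(\<forall>v\<in>jspan f w. psiH (?f x) *v v = 0) \<longleftrightarrow> (\<forall>v\<in>jspan std_j w. psiH x *v v = 0)"
    proof
      assume a: "\<forall>v\<in>jspan f w. psiH (?f x) *v v = 0"
      show "\<forall>v\<in>jspan std_j w. psiH x *v v = 0"
      proof
        fix v :: "complex^('m + 'm)" assume "v \<in> jspan std_j w"
        then have "g *v v \<in> jspan f w" using mem[OF u(2), of "g *v v"] by (simp add: gg)
        then have "g *v (psiH x *v v) = 0" using a 1[of "g *v v"] by (simp add: gg)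
        then show "psiH x *v v = 0" using gg(2)[of "psiH x *v v"] by simp
      qed
    next
      assume a: "\<forall>v\<in>jspan std_j w. psiH x *v v = 0"
      show "\<forall>v\<in>jspan f w. psiH (?f x) *v v = 0"
        using a mem[OF u(2)] by (simp add: 1)
    qed
    show ?thesis unfolding flag_ideal_def mem_Collect_eq 2 3 using c(3)[OF x] x by blast
  qed
  have bij: "?f ` slH_algebra = slH_algebra" using c(1) by (simp add: lie_automorphism_def bij_betw_def)
  have "?f ` flag_ideal (jspan std_j u) (jspan std_j w) = flag_ideal (jspan f u) (jspan f w)"
  proof (intro set_eqI iffI)
    fix y assume "y \<in> ?f ` flag_ideal (jspan std_j u) (jspan std_j w)"
    then obtain x where x: "x \<in> flag_ideal (jspan std_j u) (jspan std_j w)" "y = ?f x" by blast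
    then have "x \<in> slH_algebra" by (simp add: flag_ideal_def)
    then show "y \<in> flag_ideal (jspan f u) (jspan f w)" using iff x by blast
  next
    fix y assume y: "y \<in> flag_ideal (jspan f u) (jspan f w)"
    then have "y \<in> ?f ` slH_algebra" unfolding bij by (simp add: flag_ideal_def)
    then obtain x where x: "x \<in> slH_algebra" "y = ?f x" by blast
    then show "y \<in> ?f ` flag_ideal (jspan std_j u) (jspan std_j w)" using iff y by blast
  qed
  then show ?thesis unfolding conjugate_def using c(1) by blast
qed

lemma flag_ideal_conj:
  fixes U W U' W' :: "(complex^('m::finite + 'm)) set"
  assumes j: "jstable U" "jstable W" "U \<subseteq> W" "jstable U'" "jstable W'" "U' \<subseteq> W'"
    and d: "vec.dim U = vec.dim U'" "vec.dim W = vec.dim W'"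
  shows "conjugate slH_algebra comm_bracket (flag_ideal U W) (flag_ideal U' W')"
proof -
  obtain f u w where f: "jgood f CARD('m)" "u \<le> w" "w \<le> CARD('m)" "jspan f u = U" "jspan f w = W" "vec.dim U = 2 * u" "vec.dim W = 2 * w"
    using ex_adapted[OF j(1-3)] by metis
  obtain f' u' w' where f': "jgood f' CARD('m)" "u' \<le> w'" "w' \<le> CARD('m)" "jspan f' u' = U'" "jspan f' w' = W'" "vec.dim U' = 2 * u'" "vec.dim W' = 2 * w'"
    using ex_adapted[OF j(4-6)] by metis
  have e: "u' = u" "w' = w" using d f(6,7) f'(6,7) by auto
  have sub: "flag_ideal X Y \<subseteq> slH_algebra" for X Y :: "(complex^('m + 'm)) set" by (auto simp: flag_ideal_def)
  have c: "conjugate slH_algebra comm_bracket (flag_ideal (jspan std_j u) (jspan std_j w)) (flag_ideal U W)"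
    using flag_ideal_std_conj[OF f(1), of u w] f(2-5) by simp
  have c': "conjugate slH_algebra comm_bracket (flag_ideal (jspan std_j u) (jspan std_j w)) (flag_ideal U' W')"
    using flag_ideal_std_conj[OF f'(1), of u w] f'(2-5) e by simp
  show ?thesis by (rule slh.conjugate_trans[OF sub slh.conjugate_sym[OF sub c] c'])
qed

section \<open>The Satake setting of the quaternionic special linear algebra\<close>

locale slh_labelled = conj_labelled "slH_algebra :: (quat^'m::finite^'m) set" comm_bracket psiH sgH P R a h th l \<alpha>
  for P R :: "complex^('m::finite + 'm)^('m + 'm)"
    and a h :: "(quat^'m^'m) set" and th and l \<alpha>
begin

definition cm :: "'m + 'm \<Rightarrow> 'm + 'm \<Rightarrow> complex" where
  "cm i j = (R *v jq (e i)) $ j"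

text \<open>Elements of \<open>L\<close> commute with the antilinear \<open>jq\<close>, so
  \<open>jq\<close> maps an eigenvector to one with the conjugate eigenvalue; since \<open>h\<close>
  separates coordinates, \<open>jq\<close> permutes the eigenlines.\<close>

lemma h_eigen:
  assumes k: "k \<in> h"
  shows "cm i j * ((R ** psiH k ** P) $ j $ j - cnj ((R ** psiH k ** P) $ i $ i)) = 0"
proof -
  obtain d where d: "R ** psiH k ** P = diagm d" using h_diag[OF k] by blast
  have kL: "k \<in> slH_algebra" using k sub_h by blast
  have "psiH k *v jq (e i) = jq (psiH k *v e i)" using kL by (simp add: jq_mult slh.L_iff)
  also have "\<dots> = cnj (d i) *s jq (e i)" by (simp add: diag_eigen[OF d] jq_linear)
  finally have 1: "psiH k *v jq (e i) = cnj (d i) *s jq (e i)" .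
  have "(R ** psiH k ** P) *v (R *v jq (e i)) = R *v (psiH k *v ((P ** R) *v jq (e i)))"
    by (simp only: matrix_vector_mul_assoc matrix_mul_assoc)
  then have "diagm d *v (R *v jq (e i)) = cnj (d i) *s (R *v jq (e i))"
    by (simp add: PR 1 vector_scalar_commute d)
  then have "(diagm d *v (R *v jq (e i))) $ j = (cnj (d i) *s (R *v jq (e i))) $ j" by simp
  moreover have "(diagm d *v w) $ j = d j * w $ j" for w
    unfolding matrix_vector_nth diagm_nth by (rule sum_delta2)
  ultimately have "d j * cm i j = cnj (d i) * cm i j" by (simp add: cm_def)
  then show ?thesis by (simp add: d diagm_nth algebra_simps)
qed

lemma cm_unique:
  assumes "cm i j \<noteq> 0" "cm i j' \<noteq> 0"
  shows "j = j'"
proof -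
  have "(R ** psiH k ** P) $ j $ j = (R ** psiH k ** P) $ j' $ j'" if "k \<in> h" for k
    using h_eigen[OF that, of i j] h_eigen[OF that, of i j'] assms by simp
  then show ?thesis by (rule h_separates)
qed

lemma cm_ex: "\<exists>j. cm i j \<noteq> 0"
proof (rule ccontr)
  assume "\<nexists>j. cm i j \<noteq> 0"
  then have "R *v jq (e i) = 0" by (simp add: vec_eq_iff cm_def)
  then have "jq (e i) = 0" using PRv(1)[of "jq (e i)"] by simp
  then show False using e_nz by (simp add: jq_eq_0)
qed

definition tau :: "'m + 'm \<Rightarrow> 'm + 'm" where
  "tau i = (THE j. cm i j \<noteq> 0)"

lemma cm_tau: "cm i j \<noteq> 0 \<longleftrightarrow> j = tau i"
proof -
  obtain k where k: "cm i k \<noteq> 0" using cm_ex[of i] by (rule exE)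
  have "tau i = k" unfolding tau_def by (rule the_equality) (rule k, rule cm_unique[OF _ k])
  then show ?thesis using k cm_unique[OF k, of j] by auto
qed

lemma jq_e: "jq (e i) = cm i (tau i) *s e (tau i)"
proof -
  have "jq (e i) = P *v (R *v jq (e i))" by (simp add: PRv)
  also have "\<dots> = (\<Sum>j\<in>UNIV. cm i j *s e j)" unfolding P_expand cm_def ..
  also have "\<dots> = (\<Sum>j\<in>UNIV. if j = tau i then cm i (tau i) *s e (tau i) else 0)"
    by (rule sum.cong) (use cm_tau[of i] in auto)
  finally show ?thesis by simp
qed

text \<open>A line fixed by \<open>jq\<close> would give \<open>-1 = |c|^2\<close> because
  \<open>jq\<close> has square -1. Unlike for \<open>su\<close>, all lines therefore come in proper
  pairs.\<close>

lemma tau_tau [simp]: "tau (tau i) = i" and tau_neq: "tau i \<noteq> i"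
proof -
  have "- e i = jq (jq (e i))" by simp
  also have "\<dots> = (cnj (cm i (tau i)) * cm (tau i) (tau (tau i))) *s e (tau (tau i))"
    unfolding jq_e[of i] jq_linear(2) jq_e[of "tau i"] by simp
  finally have *: "- e i = (cnj (cm i (tau i)) * cm (tau i) (tau (tau i))) *s e (tau (tau i))" .
  have Rn: "R *v (- v) = - (R *v v)" for v by (simp add: vec_eq_iff matrix_vector_nth sum_negf)
  have "(R *v (- e i)) $ i = (cnj (cm i (tau i)) * cm (tau i) (tau (tau i))) * (R *v e (tau (tau i))) $ i"
    unfolding * vector_scalar_commute by simp
  then have c: "- 1 = (cnj (cm i (tau i)) * cm (tau i) (tau (tau i))) * (if i = tau (tau i) then 1 else 0)"
    unfolding Rn by (simp add: R_e)
  then show tt: "tau (tau i) = i" by (auto split: if_splits)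
  show "tau i \<noteq> i"
  proof
    assume t: "tau i = i"
    then have "- 1 = cnj (cm i i) * cm i i" using c by simp
    also have "\<dots> = of_real ((cmod (cm i i))\<^sup>2)" by (subst complex_norm_square) (rule mult.commute)
    finally have "Re (- 1) = (cmod (cm i i))\<^sup>2" by (metis Re_complex_of_real)
    then show False using zero_le_power2[of "cmod (cm i i)"] by simp
  qed
qed

text \<open>Paired eigenlines share a real eigenvalue, so the matrix commutes with
  \<open>jq\<close>.\<close>

lemma diag_in_a:
  assumes d: "\<And>i. d (tau i) = d i" "(\<Sum>i\<in>UNIV. d i) = 0"
  obtains x where "x \<in> a" "R ** psiH x ** P = diagm (\<lambda>i. complex_of_real (d i))"
proof -
  let ?D = "diagm (\<lambda>i. complex_of_real (d i))"
  let ?z = "P ** ?D ** R"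
  have Rz: "R ** ?z ** P = ?D" by (rule conj_id)
  have tr: "trace ?z = 0"
  proof -
    have "trace ?z = trace ?D" by (subst trace_mul_sym) (simp add: matrix_mul_assoc PR)
    also have "\<dots> = of_real (\<Sum>i\<in>UNIV. d i)" by (simp add: trace_diagm)
    finally show ?thesis by (simp add: d)
  qed
  have ze: "?z *v e i = of_real (d i) *s e i" for i by (rule diag_eigen[OF Rz])
  have sumv: "?z *v (\<Sum>i\<in>UNIV. f i) = (\<Sum>i\<in>UNIV. ?z *v f i)" for f :: "'m + 'm \<Rightarrow> complex^('m + 'm)"
    by (rule vec.sum)
  have "?z *v jq v = jq (?z *v v)" for v
  proof -
    have v: "v = (\<Sum>i\<in>UNIV. (R *v v) $ i *s e i)" using P_expand[of "R *v v"] by (simp add: PRv)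
    have 1: "?z *v (c *s jq (e i)) = jq (?z *v (cnj c *s e i))" for c i
      by (simp add: vector_scalar_commute ze jq_linear) (simp add: jq_e vector_scalar_commute ze d(1) mult.commute mult.left_commute)
    have "jq v = (\<Sum>i\<in>UNIV. cnj ((R *v v) $ i) *s jq (e i))"
      by (subst v) (simp only: jq_sum jq_linear)
    then have "?z *v jq v = (\<Sum>i\<in>UNIV. ?z *v (cnj ((R *v v) $ i) *s jq (e i)))" using sumv by simp
    also have "\<dots> = (\<Sum>i\<in>UNIV. jq (?z *v ((R *v v) $ i *s e i)))" unfolding 1 by simp
    also have "\<dots> = jq (?z *v (\<Sum>i\<in>UNIV. (R *v v) $ i *s e i))" unfolding sumv jq_sum ..
    also have "\<dots> = jq (?z *v v)" using v by simp
    finally show ?thesis .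
  qed
  then have "sgH ?z = ?z" by (rule sgH_eqI)
  then have "?z \<in> psiH ` slH_algebra" using tr unfolding slh.psi_L by blast
  then obtain x where x: "x \<in> slH_algebra" "psiH x = ?z" by auto
  then have "R ** psiH x ** P = ?D" using Rz by simp
  moreover from this have "x \<in> a" using x(1) unfolding a_eq by blast
  ultimately show ?thesis using that by blast
qed

lemma a_sym:
  assumes "x \<in> a"
  shows "(R ** psiH x ** P) $ tau i $ tau i = (R ** psiH x ** P) $ i $ i"
proof -
  have "x \<in> h" using assms ah by blast
  then have "(R ** psiH x ** P) $ tau i $ tau i = cnj ((R ** psiH x ** P) $ i $ i)"
    using h_eigen[of x i "tau i"] cm_tau[of i "tau i"] by simp
  then show ?thesis using a_real(1)[OF assms, of i] by (simp add: complex_eq_iff)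
qed

definition T :: "nat \<Rightarrow> nat" where
  "T i = pos (tau (s i))"

lemma T: "T i \<in> {1..l+1}" "s (T i) = tau (s i)" "i \<in> {1..l+1} \<Longrightarrow> T (T i) = i" "T i \<noteq> i"
proof -
  show "T i \<noteq> i"
  proof
    assume "T i = i"
    then have "s (T i) = s i" by simp
    then show False using tau_neq by (simp add: T_def pos)
  qed
  show "T i \<in> {1..l+1}" unfolding T_def by (rule pos(1))
  show "s (T i) = tau (s i)" unfolding T_def by (rule pos(2))
  show "T (T i) = i" if "i \<in> {1..l+1}" by (simp only: T_def pos(2) tau_tau pos(3)[OF that])
qed

lemma card_m: "2 * CARD('m) = l + 1"
  using card_n by simp

text \<open>The values \<open>K\<close> of a regular element are equal on partners and strictly
  decreasing otherwise, so partners must be adjacent. Induction pairs them off from the start of the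
  chain.\<close>

lemma T_pair:
  assumes "1 \<le> v" "v \<le> CARD('m)"
  shows "T (2 * v - 1) = 2 * v"
proof -
  obtain k where k: "k \<in> a" "\<And>i j. 1 \<le> i \<Longrightarrow> i < j \<Longrightarrow> j \<le> l + 1 \<Longrightarrow>
    (\<forall>x\<in>a. (R ** psiH x ** P) $ s i $ s i = (R ** psiH x ** P) $ s j $ s j) \<or> Re ((R ** psiH k ** P) $ s i $ s i) > Re ((R ** psiH k ** P) $ s j $ s j)"
    using ex_regular by blast
  define K where "K i = Re ((R ** psiH k ** P) $ s i $ s i)" for i
  have KT: "K (T i) = K i" for i using a_sym[OF k(1), of "s i"] by (simp add: K_def T)
  have strict: "K i > K j" if ij: "1 \<le> i" "i < j" "j \<le> l + 1" "T i \<noteq> j" for i j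
  proof -
    have m: "i \<in> {1..l+1}" "j \<in> {1..l+1}" using ij by auto
    have n1: "s i \<noteq> s j" using s_inj[OF m] ij by simp
    have n2: "tau (s i) \<noteq> s j" using T(2)[of i] s_inj[OF T(1) m(2), of i] ij by auto
    have n3: "s i \<noteq> tau (s j)" using n2 by auto
    have n4: "tau (s i) \<noteq> tau (s j)" using n1 by (metis tau_tau)
    \<comment> \<open>1 on the pair of \<open>s i\<close> and -1 on the pair of \<open>s j\<close>:
      symmetric, of trace zero, and separating the two positions.\<close>
    define d where "d x = of_bool (x = s i) + of_bool (x = tau (s i)) - of_bool (x = s j) - (of_bool (x = tau (s j)) :: real)" for x
    have tx: "tau x = y \<longleftrightarrow> x = tau y" for x y by (metis tau_tau)
    have "d (tau x) = d x" for x by (simp add: d_def tx)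
    moreover have "(\<Sum>x\<in>UNIV. d x) = 0"
      by (simp add: d_def sum.distrib sum_subtractf of_bool_def)
    ultimately obtain x where x: "x \<in> a" "R ** psiH x ** P = diagm (\<lambda>i. complex_of_real (d i))"
      using diag_in_a[of d] by blast
    have "d (s i) = 1" "d (s j) = - 1" using n1 n2 n3 n4 tau_neq[of "s i"] tau_neq[of "s j"] by (auto simp: d_def)
    then have "(R ** psiH x ** P) $ s i $ s i \<noteq> (R ** psiH x ** P) $ s j $ s j" unfolding x(2) by (simp add: diagm_nth)
    then show ?thesis using k(2)[OF ij(1-3)] x(1) by (auto simp: K_def)
  qed
  have mono: "K i \<ge> K j" if ij: "1 \<le> i" "i < j" "j \<le> l + 1" for i j
    using k(2)[OF ij] k(1) by (force simp: K_def)
  show ?thesis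
    using assms
  proof (induction v rule: less_induct)
    case (less v)
    let ?i = "2 * v - 1"
    have i: "?i \<in> {1..l+1}" "2 * v \<le> l + 1" using less(2,3) card_m by auto
    \<comment> \<open>All smaller positions are already paired among themselves by the induction
      hypothesis.\<close>
    have "\<not> T ?i < ?i"
    proof
      assume lt: "T ?i < ?i"
      define u where "u = (T ?i + 1) div 2"
      have Ti: "1 \<le> T ?i" using T(1)[of ?i] by simp
      have u: "u < v" "1 \<le> u" "T ?i = 2 * u - 1 \<or> T ?i = 2 * u" using lt Ti unfolding u_def by linarith+
      have Tu: "T (2 * u - 1) = 2 * u" using less(1)[OF u(1,2)] u(1) less(3) by simp
      have TT: "T (T ?i) = ?i" by (rule T(3)[OF i(1)])
      show False using u(3)
      proof
        assume "T ?i = 2 * u - 1"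
        then have "?i = 2 * u" using TT Tu by simp
        then show False using u less(2) by presburger
      next
        assume e: "T ?i = 2 * u"
        have "2 * u - 1 \<in> {1..l+1}" using u i by auto
        then have "T (2 * u) = 2 * u - 1" using T(3)[of "2 * u - 1"] Tu by simp
        then have "?i = 2 * u - 1" using TT e by simp
        then show False using u by simp
      qed
    qed
    then have gt: "?i < T ?i" using T(4)[of ?i] by linarith
    show "T ?i = 2 * v"
    proof (rule ccontr)
      assume n: "T ?i \<noteq> 2 * v"
      have e: "?i + 1 = 2 * v" using less(2) by simp
      \<comment> \<open>A partner beyond \<open>2 v\<close> would have value at most
        \<open>K (2 v) < K (2 v - 1)\<close>, whereas partners have equal values.\<close>
      have "2 * v < T ?i" using n gt e by linarith
      then have "K (T ?i) \<le> K (2 * v)" using mono[of "2 * v" "T ?i"] T(1)[of ?i] less(2) by auto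
      moreover have "K ?i > K (2 * v)" using strict[of ?i "2 * v"] i e n less(2) by auto
      ultimately show False using KT[of ?i] by simp
    qed
  qed
qed

lemma T_even:
  assumes i: "i \<in> {1..l+1}"
  shows "T i \<le> 2 * u \<longleftrightarrow> i \<le> 2 * u"
proof -
  define v where "v = (i + 1) div 2"
  have v: "1 \<le> v" "v \<le> CARD('m)" "i = 2 * v - 1 \<or> i = 2 * v" using i card_m unfolding v_def by auto
  have 1: "T (2 * v - 1) = 2 * v" by (rule T_pair[OF v(1,2)])
  have "2 * v - 1 \<in> {1..l+1}" using v card_m by auto
  then have 2: "T (2 * v) = 2 * v - 1" using T(3)[of "2 * v - 1"] 1 by simp
  show ?thesis using v(3)
  proof
    assume "i = 2 * v - 1" then show ?thesis using 1 v by auto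
  next
    assume "i = 2 * v" then show ?thesis using 2 v by auto
  qed
qed

lemma sum_pos_le: "t \<le> l + 1 \<Longrightarrow> (\<Sum>x\<in>UNIV. of_bool (pos x \<le> t)) = real t"
proof -
  assume t: "t \<le> l + 1"
  have "(\<Sum>x\<in>UNIV. of_bool (pos x \<le> t)) = (\<Sum>i\<in>{1..l+1}. of_bool (pos (s i) \<le> t) :: real)"
    by (rule sum.reindex_bij_betw[OF s_bij, symmetric])
  also have "\<dots> = (\<Sum>i\<in>{1..l+1}. if i \<in> {1..t} then 1 else 0)"
    by (rule sum.cong) (auto simp: pos)
  also have "\<dots> = (\<Sum>i\<in>{1..l+1} \<inter> {1..t}. 1)" by (rule sum.inter_restrict[symmetric]) simp
  also have "{1..l+1} \<inter> {1..t} = {1..t}" using t by auto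
  finally show ?thesis by simp
qed

lemma ex_D:
  assumes uw: "u \<le> CARD('m)" "w \<le> CARD('m)"
  obtains x c where "x \<in> a" "\<And>i. i \<in> {1..l+1} \<Longrightarrow>
    (R ** psiH x ** P) $ s i $ s i = of_real (of_bool (i \<le> 2 * u) + of_bool (i \<le> 2 * w) - c)"
proof -
  \<comment> \<open>The mean of the two step functions; subtracting it gives trace zero. It need not
    be 1, as the two steps are not symmetric to each other in general.\<close>
  define c where "c = real (2 * u + 2 * w) / real (l + 1)"
  define d where "d x = of_bool (pos x \<le> 2 * u) + of_bool (pos x \<le> 2 * w) - c" for x
  have "d (tau x) = d x" for x
  proof -
    have "pos (tau x) = T (pos x)" by (simp add: T_def pos)
    then show ?thesis using T_even[OF pos(1)[of x], of u] T_even[OF pos(1)[of x], of w] by (simp add: d_def)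
  qed
  moreover have "(\<Sum>x\<in>UNIV. d x) = 0"
  proof -
    have "(\<Sum>x\<in>UNIV. d x) = real (2 * u) + real (2 * w) - real CARD('m + 'm) * c"
      using sum_pos_le[of "2 * u"] sum_pos_le[of "2 * w"] uw card_m by (simp add: d_def sum.distrib sum_subtractf)
    also have "real CARD('m + 'm) * c = real (2 * u + 2 * w)"
      unfolding card_n c_def by simp
    finally show ?thesis by simp
  qed
  ultimately obtain x where x: "x \<in> a" "R ** psiH x ** P = diagm (\<lambda>i. complex_of_real (d i))"
    using diag_in_a[of d] by blast
  show ?thesis
    by (rule that[OF x(1), of c]) (simp add: x(2) diagm_nth d_def pos)
qed

lemma flag:
  assumes u: "u \<le> CARD('m)"
  shows "jstable (flag (2 * u))" "vec.dim (flag (2 * u)) = 2 * u"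
proof -
  show "vec.dim (flag (2 * u)) = 2 * u" using dim_column_flag[OF PR s_bij'] u by simp
  have "jq v \<in> flag (2 * u)" if v: "v \<in> flag (2 * u)" for v
    unfolding column_flag_def card_n
  proof (intro CollectI ballI impI)
    fix i assume i: "i \<in> {1..l+1}" "2 * u < i"
    have ve: "v = (\<Sum>x\<in>UNIV. (R *v v) $ x *s e x)" using P_expand[of "R *v v"] by (simp add: PRv)
    have "jq v = (\<Sum>x\<in>UNIV. cnj ((R *v v) $ x) *s jq (e x))"
      by (subst ve) (simp only: jq_sum jq_linear)
    then have "R *v jq v = (\<Sum>x\<in>UNIV. R *v (cnj ((R *v v) $ x) *s jq (e x)))" using vec.sum[of R] by simp
    then have "(R *v jq v) $ s i = (\<Sum>x\<in>UNIV. cnj ((R *v v) $ x) * cm x (s i))"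
      by (simp add: vector_scalar_commute cm_def)
    also have "\<dots> = 0"
    proof (rule sum.neutral, intro ballI)
      fix x
      show "cnj ((R *v v) $ x) * cm x (s i) = 0"
      proof (cases "s i = tau x")
        case True
        then have "x = tau (s i)" by simp
        then have x: "x = s (T i)" by (simp add: T)
        have "2 * u < T i" using T_even[OF i(1), of u] i(2) by simp
        then have "(R *v v) $ x = 0" using v T(1)[of i] unfolding x column_flag_def card_n by blast
        then show ?thesis by simp
      next
        case False
        then show ?thesis using cm_tau[of x "s i"] by auto
      qed
    qed
    finally show "(R *v jq v) $ s i = 0" .
  qed
  then show "jstable (flag (2 * u))" by (simp add: jstable_def subspace_column_flag)
qed

lemma BI_flag:
  assumes uw: "1 \<le> u" "u \<le> w" "w < CARD('m)"
  shows "BI slH_algebra comm_bracket a h l \<alpha> {rho (2 * u), rho (2 * w)} = flag_ideal (flag (2 * u)) (flag (2 * w))"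
    "admissible slH_algebra comm_bracket a h l \<alpha> {rho (2 * u), rho (2 * w)}"
    "nonzero_abelian_inner_ideal slH_algebra comm_bracket (BI slH_algebra comm_bracket a h l \<alpha> {rho (2 * u), rho (2 * w)})"
proof -
  have tt: "1 \<le> 2 * u" "2 * u \<le> 2 * w" "2 * w \<le> l" using uw card_m by auto
  obtain x c where D: "x \<in> a" "\<And>i. i \<in> {1..l+1} \<Longrightarrow>
    (R ** psiH x ** P) $ s i $ s i = of_real (of_bool (i \<le> 2 * u) + of_bool (i \<le> 2 * w) - c)"
    using ex_D[of u w] uw by auto
  show "admissible slH_algebra comm_bracket a h l \<alpha> {rho (2 * u), rho (2 * w)}"
    by (rule D_admissible[OF tt D])
  show "nonzero_abelian_inner_ideal slH_algebra comm_bracket (BI slH_algebra comm_bracket a h l \<alpha> {rho (2 * u), rho (2 * w)})"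
    by (rule BI_nonzero_abelian_inner_ideal[OF tt D])
  have "x \<in> supported (2 * u) (2 * w) \<longleftrightarrow> x \<in> flag_ideal (flag (2 * u)) (flag (2 * w))" for x
  proof -
    let ?A = "psiH x" and ?N = "R ** psiH x ** P"
    have rows: "(\<forall>v. ?A *v v \<in> flag (2 * u)) \<longleftrightarrow> (\<forall>i\<in>{1..l+1}. \<forall>j\<in>{1..l+1}. ?N $ s i $ s j \<noteq> 0 \<longrightarrow> i \<le> 2 * u)"
      using range_in_column_flag[OF PR s_bij', of ?A "2 * u"] unfolding card_n .
    have Ne: "(R *v (?A *v e y)) $ i = ?N $ i $ y" for i y
    proof -
      have "R *v (?A *v e y) = ?N *v axis y 1" by (simp only: e_def matrix_vector_mul_assoc matrix_mul_assoc)
      then show ?thesis by (simp only: matrix_axis)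
    qed
    have cols: "(\<forall>v\<in>flag (2 * w). ?A *v v = 0) \<longleftrightarrow> (\<forall>i\<in>{1..l+1}. \<forall>j\<in>{1..l+1}. ?N $ s i $ s j \<noteq> 0 \<longrightarrow> 2 * w < j)"
    proof
      assume f: "\<forall>v\<in>flag (2 * w). ?A *v v = 0"
      show "\<forall>i\<in>{1..l+1}. \<forall>j\<in>{1..l+1}. ?N $ s i $ s j \<noteq> 0 \<longrightarrow> 2 * w < j"
      proof (intro ballI impI, rule ccontr)
        fix i j assume ij: "i \<in> {1..l+1}" "j \<in> {1..l+1}" "?N $ s i $ s j \<noteq> 0" "\<not> 2 * w < j"
        have "e (s j) \<in> flag (2 * w)"
          unfolding column_flag_def card_n using ij s_inj by (auto simp: R_e)
        then have "?A *v e (s j) = 0" using f by blast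
        then have "(R *v (?A *v e (s j))) $ s i = 0" by simp
        then show False using ij(3) unfolding Ne by simp
      qed
    next
      assume f: "\<forall>i\<in>{1..l+1}. \<forall>j\<in>{1..l+1}. ?N $ s i $ s j \<noteq> 0 \<longrightarrow> 2 * w < j"
      show "\<forall>v\<in>flag (2 * w). ?A *v v = 0"
      proof
        fix v assume v: "v \<in> flag (2 * w)"
        have z: "?N $ x $ y * (R *v v) $ y = 0" for x y
        proof (rule ccontr)
          assume n: "?N $ x $ y * (R *v v) $ y \<noteq> 0"
          then have "?N $ s (pos x) $ s (pos y) \<noteq> 0" by (simp add: pos)
          then have "2 * w < pos y" using f pos(1)[of x] pos(1)[of y] by blast
          then have "(R *v v) $ s (pos y) = 0" using v pos(1)[of y] unfolding column_flag_def card_n by blast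
          then show False using n by (simp add: pos)
        qed
        have "(?N *v (R *v v)) $ x = 0" for x
          unfolding matrix_vector_nth[of ?N] by (intro sum.neutral ballI z)
        then have "?N *v (R *v v) = 0" by (simp only: vec_eq_iff zero_index simp_thms)
        moreover have "?N *v (R *v v) = R *v (?A *v ((P ** R) *v v))" by (simp only: matrix_vector_mul_assoc matrix_mul_assoc)
        ultimately have "R *v (?A *v v) = 0" by (simp add: PR)
        then show "?A *v v = 0" using PRv(1)[of "?A *v v"] by simp
      qed
    qed
    show ?thesis
      unfolding supported_def flag_ideal_def mem_Collect_eq rows cols by blast
  qed
  then show "BI slH_algebra comm_bracket a h l \<alpha> {rho (2 * u), rho (2 * w)} = flag_ideal (flag (2 * u)) (flag (2 * w))"
    using BI_eq[OF tt D] by blast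
qed

end

section \<open>From a Satake setting to the diagonal coordinates, and the two cases of the
  theorem\<close>

lemma cartan_pair_of_setting:
  assumes rf: "real_form L lb psi sg" and set: "satake_setting L lb a h l \<alpha>"
  obtains th where "cartan_pair L lb psi sg a h th"
proof -
  have s: "maximal_split_abelian L lb a" "maximal_abelian_subalgebra L lb h" "a \<subseteq> h"
    using set by (simp_all add: satake_setting_def)
  obtain th where th: "cartan_involution L lb th" "\<forall>x\<in>a. th x = - x"
    using s(1) unfolding maximal_split_abelian_def split_abelian_def by (elim conjE exE)
  have "cartan_pair L lb psi sg a h th"
    using s th(2) by (intro cartan_pair.intro cartan_pair_axioms.intro rf th(1)) simp_all
  then show ?thesis by (rule that)
qed

lemma conj_labelled_of_setting:
  fixes P R :: "complex^'n^'n"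
  assumes c: "cartan_pair L lb psi sg a h th" and set: "satake_setting L lb a h l \<alpha>"
    and PR: "P ** R = mat 1" "R ** P = mat 1" "\<forall>y\<in>h. \<exists>d. R ** psi y ** P = diagm d"
    and l: "CARD('n) = l + 1" "1 \<le> l"
  shows "conj_labelled L lb psi sg P R a h th l \<alpha>"
proof -
  interpret c: cartan_pair L lb psi sg a h th by (rule c)
  note r = c.real_form_conj[OF PR(1,2)]
  have "cartan_pair L lb (\<lambda>x. R ** psi x ** P) (\<lambda>z. R ** sg (P ** z ** R) ** P) a h th"
    by (intro cartan_pair.intro cartan_pair_axioms.intro r c.a_max c.th_cartan c.h_max c.ah c.th_a)
  then have "diag_pair L lb (\<lambda>x. R ** psi x ** P) (\<lambda>z. R ** sg (P ** z ** R) ** P) a h th"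
    by (rule diag_pair.intro) (rule diag_pair_axioms.intro, rule bspec[OF PR(3)])
  then show ?thesis
    by (intro conj_labelled.intro labelled.intro conj_labelled_axioms.intro labelled_axioms.intro[OF set l] PR(1,2))
qed

lemma labelled_su:
  fixes a h :: "(complex^('p::finite + 'q::finite)^('p + 'q)) set"
  assumes set: "satake_setting su_algebra comm_bracket a h l \<alpha>" and card: "CARD('p + 'q) = l + 1" "1 \<le> l"
    and pq: "CARD('p) \<le> CARD('q)"
  obtains P R th where "su_labelled P R a h th l \<alpha>"
proof -
  obtain th where c: "cartan_pair su_algebra comm_bracket (\<lambda>x. x) sgU a h th"
    by (rule cartan_pair_of_setting[OF su.real_form_axioms set])
  obtain P R :: "complex^('p + 'q)^('p + 'q)" where PR: "P ** R = mat 1" "R ** P = mat 1"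
    "\<forall>y\<in>h. \<exists>d. R ** y ** P = diagm d"
    using cartan_pair.h_diagonalisable[OF c] by (elim exE conjE)
  have "su_labelled P R a h th l \<alpha>"
    by (intro su_labelled.intro su_labelled_axioms.intro conj_labelled_of_setting[OF c set PR card] pq)
  then show ?thesis by (rule that)
qed

lemma labelled_slH:
  fixes a h :: "(quat^'m::finite^'m) set"
  assumes set: "satake_setting slH_algebra comm_bracket a h l \<alpha>" and card: "CARD('m + 'm) = l + 1" "1 \<le> l"
  obtains P R th where "slh_labelled P R a h th l \<alpha>"
proof -
  obtain th where c: "cartan_pair slH_algebra comm_bracket psiH sgH a h th"
    by (rule cartan_pair_of_setting[OF slh.real_form_axioms set])
  obtain P R :: "complex^('m + 'm)^('m + 'm)" where PR: "P ** R = mat 1" "R ** P = mat 1"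
    "\<forall>y\<in>h. \<exists>d. R ** psiH y ** P = diagm d"
    using cartan_pair.h_diagonalisable[OF c] by (elim exE conjE)
  have "slh_labelled P R a h th l \<alpha>"
    by (intro slh_labelled.intro conj_labelled_of_setting[OF c set PR card])
  then show ?thesis by (rule that)
qed

lemma su_case:
  fixes a h :: "(complex^('p::finite + 'q::finite)^('p + 'q)) set"
  assumes set: "satake_setting su_algebra comm_bracket a h l \<alpha>" and card: "CARD('p + 'q) = l + 1" "1 \<le> l"
    and pq: "CARD('p) \<le> CARD('q)"
  defines "\<B> \<equiv> \<lambda>s. BI su_algebra comm_bracket a h l \<alpha> {s, l + 1 - s}"
  shows "\<forall>s\<in>{1..CARD('p)}. admissible su_algebra comm_bracket a h l \<alpha> {s, l + 1 - s} \<and>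
      nonzero_abelian_inner_ideal su_algebra comm_bracket (\<B> s)"
    "\<forall>s. 1 \<le> s \<and> s < CARD('p) \<longrightarrow> \<B> s \<subset> \<B> (s + 1)"
    "\<forall>B. nonzero_abelian_inner_ideal su_algebra comm_bracket B \<longrightarrow>
      (\<exists>!s. s \<in> {1..CARD('p)} \<and> conjugate su_algebra comm_bracket B (\<B> s))"
proof -
  obtain P R th where "su_labelled P R a h th l \<alpha>" using labelled_su[OF set card pq] by blast
  then interpret su_labelled P R a h th l \<alpha> .
  have B: "\<B> s = range_ideal (flag s)" "isotropic (flag s)" "vec.dim (flag s) = s" if "s \<in> {1..CARD('p)}" for s
  proof -
    have s: "1 \<le> s" "s \<le> CARD('p)" using that unfolding atLeastAtMost_iff by blast+
    show "\<B> s = range_ideal (flag s)" unfolding \<B>_def by (rule BI_flag(1)[OF s])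
    show "isotropic (flag s)" "vec.dim (flag s) = s" by (rule flag[OF s(2)])+
  qed
  have N: "nonzero_abelian_inner_ideal su_algebra comm_bracket (\<B> s)" if s: "s \<in> {1..CARD('p)}" for s
  proof -
    have "flag s \<noteq> {0}"
    proof
      assume "flag s = {0}"
      then have "vec.dim (flag s) = 0" by (simp only: vec.dim_eq_0 order_refl)
      then have "s = 0" unfolding B(3)[OF s] .
      then show False using s by simp
    qed
    then show ?thesis unfolding B(1)[OF s] by (rule range_ideal_inner[OF B(2)[OF s]])
  qed
  have strict: "\<B> s \<subset> \<B> t" if st: "s \<in> {1..CARD('p)}" "t \<in> {1..CARD('p)}" "s < t" for s t
    unfolding B(1)[OF st(1)] B(1)[OF st(2)]
    by (rule range_ideal_strict[OF B(2)[OF st(2)] subspace_column_flag flag_strict]) (use st in auto)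
  show "\<forall>s\<in>{1..CARD('p)}. admissible su_algebra comm_bracket a h l \<alpha> {s, l + 1 - s} \<and>
      nonzero_abelian_inner_ideal su_algebra comm_bracket (\<B> s)"
    using BI_flag(2) N unfolding Ball_def atLeastAtMost_iff by blast
  show "\<forall>s. 1 \<le> s \<and> s < CARD('p) \<longrightarrow> \<B> s \<subset> \<B> (s + 1)"
  proof (intro allI impI)
    fix s assume s: "1 \<le> s \<and> s < CARD('p)"
    show "\<B> s \<subset> \<B> (s + 1)" by (rule strict) (use s in \<open>simp_all add: Suc_le_eq\<close>)
  qed
  show "\<forall>B. nonzero_abelian_inner_ideal su_algebra comm_bracket B \<longrightarrow>
      (\<exists>!s. s \<in> {1..CARD('p)} \<and> conjugate su_algebra comm_bracket B (\<B> s))"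
  proof (intro allI impI)
    fix B :: "(complex^('p + 'q)^('p + 'q)) set"
    assume BN: "nonzero_abelian_inner_ideal su_algebra comm_bracket B"
    obtain U where U: "isotropic U" "U \<noteq> {0}" "B = range_ideal U" using abelian_inner_ideal_su[OF BN] by blast
    have "vec.dim U \<noteq> 0" using U(1,2) vec.dim_eq_0[of U] vec.subspace_0[of U] by (auto simp: isotropic_def)
    then have "1 \<le> vec.dim U" by linarith
    then have t: "vec.dim U \<in> {1..CARD('p)}" using isotropic_dim(1)[OF U(1)] by (simp only: atLeastAtMost_iff)
    have c: "conjugate su_algebra comm_bracket B (\<B> (vec.dim U))"
      unfolding U(3) B(1)[OF t] by (rule range_ideal_conj[OF U(1) B(2)[OF t]]) (simp add: B(3)[OF t])
    have BL: "B \<subseteq> su_algebra" unfolding U(3) by (rule range_ideal_sub)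
    have sub: "subspace (\<B> s)" "\<B> s \<subseteq> su_algebra" if "s \<in> {1..CARD('p)}" for s
      using N[OF that] unfolding su.nonzero_abelian_inner_ideal_iff by blast+
    \<comment> \<open>Two members conjugate to \<open>B\<close> are conjugate to each other, which a
      strict inclusion rules out by dimension.\<close>
    have no: "\<not> s < t" if st: "s \<in> {1..CARD('p)}" "t \<in> {1..CARD('p)}"
      "conjugate su_algebra comm_bracket B (\<B> s)" "conjugate su_algebra comm_bracket B (\<B> t)" for s t
    proof
      assume "s < t"
      have "conjugate su_algebra comm_bracket (\<B> s) (\<B> t)"
        by (rule su.conjugate_trans[OF sub(2)[OF st(1)] su.conjugate_sym[OF BL st(3)] st(4)])
      then show False using not_conjugate_psubset[OF sub(1)[OF st(1)] sub[OF st(2)] strict[OF st(1,2) \<open>s < t\<close>]] by blast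
    qed
    show "\<exists>!s. s \<in> {1..CARD('p)} \<and> conjugate su_algebra comm_bracket B (\<B> s)"
    proof (rule ex1I[of _ "vec.dim U"])
      show "vec.dim U \<in> {1..CARD('p)} \<and> conjugate su_algebra comm_bracket B (\<B> (vec.dim U))" using t c by blast
      fix s assume s: "s \<in> {1..CARD('p)} \<and> conjugate su_algebra comm_bracket B (\<B> s)"
      then show "s = vec.dim U" using no[of s "vec.dim U"] no[of "vec.dim U" s] t c by (meson linorder_neqE_nat)
    qed
  qed
qed

lemma slH_case:
  fixes a h :: "(quat^'m::finite^'m) set"
  assumes set: "satake_setting slH_algebra comm_bracket a h l \<alpha>" and card: "2 * CARD('m) = l + 1" "1 \<le> l"
  defines "\<B> \<equiv> \<lambda>s t. BI slH_algebra comm_bracket a h l \<alpha> {2 * s, 2 * t}"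
  shows "\<forall>s t. 1 \<le> s \<and> s \<le> t \<and> t \<le> CARD('m) - 1 \<longrightarrow>
      admissible slH_algebra comm_bracket a h l \<alpha> {2 * s, 2 * t} \<and>
      nonzero_abelian_inner_ideal slH_algebra comm_bracket (\<B> s t)"
    "\<forall>B. nonzero_abelian_inner_ideal slH_algebra comm_bracket B \<longrightarrow>
      (\<exists>s t. 1 \<le> s \<and> s \<le> t \<and> t \<le> CARD('m) - 1 \<and> conjugate slH_algebra comm_bracket B (\<B> s t))"
proof -
  have "CARD('m + 'm) = l + 1" using card(1) by simp
  then obtain P R th where "slh_labelled P R a h th l \<alpha>" using labelled_slH[OF set _ card(2)] by blast
  then interpret slh_labelled P R a h th l \<alpha> .
  text \<open>Reversing the numbering of the chain exchanges \<open>{2s, 2t}\<close> with \<open>{2(m - t), 2(m - s)}\<close>.\<close>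
  have ex: "\<exists>u w. 1 \<le> u \<and> u \<le> w \<and> w < CARD('m) \<and> {rho (2 * u), rho (2 * w)} = {2 * s, 2 * t}"
    if st: "1 \<le> s" "s \<le> t" "t \<le> CARD('m) - 1" for s t
    using rho_cases
  proof
    assume "\<forall>i. rho i = i"
    then show ?thesis using st by (intro exI[of _ s] exI[of _ t]) auto
  next
    assume r: "\<forall>i. rho i = l + 1 - i"
    have "l + 1 - 2 * (CARD('m) - t) = 2 * t" "l + 1 - 2 * (CARD('m) - s) = 2 * s" using st card(1) by auto
    then show ?thesis using r st by (intro exI[of _ "CARD('m) - t"] exI[of _ "CARD('m) - s"]) auto
  qed
  \<comment> \<open>The converse bookkeeping: dimensions found along the chain are turned back into
    labels of the diagram, reversed if necessary.\<close>
  have ex': "\<exists>s t. 1 \<le> s \<and> s \<le> t \<and> t \<le> CARD('m) - 1 \<and> {rho (2 * u), rho (2 * w)} = {2 * s, 2 * t}"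
    if uw: "1 \<le> u" "u \<le> w" "w < CARD('m)" for u w
    using rho_cases
  proof
    assume "\<forall>i. rho i = i"
    then show ?thesis using uw by (intro exI[of _ u] exI[of _ w]) auto
  next
    assume r: "\<forall>i. rho i = l + 1 - i"
    have "l + 1 - 2 * u = 2 * (CARD('m) - u)" "l + 1 - 2 * w = 2 * (CARD('m) - w)" using uw card(1) by auto
    then show ?thesis using r uw by (intro exI[of _ "CARD('m) - w"] exI[of _ "CARD('m) - u"]) auto
  qed
  show "\<forall>s t. 1 \<le> s \<and> s \<le> t \<and> t \<le> CARD('m) - 1 \<longrightarrow>
      admissible slH_algebra comm_bracket a h l \<alpha> {2 * s, 2 * t} \<and>
      nonzero_abelian_inner_ideal slH_algebra comm_bracket (\<B> s t)"
  proof (intro allI impI)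
    fix s t assume "1 \<le> s \<and> s \<le> t \<and> t \<le> CARD('m) - 1"
    then obtain u w where uw: "1 \<le> u" "u \<le> w" "w < CARD('m)" "{rho (2 * u), rho (2 * w)} = {2 * s, 2 * t}"
      using ex by meson
    show "admissible slH_algebra comm_bracket a h l \<alpha> {2 * s, 2 * t} \<and>
      nonzero_abelian_inner_ideal slH_algebra comm_bracket (\<B> s t)"
      using BI_flag(2,3)[OF uw(1-3)] unfolding uw(4) \<B>_def by blast
  qed
  show "\<forall>B. nonzero_abelian_inner_ideal slH_algebra comm_bracket B \<longrightarrow>
      (\<exists>s t. 1 \<le> s \<and> s \<le> t \<and> t \<le> CARD('m) - 1 \<and> conjugate slH_algebra comm_bracket B (\<B> s t))"
  proof (intro allI impI)
    fix B :: "(quat^'m^'m) set"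
    assume "nonzero_abelian_inner_ideal slH_algebra comm_bracket B"
    then obtain U W where UW: "jstable U" "jstable W" "U \<subseteq> W" "U \<noteq> {0}" "W \<noteq> UNIV" "B = flag_ideal U W"
      using abelian_inner_ideal_slH by blast
    obtain f u w where f: "u \<le> w" "w \<le> CARD('m)" "vec.dim U = 2 * u" "vec.dim W = 2 * w"
      using ex_adapted[OF UW(1-3)] by metis
    have sU: "vec.subspace U" "vec.subspace W" using UW(1,2) by (auto simp: jstable_def)
    have "u \<noteq> 0" using f(3) UW(4) vec.dim_eq_0[of U] vec.subspace_0[OF sU(1)] by auto
    \<comment> \<open>The bounds \<open>1 \<le> u\<close> and \<open>w < m\<close> reflect that
      \<open>U\<close> is non-zero and \<open>W\<close> is not the whole space.\<close>
    then have u: "1 \<le> u" by linarith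
    have "w \<noteq> CARD('m)"
    proof
      assume "w = CARD('m)"
      then have "vec.dim W = vec.dim (UNIV :: (complex^('m + 'm)) set)" unfolding vec_dim_card using f(4) by simp
      then have "W = UNIV" using vec.subspace_dim_equal[OF sU(2) vec.subspace_UNIV] by simp
      then show False using UW(5) by simp
    qed
    then have w: "w < CARD('m)" using f(2) by linarith
    obtain s t where st: "1 \<le> s" "s \<le> t" "t \<le> CARD('m) - 1" "{rho (2 * u), rho (2 * w)} = {2 * s, 2 * t}"
      using ex'[OF u f(1) w] by meson
    have "conjugate slH_algebra comm_bracket B (flag_ideal (flag (2 * u)) (flag (2 * w)))"
      unfolding UW(6)
      by (rule flag_ideal_conj) (use UW flag[of u] flag[of w] column_flag_mono[of "2 * u" "2 * w"] f w in auto)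
    then have "conjugate slH_algebra comm_bracket B (\<B> s t)"
      using BI_flag(1)[OF u f(1) w] unfolding st(4) \<B>_def by simp
    then show "\<exists>s t. 1 \<le> s \<and> s \<le> t \<and> t \<le> CARD('m) - 1 \<and> conjugate slH_algebra comm_bracket B (\<B> s t)"
      using st by blast
  qed
qed

theorem proposition4p1:
  shows
    "(\<forall>l p. 1 \<le> l \<longrightarrow> 1 \<le> p \<longrightarrow> 2 * p \<le> l + 1 \<longrightarrow>
        CARD('p::finite) = p \<longrightarrow> CARD('q::finite) = l + 1 - p \<longrightarrow>
        (let L = (su_algebra :: (complex^('p + 'q)^('p + 'q)) set); br = comm_bracket in
           card (abelian_inner_ideal_classes L br) = p \<and>
           (\<forall>a h \<alpha>. satake_setting L br a h l \<alpha> \<longrightarrow>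
              (let \<B> = (\<lambda>s. BI L br a h l \<alpha> {s, l + 1 - s}) in
                 (\<forall>s\<in>{1..p}. admissible L br a h l \<alpha> {s, l + 1 - s} \<and>
                    nonzero_abelian_inner_ideal L br (\<B> s)) \<and>
                 (\<forall>s. 1 \<le> s \<and> s < p \<longrightarrow> \<B> s \<subset> \<B> (s + 1)) \<and>
                 (\<forall>B. nonzero_abelian_inner_ideal L br B \<longrightarrow>
                    (\<exists>!s. s \<in> {1..p} \<and> conjugate L br B (\<B> s)))))))
     \<and>
     (\<forall>l m. 1 < l \<longrightarrow> odd l \<longrightarrow> m = (l + 1) div 2 \<longrightarrow> CARD('m::finite) = m \<longrightarrow>
        (let L = (slH_algebra :: (quat^'m^'m) set); br = comm_bracket in
           \<forall>a h \<alpha>. satake_setting L br a h l \<alpha> \<longrightarrow>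
              (let \<B> = (\<lambda>s t. BI L br a h l \<alpha> {2 * s, 2 * t}) in
                 (\<forall>s t. 1 \<le> s \<and> s \<le> t \<and> t \<le> m - 1 \<longrightarrow>
                    admissible L br a h l \<alpha> {2 * s, 2 * t} \<and>
                    nonzero_abelian_inner_ideal L br (\<B> s t)) \<and>
                 (\<forall>B. nonzero_abelian_inner_ideal L br B \<longrightarrow>
                    (\<exists>s t. 1 \<le> s \<and> s \<le> t \<and> t \<le> m - 1 \<and>
                       conjugate L br B (\<B> s t))))))"
proof (intro conjI allI impI)
  fix l p :: nat
  assume lp: "1 \<le> l" "1 \<le> p" "2 * p \<le> l + 1" "CARD('p) = p" "CARD('q) = l + 1 - p"
  have pq: "CARD('p) \<le> CARD('q)" and card: "CARD('p + 'q) = l + 1" using lp by auto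
  show "let L = (su_algebra :: (complex^('p + 'q)^('p + 'q)) set); br = comm_bracket in
           card (abelian_inner_ideal_classes L br) = p \<and>
           (\<forall>a h \<alpha>. satake_setting L br a h l \<alpha> \<longrightarrow>
              (let \<B> = (\<lambda>s. BI L br a h l \<alpha> {s, l + 1 - s}) in
                 (\<forall>s\<in>{1..p}. admissible L br a h l \<alpha> {s, l + 1 - s} \<and>
                    nonzero_abelian_inner_ideal L br (\<B> s)) \<and>
                 (\<forall>s. 1 \<le> s \<and> s < p \<longrightarrow> \<B> s \<subset> \<B> (s + 1)) \<and>
                 (\<forall>B. nonzero_abelian_inner_ideal L br B \<longrightarrow>
                    (\<exists>!s. s \<in> {1..p} \<and> conjugate L br B (\<B> s)))))"
    unfolding Let_def
  proof (rule conjI, goal_cases)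
    case 1
    show ?case using card_classes_su[OF pq] unfolding lp(4) .
  next
    case 2
    show ?case
    proof (intro allI impI, goal_cases)
      case (1 a h \<alpha>)
      note c = su_case[OF 1 card lp(1) pq, unfolded lp(4)]
      show ?case by (rule conjI[OF c(1) conjI[OF c(2,3)]])
    qed
  qed
next
  fix l m :: nat
  assume lm: "1 < l" "odd l" "m = (l + 1) div 2" "CARD('m) = m"
  have card: "2 * CARD('m) = l + 1" using lm by auto
  have l: "1 \<le> l" using lm by simp
  show "let L = (slH_algebra :: (quat^'m^'m) set); br = comm_bracket in
           \<forall>a h \<alpha>. satake_setting L br a h l \<alpha> \<longrightarrow>
              (let \<B> = (\<lambda>s t. BI L br a h l \<alpha> {2 * s, 2 * t}) in
                 (\<forall>s t. 1 \<le> s \<and> s \<le> t \<and> t \<le> m - 1 \<longrightarrow>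
                    admissible L br a h l \<alpha> {2 * s, 2 * t} \<and>
                    nonzero_abelian_inner_ideal L br (\<B> s t)) \<and>
                 (\<forall>B. nonzero_abelian_inner_ideal L br B \<longrightarrow>
                    (\<exists>s t. 1 \<le> s \<and> s \<le> t \<and> t \<le> m - 1 \<and>
                       conjugate L br B (\<B> s t))))"
    unfolding Let_def
  proof (intro allI impI, goal_cases)
    case (1 a h \<alpha>)
    note c = slH_case[OF 1 card l, unfolded lm(4)]
    show ?case by (rule conjI[OF c])
  qed
qed

end
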